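(* Let $(k,l)$ be a pair of relatively prime integers such that $k>l>0$, and let $FS_{k,l}$ be the Fraser-Sargent surface in $\mathbb E^4$. Then $$\mathrm{Ind}(FS_{k,l})=\begin{cases}2k-1,&k\text{ odd},\\ k-1,&k\text{ even},\end{cases}\qquad\text{and}\qquad \mathrm{Nul}(FS_{k,l})=4.$$
   Context: Notation: $\mathbb E^n$ is Euclidean $n$-space. Fraser-Sargent surfaces. For relatively prime integers $k>l>0$ let $T_{k,l}$ be the unique positive solution of $k\tanh(kt)=l\coth(lt)$, let $r=r_{k,l}=\sqrt{k^2\sinh^2(lT_{k,l})+l^2\cosh^2(kT_{k,l})}$, and let $$u(t,\theta)=\tfrac1r\,(k\sinh lt\cos l\theta,\;k\sinh lt\sin l\theta,\;l\cosh kt\cos k\theta,\;l\cosh kt\sin k\theta),\quad t\in\mathbb R,\ \theta\in\mathbb R/2\pi\mathbb Z.$$ This is a conformal minimal immersion of the cylinder into $\mathbb E^4$. If $k$ is odd, $FS_{k,l}$ is the cylinder $\mathbb R\times(\mathbb R/2\pi\mathbb Z)$ immersed by $u$. If $k$ is even (so $l$ is odd), $u$ is invariant under the fixed-point-free involution $(t,\theta)\mapsto(-t,\theta+\pi)$, and $FS_{k,l}$ is the quotient Möbius band immersed by the map induced by $u$. Index and nullity. Let $\Sigma$ be an immersed minimal surface without boundary in $\mathbb E^n$ with normal bundle $N\Sigma$, normal connection $\nabla^\bot$, normal Laplacian $\Delta^\bot=\sum_i(\nabla^\bot_{e_i}\nabla^\bot_{e_i}-\nabla^\bot_{\nabla^\top_{e_i}e_i})$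 ($e_1,e_2$ a local orthonormal tangent frame, $\nabla^\top$ the Levi-Civita connection of $\Sigma$), second fundamental form $b_{ij}=(\nabla_{e_i}e_j)^\bot$ and Simons operator $\mathcal B(X)=\sum_{i,j}\langle b_{ij},X\rangle b_{ij}$. The Jacobi operator is $L=\Delta^\bot+\mathcal B$ and the second variation of area is $\delta^2A(X)=\int_\Sigma(|\nabla^\bot X|^2-\langle\mathcal B(X),X\rangle)\,dA$. For a bounded (relatively compact) domain $\Omega\subset\Sigma$, $\mathrm{Ind}(\Omega)$ is the maximal dimension of a vector space of smooth sections of $N\Sigma$ supported in $\Omega$ on which $\delta^2A$ is negative definite; $\mathrm{Ind}(\Sigma)=\sup_\Omega\mathrm{Ind}(\Omega)$. $\mathrm{Nul}(\Sigma)$ is the dimension of the space of bounded sections $X$ of $N\Sigma$ with $LX=0$ (bounded Jacobi fields). *)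

theory Defs
  imports "HOL-Analysis.Analysis" "HOL-Library.Function_Algebras"
begin

section \<open>Vector spaces of functions and their dimension\<close>

instantiation "fun" :: (type, real_vector) real_vector
begin

definition "c *\<^sub>R f = (\<lambda>x. c *\<^sub>R f x)"

instance
  by standard (simp_all add: scaleR_fun_def fun_eq_iff scaleR_add_right scaleR_add_left)

end

lemma scaleR_fun_apply [simp]: "(c *\<^sub>R f) x = c *\<^sub>R f x"
  by (simp add: scaleR_fun_def)

text \<open>The library's \<open>dim\<close> is \<open>0\<close> on infinite-dimensional spaces; here they get dimension \<open>\<infinity>\<close>.\<close>

definition vdim :: "'a::real_vector set \<Rightarrow> enat" where
  "vdim V = (if \<exists>B. finite B \<and> V \<subseteq> span B then enat (dim V) else \<infinity>)"

section \<open>Smooth maps\<close>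

definition dd :: "('a::real_normed_vector \<Rightarrow> 'b::real_normed_vector) \<Rightarrow> 'a \<Rightarrow> 'a \<Rightarrow> 'b" where
  "dd F v p = frechet_derivative F (at p) v"

fun Ck :: "nat \<Rightarrow> ('a::real_normed_vector \<Rightarrow> 'b::real_normed_vector) \<Rightarrow> bool" where
  "Ck 0 F \<longleftrightarrow> continuous_on UNIV F"
| "Ck (Suc n) F \<longleftrightarrow> (\<forall>p. F differentiable (at p)) \<and> (\<forall>v. Ck n (dd F v))"

definition smooth :: "('a::real_normed_vector \<Rightarrow> 'b::real_normed_vector) \<Rightarrow> bool" where
  "smooth F \<longleftrightarrow> (\<forall>n. Ck n F)"

section \<open>Local geometry of an immersion \<open>f\<close> of the plane into a Euclidean space\<close>

text \<open>
  Tangent vectors of the surface are written in coordinates, as vectors in the parameter plane;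
  \<open>dd f v p\<close> is the corresponding vector in the ambient space. \<open>frame f 1, frame f 2\<close> is the
  Gram--Schmidt orthonormalisation of the coordinate frame with respect to the metric induced by
  \<open>f\<close>; the operators below do not depend on the choice of orthonormal frame.
\<close>

type_synonym plane = "real \<times> real"

definition frame1 :: "(plane \<Rightarrow> 'a::euclidean_space) \<Rightarrow> plane \<Rightarrow> plane" where
  "frame1 f p = (1 / norm (dd f (1, 0) p)) *\<^sub>R (1, 0)"

definition frame2 :: "(plane \<Rightarrow> 'a::euclidean_space) \<Rightarrow> plane \<Rightarrow> plane" where
  "frame2 f p =
     (let w = (0, 1) - (dd f (0, 1) p \<bullet> dd f (frame1 f p) p) *\<^sub>R frame1 f p
      in (1 / norm (dd f w p)) *\<^sub>R w)"

definition frame :: "(plane \<Rightarrow> 'a::euclidean_space) \<Rightarrow> nat \<Rightarrow> plane \<Rightarrow> plane" where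
  "frame f i = (if i = 1 then frame1 f else frame2 f)"

definition push :: "(plane \<Rightarrow> 'a::euclidean_space) \<Rightarrow> (plane \<Rightarrow> plane) \<Rightarrow> plane \<Rightarrow> 'a" where
  "push f V p = dd f (V p) p"

definition tangential_part :: "(plane \<Rightarrow> 'a::euclidean_space) \<Rightarrow> plane \<Rightarrow> 'a \<Rightarrow> plane" where
  "tangential_part f p w = (\<Sum>i\<in>{1,2}. (w \<bullet> push f (frame f i) p) *\<^sub>R frame f i p)"

definition normal_part :: "(plane \<Rightarrow> 'a::euclidean_space) \<Rightarrow> plane \<Rightarrow> 'a \<Rightarrow> 'a" where
  "normal_part f p w = w - (\<Sum>i\<in>{1,2}. (w \<bullet> push f (frame f i) p) *\<^sub>R push f (frame f i) p)"

definition normal_conn ::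
    "(plane \<Rightarrow> 'a::euclidean_space) \<Rightarrow> (plane \<Rightarrow> plane) \<Rightarrow> (plane \<Rightarrow> 'a) \<Rightarrow> plane \<Rightarrow> 'a" where
  "normal_conn f V X p = normal_part f p (dd X (V p) p)"

definition levi_civita ::
    "(plane \<Rightarrow> 'a::euclidean_space) \<Rightarrow> (plane \<Rightarrow> plane) \<Rightarrow> (plane \<Rightarrow> plane) \<Rightarrow> plane \<Rightarrow> plane" where
  "levi_civita f V W p = tangential_part f p (dd (push f W) (V p) p)"

definition normal_laplacian ::
    "(plane \<Rightarrow> 'a::euclidean_space) \<Rightarrow> (plane \<Rightarrow> 'a) \<Rightarrow> plane \<Rightarrow> 'a" where
  "normal_laplacian f X p =
     (\<Sum>i\<in>{1,2}. normal_conn f (frame f i) (normal_conn f (frame f i) X) p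
                - normal_conn f (levi_civita f (frame f i) (frame f i)) X p)"

definition second_ff :: "(plane \<Rightarrow> 'a::euclidean_space) \<Rightarrow> nat \<Rightarrow> nat \<Rightarrow> plane \<Rightarrow> 'a" where
  "second_ff f i j p = normal_part f p (dd (push f (frame f j)) (frame f i p) p)"

definition simons :: "(plane \<Rightarrow> 'a::euclidean_space) \<Rightarrow> (plane \<Rightarrow> 'a) \<Rightarrow> plane \<Rightarrow> 'a" where
  "simons f X p = (\<Sum>i\<in>{1,2}. \<Sum>j\<in>{1,2}. (second_ff f i j p \<bullet> X p) *\<^sub>R second_ff f i j p)"

definition jacobi_op :: "(plane \<Rightarrow> 'a::euclidean_space) \<Rightarrow> (plane \<Rightarrow> 'a) \<Rightarrow> plane \<Rightarrow> 'a" where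
  "jacobi_op f X p = normal_laplacian f X p + simons f X p"

definition area_density :: "(plane \<Rightarrow> 'a::euclidean_space) \<Rightarrow> plane \<Rightarrow> real" where
  "area_density f p =
     sqrt ((dd f (1, 0) p \<bullet> dd f (1, 0) p) * (dd f (0, 1) p \<bullet> dd f (0, 1) p)
           - (dd f (1, 0) p \<bullet> dd f (0, 1) p)\<^sup>2)"

section \<open>Immersed surfaces, index and nullity\<close>

text \<open>
  An immersed surface without boundary is presented as a quotient of the plane: \<open>deck\<close> is a group
  of diffeomorphisms of the plane acting freely and properly discontinuously, \<open>immersion\<close> is a
  \<open>deck\<close>-invariant immersion, and \<open>fdom\<close> is a measurable fundamental domain (it meets each orbit
  exactly once), used to integrate over the quotient. The points of the surface are the orbits.
\<close>

record 'a surface =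
  immersion :: "plane \<Rightarrow> 'a"
  deck :: "(plane \<Rightarrow> plane) set"
  fdom :: "plane set"

definition orbit :: "('p \<Rightarrow> 'p) set \<Rightarrow> 'p \<Rightarrow> 'p set" where
  "orbit G p = (\<lambda>g. g p) ` G"

definition quotient_top :: "('p::topological_space \<Rightarrow> 'p) set \<Rightarrow> 'p set topology" where
  "quotient_top G = topology (\<lambda>U. U \<subseteq> range (orbit G) \<and> open (orbit G -` U))"

lemma openin_quotient_top:
  "openin (quotient_top G) U \<longleftrightarrow> U \<subseteq> range (orbit G) \<and> open (orbit G -` U)"
proof -
  let ?P = "\<lambda>U. U \<subseteq> range (orbit G) \<and> open (orbit G -` U)"
  have "istopology ?P"
    unfolding istopology_def
  proof (rule conjI; intro allI impI)
    fix U V assume "?P U" "?P V"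
    then show "?P (U \<inter> V)"
      by (simp add: vimage_Int open_Int le_infI1)
  next
    fix \<K> assume "\<forall>K\<in>\<K>. ?P K"
    then show "?P (\<Union>\<K>)"
      by (simp add: vimage_Union open_UN Sup_le_iff)
  qed
  then show ?thesis
    by (simp add: quotient_top_def topology_inverse')
qed

lemma quotient_map_quotient_top: "quotient_map euclidean (quotient_top G) (orbit G)"
proof -
  have "orbit G -` range (orbit G) = UNIV"
    by blast
  then have "openin (quotient_top G) (range (orbit G))"
    by (simp only: openin_quotient_top) simp
  then have top: "topspace (quotient_top G) = range (orbit G)"
    by (meson openin_quotient_top openin_subset openin_topspace subset_antisym)
  show ?thesis
    by (simp add: quotient_map_def top openin_quotient_top vimage_def)
qed

abbreviation surface_top :: "'a surface \<Rightarrow> plane set topology" where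
  "surface_top S \<equiv> quotient_top (deck S)"

definition bounded_domain :: "'a surface \<Rightarrow> plane set set \<Rightarrow> bool" where
  "bounded_domain S \<Omega> \<longleftrightarrow>
     openin (surface_top S) \<Omega> \<and> connectedin (surface_top S) \<Omega> \<and>
     compactin (surface_top S) (surface_top S closure_of \<Omega>)"

text \<open>
  The fibres of the normal bundle are subspaces of the ambient space, so a section over the quotient
  is a \<open>deck\<close>-invariant ambient-valued map.
\<close>

definition normal_sections :: "'a::euclidean_space surface \<Rightarrow> (plane \<Rightarrow> 'a) set" where
  "normal_sections S =
     {X. smooth X \<and> (\<forall>p v. X p \<bullet> dd (immersion S) v p = 0) \<and> (\<forall>g\<in>deck S. \<forall>p. X (g p) = X p)}"

definition section_support :: "'a::euclidean_space surface \<Rightarrow> (plane \<Rightarrow> 'a) \<Rightarrow> plane set set" where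
  "section_support S X = surface_top S closure_of (orbit (deck S) ` {p. X p \<noteq> 0})"

definition second_variation :: "'a::euclidean_space surface \<Rightarrow> (plane \<Rightarrow> 'a) \<Rightarrow> real" where
  "second_variation S X = (let f = immersion S in
     (LINT p:fdom S|lborel.
        ((\<Sum>i\<in>{1,2}. (norm (normal_conn f (frame f i) X p))\<^sup>2) - simons f X p \<bullet> X p)
        * area_density f p))"

definition index_on :: "'a::euclidean_space surface \<Rightarrow> plane set set \<Rightarrow> enat" where
  "index_on S \<Omega> = Sup {vdim V | V. subspace V \<and>
     V \<subseteq> {X \<in> normal_sections S. section_support S X \<subseteq> \<Omega>} \<and>
     (\<forall>X\<in>V. X \<noteq> 0 \<longrightarrow> second_variation S X < 0)}"

definition index :: "'a::euclidean_space surface \<Rightarrow> enat" where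
  "index S = (SUP \<Omega>\<in>{\<Omega>. bounded_domain S \<Omega>}. index_on S \<Omega>)"

definition nullity :: "'a::euclidean_space surface \<Rightarrow> enat" where
  "nullity S = vdim {X \<in> normal_sections S.
     (\<forall>p. jacobi_op (immersion S) X p = 0) \<and> bounded (range X)}"

section \<open>Fraser--Sargent surfaces\<close>

definition coth :: "real \<Rightarrow> real" where
  "coth x = cosh x / sinh x"

definition FS_T :: "nat \<Rightarrow> nat \<Rightarrow> real" where
  "FS_T k l = (THE t. t > 0 \<and> real k * tanh (real k * t) = real l * coth (real l * t))"

definition FS_r :: "nat \<Rightarrow> nat \<Rightarrow> real" where
  "FS_r k l = sqrt ((real k)\<^sup>2 * (sinh (real l * FS_T k l))\<^sup>2
                    + (real l)\<^sup>2 * (cosh (real k * FS_T k l))\<^sup>2)"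

definition FS_u :: "nat \<Rightarrow> nat \<Rightarrow> plane \<Rightarrow> real ^ 4" where
  "FS_u k l = (\<lambda>(t, \<theta>). (1 / FS_r k l) *\<^sub>R vector
     [real k * sinh (real l * t) * cos (real l * \<theta>),
      real k * sinh (real l * t) * sin (real l * \<theta>),
      real l * cosh (real k * t) * cos (real k * \<theta>),
      real l * cosh (real k * t) * sin (real k * \<theta>)])"

definition cylinder_deck :: "(plane \<Rightarrow> plane) set" where
  "cylinder_deck = range (\<lambda>n::int. \<lambda>(t, \<theta>). (t, \<theta> + 2 * pi * of_int n))"

definition FS_involution :: "plane \<Rightarrow> plane" where
  "FS_involution = (\<lambda>(t, \<theta>). (- t, \<theta> + pi))"

definition moebius_deck :: "(plane \<Rightarrow> plane) set" where
  "moebius_deck = cylinder_deck \<union> (\<lambda>g. g \<circ> FS_involution) ` cylinder_deck"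

definition FS :: "nat \<Rightarrow> nat \<Rightarrow> (real ^ 4) surface" where
  "FS k l =
     (if odd k
      then \<lparr>immersion = FS_u k l, deck = cylinder_deck, fdom = UNIV \<times> {0..<2 * pi}\<rparr>
      else \<lparr>immersion = FS_u k l, deck = moebius_deck, fdom = UNIV \<times> {0..<pi}\<rparr>)"

lemma FS_u_cylinder_deck:
  assumes "g \<in> cylinder_deck"
  shows "FS_u k l (g p) = FS_u k l p"
proof -
  obtain n :: int where g: "g = (\<lambda>(t, \<theta>). (t, \<theta> + 2 * pi * of_int n))"
    using assms by (auto simp: cylinder_deck_def)
  obtain t \<theta> where p: "p = (t, \<theta>)" by (cases p)
  have per: "cos (x + 2 * pi * of_int j) = cos x" "sin (x + 2 * pi * of_int j) = sin x"
    for x :: real and j :: int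
    using cos_int_2pin[of j] sin_int_2pin[of j] by (simp_all add: cos_add sin_add)
  have "real m * (\<theta> + 2 * pi * of_int n) = real m * \<theta> + 2 * pi * of_int (int m * n)" for m
    by (simp add: algebra_simps)
  then have "cos (real m * (\<theta> + 2 * pi * of_int n)) = cos (real m * \<theta>)"
    and "sin (real m * (\<theta> + 2 * pi * of_int n)) = sin (real m * \<theta>)" for m
    by (simp_all only: per)
  then show ?thesis
    by (simp add: g p FS_u_def)
qed

lemma FS_u_involution:
  assumes "even k" "odd l"
  shows "FS_u k l (FS_involution p) = FS_u k l p"
proof -
  obtain t \<theta> where p: "p = (t, \<theta>)" by (cases p)
  have "cos (real m * (\<theta> + pi)) = (- 1) ^ m * cos (real m * \<theta>)"
    and "sin (real m * (\<theta> + pi)) = (- 1) ^ m * sin (real m * \<theta>)" for m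
    by (simp_all add: distrib_left cos_add sin_add)
  with assms show ?thesis
    by (simp add: p FS_u_def FS_involution_def)
qed

lemma FS_deck_invariant:
  assumes "coprime k l" "g \<in> deck (FS k l)"
  shows "immersion (FS k l) (g p) = immersion (FS k l) p"
proof (cases "odd k")
  case True
  with assms(2) show ?thesis
    by (simp add: FS_def FS_u_cylinder_deck)
next
  case False
  have "odd l"
    using False assms(1) coprime_common_divisor[of k l 2] by auto
  with False assms(2) show ?thesis
    by (auto simp: FS_def moebius_deck_def FS_u_cylinder_deck FS_u_involution)
qed

lemma ex1_shift:
  fixes x c :: real
  assumes "c > 0"
  shows "\<exists>!n::int. x + c * of_int n \<in> {0..<c}"
proof -
  have "x + c * of_int n \<in> {0..<c} \<longleftrightarrow> of_int (- n) \<le> x / c \<and> x / c < of_int (- n) + 1" for n :: int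
    using assms by (auto simp: field_simps)
  then have "x + c * of_int n \<in> {0..<c} \<longleftrightarrow> - n = \<lfloor>x / c\<rfloor>" for n :: int
    by (metis floor_correct floor_unique of_int_1 of_int_add)
  then show ?thesis
    by (metis minus_minus)
qed

lemma FS_fdom: "\<exists>!q. q \<in> orbit (deck (FS k l)) p \<inter> fdom (FS k l)"
proof -
  obtain t \<theta> where p: "p = (t, \<theta>)" by (cases p)
  show ?thesis
  proof (cases "odd k")
    case True
    obtain n :: int where n: "\<theta> + 2 * pi * of_int n \<in> {0..<2 * pi}"
      and uniq: "\<And>m::int. \<theta> + 2 * pi * of_int m \<in> {0..<2 * pi} \<Longrightarrow> m = n"
      using ex1_shift[of "2 * pi" \<theta>] by auto
    show ?thesis
    proof (rule ex1I[of _ "(t, \<theta> + 2 * pi * of_int n)"])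
      show "(t, \<theta> + 2 * pi * of_int n) \<in> orbit (deck (FS k l)) p \<inter> fdom (FS k l)"
        using True n by (simp add: FS_def orbit_def cylinder_deck_def p image_image)
    next
      fix q assume "q \<in> orbit (deck (FS k l)) p \<inter> fdom (FS k l)"
      then obtain m :: int where "q = (t, \<theta> + 2 * pi * of_int m)"
        "\<theta> + 2 * pi * of_int m \<in> {0..<2 * pi}"
        using True by (auto simp: FS_def orbit_def cylinder_deck_def p)
      then show "q = (t, \<theta> + 2 * pi * of_int n)"
        using uniq by blast
    qed
  next
    case False
    define h where "h n = ((if even n then t else - t), \<theta> + pi * of_int n)" for n :: int
    have orb: "orbit (deck (FS k l)) p = range h"
    proof -
      have "orbit (deck (FS k l)) p = range (\<lambda>m. h (2 * m)) \<union> range (\<lambda>m. h (2 * m + 1))"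
        using False
        by (simp add: FS_def orbit_def moebius_deck_def cylinder_deck_def FS_involution_def
            p h_def image_Un image_image algebra_simps)
      also have "\<dots> = range h"
        by (auto simp: image_iff) (metis evenE oddE)
      finally show ?thesis .
    qed
    obtain n :: int where n: "\<theta> + pi * of_int n \<in> {0..<pi}"
      and uniq: "\<And>m::int. \<theta> + pi * of_int m \<in> {0..<pi} \<Longrightarrow> m = n"
      using ex1_shift[of pi \<theta>] by auto
    show ?thesis
    proof (rule ex1I[of _ "h n"])
      show "h n \<in> orbit (deck (FS k l)) p \<inter> fdom (FS k l)"
        using False n by (auto simp: orb) (simp add: FS_def h_def)
    next
      fix q assume "q \<in> orbit (deck (FS k l)) p \<inter> fdom (FS k l)"
      then obtain m where "q = h m" "h m \<in> fdom (FS k l)"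
        by (auto simp: orb)
      then show "q = h n"
        using False uniq[of m] by (simp add: FS_def h_def)
    qed
  qed
qed

end

theory Submission
  imports Defs
begin

text \<open>
  In the rotating orthonormal frame of the normal bundle a section becomes a complex function on the
  cylinder, and its second variation splits over the pairs of Fourier modes \<open>(m, -m)\<close>. Completing the
  square with a potential that is singular only where \<open>rate t = m\<close> shows that each pair is non-negative
  once a single linear functional vanishes, and that there is nothing to impose for \<open>m \<ge> k\<close>: this
  bounds the index of the cylinder by \<open>2 * k - 1\<close>. Explicit fields that solve a first-order system, cut off
  far out, realise the bound. On the Moebius band the same form splits orthogonally into invariant and
  anti-invariant fields. For the nullity the mode equations have constant Wronskians with explicit
  solutions, which leaves only the modes \<open>k\<close> and \<open>l\<close>; these are the normal parts of constant vectors.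
\<close>

text \<open>The singular potential is the Riccati form of explicit solutions. For every mode,
  \<open>fund_p\<close> and \<open>fund_q\<close> with a = \<alpha> and with a = - \<alpha> give two
  Jacobi solutions on which the derivative of (p, q) is a symmetric matrix applied to (p, q): its
  diagonal part has the entries m + conn and m - conn, and a rank-one term built from (wa, wb) is
  divided by 2 * (rate - m). The pole sits where these two solutions become dependent. As
  \<open>rate\<close> increases strictly and stays between - k and k, that happens at most once, and
  never for m \<ge> k. Mode 0 is paired with itself and costs one real condition, each m from 1 to k
  - 1 costs one complex condition, whence 1 + 2 * (k - 1). The test pairs have exponents
  proportional to the mode number. They interpolate between the Jacobi fields of the modes k and -
  k, which come from constant vectors, and their energy is negative strictly in between. Infinite
  Fourier series are avoided: the form is compared with finite truncations, the error being of
  second order in the inverse of the cut-off frequency.\<close>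

section \<open>Completing the square for one pair of Fourier modes\<close>

lemma sq1: "2 * a * P * p' + 2 * g * (A * p' - (\<sigma> + a) * A * P) - g\<^sup>2 * A\<^sup>2 - p'\<^sup>2 - a\<^sup>2 * P\<^sup>2 + (p' - a * P - A * g)\<^sup>2 = - (2 * g * \<sigma> * (A * P))"
  for A :: real
  by (simp add: power2_eq_square algebra_simps)
lemma sq2: "(A\<^sup>2 - B\<^sup>2) / 2 * P\<^sup>2 - (A\<^sup>2 - B\<^sup>2) / 2 * Q\<^sup>2 + (A\<^sup>2 + B\<^sup>2) / 2 * (P\<^sup>2 + Q\<^sup>2) + 2 * (A * B) * P * Q = (A * P + B * Q)\<^sup>2"
  for A :: real
  by (simp add: power2_eq_square field_simps)
text \<open>The pointwise algebra of the Riccati equation: \<sigma> stands for rate - m, g for s /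
  (2 * \<sigma>), and a, b for m + conn and m - conn. The two instances of \<open>sq1\<close> leave
  - 2 * g * \<sigma> * s, which cancels the square of s supplied by \<open>sq2\<close>.\<close>

lemma mode_identity:
  fixes A :: real
  assumes "s = A * P + B * Q" "s * s = 2 * \<sigma> * g * s"
  shows "(A\<^sup>2 - B\<^sup>2) / 2 * P\<^sup>2 + a * (2 * P * p') - (A\<^sup>2 - B\<^sup>2) / 2 * Q\<^sup>2 + b * (2 * Q * q')
      + (2 * g * (- (\<sigma> + a) * A * P + A * p' - (\<sigma> + b) * B * Q + B * q') - g\<^sup>2 * (A\<^sup>2 + B\<^sup>2))
    = (p'\<^sup>2 + q'\<^sup>2 + a\<^sup>2 * P\<^sup>2 + b\<^sup>2 * Q\<^sup>2
     - (A\<^sup>2 + B\<^sup>2) / 2 * (P\<^sup>2 + Q\<^sup>2) - 2 * (A * B) * P * Q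
    - ((p' - a * P - A * g)\<^sup>2 + (q' - b * Q - B * g)\<^sup>2))"
proof -
  have "(A * P + B * Q)\<^sup>2 = 2 * g * \<sigma> * (A * P) + 2 * g * \<sigma> * (B * Q)"
    using assms by (simp add: power2_eq_square algebra_simps)
  moreover have "2 * g * (- (\<sigma> + a) * A * P + A * p' - (\<sigma> + b) * B * Q + B * q') 
    = 2 * g * (A * p' - (\<sigma> + a) * A * P) + 2 * g * (B * q' - (\<sigma> + b) * B * Q)"
    by (simp add: algebra_simps)
  moreover have "g\<^sup>2 * (A\<^sup>2 + B\<^sup>2) = g\<^sup>2 * A\<^sup>2 + g\<^sup>2 * B\<^sup>2" by (simp add: algebra_simps)
  moreover have "a * (2 * P * p') = 2 * a * P * p'" "b * (2 * Q * q') = 2 * b * Q * q'" by simp_all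
  ultimately show ?thesis
    using sq1[of a P p' g A \<sigma>] sq1[of b Q q' g B \<sigma>] sq2[of A B P Q] by linarith
qed

text \<open>The analysis of the modes involves only two positive numbers. On the surface they are k
  + l and k - l, so that \<open>\<kappa>\<close> and \<open>\<mu>\<close> below become k and
  l.\<close>

locale two_rates =
  fixes \<alpha> \<beta> :: real
  assumes beta_pos: "0 < \<beta>" and beta_less: "\<beta> < \<alpha>"
begin

text \<open>The normal connection: along the circles of constant t the orthonormal normal frame
  turns with this angular speed, while it is parallel along the lines of constant \<theta>.\<close>

definition conn :: "real \<Rightarrow> real" where
  "conn t = (\<alpha> * tanh (\<alpha> * t) - \<beta> * tanh (\<beta> * t)) / 2"

text \<open>The logarithmic derivative of sqrt (cosh (\<alpha> * t) * cosh (\<beta> * t)), to which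
  the length of the coordinate vectors of the immersion is proportional.\<close>

definition rate :: "real \<Rightarrow> real" where
  "rate t = (\<alpha> * tanh (\<alpha> * t) + \<beta> * tanh (\<beta> * t)) / 2"

text \<open>Up to the conformal factor, half the sum and half the difference of \<open>wa\<close>
  and \<open>wb\<close> are the semi-axes of the curvature ellipse.\<close>

definition wa :: "real \<Rightarrow> real" where "wa t = \<alpha> / cosh (\<alpha> * t)"
definition wb :: "real \<Rightarrow> real" where "wb t = \<beta> / cosh (\<beta> * t)"

text \<open>Here p is the real or imaginary part of the Fourier coefficient of order m, and q that
  of the conjugate of the coefficient of order - m. The conjugation is the reason for the opposite
  signs of \<open>conn\<close>.\<close>

definition mode_form :: "real \<Rightarrow> real \<Rightarrow> real \<Rightarrow> real \<Rightarrow> real \<Rightarrow> real \<Rightarrow> real" where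
  "mode_form m t p q p' q' = p'\<^sup>2 + q'\<^sup>2 + (m + conn t)\<^sup>2 * p\<^sup>2 + (m - conn t)\<^sup>2 * q\<^sup>2
     - ((wa t)\<^sup>2 + (wb t)\<^sup>2) / 2 * (p\<^sup>2 + q\<^sup>2) - 2 * (wa t * wb t) * p * q"

lemma alpha_pos: "0 < \<alpha>"
  using beta_pos beta_less by linarith

lemma DERIV_wa [derivative_intros]:
  assumes "(g has_real_derivative g') (at t within S)"
  shows "((\<lambda>t. wa (g t)) has_real_derivative - (\<alpha> * tanh (\<alpha> * g t)) * wa (g t) * g') (at t within S)"
  unfolding wa_def using assms
  by (auto intro!: derivative_eq_intros simp: tanh_def field_simps power2_eq_square)

lemma DERIV_wb [derivative_intros]:
  assumes "(g has_real_derivative g') (at t within S)"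
  shows "((\<lambda>t. wb (g t)) has_real_derivative - (\<beta> * tanh (\<beta> * g t)) * wb (g t) * g') (at t within S)"
  unfolding wb_def using assms
  by (auto intro!: derivative_eq_intros simp: tanh_def field_simps power2_eq_square)

lemma one_minus_tanh_sq: "1 - (tanh x)\<^sup>2 = 1 / (cosh x)\<^sup>2" for x :: real
  using hyperbolic_pythagoras[of x] by (simp add: tanh_def power_divide diff_divide_eq_iff)

lemma wa_sq: "(wa t)\<^sup>2 = \<alpha>\<^sup>2 * (1 - (tanh (\<alpha> * t))\<^sup>2)"
  and wb_sq: "(wb t)\<^sup>2 = \<beta>\<^sup>2 * (1 - (tanh (\<beta> * t))\<^sup>2)"
  by (simp_all add: wa_def wb_def one_minus_tanh_sq power_divide)

lemma DERIV_conn [derivative_intros]: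
  assumes "(g has_real_derivative g') (at t within S)"
  shows "((\<lambda>t. conn (g t)) has_real_derivative ((wa (g t))\<^sup>2 - (wb (g t))\<^sup>2) / 2 * g') (at t within S)"
  unfolding conn_def wa_sq wb_sq using assms
  by (auto intro!: derivative_eq_intros simp: power2_eq_square field_simps)

lemma DERIV_rate [derivative_intros]:
  assumes "(g has_real_derivative g') (at t within S)"
  shows "((\<lambda>t. rate (g t)) has_real_derivative ((wa (g t))\<^sup>2 + (wb (g t))\<^sup>2) / 2 * g') (at t within S)"
  unfolding rate_def wa_sq wb_sq using assms
  by (auto intro!: derivative_eq_intros simp: power2_eq_square field_simps)

lemma continuous_coeffs [continuous_intros]:
  assumes "continuous_on S g"
  shows "continuous_on S (\<lambda>x. conn (g x))" "continuous_on S (\<lambda>x. rate (g x))"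
    "continuous_on S (\<lambda>x. wa (g x))" "continuous_on S (\<lambda>x. wb (g x))"
  unfolding conn_def rate_def wa_def wb_def
  by (intro continuous_intros assms; simp)+

lemma wa_pos [simp]: "0 < wa t" and wb_pos [simp]: "0 < wb t"
  using alpha_pos beta_pos by (simp_all add: wa_def wb_def)

lemma wa_neq_0 [simp]: "wa t \<noteq> 0" and wb_neq_0 [simp]: "wb t \<noteq> 0"
  using wa_pos[of t] wb_pos[of t] by linarith+

lemma rate_conn: "rate t + conn t = \<alpha> * tanh (\<alpha> * t)" "rate t - conn t = \<beta> * tanh (\<beta> * t)"
  by (simp_all add: rate_def conn_def field_simps)

text \<open>This strict bound is what makes the large modes harmless: \<open>rate\<close> cannot
  reach m once m is at least \<kappa>, so the potential of such a mode has no pole.\<close>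

lemma rate_bound: "\<bar>rate t\<bar> < (\<alpha> + \<beta>) / 2"
proof -
  have "\<alpha> * tanh x < \<alpha> * 1" "\<alpha> * (- 1) < \<alpha> * tanh x"
    "\<beta> * tanh x < \<beta> * 1" "\<beta> * (- 1) < \<beta> * tanh x" for x
    by (intro mult_strict_left_mono tanh_real_lt_1 tanh_real_gt_neg1 alpha_pos beta_pos)+
  from this(1,2)[of "\<alpha> * t"] this(3,4)[of "\<beta> * t"] show ?thesis by (auto simp: rate_def abs_less_iff)
qed

lemma rate_strict_mono: "s < t \<Longrightarrow> rate s < rate t"
proof (rule DERIV_pos_imp_increasing, assumption)
  show "\<exists>y. (rate has_real_derivative y) (at x) \<and> 0 < y" for x
    using DERIV_rate[OF DERIV_ident, of x] by (auto intro!: exI add_pos_pos)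
qed

text \<open>
  The Riccati substitution: the mode form is a square plus the derivative of \<open>mode_pot\<close>. At the only
  zero of \<open>rate - m\<close> the potential is made continuous by the condition \<open>wa * p + wb * q = 0\<close>.
\<close>

definition mode_pot :: "real \<Rightarrow> (real \<Rightarrow> real) \<Rightarrow> (real \<Rightarrow> real) \<Rightarrow> real \<Rightarrow> real" where
  "mode_pot m p q t = (m + conn t) * (p t)\<^sup>2 + (m - conn t) * (q t)\<^sup>2
     + (wa t * p t + wb t * q t)\<^sup>2 / (2 * (rate t - m))"

text \<open>The squares measure how far (p, q) is from solving the first-order system described by
  the potential. The pole term fits because the derivative of \<open>rate\<close> is half the
  squared length of (wa, wb).\<close>

lemma mode_pot_deriv:
  assumes p: "(p has_real_derivative p') (at t)" and q: "(q has_real_derivative q') (at t)"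
    and nz: "rate t \<noteq> m"
  shows "(mode_pot m p q has_real_derivative
    mode_form m t (p t) (q t) p' q'
    - ((p' - (m + conn t) * p t - wa t * (wa t * p t + wb t * q t) / (2 * (rate t - m)))\<^sup>2
     + (q' - (m - conn t) * q t - wb t * (wa t * p t + wb t * q t) / (2 * (rate t - m)))\<^sup>2)) (at t)"
proof -
  define A where "A = wa t"
  define B where "B = wb t"
  define w where "w = conn t"
  define \<sigma> where "\<sigma> = rate t - m"
  define P where "P = p t"
  define Q where "Q = q t"
  define s where "s = A * P + B * Q"
  define s' where "s' = - (\<sigma> + m + w) * A * P + A * p' - (\<sigma> + m - w) * B * Q + B * q'"
  define g where "g = s / (2 * \<sigma>)"
  note defs = A_def B_def w_def \<sigma>_def P_def Q_def
  have nz': "\<sigma> \<noteq> 0" using nz by (simp add: \<sigma>_def)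
  have ta: "\<alpha> * tanh (\<alpha> * t) = \<sigma> + m + w" "\<beta> * tanh (\<beta> * t) = \<sigma> + m - w"
    using rate_conn[of t] by (auto simp: defs)
  have ds: "((\<lambda>u. wa u * p u + wb u * q u) has_real_derivative s') (at t)"
    by (rule DERIV_cong[OF DERIV_add[OF DERIV_mult[OF DERIV_wa[OF DERIV_ident] p]
          DERIV_mult[OF DERIV_wb[OF DERIV_ident] q]]])
      (simp only: ta s'_def defs, simp add: algebra_simps)
  have d\<sigma>: "((\<lambda>u. 2 * (rate u - m)) has_real_derivative (A\<^sup>2 + B\<^sup>2)) (at t)"
    by (auto intro!: derivative_eq_intros simp: defs)
  have "((\<lambda>u. (wa u * p u + wb u * q u)\<^sup>2 / (2 * (rate u - m))) has_real_derivative
      2 * g * s' - g\<^sup>2 * (A\<^sup>2 + B\<^sup>2)) (at t)"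
    by (rule DERIV_cong[OF DERIV_divide[OF DERIV_power[OF ds, of 2] d\<sigma>]])
      (use nz' in \<open>simp_all add: g_def s_def field_simps power2_eq_square flip: defs\<close>)
  moreover have "((\<lambda>u. (m + conn u) * (p u)\<^sup>2 + (m - conn u) * (q u)\<^sup>2) has_real_derivative
      (A\<^sup>2 - B\<^sup>2) / 2 * P\<^sup>2 + (m + w) * (2 * P * p') - (A\<^sup>2 - B\<^sup>2) / 2 * Q\<^sup>2 + (m - w) * (2 * Q * q')) (at t)"
    using p q by (auto intro!: derivative_eq_intros simp flip: defs)
  ultimately have D: "(mode_pot m p q has_real_derivative
      (A\<^sup>2 - B\<^sup>2) / 2 * P\<^sup>2 + (m + w) * (2 * P * p') - (A\<^sup>2 - B\<^sup>2) / 2 * Q\<^sup>2 + (m - w) * (2 * Q * q')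
      + (2 * g * s' - g\<^sup>2 * (A\<^sup>2 + B\<^sup>2))) (at t)"
    unfolding mode_pot_def[abs_def] by (rule DERIV_add[rotated])
  have eq: "(A\<^sup>2 - B\<^sup>2) / 2 * P\<^sup>2 + (m + w) * (2 * P * p') - (A\<^sup>2 - B\<^sup>2) / 2 * Q\<^sup>2 + (m - w) * (2 * Q * q')
      + (2 * g * s' - g\<^sup>2 * (A\<^sup>2 + B\<^sup>2))
    = p'\<^sup>2 + q'\<^sup>2 + (m + w)\<^sup>2 * P\<^sup>2 + (m - w)\<^sup>2 * Q\<^sup>2
     - (A\<^sup>2 + B\<^sup>2) / 2 * (P\<^sup>2 + Q\<^sup>2) - 2 * (A * B) * P * Q
    - ((p' - (m + w) * P - A * g)\<^sup>2 + (q' - (m - w) * Q - B * g)\<^sup>2)"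
    using mode_identity[OF s_def, of \<sigma> g "m + w" p' "m - w" q'] nz'
    by (simp add: s'_def add.assoc add_diff_eq g_def)
  have g': "x * (wa t * p t + wb t * q t) / (2 * (rate t - m)) = x * g" for x
    by (simp add: g_def s_def defs)
  from D[unfolded eq] show ?thesis
    unfolding g' mode_form_def defs .
qed

text \<open>At a zero of rate - m the numerator vanishes to second order and the denominator only to
  first order, because \<open>rate\<close> has positive derivative; the quotient tends to 0.\<close>

lemma mode_pot_isCont:
  assumes p: "(p has_real_derivative p') (at t)" and q: "(q has_real_derivative q') (at t)"
    and z: "rate t = m \<Longrightarrow> wa t * p t + wb t * q t = 0"
  shows "isCont (mode_pot m p q) t"
proof (cases "rate t = m")
  case False
  show ?thesis using mode_pot_deriv[OF p q False] by (rule DERIV_isCont)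
next
  case True
  define s \<sigma> where "s = (\<lambda>u. wa u * p u + wb u * q u)" "\<sigma> = (\<lambda>u. rate u - m)"
  note defs = this
  obtain s' where s': "(s has_real_derivative s') (at t)"
  proof (rule that)
    show "(s has_real_derivative ((- (\<alpha> * tanh (\<alpha> * t)) * wa t * 1) * p t + p' * wa t
       + ((- (\<beta> * tanh (\<beta> * t)) * wb t * 1) * q t + q' * wb t))) (at t)"
      unfolding defs by (intro DERIV_add DERIV_mult DERIV_wa DERIV_wb DERIV_ident p q)
  qed
  define r where "r = ((wa t)\<^sup>2 + (wb t)\<^sup>2) / 2"
  have r: "(\<sigma> has_real_derivative r) (at t)" and r0: "r > 0"
    unfolding defs r_def by (auto intro!: derivative_eq_intros add_pos_pos)
  have s0: "s t = 0" "\<sigma> t = 0" using z[OF True] True by (simp_all add: defs)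
  have sc: "(s \<longlongrightarrow> 0) (at t)" using DERIV_isCont[OF s'] s0 by (simp add: isCont_def)
  have "((\<lambda>u. s u * (s u / (u - t)) / (2 * (\<sigma> u / (u - t)))) \<longlongrightarrow> 0 * s' / (2 * r)) (at t)"
    using s' r r0 s0 by (intro tendsto_intros sc) (auto simp: has_field_derivative_iff)
  then have "((\<lambda>u. (s u)\<^sup>2 / (2 * \<sigma> u)) \<longlongrightarrow> 0 * s' / (2 * r)) (at t)"
    by (rule Lim_transform_eventually) (auto simp: eventually_at_filter power2_eq_square)
  \<comment> \<open>At the point itself the quotient is a division by zero with value 0, which
    agrees with the limit.\<close>
  then have c: "isCont (\<lambda>u. (s u)\<^sup>2 / (2 * \<sigma> u)) t" by (simp add: isCont_def s0)
  have "isCont (\<lambda>u. (m + conn u) * (p u)\<^sup>2 + (m - conn u) * (q u)\<^sup>2) t"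
    by (rule DERIV_isCont) (auto intro!: derivative_eq_intros p q)
  from isCont_add[OF this c] show ?thesis
    by (simp add: mode_pot_def[abs_def] defs)
qed

text \<open>The running integral minus the potential has a sum of squares as derivative wherever
  rate differs from m. Strict monotonicity of \<open>rate\<close> leaves at most one exceptional
  point, and continuity there lets the monotonicity pass across it. The potential vanishes at both
  ends.\<close>

lemma mode_form_integral_nonneg:
  assumes p: "\<And>t. (p has_real_derivative p' t) (at t)" and q: "\<And>t. (q has_real_derivative q' t) (at t)"
    and cp: "continuous_on UNIV p'" and cq: "continuous_on UNIV q'"
    and z: "\<And>t. rate t = m \<Longrightarrow> wa t * p t + wb t * q t = 0"
    and L: "0 < L" and supp: "p L = 0" "q L = 0" "p (-L) = 0" "q (-L) = 0"
  shows "0 \<le> integral {-L..L} (\<lambda>t. mode_form m t (p t) (q t) (p' t) (q' t))"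
proof -
  let ?g = "\<lambda>t. mode_form m t (p t) (q t) (p' t) (q' t)"
  have cont: "continuous_on UNIV p" "continuous_on UNIV q"
    using p q by (auto intro!: continuous_at_imp_continuous_on DERIV_isCont)
  have cg: "continuous_on S ?g" for S
    unfolding mode_form_def
    by (intro continuous_intros continuous_on_subset[OF cp] continuous_on_subset[OF cq]
        continuous_on_subset[OF cont(1)] continuous_on_subset[OF cont(2)]; simp)
  define H where "H t = integral {-L..t} ?g - mode_pot m p q t" for t
  have dint: "((\<lambda>x. integral {-L..x} ?g) has_real_derivative ?g t) (at t)" if "-L < t" "t < L" for t
    using integral_has_real_derivative[OF cg, of t "-L" L] that at_within_Icc_at[of "-L" t L]
    by simp
  have cint: "continuous_on {-L..L} (\<lambda>x. integral {-L..x} ?g)"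
    by (intro indefinite_integral_continuous_1 integrable_continuous_real cg)
  have cH: "continuous_on {-L..L} H"
    unfolding H_def
    by (intro continuous_intros cint continuous_at_imp_continuous_on ballI mode_pot_isCont[OF p q z])
  have dH: "\<exists>y. (H has_real_derivative y) (at t) \<and> 0 \<le> y" if "-L < t" "t < L" "rate t \<noteq> m" for t
    unfolding H_def
    by (rule exI, rule conjI, rule DERIV_diff[OF dint[OF that(1,2)] mode_pot_deriv[OF p q that(3)]]) simp
  have incr: "H a \<le> H b" if "-L \<le> a" "a \<le> b" "b \<le> L" "\<And>t. a < t \<Longrightarrow> t < b \<Longrightarrow> rate t \<noteq> m" for a b
  proof (cases "a = b")
    case False
    show ?thesis
      by (rule DERIV_nonneg_imp_increasing_open)
        (use that dH continuous_on_subset[OF cH, of "{a..b}"] in \<open>auto\<close>)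
  qed simp
  have "H (-L) \<le> H L"
  proof (cases "\<exists>t\<in>{-L..L}. rate t = m")
    case True
    then obtain t0 where t0: "t0 \<in> {-L..L}" "rate t0 = m" by blast
    have ne: "rate t \<noteq> m" if "t \<noteq> t0" for t
      using rate_strict_mono[of t t0] rate_strict_mono[of t0 t] t0 that by linarith
    have "H (-L) \<le> H t0" "H t0 \<le> H L"
      using t0 ne by (auto intro!: incr)
    then show ?thesis by simp
  next
    case False
    then show ?thesis using L by (intro incr) auto
  qed
  moreover have "mode_pot m p q L = 0" "mode_pot m p q (-L) = 0"
    by (simp_all add: mode_pot_def supp)
  ultimately show ?thesis by (simp add: H_def)
qed

end

section \<open>The Jacobi equations of a pair of modes\<close>

context two_rates begin

definition \<kappa> :: real where "\<kappa> = (\<alpha> + \<beta>) / 2"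
definition \<mu> :: real where "\<mu> = (\<alpha> - \<beta>) / 2"

lemma kappa_mu: "\<alpha> = \<kappa> + \<mu>" "\<beta> = \<kappa> - \<mu>" "0 < \<mu>" "\<mu> < \<kappa>" "0 < \<kappa>"
  using beta_pos beta_less by (auto simp: \<kappa>_def \<mu>_def field_simps)

text \<open>The factor that brings the hyperbolic normal frame of the surface to unit length. Its
  logarithmic derivative is - rate.\<close>

definition nrm :: "real \<Rightarrow> real" where "nrm t = 1 / sqrt (cosh (\<alpha> * t) * cosh (\<beta> * t))"

lemma nrm_pos [simp]: "0 < nrm t"
  by (simp add: nrm_def)

lemma nrm_sq: "(nrm t)\<^sup>2 = 1 / (cosh (\<alpha> * t) * cosh (\<beta> * t))"
  by (simp add: nrm_def power_divide abs_of_pos)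

lemma nrm_0 [simp]: "nrm 0 = 1" and rate_0 [simp]: "rate 0 = 0" and conn_0 [simp]: "conn 0 = 0"
  by (simp_all add: nrm_def rate_def conn_def)

lemma parity [simp]: "nrm (- t) = nrm t" "rate (- t) = - rate t" "conn (- t) = - conn t"
    "wa (- t) = wa t" "wb (- t) = wb t"
  by (simp_all add: nrm_def rate_def conn_def wa_def wb_def divide_simps)

lemma DERIV_nrm [derivative_intros]:
  assumes "(g has_real_derivative g') (at t within S)"
  shows "((\<lambda>t. nrm (g t)) has_real_derivative - rate (g t) * nrm (g t) * g') (at t within S)"
proof -
  define E where "E t = cosh (\<alpha> * t) * cosh (\<beta> * t)" for t
  have E0: "E t > 0" for t by (simp add: E_def)
  have dE: "(E has_real_derivative 2 * rate t * E t) (at t)" for t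
    unfolding E_def[abs_def]
    by (auto intro!: derivative_eq_intros simp: rate_def tanh_def field_simps)
  have "((\<lambda>t. 1 / sqrt (E t)) has_real_derivative - rate t * (1 / sqrt (E t))) (at t)" for t
  proof -
    have "sqrt (E t) * sqrt (E t) = E t" using E0[of t] by simp
    then show ?thesis using E0[of t] dE[of t]
      by (auto intro!: derivative_eq_intros simp: field_simps)
  qed
  then have "(nrm has_real_derivative - rate t * nrm t) (at t)" for t
    by (simp add: nrm_def[abs_def] E_def)
  from DERIV_chain2[OF this assms] show ?thesis .
qed

lemma continuous_nrm [continuous_intros]:
  "continuous_on S g \<Longrightarrow> continuous_on S (\<lambda>x. nrm (g x))"
  unfolding nrm_def by (intro continuous_intros) (auto simp: less_imp_neq[symmetric])

lemma one_plus_tanh: "1 + tanh x = exp x / cosh x" "1 - tanh x = exp (- x) / cosh x" for x :: real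
  by (simp_all add: tanh_def add_divide_eq_iff diff_divide_eq_iff cosh_plus_sinh cosh_minus_sinh)

lemma cosh_ge: "exp x / 2 \<le> cosh x" "exp (- x) / 2 \<le> cosh x" for x :: real
  by (simp_all add: cosh_def)

lemma nrm_le: "nrm t \<le> 2 * exp (\<kappa> * t)" "nrm t \<le> 2 * exp (- \<kappa> * t)"
proof -
  have *: "nrm t \<le> 2 * exp (\<kappa> * t)" for t
  proof -
    have "exp (- (\<alpha> * t)) / 2 * (exp (- (\<beta> * t)) / 2) \<le> cosh (\<alpha> * t) * cosh (\<beta> * t)"
      by (rule mult_mono[OF cosh_ge(2) cosh_ge(2)]) simp_all
    moreover have "exp (- (\<alpha> * t)) / 2 * (exp (- (\<beta> * t)) / 2) = (exp (- \<kappa> * t) / 2)\<^sup>2"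
    proof -
      have "exp (- (\<alpha> * t)) * exp (- (\<beta> * t)) = exp (- \<kappa> * t) * exp (- \<kappa> * t)"
        unfolding exp_add[symmetric] by (simp add: \<kappa>_def field_simps)
      then show ?thesis by (simp add: power2_eq_square)
    qed
    ultimately have "(exp (- \<kappa> * t) / 2)\<^sup>2 \<le> cosh (\<alpha> * t) * cosh (\<beta> * t)" by simp
    then have "exp (- \<kappa> * t) / 2 \<le> sqrt (cosh (\<alpha> * t) * cosh (\<beta> * t))"
      by (rule real_le_rsqrt)
    then have "nrm t \<le> 1 / (exp (- \<kappa> * t) / 2)"
      unfolding nrm_def by (intro divide_left_mono) auto
    then show ?thesis by (simp add: exp_minus field_simps)
  qed
  show "nrm t \<le> 2 * exp (\<kappa> * t)" by (rule *)
  show "nrm t \<le> 2 * exp (- \<kappa> * t)" using *[of "- t"] by simp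
qed

text \<open>The coefficient of p in the Euler-Lagrange equations of \<open>mode_form\<close>; the
  coefficient of q is \<open>pot (- m)\<close>, since only the square of m - conn matters.\<close>

definition pot :: "real \<Rightarrow> real \<Rightarrow> real" where
  "pot m t = (m + conn t)\<^sup>2 - ((wa t)\<^sup>2 + (wb t)\<^sup>2) / 2"

lemma pot_minus: "pot m (- t) = pot (- m) t"
  by (simp add: pot_def power2_commute)

definition solves :: "real \<Rightarrow> (real \<Rightarrow> real) \<Rightarrow> (real \<Rightarrow> real) \<Rightarrow> (real \<Rightarrow> real) \<Rightarrow> (real \<Rightarrow> real) \<Rightarrow> bool" where
  "solves m p q p' q' \<longleftrightarrow> (\<forall>t.
     (p has_real_derivative p' t) (at t) \<and> (q has_real_derivative q' t) (at t) \<and>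
     (p' has_real_derivative pot m t * p t - wa t * wb t * q t) (at t) \<and>
     (q' has_real_derivative pot (- m) t * q t - wa t * wb t * p t) (at t))"

text \<open>Reversing t changes the sign of \<open>conn\<close> and keeps \<open>wa\<close> and
  \<open>wb\<close>, so it exchanges the roles of p and q.\<close>

lemma solves_mirror:
  assumes "solves m p q p' q'"
  shows "solves m (\<lambda>t. q (- t)) (\<lambda>t. p (- t)) (\<lambda>t. - q' (- t)) (\<lambda>t. - p' (- t))"
  unfolding solves_def
proof (intro allI conjI)
  fix t
  have *: "(p has_real_derivative p' (- t)) (at (- t))" "(q has_real_derivative q' (- t)) (at (- t))"
    "(p' has_real_derivative pot (- m) t * p (- t) - wa t * wb t * q (- t)) (at (- t))"
    "(q' has_real_derivative pot m t * q (- t) - wa t * wb t * p (- t)) (at (- t))"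
    using assms[unfolded solves_def, rule_format, of "- t"] by (simp_all add: pot_minus)
  show "((\<lambda>t. q (- t)) has_real_derivative - q' (- t)) (at t)"
    "((\<lambda>t. p (- t)) has_real_derivative - p' (- t)) (at t)"
    using * by (simp_all add: DERIV_mirror[symmetric])
  show "((\<lambda>t. - q' (- t)) has_real_derivative pot m t * q (- t) - wa t * wb t * p (- t)) (at t)"
    "((\<lambda>t. - p' (- t)) has_real_derivative pot (- m) t * p (- t) - wa t * wb t * q (- t)) (at t)"
    using DERIV_minus[OF *(3)[unfolded DERIV_mirror]] DERIV_minus[OF *(4)[unfolded DERIV_mirror]]
    by simp_all
qed

lemma solves_diff_scale:
  assumes "solves m p q p' q'" "solves m y z y' z'"
  shows "solves m (\<lambda>t. p t - c * y t) (\<lambda>t. q t - c * z t) (\<lambda>t. p' t - c * y' t) (\<lambda>t. q' t - c * z' t)"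
  using assms unfolding solves_def
  by (auto intro!: derivative_eq_intros simp: algebra_simps)

text \<open>The coefficient matrix of the second-order system is symmetric, so the symplectic
  product of two solutions has derivative zero.\<close>

lemma solves_wronskian:
  assumes "solves m p q p' q'" "solves m y z y' z'"
  shows "y t * p' t + z t * q' t - y' t * p t - z' t * q t
       = y 0 * p' 0 + z 0 * q' 0 - y' 0 * p 0 - z' 0 * q 0"
proof -
  have "((\<lambda>t. y t * p' t + z t * q' t - y' t * p t - z' t * q t) has_real_derivative 0) (at t)" for t
    using assms unfolding solves_def
    by (auto intro!: derivative_eq_intros simp: algebra_simps)
  from DERIV_isconst_all[OF allI[OF this]] show ?thesis .
qed

text \<open>A Gronwall argument: the sum N of the four squares satisfies \<bar>N'\<bar> \<le> G * N
  on a compact interval, so N weighted by an exponential is monotone on either side of 0.\<close>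

lemma solves_unique:
  assumes s: "solves m p q p' q'" and z: "p 0 = 0" "q 0 = 0" "p' 0 = 0" "q' 0 = 0"
  shows "p t = 0 \<and> q t = 0"
proof -
  define N where "N t = (p t)\<^sup>2 + (q t)\<^sup>2 + (p' t)\<^sup>2 + (q' t)\<^sup>2" for t
  define A B C where "A t = pot m t" and "B t = pot (- m) t" and "C t = wa t * wb t" for t
  define N' where "N' t = 2 * p t * p' t + 2 * q t * q' t + 2 * p' t * (A t * p t - C t * q t)
     + 2 * q' t * (B t * q t - C t * p t)" for t
  have dN: "(N has_real_derivative N' t) (at t)" for t
    using s unfolding solves_def N_def[abs_def] N'_def A_def B_def C_def
    by (auto intro!: derivative_eq_intros simp: algebra_simps)
  have cont: "continuous_on {- \<bar>t\<bar>..\<bar>t\<bar>} (\<lambda>t. \<bar>A t\<bar> + \<bar>B t\<bar> + \<bar>C t\<bar>)"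
    unfolding A_def B_def C_def pot_def by (intro continuous_intros; simp)
  obtain K where K: "\<And>u. u \<in> {- \<bar>t\<bar>..\<bar>t\<bar>} \<Longrightarrow> \<bar>A u\<bar> + \<bar>B u\<bar> + \<bar>C u\<bar> \<le> K"
    using compact_continuous_image[OF cont compact_Icc, THEN compact_imp_bounded]
    unfolding bounded_iff by force
  \<comment> \<open>The 1 comes from the products p * p' and q * q'; each of the four squares of N
    then occurs in exactly two of the four estimates with factor K.\<close>
  define G where "G = 1 + 2 * K"
  have NN: "\<bar>N' u\<bar> \<le> G * N u" if u: "u \<in> {- \<bar>t\<bar>..\<bar>t\<bar>}" for u
  proof -
    have K': "\<bar>A u\<bar> \<le> K" "\<bar>B u\<bar> \<le> K" "\<bar>C u\<bar> \<le> K" using K[OF u] by linarith+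
    have ab: "\<bar>2 * x * y\<bar> \<le> x\<^sup>2 + y\<^sup>2" for x y :: real
      using zero_le_power2[of "x - y"] zero_le_power2[of "x + y"]
      by (simp add: power2_sum power2_diff abs_le_iff)
    have kab: "\<bar>2 * x * (c * y)\<bar> \<le> K * (x\<^sup>2 + y\<^sup>2)" if "\<bar>c\<bar> \<le> K" for c x y
    proof -
      have "\<bar>2 * x * (c * y)\<bar> = \<bar>c\<bar> * \<bar>2 * x * y\<bar>" by (simp add: abs_mult)
      also have "\<dots> \<le> K * (x\<^sup>2 + y\<^sup>2)" by (intro mult_mono ab that) (use that in auto)
      finally show ?thesis .
    qed
    have N'_eq: "N' u = 2 * p u * p' u + 2 * q u * q' u + 2 * p' u * (A u * p u) - 2 * p' u * (C u * q u)
       + 2 * q' u * (B u * q u) - 2 * q' u * (C u * p u)"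
      by (simp add: N'_def algebra_simps)
    have "\<bar>N' u\<bar> \<le> ((p u)\<^sup>2 + (p' u)\<^sup>2) + ((q u)\<^sup>2 + (q' u)\<^sup>2) + K * ((p' u)\<^sup>2 + (p u)\<^sup>2)
        + K * ((p' u)\<^sup>2 + (q u)\<^sup>2) + K * ((q' u)\<^sup>2 + (q u)\<^sup>2) + K * ((q' u)\<^sup>2 + (p u)\<^sup>2)"
      using ab[of "p u" "p' u"] ab[of "q u" "q' u"] kab[OF K'(1), of "p' u" "p u"]
        kab[OF K'(3), of "p' u" "q u"] kab[OF K'(2), of "q' u" "q u"] kab[OF K'(3), of "q' u" "p u"]
      unfolding abs_le_iff N'_eq by linarith
    also have "\<dots> = G * N u" by (simp add: G_def N_def algebra_simps)
    finally show ?thesis .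
  qed
  have N0: "N 0 = 0" by (simp add: N_def z)
  have "N t \<le> 0"
  proof (cases "t \<ge> 0")
    case True
    have "N t * exp (- G * t) \<le> N 0 * exp (- G * 0)"
    proof (rule DERIV_nonpos_imp_nonincreasing[OF True])
      fix u assume u: "0 \<le> u" "u \<le> t"
      have "((\<lambda>t. N t * exp (- G * t)) has_real_derivative (N' u - G * N u) * exp (- G * u)) (at u)"
        by (auto intro!: derivative_eq_intros dN simp: algebra_simps)
      moreover have "(N' u - G * N u) * exp (- G * u) \<le> 0"
        using NN[of u] u by (intro mult_nonpos_nonneg) auto
      ultimately show "\<exists>y. ((\<lambda>t. N t * exp (- G * t)) has_real_derivative y) (at u) \<and> y \<le> 0" by blast
    qed
    then show ?thesis by (simp add: N0 mult_le_0_iff)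
  next
    case False
    then have tn: "t \<le> 0" by simp
    have "N t * exp (G * t) \<le> N 0 * exp (G * 0)"
    proof (rule DERIV_nonneg_imp_nondecreasing[OF tn])
      fix u assume u: "t \<le> u" "u \<le> 0"
      have "((\<lambda>t. N t * exp (G * t)) has_real_derivative (N' u + G * N u) * exp (G * u)) (at u)"
        by (auto intro!: derivative_eq_intros dN simp: algebra_simps)
      moreover have "(N' u + G * N u) * exp (G * u) \<ge> 0"
        using NN[of u] u False by (intro mult_nonneg_nonneg) auto
      ultimately show "\<exists>y. ((\<lambda>t. N t * exp (G * t)) has_real_derivative y) (at u) \<and> 0 \<le> y" by blast
    qed
    then show ?thesis by (simp add: N0 mult_le_0_iff)
  qed
  then have "(p t)\<^sup>2 \<le> 0" "(q t)\<^sup>2 \<le> 0"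
    using zero_le_power2[of "p t"] zero_le_power2[of "q t"] zero_le_power2[of "p' t"] zero_le_power2[of "q' t"]
    unfolding N_def by linarith+
  then show ?thesis by simp
qed

end

section \<open>Explicit exponential solutions and Wronskians with bounded solutions\<close>

context two_rates begin
text \<open>The building block of all explicit solutions and of all test fields: it solves y' = (c -
  rate) * y, and it is bounded on the line when c lies between - \<kappa> and \<kappa>.\<close>

definition ex :: "real \<Rightarrow> real \<Rightarrow> real" where "ex c t = exp (c * t) * nrm t"

lemma ex_0 [simp]: "ex c 0 = 1" and ex_minus: "ex c (- t) = ex (- c) t"
  by (simp_all add: ex_def)

lemma DERIV_ex [derivative_intros]:
  assumes "(g has_real_derivative g') (at t within S)"
  shows "((\<lambda>t. ex c (g t)) has_real_derivative (c - rate (g t)) * ex c (g t) * g') (at t within S)"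
  unfolding ex_def using assms by (auto intro!: derivative_eq_intros simp: algebra_simps)

lemma DERIV_ex_first: "(ex c has_real_derivative (c - rate t) * ex c t) (at t)"
  using DERIV_ex[OF DERIV_ident, of c t UNIV] by simp

lemma DERIV_ex_second:
  "((\<lambda>t. (c - rate t) * ex c t) has_real_derivative ((c - rate t)\<^sup>2 - ((wa t)\<^sup>2 + (wb t)\<^sup>2) / 2) * ex c t) (at t)"
  by (rule DERIV_cong, (rule derivative_eq_intros refl)+) (simp add: algebra_simps power2_eq_square)

text \<open>Exactly what the Wronskian argument uses, and only at the left end of the line; the
  right end is reached by reflection.\<close>

definition decays :: "(real \<Rightarrow> real) \<Rightarrow> (real \<Rightarrow> real) \<Rightarrow> bool" where
  "decays y y' \<longleftrightarrow> (\<exists>C D \<delta>. 0 < \<delta> \<and> 0 \<le> D \<and> (\<forall>t\<le>0. \<bar>y t\<bar> \<le> C \<and> \<bar>y' t\<bar> \<le> D * exp (\<delta> * t)))"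

lemma decaysI:
  "0 < \<delta> \<Longrightarrow> 0 \<le> D \<Longrightarrow> (\<And>t. t \<le> 0 \<Longrightarrow> \<bar>y t\<bar> \<le> C) \<Longrightarrow>
    (\<And>t. t \<le> 0 \<Longrightarrow> \<bar>y' t\<bar> \<le> D * exp (\<delta> * t)) \<Longrightarrow> decays y y'"
  unfolding decays_def by blast

lemma decays_scale: "decays y y' \<Longrightarrow> decays (\<lambda>t. c * y t) (\<lambda>t. c * y' t)"
  unfolding decays_def
proof (elim exE conjE)
  fix C D \<delta> assume *: "0 < \<delta>" "0 \<le> D" "\<forall>t\<le>0. \<bar>y t\<bar> \<le> C \<and> \<bar>y' t\<bar> \<le> D * exp (\<delta> * t)"
  show "\<exists>C D \<delta>. 0 < \<delta> \<and> 0 \<le> D \<and> (\<forall>t\<le>0. \<bar>c * y t\<bar> \<le> C \<and> \<bar>c * y' t\<bar> \<le> D * exp (\<delta> * t))"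
    by (rule exI[of _ "\<bar>c\<bar> * C"], rule exI[of _ "\<bar>c\<bar> * D"], rule exI[of _ \<delta>])
       (use * in \<open>auto simp: abs_mult mult.assoc intro!: mult_left_mono\<close>)
qed

lemma decays_add:
  assumes "decays y y'" "decays z z'"
  shows "decays (\<lambda>t. y t + z t) (\<lambda>t. y' t + z' t)"
proof -
  obtain C D \<delta> where y: "0 < \<delta>" "0 \<le> D" "\<And>t. t \<le> 0 \<Longrightarrow> \<bar>y t\<bar> \<le> C" "\<And>t. t \<le> 0 \<Longrightarrow> \<bar>y' t\<bar> \<le> D * exp (\<delta> * t)"
    using assms(1) unfolding decays_def by metis
  obtain C2 D2 \<delta>2 where z: "0 < \<delta>2" "0 \<le> D2" "\<And>t. t \<le> 0 \<Longrightarrow> \<bar>z t\<bar> \<le> C2" "\<And>t. t \<le> 0 \<Longrightarrow> \<bar>z' t\<bar> \<le> D2 * exp (\<delta>2 * t)"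
    using assms(2) unfolding decays_def by metis
  define d where "d = min \<delta> \<delta>2"
  have b: "\<bar>y t + z t\<bar> \<le> C + C2 \<and> \<bar>y' t + z' t\<bar> \<le> (D + D2) * exp (d * t)" if t: "t \<le> 0" for t
  proof
    show "\<bar>y t + z t\<bar> \<le> C + C2" using y(3)[OF t] z(3)[OF t] by linarith
    have "exp (\<delta> * t) \<le> exp (d * t)" "exp (\<delta>2 * t) \<le> exp (d * t)"
      using t by (auto simp: d_def intro!: mult_right_mono_neg)
    then have "D * exp (\<delta> * t) \<le> D * exp (d * t)" "D2 * exp (\<delta>2 * t) \<le> D2 * exp (d * t)"
      using y(2) z(2) by (auto intro!: mult_left_mono)
    with y(4)[OF t] z(4)[OF t] show "\<bar>y' t + z' t\<bar> \<le> (D + D2) * exp (d * t)"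
      by (simp add: distrib_right)
  qed
  show ?thesis unfolding decays_def
    by (rule exI[of _ "C + C2"], rule exI[of _ "D + D2"], rule exI[of _ d])
       (use y z b in \<open>auto simp: d_def\<close>)
qed

text \<open>For c > - \<kappa> the whole function decays exponentially at the left end. For c = -
  \<kappa> it tends to a non-zero constant and the decay of its derivative comes from the factor c -
  rate alone; the slower of the exponents 2 * \<alpha> and 2 * \<beta> governs it.\<close>

lemma decays_ex:
  assumes "0 \<le> c + \<kappa>"
  shows "decays (ex c) (\<lambda>t. (c - rate t) * ex c t)"
proof -
  have bd: "\<bar>ex c t\<bar> \<le> 2 * exp ((c + \<kappa>) * t)" for t
  proof -
    have "exp (c * t) * nrm t \<le> exp (c * t) * (2 * exp (\<kappa> * t))"
      by (intro mult_left_mono nrm_le) simp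
    also have "\<dots> = 2 * exp ((c + \<kappa>) * t)" by (simp add: distrib_right exp_add)
    finally show ?thesis by (simp add: ex_def abs_mult less_imp_le)
  qed
  have rate: "\<bar>rate t\<bar> \<le> \<kappa>" for t using rate_bound[of t] by (simp add: \<kappa>_def)
  have ex2: "\<bar>ex c t\<bar> \<le> 2" if "t \<le> 0" for t
    using order_trans[OF bd[of t], of 2] mult_nonneg_nonpos[OF assms that] by simp
  show ?thesis
  proof (cases "c + \<kappa> = 0")
    case False
    have bd': "\<bar>(c - rate t) * ex c t\<bar> \<le> ((\<bar>c\<bar> + \<kappa>) * 2) * exp ((c + \<kappa>) * t)" for t
      unfolding abs_mult mult.assoc using rate[of t] by (intro mult_mono bd) auto
    show ?thesis
      by (rule decaysI[OF _ _ ex2 bd']) (use False assms kappa_mu(5) in auto)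
  next
    case True
    have th: "0 \<le> 1 + tanh x \<and> 1 + tanh x \<le> 2 * exp (2 * x)" for x :: real
    proof -
      have "exp x / cosh x \<le> exp x / (exp (- x) / 2)"
        using cosh_ge[of x] by (intro divide_left_mono) auto
      also have "\<dots> = 2 * exp (2 * x)" by (simp add: exp_minus field_simps mult_exp_exp)
      finally show ?thesis by (simp add: one_plus_tanh)
    qed
    have "\<bar>c - rate t\<bar> \<le> (\<alpha> + \<beta>) * exp (2 * \<beta> * t)" if "t \<le> 0" for t
    proof -
      have "exp (2 * (\<alpha> * t)) \<le> exp (2 * \<beta> * t)"
        using that beta_less by (auto intro: mult_right_mono_neg)
      then have "1 + tanh (\<alpha> * t) \<le> 2 * exp (2 * \<beta> * t)" using th[of "\<alpha> * t"] by linarith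
      then have a: "\<alpha> * (1 + tanh (\<alpha> * t)) \<le> \<alpha> * (2 * exp (2 * \<beta> * t))"
        using alpha_pos by (intro mult_left_mono) auto
      have b: "\<beta> * (1 + tanh (\<beta> * t)) \<le> \<beta> * (2 * exp (2 * \<beta> * t))"
        using th[of "\<beta> * t"] beta_pos by (intro mult_left_mono) (auto simp: mult.assoc)
      have "0 \<le> \<alpha> * (1 + tanh (\<alpha> * t))" "0 \<le> \<beta> * (1 + tanh (\<beta> * t))"
        using th alpha_pos beta_pos by auto
      moreover have "rate t - c = (\<alpha> * (1 + tanh (\<alpha> * t)) + \<beta> * (1 + tanh (\<beta> * t))) / 2"
        using True by (simp add: rate_def \<kappa>_def field_simps)
      moreover have "0 \<le> r \<and> r \<le> (P + Q) / 2" if "0 \<le> X" "0 \<le> Y" "r = (X + Y) / 2" "X \<le> P" "Y \<le> Q"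
        for r P Q X Y :: real
        using that by simp
      ultimately have "0 \<le> rate t - c \<and> rate t - c \<le> (\<alpha> * (2 * exp (2 * \<beta> * t)) + \<beta> * (2 * exp (2 * \<beta> * t))) / 2"
        using a b by blast
      then show ?thesis by (simp add: algebra_simps add_divide_distrib)
    qed
    note lin = this
    have bd': "\<bar>(c - rate t) * ex c t\<bar> \<le> ((\<alpha> + \<beta>) * 2) * exp (2 * \<beta> * t)" if "t \<le> 0" for t
    proof -
      have "\<bar>(c - rate t) * ex c t\<bar> \<le> ((\<alpha> + \<beta>) * exp (2 * \<beta> * t)) * 2"
        unfolding abs_mult using that ex2[OF that] alpha_pos beta_pos
        by (intro mult_mono lin) auto
      then show ?thesis by (simp add: algebra_simps)
    qed
    show ?thesis
      by (rule decaysI[OF _ _ ex2 bd']) (use alpha_pos beta_pos in auto)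
  qed
qed

text \<open>A non-zero constant value of the Wronskian would make \<open>y \<bullet> x\<close> grow linearly at \<open>-\<infinity>\<close>.\<close>

lemma wronskian_zero:
  assumes x: "solves m p q p' q'" and y: "solves m y z y' z'"
    and bd: "\<And>t. \<bar>p t\<bar> \<le> M" "\<And>t. \<bar>q t\<bar> \<le> M" and dec: "decays y y'" "decays z z'"
  shows "y 0 * p' 0 + z 0 * q' 0 - y' 0 * p 0 - z' 0 * q 0 = 0" (is "?W = 0")
proof (rule ccontr)
  assume W: "?W \<noteq> 0"
  obtain C D \<delta> where d: "0 < \<delta>" "0 \<le> D" "\<And>t. t \<le> 0 \<Longrightarrow> \<bar>y t\<bar> \<le> C" "\<And>t. t \<le> 0 \<Longrightarrow> \<bar>y' t\<bar> \<le> D * exp (\<delta> * t)"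
    using dec(1) unfolding decays_def by metis
  obtain C2 D2 \<delta>2 where d2: "0 < \<delta>2" "0 \<le> D2" "\<And>t. t \<le> 0 \<Longrightarrow> \<bar>z t\<bar> \<le> C2" "\<And>t. t \<le> 0 \<Longrightarrow> \<bar>z' t\<bar> \<le> D2 * exp (\<delta>2 * t)"
    using dec(2) unfolding decays_def by metis
  have M: "0 \<le> M" using bd(1)[of 0] by linarith
  \<comment> \<open>An antiderivative of the exponential bound for twice y' * p + z' * q.\<close>
  define V where "V t = 2 * M * D / \<delta> * exp (\<delta> * t) + 2 * M * D2 / \<delta>2 * exp (\<delta>2 * t)" for t
  define F where "F t = y t * p t + z t * q t" for t
  \<comment> \<open>By constancy of the Wronskian the terms with p' and q' equal its value plus y' *
    p + z' * q, so the derivative of F is that value up to an exponentially small error.\<close>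
  define F' where "F' t = ?W + 2 * (y' t * p t + z' t * q t)" for t
  have dF: "(F has_real_derivative F' t) (at t)" for t
  proof -
    have "(F has_real_derivative y t * p' t + y' t * p t + (z t * q' t + z' t * q t)) (at t)"
      using x y unfolding solves_def F_def[abs_def] by (auto intro!: derivative_eq_intros)
    then show ?thesis unfolding F'_def solves_wronskian[OF x y, of t, symmetric]
      by (rule DERIV_cong) simp
  qed
  have dV: "(V has_real_derivative 2 * M * D * exp (\<delta> * t) + 2 * M * D2 * exp (\<delta>2 * t)) (at t)" for t
    unfolding V_def[abs_def] using d d2 by (auto intro!: derivative_eq_intros)
  have F'b: "\<bar>F' t - ?W\<bar> \<le> 2 * M * D * exp (\<delta> * t) + 2 * M * D2 * exp (\<delta>2 * t)" if "t \<le> 0" for t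
  proof -
    have "\<bar>y' t * p t\<bar> \<le> (D * exp (\<delta> * t)) * M" "\<bar>z' t * q t\<bar> \<le> (D2 * exp (\<delta>2 * t)) * M"
      unfolding abs_mult by (intro mult_mono bd d d2 that; use d d2 in simp)+
    then show ?thesis unfolding F'_def by (simp add: mult_ac)
  qed
  have dist: "\<bar>F 0 - F t + ?W * t\<bar> \<le> V 0 - V t" if t: "t \<le> 0" for t
  proof -
    have "V t - (F t - ?W * t) \<le> V 0 - (F 0 - ?W * 0)"
    proof (rule DERIV_nonneg_imp_nondecreasing[OF t])
      fix u assume u: "t \<le> u" "u \<le> 0"
      have "((\<lambda>t. V t - (F t - ?W * t)) has_real_derivative
          (2 * M * D * exp (\<delta> * u) + 2 * M * D2 * exp (\<delta>2 * u)) - (F' u - ?W * 1)) (at u)"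
        by (intro DERIV_diff dV dF DERIV_cmult DERIV_ident)
      then show "\<exists>y. ((\<lambda>t. V t - (F t - ?W * t)) has_real_derivative y) (at u) \<and> 0 \<le> y"
        using F'b[OF u(2)] by (intro exI conjI) auto
    qed
    moreover have "V t + (F t - ?W * t) \<le> V 0 + (F 0 - ?W * 0)"
    proof (rule DERIV_nonneg_imp_nondecreasing[OF t])
      fix u assume u: "t \<le> u" "u \<le> 0"
      have "((\<lambda>t. V t + (F t - ?W * t)) has_real_derivative
          (2 * M * D * exp (\<delta> * u) + 2 * M * D2 * exp (\<delta>2 * u)) + (F' u - ?W * 1)) (at u)"
        by (intro DERIV_diff DERIV_add dV dF DERIV_cmult DERIV_ident)
      then show "\<exists>y. ((\<lambda>t. V t + (F t - ?W * t)) has_real_derivative y) (at u) \<and> 0 \<le> y"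
        using F'b[OF u(2)] by (intro exI conjI) auto
    qed
    ultimately show ?thesis by (simp add: abs_le_iff)
  qed
  have Fb: "\<bar>F t\<bar> \<le> C * M + C2 * M" if "t \<le> 0" for t
  proof -
    have "0 \<le> C" "0 \<le> C2" using d(3)[of 0] d2(3)[of 0] by linarith+
    then have "\<bar>y t * p t\<bar> \<le> C * M" "\<bar>z t * q t\<bar> \<le> C2 * M"
      unfolding abs_mult by (intro mult_mono bd d d2 that; simp)+
    then show ?thesis unfolding F_def by linarith
  qed
  have V0: "0 \<le> V t" for t unfolding V_def using M d d2 by simp
  define R where "R = V 0 + 2 * (C * M + C2 * M)"
  have "\<bar>?W\<bar> * s \<le> R" if "s \<ge> 0" for s
  proof -
    have "\<bar>w\<bar> * s \<le> d + 2 * c"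
      if "\<bar>a - b + w * (- s)\<bar> \<le> d - e" "\<bar>a\<bar> \<le> c" "\<bar>b\<bar> \<le> c" "0 \<le> e" for a b c d e w :: real
    proof -
      have "\<bar>w\<bar> * s = \<bar>w * s\<bar>" using \<open>s \<ge> 0\<close> by (simp add: abs_mult)
      then show ?thesis using that by simp
    qed
    from this[OF dist[of "- s"] Fb[of 0] Fb[of "- s"] V0[of "- s"]] that
    show ?thesis unfolding R_def by simp
  qed
  \<comment> \<open>The argument is chosen such that the left side is \<bar>R\<bar> + 1.\<close>
  from this[of "(\<bar>R\<bar> + 1) / \<bar>?W\<bar>"] W show False by simp
qed

text \<open>For a = \<alpha> and a = - \<alpha> these two pairs span the solutions of the
  first-order system behind \<open>mode_pot\<close>: on them wa * p + wb * q is a multiple of rate -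
  m, so that the pole cancels.\<close>

definition fund_p :: "real \<Rightarrow> real \<Rightarrow> real \<Rightarrow> real" where
  "fund_p a m t = \<beta> * ex (m + a) t"
definition fund_q :: "real \<Rightarrow> real \<Rightarrow> real \<Rightarrow> real" where
  "fund_q a m t = - (a / \<alpha>) * (m + (a - \<beta>) / 2) * ex (m + \<beta>) t + - (a / \<alpha>) * (m + (a + \<beta>) / 2) * ex (m - \<beta>) t"
definition fund_p' :: "real \<Rightarrow> real \<Rightarrow> real \<Rightarrow> real" where
  "fund_p' a m t = \<beta> * ((m + a - rate t) * ex (m + a) t)"
definition fund_q' :: "real \<Rightarrow> real \<Rightarrow> real \<Rightarrow> real" where
  "fund_q' a m t = - (a / \<alpha>) * (m + (a - \<beta>) / 2) * ((m + \<beta> - rate t) * ex (m + \<beta>) t)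
     + - (a / \<alpha>) * (m + (a + \<beta>) / 2) * ((m - \<beta> - rate t) * ex (m - \<beta>) t)"

text \<open>In both equations the difference of the two squares factors into terms with a single
  hyperbolic tangent each. Multiplied by a matching exponential such a term collapses to a multiple
  of 1 / cosh, and this is the coupling to the other component.\<close>

lemma solves_fund:
  assumes a: "a = \<alpha> \<or> a = - \<alpha>"
  shows "solves m (fund_p a m) (fund_q a m) (fund_p' a m) (fund_q' a m)"
  unfolding solves_def
proof (intro allI conjI)
  fix t
  show "(fund_p a m has_real_derivative fund_p' a m t) (at t)"
    "(fund_q a m has_real_derivative fund_q' a m t) (at t)"
    unfolding fund_p_def[abs_def] fund_p'_def fund_q_def[abs_def] fund_q'_def
    by (intro DERIV_cmult DERIV_add DERIV_ex_first)+
  define T S where "T = \<alpha> * tanh (\<alpha> * t)" and "S = \<beta> * tanh (\<beta> * t)"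
  define A B B' e where "A = exp (a * t)" and "B = exp (\<beta> * t)" and "B' = exp (- (\<beta> * t))" and "e = exp (m * t) * nrm t"
  define u v where "u = 1 / cosh (\<alpha> * t)" and "v = 1 / cosh (\<beta> * t)"
  define c1 c2 where "c1 = m + (a - \<beta>) / 2" and "c2 = m + (a + \<beta>) / 2"
  have ex: "ex (m + a) t = e * A" "ex (m + \<beta>) t = e * B" "ex (m - \<beta>) t = e * B'"
    by (simp_all add: ex_def e_def A_def B_def B'_def distrib_right left_diff_distrib exp_add exp_diff exp_minus field_simps)
  have Ta: "T = a * tanh (a * t)" and ua: "u = 1 / cosh (a * t)" using a by (auto simp: T_def u_def)
  have "(1 - tanh x) * exp x = 1 / cosh x" "(1 + tanh x) * exp (- x) = 1 / cosh x" for x :: real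
    by (simp_all add: one_plus_tanh flip: exp_add)
  note th = this
  have f1: "(a - T) * A = a * u"
  proof -
    have "(a - T) * A = a * ((1 - tanh (a * t)) * A)" by (simp add: Ta algebra_simps)
    then show ?thesis by (simp only: A_def th ua)
  qed
  have f2: "a + T = a * (A * u)"
  proof -
    have "a + T = a * (1 + tanh (a * t))" by (simp add: Ta algebra_simps)
    then show ?thesis unfolding one_plus_tanh by (simp add: A_def ua)
  qed
  have f3: "(\<beta> - S) * B = \<beta> * v"
  proof -
    have "(\<beta> - S) * B = \<beta> * ((1 - tanh (\<beta> * t)) * B)" by (simp add: S_def algebra_simps)
    then show ?thesis by (simp only: B_def th v_def)
  qed
  have f4: "(\<beta> + S) * B' = \<beta> * v"
  proof -
    have "(\<beta> + S) * B' = \<beta> * ((1 + tanh (\<beta> * t)) * B')" by (simp add: S_def algebra_simps)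
    then show ?thesis by (simp only: B'_def th v_def)
  qed
  \<comment> \<open>The two coefficients of \<open>fund_q\<close> are dictated by this
    identity.\<close>
  have f5: "2 * m + a - S = v * (c1 * B + c2 * B')"
    unfolding S_def v_def B_def B'_def c1_def c2_def tanh_def
    by (simp add: field_simps) (simp add: sinh_def cosh_def field_simps)
  have w: "wa t * wb t = \<alpha> * \<beta> * u * v" by (simp add: wa_def wb_def u_def v_def)
  have rc: "rate t = (T + S) / 2" "conn t = (T - S) / 2" by (simp_all add: rate_def conn_def T_def S_def)
  have aa: "a * a = \<alpha> * \<alpha>" and a0: "a / \<alpha> * \<alpha> = a" "a / \<alpha> * a = \<alpha>" using a alpha_pos by auto
  define R where "R = ((wa t)\<^sup>2 + (wb t)\<^sup>2) / 2"
  have pot: "pot m t = (m + conn t)\<^sup>2 - R" "pot (- m) t = (m - conn t)\<^sup>2 - R"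
    by (simp_all add: pot_def R_def power2_commute)
  have "(fund_p' a m has_real_derivative \<beta> * (((m + a - rate t)\<^sup>2 - R) * ex (m + a) t)) (at t)"
    unfolding fund_p'_def[abs_def] R_def by (intro DERIV_cmult DERIV_ex_second)
  moreover have "\<beta> * (((m + a - rate t)\<^sup>2 - R) * ex (m + a) t) = pot m t * fund_p a m t - wa t * wb t * fund_q a m t"
  proof -
    have "\<beta> * (((m + a - rate t)\<^sup>2 - R) * ex (m + a) t) - pot m t * fund_p a m t
        = \<beta> * e * ((m + a - rate t)\<^sup>2 - (m + conn t)\<^sup>2) * A"
      unfolding pot fund_p_def ex by (simp add: algebra_simps)
    also have "(m + a - rate t)\<^sup>2 - (m + conn t)\<^sup>2 = (a - T) * (2 * m + a - S)"
      unfolding rc by (simp add: power2_eq_square field_simps)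
    also have "\<beta> * e * ((a - T) * (2 * m + a - S)) * A = \<beta> * e * ((a - T) * A) * (2 * m + a - S)"
      by simp
    also have "\<dots> = \<beta> * e * (a * u) * (v * (c1 * B + c2 * B'))" by (simp only: f1 f5)
    also have "\<dots> = \<beta> * e * (a / \<alpha> * \<alpha> * u) * (v * (c1 * B + c2 * B'))" by (simp only: a0)
    also have "\<dots> = - (wa t * wb t * fund_q a m t)"
    proof -
      have "fund_q a m t = - (a / \<alpha>) * e * (c1 * B + c2 * B')"
      proof -
        have "r * c1 * (e * B) + r * c2 * (e * B') = r * e * (c1 * B + c2 * B')" for r
          by (simp add: algebra_simps)
        then show ?thesis unfolding fund_q_def ex c1_def[symmetric] c2_def[symmetric] .
      qed
      then show ?thesis unfolding w by simp
    qed
    finally show ?thesis by simp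
  qed
  ultimately show "(fund_p' a m has_real_derivative pot m t * fund_p a m t - wa t * wb t * fund_q a m t) (at t)"
    by simp
  have "(fund_q' a m has_real_derivative
       - (a / \<alpha>) * c1 * (((m + \<beta> - rate t)\<^sup>2 - R) * ex (m + \<beta>) t)
     + - (a / \<alpha>) * c2 * (((m - \<beta> - rate t)\<^sup>2 - R) * ex (m - \<beta>) t)) (at t)"
    unfolding fund_q'_def[abs_def] R_def c1_def c2_def by (intro DERIV_cmult DERIV_add DERIV_ex_second)
  moreover have "- (a / \<alpha>) * c1 * (((m + \<beta> - rate t)\<^sup>2 - R) * ex (m + \<beta>) t)
     + - (a / \<alpha>) * c2 * (((m - \<beta> - rate t)\<^sup>2 - R) * ex (m - \<beta>) t)
     = pot (- m) t * fund_q a m t - wa t * wb t * fund_p a m t"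
  proof -
    define r where "r = - (a / \<alpha>)"
    have "r * c1 * (((m + \<beta> - rate t)\<^sup>2 - R) * ex (m + \<beta>) t)
     + r * c2 * (((m - \<beta> - rate t)\<^sup>2 - R) * ex (m - \<beta>) t) - pot (- m) t * fund_q a m t
     = r * e * (c1 * (((m + \<beta> - rate t)\<^sup>2 - (m - conn t)\<^sup>2) * B) + c2 * (((m - \<beta> - rate t)\<^sup>2 - (m - conn t)\<^sup>2) * B'))"
    proof -
      have "r * c1 * ((x - R) * (e * B)) + r * c2 * ((y - R) * (e * B')) - (z - R) * (r * c1 * (e * B) + r * c2 * (e * B'))
        = r * e * (c1 * ((x - z) * B) + c2 * ((y - z) * B'))" for x y z
        by (simp add: algebra_simps)
      then show ?thesis unfolding pot fund_q_def c1_def[symmetric] c2_def[symmetric] ex r_def[symmetric] .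
    qed
    also have "((m + \<beta> - rate t)\<^sup>2 - (m - conn t)\<^sup>2) = (\<beta> - S) * (2 * m + \<beta> - T)"
      unfolding rc by (simp add: power2_eq_square field_simps)
    also have "((m - \<beta> - rate t)\<^sup>2 - (m - conn t)\<^sup>2) = (\<beta> + S) * - (2 * m - \<beta> - T)"
      unfolding rc by (simp add: power2_eq_square field_simps)
    also have "(\<beta> - S) * (2 * m + \<beta> - T) * B = \<beta> * v * (2 * m + \<beta> - T)"
      unfolding f3[symmetric] by simp
    also have "(\<beta> + S) * - (2 * m - \<beta> - T) * B' = \<beta> * v * - (2 * m - \<beta> - T)"
      unfolding f4[symmetric] by simp
    also have "c1 * (\<beta> * v * (2 * m + \<beta> - T)) + c2 * (\<beta> * v * - (2 * m - \<beta> - T)) = \<beta> * v * (\<beta> * (a + T))"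
      unfolding c1_def c2_def by (simp add: field_simps)
    also have "r * e * (\<beta> * v * (\<beta> * (a + T))) = - ((a / \<alpha> * a) * e * \<beta> * v * \<beta> * (A * u))"
      unfolding f2 r_def by simp
    also have "\<dots> = - (wa t * wb t * fund_p a m t)"
      unfolding w a0 fund_p_def ex by simp
    finally show ?thesis unfolding r_def by simp
  qed
  ultimately show "(fund_q' a m has_real_derivative pot (- m) t * fund_q a m t - wa t * wb t * fund_p a m t) (at t)"
    by simp
qed

lemma solves_swap: "solves m p q p' q' \<Longrightarrow> solves (- m) q p q' p'"
  by (auto simp: solves_def mult_ac)

text \<open>The exponents m + a, m + \<beta>, m - \<beta> are all at least - \<kappa>, except when a
  = - \<alpha> and m < \<mu>. In that case they are all at most \<kappa>, so the solution is
  controlled at the right end instead, and reflecting t while replacing m by - m reduces it to the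
  first situation.\<close>

lemma fund_wronskian:
  assumes x: "solves m p q p' q'" and m: "0 \<le> m" and a: "a = \<alpha> \<or> a = - \<alpha>"
    and bd: "\<And>t. \<bar>p t\<bar> \<le> M" "\<And>t. \<bar>q t\<bar> \<le> M"
  shows "fund_p a m 0 * p' 0 + fund_q a m 0 * q' 0 - fund_p' a m 0 * p 0 - fund_q' a m 0 * q 0 = 0"
proof (cases "a = \<alpha> \<or> \<mu> \<le> m")
  case True
  have c: "0 \<le> m + a + \<kappa>" "0 \<le> m + \<beta> + \<kappa>" "0 \<le> m - \<beta> + \<kappa>"
    using True a m kappa_mu by auto
  show ?thesis
  proof (rule wronskian_zero[OF x solves_fund[OF a] bd])
    show "decays (fund_p a m) (fund_p' a m)" "decays (fund_q a m) (fund_q' a m)"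
      unfolding fund_p_def[abs_def] fund_p'_def[abs_def] fund_q_def[abs_def] fund_q'_def[abs_def]
      by (intro decays_scale decays_add decays_ex c)+
  qed
next
  case False
  then have a': "a = - \<alpha>" "m < \<mu>" using a by auto
  have c: "0 \<le> - (m + a) + \<kappa>" "0 \<le> - (m + \<beta>) + \<kappa>" "0 \<le> - (m - \<beta>) + \<kappa>"
    using a' m kappa_mu by auto
  have rev: "(\<lambda>t. ex c (- t)) = ex (- c)" "(\<lambda>t. - ((c - rate (- t)) * ex c (- t))) = (\<lambda>t. (- c - rate t) * ex (- c) t)" for c
    by (auto simp: fun_eq_iff ex_minus algebra_simps)
  have dec: "decays (\<lambda>t. ex c (- t)) (\<lambda>t. - ((c - rate (- t)) * ex c (- t)))" if "0 \<le> - c + \<kappa>" for c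
    unfolding rev by (rule decays_ex[OF that])
  have "fund_p a m (- 0) * - p' (- 0) + fund_q a m (- 0) * - q' (- 0)
     - - fund_p' a m (- 0) * p (- 0) - - fund_q' a m (- 0) * q (- 0) = 0"
  proof (rule wronskian_zero[OF solves_swap[OF solves_mirror[OF x]] solves_swap[OF solves_mirror[OF solves_fund[OF a]]], where M = M])
    have "(\<lambda>t. - fund_p' a m (- t)) = (\<lambda>t. \<beta> * - ((m + a - rate (- t)) * ex (m + a) (- t)))"
      "(\<lambda>t. - fund_q' a m (- t)) = (\<lambda>t. - (a / \<alpha>) * (m + (a - \<beta>) / 2) * - ((m + \<beta> - rate (- t)) * ex (m + \<beta>) (- t))
     + - (a / \<alpha>) * (m + (a + \<beta>) / 2) * - ((m - \<beta> - rate (- t)) * ex (m - \<beta>) (- t)))"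
      by (simp_all add: fun_eq_iff fund_p'_def fund_q'_def)
    then show "decays (\<lambda>t. fund_p a m (- t)) (\<lambda>t. - fund_p' a m (- t))"
      "decays (\<lambda>t. fund_q a m (- t)) (\<lambda>t. - fund_q' a m (- t))"
      unfolding fund_p_def fund_q_def
      by (simp only:, intro decays_scale decays_add dec c)+
  qed (use bd in auto)
  then show ?thesis by simp
qed

end

section \<open>Classification of the bounded solutions of a mode\<close>

context two_rates begin

lemma neg_halves: "(- \<alpha> - \<beta>) / 2 = - \<kappa>" "(- \<alpha> + \<beta>) / 2 = - \<mu>"
  by (simp_all only: \<kappa>_def \<mu>_def, simp_all add: divide_simps)

lemma quot: "\<alpha> / \<alpha> = 1" "- \<alpha> / \<alpha> = - 1"
  using alpha_pos by auto

lemma fund_0: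
  "fund_p a m 0 = \<beta>"
  "fund_p' \<alpha> m 0 = \<beta> * (m + \<alpha>)" "fund_p' (- \<alpha>) m 0 = \<beta> * (m - \<alpha>)"
  "fund_q \<alpha> m 0 = - (2 * m + \<alpha>)" "fund_q (- \<alpha>) m 0 = 2 * m - \<alpha>"
  "fund_q' \<alpha> m 0 = - ((m + \<mu>) * (m + \<beta>) + (m + \<kappa>) * (m - \<beta>))"
  "fund_q' (- \<alpha>) m 0 = (m - \<kappa>) * (m + \<beta>) + (m - \<mu>) * (m - \<beta>)"
proof -
  show "fund_p a m 0 = \<beta>" "fund_p' \<alpha> m 0 = \<beta> * (m + \<alpha>)" "fund_p' (- \<alpha>) m 0 = \<beta> * (m - \<alpha>)"
    by (simp_all add: fund_p_def fund_p'_def)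
  show "fund_q' \<alpha> m 0 = - ((m + \<mu>) * (m + \<beta>) + (m + \<kappa>) * (m - \<beta>))"
    unfolding fund_q'_def quot \<mu>_def[symmetric] \<kappa>_def[symmetric] by (simp add: algebra_simps)
  show "fund_q' (- \<alpha>) m 0 = (m - \<kappa>) * (m + \<beta>) + (m - \<mu>) * (m - \<beta>)"
    unfolding fund_q'_def quot neg_halves by simp
  show "fund_q \<alpha> m 0 = - (2 * m + \<alpha>)" "fund_q (- \<alpha>) m 0 = 2 * m - \<alpha>"
    unfolding fund_q_def quot by (simp_all add: field_simps)
qed

text \<open>Pairing the solution and its mirror image with both explicit solutions gives four linear
  equations for the Cauchy data at 0. They decouple in the sums and differences of p and q into
  relations multiplied by m + \<kappa>, m + \<mu>, m - \<kappa> and m - \<mu>. Only the last two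
  factors can vanish. Where both relations for one combination survive, they differ by 2 * \<beta>
  times that combination, which is then zero.\<close>

lemma bounded_solution_initial:
  assumes x: "solves m p q p' q'" and m: "0 \<le> m"
    and bd: "\<And>t. \<bar>p t\<bar> \<le> M" "\<And>t. \<bar>q t\<bar> \<le> M"
  shows "m \<noteq> \<mu> \<Longrightarrow> p 0 = q 0 \<and> p' 0 = - q' 0" "m \<noteq> \<kappa> \<Longrightarrow> p 0 = - q 0 \<and> p' 0 = q' 0"
    "p' 0 + q' 0 = - (m + \<beta>) * (p 0 - q 0)" "p' 0 - q' 0 = - (m - \<beta>) * (p 0 + q 0)"
proof -
  note W = fund_wronskian[OF x m _ bd] fund_wronskian[OF solves_mirror[OF x] m _ bd(2,1)]
  define A1 where "A1 = 2 * m + \<alpha>"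
  define A2 where "A2 = 2 * m - \<alpha>"
  define B1 where "B1 = (m + \<mu>) * (m + \<beta>) + (m + \<kappa>) * (m - \<beta>)"
  define B2 where "B2 = (m - \<kappa>) * (m + \<beta>) + (m - \<mu>) * (m - \<beta>)"
  define C1 where "C1 = \<beta> * (m + \<alpha>)"
  define C2 where "C2 = \<beta> * (m - \<alpha>)"
  note ABC = A1_def A2_def B1_def B2_def C1_def C2_def
  note v = fund_0[where m = m, folded ABC]
  have e1: "\<beta> * p' 0 - A1 * q' 0 - C1 * p 0 + B1 * q 0 = 0"
    using W(1)[OF disjI1[OF refl], unfolded v] unfolding minus_zero by linarith
  have e1': "- \<beta> * q' 0 + A1 * p' 0 - C1 * q 0 + B1 * p 0 = 0"
    using W(2)[OF disjI1[OF refl], unfolded v] unfolding minus_zero by linarith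
  have e2: "\<beta> * p' 0 + A2 * q' 0 - C2 * p 0 - B2 * q 0 = 0"
    using W(1)[OF disjI2[OF refl], unfolded v] unfolding minus_zero by linarith
  have e2': "- \<beta> * q' 0 - A2 * p' 0 - C2 * q 0 - B2 * p 0 = 0"
    using W(2)[OF disjI2[OF refl], unfolded v] unfolding minus_zero by linarith
  define U V U' V' where "U = p 0 + q 0" and "V = p 0 - q 0" and "U' = p' 0 + q' 0" and "V' = p' 0 - q' 0"
  note d = U_def V_def U'_def V'_def
  \<comment> \<open>With k and l as variables for \<kappa> and \<mu> the coefficients become
    polynomials and the combinations are ring identities.\<close>
  have gen: "2 * ((m + k) * ((P' - Q') + (m - (k - l)) * (P + Q)))
      = ((k - l) * P' - (2 * m + (k + l)) * Q' - (k - l) * (m + (k + l)) * P + ((m + l) * (m + (k - l)) + (m + k) * (m - (k - l))) * Q)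
      + (- (k - l) * Q' + (2 * m + (k + l)) * P' - (k - l) * (m + (k + l)) * Q + ((m + l) * (m + (k - l)) + (m + k) * (m - (k - l))) * P)"
    "2 * ((m + l) * ((P' + Q') + (m + (k - l)) * (P - Q)))
      = (- (k - l) * Q' + (2 * m + (k + l)) * P' - (k - l) * (m + (k + l)) * Q + ((m + l) * (m + (k - l)) + (m + k) * (m - (k - l))) * P)
      - ((k - l) * P' - (2 * m + (k + l)) * Q' - (k - l) * (m + (k + l)) * P + ((m + l) * (m + (k - l)) + (m + k) * (m - (k - l))) * Q)"
    "2 * ((m - k) * ((P' - Q') + (m + (k - l)) * (P + Q)))
      = - ((k - l) * P' + (2 * m - (k + l)) * Q' - (k - l) * (m - (k + l)) * P - ((m - k) * (m + (k - l)) + (m - l) * (m - (k - l))) * Q)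
      - (- (k - l) * Q' - (2 * m - (k + l)) * P' - (k - l) * (m - (k + l)) * Q - ((m - k) * (m + (k - l)) + (m - l) * (m - (k - l))) * P)"
    "2 * ((m - l) * ((P' + Q') + (m - (k - l)) * (P - Q)))
      = ((k - l) * P' + (2 * m - (k + l)) * Q' - (k - l) * (m - (k + l)) * P - ((m - k) * (m + (k - l)) + (m - l) * (m - (k - l))) * Q)
      - (- (k - l) * Q' - (2 * m - (k + l)) * P' - (k - l) * (m - (k + l)) * Q - ((m - k) * (m + (k - l)) + (m - l) * (m - (k - l))) * P)"
    for P Q P' Q' k l :: real
    by (simp_all add: algebra_simps)
  note G = gen[where k = \<kappa> and l = \<mu> and P = "p 0" and Q = "q 0" and P' = "p' 0" and Q' = "q' 0", folded kappa_mu(1,2), folded ABC d, unfolded e1 e1' e2 e2']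
  have 1: "V' = - (m - \<beta>) * U" unfolding mult_minus_left eq_neg_iff_add_eq_0 using G(1) m kappa_mu(5) by auto
  have 2: "U' = - (m + \<beta>) * V" unfolding mult_minus_left eq_neg_iff_add_eq_0 using G(2) m kappa_mu(3) by auto
  have 3: "m \<noteq> \<kappa> \<Longrightarrow> V' = - (m + \<beta>) * U" unfolding mult_minus_left eq_neg_iff_add_eq_0 using G(3) by auto
  have 4: "m \<noteq> \<mu> \<Longrightarrow> U' = - (m - \<beta>) * V" unfolding mult_minus_left eq_neg_iff_add_eq_0 using G(4) by auto
  show "p' 0 + q' 0 = - (m + \<beta>) * (p 0 - q 0)" "p' 0 - q' 0 = - (m - \<beta>) * (p 0 + q 0)"
    using 1 2 by (simp_all only: d)
  show "p 0 = q 0 \<and> p' 0 = - q' 0" if "m \<noteq> \<mu>"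
  proof -
    have "2 * (\<beta> * V) = 0" using 2 4[OF that] by (simp add: algebra_simps)
    then have "V = 0" using beta_pos by simp
    then show ?thesis using 2 by (simp add: d)
  qed
  show "p 0 = - q 0 \<and> p' 0 = q' 0" if "m \<noteq> \<kappa>"
  proof -
    have "2 * (\<beta> * U) = 0" using 1 3[OF that] by (simp add: algebra_simps)
    then have "U = 0" using beta_pos by simp
    then show ?thesis using 1 by (simp add: d)
  qed
qed

text \<open>By uniqueness it suffices to compare Cauchy data with a multiple of the explicit
  solution for a = - \<alpha>. Its coefficients are proportional to m - \<kappa> and m - \<mu>, so
  in each exceptional mode one of its two terms drops out and a bounded solution remains.\<close>

lemma bounded_solution:
  assumes x: "solves m p q p' q'" and m: "0 \<le> m"
    and bd: "\<And>t. \<bar>p t\<bar> \<le> M" "\<And>t. \<bar>q t\<bar> \<le> M"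
  shows "m \<noteq> \<mu> \<Longrightarrow> m \<noteq> \<kappa> \<Longrightarrow> p t = 0 \<and> q t = 0"
    "m = \<mu> \<Longrightarrow> \<exists>c. \<forall>t. p t = - c * ex (- \<kappa>) t \<and> q t = c * ex \<kappa> t"
    "m = \<kappa> \<Longrightarrow> \<exists>c. \<forall>t. p t = c * ex (- \<mu>) t \<and> q t = c * ex \<mu> t"
proof -
  note I = bounded_solution_initial[OF x m bd]
  show "p t = 0 \<and> q t = 0" if "m \<noteq> \<mu>" "m \<noteq> \<kappa>"
    using I(1)[OF that(1)] I(2)[OF that(2)] by (intro solves_unique[OF x]) auto
  have b0: "\<beta> \<noteq> 0" and ne: "\<mu> \<noteq> \<kappa>" using beta_pos kappa_mu by auto
  show "\<exists>c. \<forall>t. p t = - c * ex (- \<kappa>) t \<and> q t = c * ex \<kappa> t" if mm: "m = \<mu>"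
  proof -
    define c where "c = - p 0"
    have e: "\<mu> + (\<beta> - \<alpha>) / 2 = 0" "\<mu> + - \<alpha> = - \<kappa>" "\<mu> + \<beta> = \<kappa>" "\<mu> + - \<kappa> = - \<beta>" "\<mu> - \<alpha> = - \<kappa>"
      by (simp_all add: \<kappa>_def \<mu>_def field_simps)
    have v: "fund_p (- \<alpha>) m t = \<beta> * ex (- \<kappa>) t" "fund_q (- \<alpha>) m t = - \<beta> * ex \<kappa> t"
      "fund_p' (- \<alpha>) m 0 = - \<beta> * \<kappa>" "fund_q' (- \<alpha>) m 0 = - \<beta> * \<kappa>" for t
      by (simp_all add: mm fund_p_def fund_q_def fund_p'_def fund_q'_def quot[simplified] neg_halves e e[simplified])
    have "\<mu> + \<beta> = \<kappa>" by (rule e(3))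
    then have i: "q 0 = c" "p' 0 = c * \<kappa>" "q' 0 = c * \<kappa>"
      using I(2) I(3) mm ne by (auto simp: c_def)
    have "p t - (- c / \<beta>) * fund_p (- \<alpha>) m t = 0 \<and> q t - (- c / \<beta>) * fund_q (- \<alpha>) m t = 0" for t
      by (rule solves_unique[OF solves_diff_scale[OF x solves_fund[OF disjI2[OF refl]]]])
         (use b0 in \<open>simp_all add: v i\<close>, simp add: c_def)
    then show ?thesis using b0 by (intro exI[of _ c]) (auto simp: v eq_neg_iff_add_eq_0)
  qed
  show "\<exists>c. \<forall>t. p t = c * ex (- \<mu>) t \<and> q t = c * ex \<mu> t" if mm: "m = \<kappa>"
  proof -
    define c where "c = p 0"
    have e: "\<kappa> + (\<beta> - \<alpha>) / 2 = \<beta>" "\<kappa> + - \<alpha> = - \<mu>" "\<kappa> - \<beta> = \<mu>" "\<kappa> + - \<mu> = \<beta>" "\<kappa> - \<alpha> = - \<mu>"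
      by (simp_all add: \<kappa>_def \<mu>_def field_simps)
    have v: "fund_p (- \<alpha>) m t = \<beta> * ex (- \<mu>) t" "fund_q (- \<alpha>) m t = \<beta> * ex \<mu> t"
      "fund_p' (- \<alpha>) m 0 = - \<beta> * \<mu>" "fund_q' (- \<alpha>) m 0 = \<beta> * \<mu>" for t
      by (simp_all add: mm fund_p_def fund_q_def fund_p'_def fund_q'_def quot[simplified] neg_halves e e[simplified])
    have "\<kappa> - \<beta> = \<mu>" by (rule e(3))
    then have i: "q 0 = c" "p' 0 = - (c * \<mu>)" "q' 0 = c * \<mu>"
      using I(1) I(4) mm ne by (auto simp: c_def)
    have "p t - (c / \<beta>) * fund_p (- \<alpha>) m t = 0 \<and> q t - (c / \<beta>) * fund_q (- \<alpha>) m t = 0" for t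
      by (rule solves_unique[OF solves_diff_scale[OF x solves_fund[OF disjI2[OF refl]]]])
         (use b0 in \<open>simp_all add: v i\<close>, simp add: c_def)
    then show ?thesis using b0 by (intro exI[of _ c]) (auto simp: v eq_neg_iff_add_eq_0)
  qed
qed

section \<open>Energy of the explicit test pairs\<close>

text \<open>The right side is even in y and takes the value of the left side at 0. Its derivative
  factors as 2 * (1 - x^2) * x * sinh (2 * x * y) * cosh (2 * y), which is non-negative for y \<ge>
  0.\<close>

lemma cosh_sinh_gap:
  fixes x y :: real
  assumes x: "\<bar>x\<bar> \<le> 1"
  shows "1 - x\<^sup>2 \<le> 1 - x\<^sup>2 * (cosh (2 * x * y) * cosh (2 * y)) + x * (sinh (2 * x * y) * sinh (2 * y))"
proof -
  let ?K = "\<lambda>y. 1 - x\<^sup>2 * (cosh (2 * x * y) * cosh (2 * y)) + x * (sinh (2 * x * y) * sinh (2 * y))"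
  have x2: "x\<^sup>2 \<le> 1" using x by (simp add: abs_square_le_1)
  have "?K 0 \<le> ?K y" if y: "0 \<le> y" for y
  proof (rule DERIV_nonneg_imp_nondecreasing[OF y])
    fix z assume z: "0 \<le> z" "z \<le> y"
    have "(?K has_real_derivative 2 * (1 - x\<^sup>2) * (x * sinh (2 * x * z)) * cosh (2 * z)) (at z)"
      by (rule DERIV_cong, (rule derivative_eq_intros refl)+) (simp add: algebra_simps power2_eq_square)
    moreover have sx: "0 \<le> x * sinh (2 * x * z)"
      using z by (cases "0 \<le> x") (auto simp: zero_le_mult_iff mult_le_0_iff)
    then have "0 \<le> 2 * (1 - x\<^sup>2) * (x * sinh (2 * x * z)) * cosh (2 * z)"
      by (intro mult_nonneg_nonneg[OF mult_nonneg_nonneg[OF _ sx]]) (use x2 in auto)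
    ultimately show "\<exists>d. (?K has_real_derivative d) (at z) \<and> 0 \<le> d"
      by blast
  qed
  from this[of "\<bar>y\<bar>"] show ?thesis by (cases "0 \<le> y") auto
qed

text \<open>For the pair \<phi> * \<open>ex (- s)\<close>, \<phi> * \<open>ex s\<close> the mode
  form is a total derivative plus a term in the square of \<phi>' minus the square of \<phi> times
  this function; a positive excess thus means negative energy.\<close>

definition excess :: "real \<Rightarrow> real \<Rightarrow> real \<Rightarrow> real" where
  "excess s m t = ((- s - rate t)\<^sup>2 - (m + conn t)\<^sup>2) * (ex (- s) t)\<^sup>2
     + ((s - rate t)\<^sup>2 - (m - conn t)\<^sup>2) * (ex s t)\<^sup>2 + 2 * (wa t * wb t) * ex (- s) t * ex s t"

text \<open>The parameters s = x * \<mu> and m = x * \<kappa> move along the segment that ends, at x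
  = 1, in the bounded solution of mode \<kappa>; there the excess vanishes. For smaller
  \<bar>x\<bar> it factors as \<alpha> * \<beta> * n^2 * H with H \<ge> 2 * (1 - x^2).\<close>

lemma excess_ge:
  assumes x: "\<bar>x\<bar> \<le> 1"
  shows "2 * \<alpha> * \<beta> * (1 - x\<^sup>2) * (nrm t) ^ 4 \<le> excess (x * \<mu>) (x * \<kappa>) t"
proof -
  define s where "s = x * \<mu>"
  define e1 e2 n where "e1 = exp (- 2 * s * t)" and "e2 = exp (2 * s * t)" and "n = (nrm t)\<^sup>2"
  define ca cb sa sb where "ca = cosh (\<alpha> * t)" and "cb = cosh (\<beta> * t)" and "sa = sinh (\<alpha> * t)" and "sb = sinh (\<beta> * t)"
  have c0: "ca > 0" "cb > 0" by (simp_all add: ca_def cb_def)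
  have n: "n * (ca * cb) = 1" using c0 by (simp add: n_def nrm_sq ca_def cb_def)
  have n0: "n \<ge> 0" by (simp add: n_def)
  have e: "(ex (- s) t)\<^sup>2 = e1 * n" "(ex s t)\<^sup>2 = e2 * n" "ex (- s) t * ex s t = n"
    by (simp_all add: ex_def e1_def e2_def n_def power2_eq_square power_mult_distrib exp_minus mult_exp_exp field_simps)
  have w: "wa t * wb t = \<alpha> * \<beta> * n"
    by (simp add: wa_def wb_def n_def nrm_sq)
  have sm: "s + x * \<kappa> = x * \<alpha>" "s - x * \<kappa> = - (x * \<beta>)"
    by (simp_all add: s_def \<kappa>_def \<mu>_def algebra_simps add_divide_distrib diff_divide_distrib)
  have ta: "\<alpha> * tanh (\<alpha> * t) = \<alpha> * (sa / ca)" "\<beta> * tanh (\<beta> * t) = \<beta> * (sb / cb)"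
    by (simp_all add: tanh_def sa_def sb_def ca_def cb_def)
  have f: "(- s - rate t)\<^sup>2 - (x * \<kappa> + conn t)\<^sup>2 = (rate t - conn t + (s - x * \<kappa>)) * (rate t + conn t + (s + x * \<kappa>))"
    "(s - rate t)\<^sup>2 - (x * \<kappa> - conn t)\<^sup>2 = (rate t - conn t - (s - x * \<kappa>)) * (rate t + conn t - (s + x * \<kappa>))"
    by (simp_all add: power2_eq_square algebra_simps)
  have g: "(\<beta> * (sb / cb) + - (x * \<beta>)) * (\<alpha> * (sa / ca) + x * \<alpha>) = \<alpha> * \<beta> * n * ((sb - x * cb) * (sa + x * ca))"
    "(\<beta> * (sb / cb) - - (x * \<beta>)) * (\<alpha> * (sa / ca) - x * \<alpha>) = \<alpha> * \<beta> * n * ((sb + x * cb) * (sa - x * ca))"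
  proof -
    have nn: "n = 1 / (ca * cb)" using n c0 by (simp add: field_simps)
    show "(\<beta> * (sb / cb) + - (x * \<beta>)) * (\<alpha> * (sa / ca) + x * \<alpha>) = \<alpha> * \<beta> * n * ((sb - x * cb) * (sa + x * ca))"
      "(\<beta> * (sb / cb) - - (x * \<beta>)) * (\<alpha> * (sa / ca) - x * \<alpha>) = \<alpha> * \<beta> * n * ((sb + x * cb) * (sa - x * ca))"
      unfolding nn using c0 by (simp_all add: field_simps)
  qed
  define H where "H = (sb - x * cb) * (sa + x * ca) * e1 + (sb + x * cb) * (sa - x * ca) * e2 + 2"
  have J: "excess s (x * \<kappa>) t = \<alpha> * \<beta> * n\<^sup>2 * H"
    unfolding excess_def f rate_conn sm ta g e w mult.assoc H_def
    unfolding mult.assoc[symmetric] by (simp add: e algebra_simps power2_eq_square)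
  have ch: "e1 = cosh (2 * s * t) - sinh (2 * s * t)" "e2 = cosh (2 * s * t) + sinh (2 * s * t)"
    by (simp_all add: e1_def e2_def cosh_minus_sinh cosh_plus_sinh)
  have y: "\<alpha> * t - \<beta> * t = 2 * (\<mu> * t)" by (simp add: \<mu>_def algebra_simps)
  \<comment> \<open>Since \<alpha> - \<beta> = 2 * \<mu>, the addition theorems express the mixed
    products in the variable of \<open>cosh_sinh_gap\<close>; what is left over is a multiple of sa
    * sb, which is non-negative.\<close>
  have cd: "cosh (2 * (\<mu> * t)) = ca * cb - sa * sb" "sinh (2 * (\<mu> * t)) = sa * cb - ca * sb"
    unfolding y[symmetric] cosh_diff sinh_diff ca_def cb_def sa_def sb_def by (simp_all add: mult_ac)
  have ss: "0 \<le> sa * sb"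
    unfolding sa_def sb_def using alpha_pos beta_pos by (cases "0 \<le> t") (auto simp: zero_le_mult_iff mult_le_0_iff)
  have "H = 2 * cosh (2 * s * t) * (sa * sb - x\<^sup>2 * (ca * cb)) + 2 * sinh (2 * s * t) * x * (sa * cb - ca * sb) + 2"
    unfolding H_def ch by (simp add: algebra_simps power2_eq_square)
  also have "\<dots> = 2 * (1 - x\<^sup>2 * (cosh (2 * s * t) * cosh (2 * (\<mu> * t))) + x * (sinh (2 * s * t) * sinh (2 * (\<mu> * t))))
      + 2 * cosh (2 * s * t) * ((1 - x\<^sup>2) * (sa * sb))"
    unfolding cd by (simp add: algebra_simps)
  also have "2 * s * t = 2 * x * (\<mu> * t)" by (simp add: s_def)
  also have "2 * (1 - x\<^sup>2) \<le> 2 * (1 - x\<^sup>2 * (cosh (2 * x * (\<mu> * t)) * cosh (2 * (\<mu> * t))) + x * (sinh (2 * x * (\<mu> * t)) * sinh (2 * (\<mu> * t))))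
      + 2 * cosh (2 * x * (\<mu> * t)) * ((1 - x\<^sup>2) * (sa * sb))"
  proof -
    have "x\<^sup>2 \<le> 1" using x by (simp add: abs_square_le_1)
    then have "0 \<le> 2 * cosh (2 * x * (\<mu> * t)) * ((1 - x\<^sup>2) * (sa * sb))"
      by (intro mult_nonneg_nonneg[OF _ mult_nonneg_nonneg[OF _ ss]]) auto
    moreover have "2 * A \<le> 2 * B + C" if "A \<le> B" "0 \<le> C" for A B C :: real using that by simp
    ultimately show ?thesis using cosh_sinh_gap[OF x, of "\<mu> * t"] by blast
  qed
  finally have "2 * (1 - x\<^sup>2) \<le> H" .
  then have "\<alpha> * \<beta> * n\<^sup>2 * (2 * (1 - x\<^sup>2)) \<le> \<alpha> * \<beta> * n\<^sup>2 * H"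
    using alpha_pos beta_pos by (intro mult_left_mono) auto
  then show ?thesis unfolding J[symmetric] s_def by (simp add: n_def mult_ac flip: power_mult)
qed

text \<open>Integration by parts in differential form: the function differentiated is p * p' + q *
  q' without the derivative of the cut-off, and this absorbs all products of \<phi> and its
  derivative.\<close>

lemma mode_form_test:
  assumes "(\<phi> has_real_derivative c') (at t)"
  shows "((\<lambda>t. (\<phi> t)\<^sup>2 * ((- s - rate t) * (ex (- s) t)\<^sup>2 + (s - rate t) * (ex s t)\<^sup>2)) has_real_derivative
     mode_form m t (\<phi> t * ex (- s) t) (\<phi> t * ex s t)
        (c' * ex (- s) t + \<phi> t * ((- s - rate t) * ex (- s) t)) (c' * ex s t + \<phi> t * ((s - rate t) * ex s t))
     - c'\<^sup>2 * ((ex (- s) t)\<^sup>2 + (ex s t)\<^sup>2) + (\<phi> t)\<^sup>2 * excess s m t) (at t)"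
  by (rule DERIV_cong, (rule derivative_eq_intros refl assms)+)
     (simp add: mode_form_def excess_def algebra_simps power2_eq_square)

end

section \<open>Fourier coefficients on the circle\<close>

text \<open>Not divided by the length of the circle; the factor 2 * pi reappears in Bessel's
  inequality and in Parseval's identity.\<close>

definition fcoef :: "(real \<Rightarrow> complex) \<Rightarrow> int \<Rightarrow> complex" where
  "fcoef f j = integral {0..2*pi} (\<lambda>\<theta>. f \<theta> * cis (- (of_int j * \<theta>)))"

definition trig :: "int set \<Rightarrow> (int \<Rightarrow> complex) \<Rightarrow> real \<Rightarrow> complex" where
  "trig J c \<theta> = (\<Sum>j\<in>J. c j * cis (of_int j * \<theta>))"

lemma cis_int_2pi: "cis (of_int j * (2 * pi)) = 1"
  using cis_multiple_2pi[of "of_int j"] by (simp add: mult.commute mult.left_commute)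

lemma has_vector_derivative_cis:
  "((\<lambda>\<theta>. cis (a * \<theta>)) has_vector_derivative \<i> * of_real a * cis (a * \<theta>)) (at \<theta> within S)"
proof -
  have "((\<lambda>\<theta>. Complex (cos (a * \<theta>)) (sin (a * \<theta>))) has_vector_derivative
      (Complex (- sin (a * \<theta>) * a) (cos (a * \<theta>) * a))) (at \<theta> within S)"
    unfolding Complex_eq has_real_derivative_iff_has_vector_derivative[symmetric]
    by (intro has_vector_derivative_add has_vector_derivative_mult_right has_vector_derivative_of_real)
       (auto intro!: derivative_eq_intros simp flip: has_real_derivative_iff_has_vector_derivative)
  then show ?thesis
    by (simp add: cis.ctr[abs_def] complex_eq_iff Complex_eq algebra_simps flip: of_real_mult)
qed

lemma integral_cis: "integral {0..2*pi} (\<lambda>\<theta>. cis (of_int j * \<theta>)) = (if j = 0 then 2 * pi else 0)"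
proof (cases "j = 0")
  case False
  have "((\<lambda>\<theta>. cis (of_int j * \<theta>)) has_integral
     (cis (of_int j * (2*pi)) / (\<i> * of_int j) - cis (of_int j * 0) / (\<i> * of_int j))) {0..2*pi}"
  proof (rule fundamental_theorem_of_calculus)
    fix x :: real
    show "((\<lambda>\<theta>. cis (of_int j * \<theta>) / (\<i> * of_int j)) has_vector_derivative cis (of_int j * x)) (at x within {0..2*pi})"
      using has_vector_derivative_divide[OF has_vector_derivative_cis[of "of_int j" x], of "\<i> * of_int j"] False
      by simp
  qed simp
  then show ?thesis using False by (simp only: cis_int_2pi) (simp add: integral_unique)
qed (simp add: scaleR_conv_of_real)

lemma continuous_cis [continuous_intros]:
  "continuous_on S g \<Longrightarrow> continuous_on S (\<lambda>x. cis (g x))"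
  unfolding cis_conv_exp by (intro continuous_intros)

lemma continuous_trig [continuous_intros]:
  "continuous_on S g \<Longrightarrow> continuous_on S (\<lambda>x. trig J c (g x))"
  unfolding trig_def by (intro continuous_intros)

lemma integral_mult_trig:
  assumes f: "continuous_on {0..2*pi} f" and J: "finite J"
  shows "integral {0..2*pi} (\<lambda>\<theta>. f \<theta> * trig J c \<theta>) = (\<Sum>j\<in>J. c j * fcoef f (- j))"
proof -
  have "integral {0..2*pi} (\<lambda>\<theta>. f \<theta> * trig J c \<theta>)
      = integral {0..2*pi} (\<lambda>\<theta>. \<Sum>j\<in>J. c j * (f \<theta> * cis (of_int j * \<theta>)))"
    by (simp add: trig_def sum_distrib_left mult_ac)
  also have "\<dots> = (\<Sum>j\<in>J. integral {0..2*pi} (\<lambda>\<theta>. c j * (f \<theta> * cis (of_int j * \<theta>))))"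
    by (intro Henstock_Kurzweil_Integration.integral_sum J integrable_continuous_real continuous_intros f)
  finally show ?thesis by (simp add: fcoef_def)
qed

lemma cnj_trig: "cnj (trig J c \<theta>) = trig (uminus ` J) (\<lambda>j. cnj (c (- j))) \<theta>"
  by (simp add: trig_def sum.reindex cis_cnj)

lemma integral_mult_cnj_trig:
  assumes f: "continuous_on {0..2*pi} f" and J: "finite J"
  shows "integral {0..2*pi} (\<lambda>\<theta>. f \<theta> * cnj (trig J c \<theta>)) = (\<Sum>j\<in>J. cnj (c j) * fcoef f j)"
  using integral_mult_trig[OF f, of "uminus ` J" "\<lambda>j. cnj (c (- j))"] J
  by (simp add: cnj_trig sum.reindex)

lemma fcoef_trig:
  fixes c :: "int \<Rightarrow> complex"
  assumes J: "finite J"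
  shows "fcoef (trig J c) j = (if j \<in> J then 2 * pi * c j else 0)"
proof -
  have "fcoef (trig J c) j = integral {0..2*pi} (\<lambda>\<theta>. cis (of_int (- j) * \<theta>) * trig J c \<theta>)"
    by (simp add: fcoef_def mult.commute)
  also have "\<dots> = (\<Sum>i\<in>J. c i * fcoef (\<lambda>\<theta>. cis (of_int (- j) * \<theta>)) (- i))"
    by (intro integral_mult_trig J continuous_intros)
  also have "\<dots> = (\<Sum>i\<in>J. c i * (if i = j then 2 * pi else 0))"
  proof (rule sum.cong[OF refl])
    fix i
    have "fcoef (\<lambda>\<theta>. cis (of_int (- j) * \<theta>)) (- i) = integral {0..2*pi} (\<lambda>\<theta>. cis (of_int (i - j) * \<theta>))"
      by (simp add: fcoef_def cis_mult algebra_simps)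
    then show "c i * fcoef (\<lambda>\<theta>. cis (of_int (- j) * \<theta>)) (- i) = c i * (if i = j then 2 * pi else 0)"
      by (simp only: integral_cis) auto
  qed
  also have "\<dots> = (if j \<in> J then 2 * pi * c j else 0)"
    using J by (simp add: if_distrib sum.delta cong: if_cong)
  finally show ?thesis .
qed

lemma integral_norm_sq:
  fixes f :: "real \<Rightarrow> complex"
  assumes "continuous_on {a..b} f"
  shows "of_real (integral {a..b} (\<lambda>\<theta>. (cmod (f \<theta>))\<^sup>2)) = integral {a..b} (\<lambda>\<theta>. f \<theta> * cnj (f \<theta>))"
  using integral_linear[OF _ bounded_linear_of_real, of "\<lambda>\<theta>. (cmod (f \<theta>))\<^sup>2" "{a..b}", where 'a1 = complex]
  by (simp add: o_def integrable_continuous_real continuous_intros assms flip: complex_norm_square)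

text \<open>Pythagoras with arbitrary coefficients c. Taking c to be the Fourier coefficients yields
  Bessel's inequality; dropping the last sum shows that they give the best approximation.\<close>

lemma remainder_norm:
  fixes f :: "real \<Rightarrow> complex"
  assumes f: "continuous_on {0..2*pi} f" and J: "finite J"
  shows "integral {0..2*pi} (\<lambda>\<theta>. (cmod (f \<theta> - trig J c \<theta>))\<^sup>2) =
     integral {0..2*pi} (\<lambda>\<theta>. (cmod (f \<theta>))\<^sup>2) - (\<Sum>j\<in>J. (cmod (fcoef f j))\<^sup>2) / (2 * pi)
     + 2 * pi * (\<Sum>j\<in>J. (cmod (c j - fcoef f j / (2 * pi)))\<^sup>2)"
proof -
  let ?I = "integral {0..2*pi}"
  define T where "T = trig J c"
  have T: "continuous_on {0..2*pi} T" unfolding T_def by (intro continuous_intros)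
  have cT: "fcoef T j = 2 * pi * c j" if "j \<in> J" for j using that J by (simp add: T_def fcoef_trig)
  define A where "A = (\<Sum>j\<in>J. cnj (c j) * fcoef f j)"
  have A: "?I (\<lambda>\<theta>. f \<theta> * cnj (T \<theta>)) = A" unfolding T_def A_def by (rule integral_mult_cnj_trig[OF f J])
  have B: "?I (\<lambda>\<theta>. T \<theta> * cnj (T \<theta>)) = (\<Sum>j\<in>J. 2 * pi * (c j * cnj (c j)))"
    using integral_mult_cnj_trig[OF T J, of c] by (simp add: T_def[symmetric] cT mult_ac)
  have C: "?I (\<lambda>\<theta>. T \<theta> * cnj (f \<theta>)) = cnj A"
  proof -
    have "?I (cnj \<circ> (\<lambda>\<theta>. f \<theta> * cnj (T \<theta>))) = cnj (?I (\<lambda>\<theta>. f \<theta> * cnj (T \<theta>)))"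
      by (intro integral_linear bounded_linear_cnj integrable_continuous_real continuous_intros f T)
    moreover have "cnj \<circ> (\<lambda>\<theta>. f \<theta> * cnj (T \<theta>)) = (\<lambda>\<theta>. T \<theta> * cnj (f \<theta>))"
      by (auto simp: fun_eq_iff)
    ultimately show ?thesis by (simp only: A)
  qed
  have "of_real (?I (\<lambda>\<theta>. (cmod (f \<theta> - T \<theta>))\<^sup>2)) = ?I (\<lambda>\<theta>. (f \<theta> - T \<theta>) * cnj (f \<theta> - T \<theta>))"
    by (intro integral_norm_sq continuous_intros f T)
  also have "\<dots> = ?I (\<lambda>\<theta>. f \<theta> * cnj (f \<theta>) - f \<theta> * cnj (T \<theta>) - (T \<theta> * cnj (f \<theta>) - T \<theta> * cnj (T \<theta>)))"
    by (simp add: algebra_simps)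
  also have "\<dots> = ?I (\<lambda>\<theta>. f \<theta> * cnj (f \<theta>)) - A - (cnj A - (\<Sum>j\<in>J. 2 * pi * (c j * cnj (c j))))"
    unfolding A[symmetric] B[symmetric] C[symmetric]
    by (simp add: A B C integrable_continuous_real continuous_intros f T
        Henstock_Kurzweil_Integration.integral_diff)
  also have "\<dots> = of_real (?I (\<lambda>\<theta>. (cmod (f \<theta>))\<^sup>2)) - (\<Sum>j\<in>J. fcoef f j * cnj (fcoef f j)) / (2 * pi)
     + 2 * pi * (\<Sum>j\<in>J. (c j - fcoef f j / (2 * pi)) * cnj (c j - fcoef f j / (2 * pi)))"
  proof -
    have "2 * pi * (\<Sum>j\<in>J. (c j - fcoef f j / (2 * pi)) * cnj (c j - fcoef f j / (2 * pi)))
       = (\<Sum>j\<in>J. 2 * pi * (c j * cnj (c j)) - cnj (c j) * fcoef f j - cnj (cnj (c j) * fcoef f j)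
           + fcoef f j * cnj (fcoef f j) / (2 * pi))"
      unfolding sum_distrib_left by (intro sum.cong refl) (simp add: field_simps)
    then show ?thesis
      unfolding A_def integral_norm_sq[OF f]
      by (simp add: sum.distrib sum_subtractf sum_divide_distrib)
  qed
  also have "\<dots> = of_real (?I (\<lambda>\<theta>. (cmod (f \<theta>))\<^sup>2) - (\<Sum>j\<in>J. (cmod (fcoef f j))\<^sup>2) / (2 * pi)
     + 2 * pi * (\<Sum>j\<in>J. (cmod (c j - fcoef f j / (2 * pi)))\<^sup>2))"
    by (simp only: complex_norm_square[symmetric] of_real_add of_real_diff of_real_sum of_real_mult
        of_real_divide of_real_numeral of_real_power)
  finally show ?thesis unfolding of_real_eq_iff T_def .
qed

text \<open>The bilinear, not the Hermitian, version: integrating a square pairs the frequency j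
  with - j, so the set of frequencies has to be symmetric.\<close>

lemma remainder_sq:
  fixes f :: "real \<Rightarrow> complex"
  assumes f: "continuous_on {0..2*pi} f" and J: "finite J" "uminus ` J = J"
  shows "integral {0..2*pi} (\<lambda>\<theta>. (f \<theta> - trig J (\<lambda>j. fcoef f j / (2 * pi)) \<theta>)\<^sup>2) =
     integral {0..2*pi} (\<lambda>\<theta>. (f \<theta>)\<^sup>2) - (\<Sum>j\<in>J. fcoef f j * fcoef f (- j)) / (2 * pi)"
proof -
  let ?I = "integral {0..2*pi}"
  define T where "T = trig J (\<lambda>j. fcoef f j / (2 * pi))"
  have T: "continuous_on {0..2*pi} T" unfolding T_def by (intro continuous_intros)
  define A where "A = (\<Sum>j\<in>J. fcoef f j / (2 * pi) * fcoef f (- j))"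
  have A: "?I (\<lambda>\<theta>. f \<theta> * T \<theta>) = A" unfolding T_def A_def by (rule integral_mult_trig[OF f J(1)])
  have "- j \<in> J" if "j \<in> J" for j using that J by blast
  then have B: "?I (\<lambda>\<theta>. T \<theta> * T \<theta>) = A"
    unfolding A_def using integral_mult_trig[OF T J(1), of "\<lambda>j. fcoef f j / (2 * pi)"]
    by (simp add: T_def fcoef_trig J)
  have "?I (\<lambda>\<theta>. (f \<theta> - T \<theta>)\<^sup>2) = ?I (\<lambda>\<theta>. (f \<theta>)\<^sup>2 - f \<theta> * T \<theta> - (f \<theta> * T \<theta> - T \<theta> * T \<theta>))"
    by (simp add: algebra_simps power2_eq_square)
  also have "\<dots> = ?I (\<lambda>\<theta>. (f \<theta>)\<^sup>2) - A"
    apply (subst Henstock_Kurzweil_Integration.integral_diff, (intro integrable_continuous_real continuous_intros f T)+)+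
    apply (simp add: A B)
    done
  finally show ?thesis by (simp add: T_def A_def sum_divide_distrib)
qed

lemma bessel:
  fixes f :: "real \<Rightarrow> complex"
  assumes f: "continuous_on {0..2*pi} f" and J: "finite J"
  shows "(\<Sum>j\<in>J. (cmod (fcoef f j))\<^sup>2) \<le> 2 * pi * integral {0..2*pi} (\<lambda>\<theta>. (cmod (f \<theta>))\<^sup>2)"
proof -
  have "0 \<le> integral {0..2*pi} (\<lambda>\<theta>. (cmod (f \<theta> - trig J (\<lambda>j. fcoef f j / (2 * pi)) \<theta>))\<^sup>2)"
    by (rule Henstock_Kurzweil_Integration.integral_nonneg)
       (auto intro!: integrable_continuous_real continuous_intros f)
  then show ?thesis
    unfolding remainder_norm[OF f J] by (simp add: field_simps)
qed

text \<open>On the unit circle real-linear functions are combinations of the frequencies 1 and - 1,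
  and trigonometric polynomials are closed under sums and products. The coefficients of a product
  collect the pairs with a given frequency sum.\<close>

lemma real_polynomial_on_circle:
  assumes "real_polynomial_function (g :: complex \<Rightarrow> real)"
  shows "\<exists>J c. finite J \<and> (\<forall>\<theta>. of_real (g (cis \<theta>)) = trig J c \<theta>)"
  using assms
proof induction
  case (linear g)
  have *: "of_real (g (cis \<theta>)) = trig {-1,1} (\<lambda>j. if j = 1 then (of_real (g 1) - \<i> * of_real (g \<i>)) / 2
        else (of_real (g 1) + \<i> * of_real (g \<i>)) / 2) \<theta>" for \<theta>
  proof -
    interpret g: bounded_linear g by (rule linear)
    have c: "cis \<theta> = cos \<theta> *\<^sub>R 1 + sin \<theta> *\<^sub>R \<i>" by (simp add: complex_eq_iff)
    have "g (cis \<theta>) = cos \<theta> * g 1 + sin \<theta> * g \<i>"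
      unfolding c g.add g.scaleR by simp
    then show ?thesis by (simp add: trig_def complex_eq_iff field_simps)
  qed
  show ?case by (rule exI, rule exI, rule conjI[rotated], rule allI, rule *, simp)
next
  case (const c)
  show ?case by (rule exI[of _ "{0}"], rule exI[of _ "\<lambda>_. of_real c"]) (simp add: trig_def)
next
  case (add f g)
  then obtain J c K d where "finite J" "finite K"
    and fg: "\<And>\<theta>. of_real (f (cis \<theta>)) = trig J c \<theta>" "\<And>\<theta>. of_real (g (cis \<theta>)) = trig K d \<theta>" by blast
  then have fin: "finite (J \<union> K)" by simp
  have "trig J c \<theta> = trig (J \<union> K) (\<lambda>j. if j \<in> J then c j else 0) \<theta>"
    "trig K d \<theta> = trig (J \<union> K) (\<lambda>j. if j \<in> K then d j else 0) \<theta>" for \<theta>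
    unfolding trig_def by (rule sum.mono_neutral_cong_left[OF fin]; auto)+
  then have *: "of_real (f (cis \<theta>) + g (cis \<theta>)) =
      trig (J \<union> K) (\<lambda>j. (if j \<in> J then c j else 0) + (if j \<in> K then d j else 0)) \<theta>" for \<theta>
    by (simp add: fg, simp add: trig_def ring_distribs sum.distrib)
  show ?case by (rule exI, rule exI, rule conjI[rotated], rule allI, rule *, rule fin)
next
  case (mult f g)
  then obtain J c K d where JK: "finite J" "finite K"
    and fg: "\<And>\<theta>. of_real (f (cis \<theta>)) = trig J c \<theta>" "\<And>\<theta>. of_real (g (cis \<theta>)) = trig K d \<theta>" by blast
  define h where "h = (\<lambda>(i, j). i + j :: int)"
  have *: "of_real (f (cis \<theta>) * g (cis \<theta>)) = trig (h ` (J \<times> K))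
      (\<lambda>n. \<Sum>x\<in>{x\<in>J \<times> K. h x = n}. c (fst x) * d (snd x)) \<theta>" for \<theta>
  proof -
    have "of_real (f (cis \<theta>) * g (cis \<theta>)) =
        (\<Sum>x\<in>J \<times> K. (c (fst x) * cis (of_int (fst x) * \<theta>)) * (d (snd x) * cis (of_int (snd x) * \<theta>)))"
      by (simp only: of_real_mult fg trig_def sum_product sum.cartesian_product) (simp add: case_prod_beta')
    also have "\<dots> = (\<Sum>x\<in>J \<times> K. c (fst x) * d (snd x) * cis (of_int (h x) * \<theta>))"
    proof (rule sum.cong[OF refl])
      fix x
      have "cis (of_int (h x) * \<theta>) = cis (of_int (fst x) * \<theta>) * cis (of_int (snd x) * \<theta>)"
        by (simp add: h_def case_prod_beta cis_mult ring_distribs)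
      then show "(c (fst x) * cis (of_int (fst x) * \<theta>)) * (d (snd x) * cis (of_int (snd x) * \<theta>))
          = c (fst x) * d (snd x) * cis (of_int (h x) * \<theta>)" by (simp only: mult_ac)
    qed
    also have "\<dots> = (\<Sum>n\<in>h ` (J \<times> K). \<Sum>x\<in>{x\<in>J \<times> K. h x = n}. c (fst x) * d (snd x) * cis (of_int (h x) * \<theta>))"
      using JK by (intro sum.image_gen) auto
    finally show ?thesis by (simp add: trig_def sum_distrib_right)
  qed
  show ?case by (rule exI, rule exI, rule conjI[rotated], rule allI, rule *) (use JK in simp)
qed

text \<open>Stone-Weierstrass on the unit circle, pulled back along the angle.\<close>

lemma trig_dense:
  fixes f :: "real \<Rightarrow> complex"
  assumes f: "continuous_on {0..2*pi} f" and per: "f 0 = f (2*pi)" and e: "0 < e"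
  shows "\<exists>J c. finite J \<and> (\<forall>\<theta>\<in>{0..<2*pi}. cmod (f \<theta> - trig J c \<theta>) < e)"
proof -
  define p where "p = (\<lambda>x. f (2 * pi * x))"
  have "path p" unfolding path_def p_def
    by (intro continuous_intros continuous_on_compose2[OF f]) auto
  \<comment> \<open>A loop is homotopic to itself; passing to the induced homotopy of circle maps
    yields continuity of the function that the loop defines on the circle, across the cut of the
    angle.\<close>
  then have "homotopic_loops UNIV p p"
    by (simp add: homotopic_loops_refl p_def pathstart_def pathfinish_def per)
  from homotopic_loops_imp_homotopic_circlemaps[OF this]
  have cont: "continuous_on (sphere 0 1) (p \<circ> (\<lambda>z. (Arg2pi z / (2 * pi))))"
    using homotopic_with_imp_continuous by blast
  obtain g where g: "polynomial_function g"
    "\<And>z. z \<in> sphere 0 1 \<Longrightarrow> cmod ((p \<circ> (\<lambda>z. (Arg2pi z / (2 * pi)))) z - g z) < e"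
    using Stone_Weierstrass_polynomial_function[OF compact_sphere cont e] by blast
  have "real_polynomial_function (Re \<circ> g)" "real_polynomial_function (Im \<circ> g)"
    using g(1) bounded_linear_Re bounded_linear_Im unfolding polynomial_function_def by auto
  then obtain J c K d where JK: "finite J" "finite K"
    and fg: "\<And>\<theta>. of_real ((Re \<circ> g) (cis \<theta>)) = trig J c \<theta>" "\<And>\<theta>. of_real ((Im \<circ> g) (cis \<theta>)) = trig K d \<theta>"
    using real_polynomial_on_circle by metis
  have fin: "finite (J \<union> K)" using JK by simp
  have "trig J c \<theta> = trig (J \<union> K) (\<lambda>j. if j \<in> J then c j else 0) \<theta>"
    "trig K d \<theta> = trig (J \<union> K) (\<lambda>j. if j \<in> K then d j else 0) \<theta>" for \<theta>
    unfolding trig_def by (rule sum.mono_neutral_cong_left[OF fin]; auto)+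
  then have G: "g (cis \<theta>) = trig (J \<union> K) (\<lambda>j. (if j \<in> J then c j else 0) + \<i> * (if j \<in> K then d j else 0)) \<theta>" for \<theta>
    using fg[of \<theta>] by (subst complex_eq) (simp add: trig_def ring_distribs sum.distrib sum_distrib_left mult_ac)
  have "cmod (f \<theta> - g (cis \<theta>)) < e" if "\<theta> \<in> {0..<2*pi}" for \<theta>
  proof -
    have "Arg2pi (cis \<theta>) = \<theta>" using that by (intro Arg2pi_unique[of 1]) (auto simp: cis_conv_exp)
    then show ?thesis using g(2)[of "cis \<theta>"] by (simp add: p_def)
  qed
  then have "\<forall>\<theta>\<in>{0..<2*pi}. cmod (f \<theta> - trig (J \<union> K)
      (\<lambda>j. (if j \<in> J then c j else 0) + \<i> * (if j \<in> K then d j else 0)) \<theta>) < e"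
    unfolding G by blast
  then show ?thesis using fin by (intro exI conjI)
qed

text \<open>The deficit of the Fourier coefficients over J is at most the squared distance to any
  trigonometric polynomial with frequencies in J, and a uniformly close one exists.\<close>

lemma parseval_deficit:
  fixes f :: "real \<Rightarrow> complex"
  assumes f: "continuous_on {0..2*pi} f" and per: "f 0 = f (2*pi)" and e: "0 < e"
  shows "\<exists>N0. \<forall>N\<ge>N0. 2 * pi * integral {0..2*pi} (\<lambda>\<theta>. (cmod (f \<theta>))\<^sup>2)
     - (\<Sum>j\<in>{- int N..int N}. (cmod (fcoef f j))\<^sup>2) \<le> e"
proof -
  \<comment> \<open>Integrating the square of d over the circle and multiplying by 2 * pi gives
    exactly e.\<close>
  define d where "d = sqrt e / (2 * pi)"
  have d: "d > 0" using e by (simp add: d_def)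
  obtain J c where J: "finite J" "\<And>\<theta>. \<theta> \<in> {0..<2*pi} \<Longrightarrow> cmod (f \<theta> - trig J c \<theta>) < d"
    using trig_dense[OF f per d] by metis
  have lt: "cmod (f \<theta> - trig J c \<theta>) \<le> d" if "\<theta> \<in> {0..2*pi}" for \<theta>
  proof (cases "\<theta> = 2 * pi")
    case True
    \<comment> \<open>The approximation is known on the half-open interval; at the right end both
      functions repeat their values at 0.\<close>
    have "trig J c (2 * pi) = trig J c 0" by (simp add: trig_def cis_int_2pi)
    then show ?thesis using J(2)[of 0] True per by simp
  next
    case False
    then show ?thesis using J(2)[of \<theta>] that by simp
  qed
  have "integral {0..2*pi} (\<lambda>\<theta>. (cmod (f \<theta> - trig J c \<theta>))\<^sup>2) \<le> integral {0..2*pi} (\<lambda>\<theta>. d\<^sup>2)"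
    by (intro integral_le integrable_continuous_real continuous_intros f power_mono lt) auto
  also have "\<dots> = 2 * pi * d\<^sup>2" by simp
  finally have "2 * pi * integral {0..2*pi} (\<lambda>\<theta>. (cmod (f \<theta> - trig J c \<theta>))\<^sup>2) \<le> 2 * pi * (2 * pi * d\<^sup>2)"
    by (intro mult_left_mono) auto
  also have "\<dots> = e" using e by (simp add: d_def power_divide power2_eq_square)
  finally have *: "2 * pi * integral {0..2*pi} (\<lambda>\<theta>. (cmod (f \<theta> - trig J c \<theta>))\<^sup>2) \<le> e" .
  define S where "S = (\<Sum>j\<in>J. (cmod (c j - fcoef f j / (2 * pi)))\<^sup>2)"
  have "0 \<le> (2 * pi)\<^sup>2 * S" by (simp add: S_def sum_nonneg)
  moreover have "2 * pi * (a - b / (2 * pi) + 2 * pi * S) = 2 * pi * a - b + (2 * pi)\<^sup>2 * S" for a b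
    by (simp add: field_simps power2_eq_square)
  ultimately have le: "2 * pi * integral {0..2*pi} (\<lambda>\<theta>. (cmod (f \<theta>))\<^sup>2) - (\<Sum>j\<in>J. (cmod (fcoef f j))\<^sup>2) \<le> e"
    using * unfolding remainder_norm[OF f J(1)] S_def by simp
  define N0 where "N0 = nat (\<Sum>j\<in>J. \<bar>j\<bar>)"
  have N0: "\<bar>j\<bar> \<le> int N0" if "j \<in> J" for j
    using member_le_sum[OF that _ J(1), of abs] by (simp add: N0_def)
  show ?thesis
  proof (intro exI allI impI)
    fix N assume "N \<ge> N0"
    then have "J \<subseteq> {- int N..int N}" using N0 by (force dest!: N0)
    then have "(\<Sum>j\<in>J. (cmod (fcoef f j))\<^sup>2) \<le> (\<Sum>j\<in>{- int N..int N}. (cmod (fcoef f j))\<^sup>2)"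
      by (intro sum_mono2) auto
    with le show "2 * pi * integral {0..2*pi} (\<lambda>\<theta>. (cmod (f \<theta>))\<^sup>2)
      - (\<Sum>j\<in>{- int N..int N}. (cmod (fcoef f j))\<^sup>2) \<le> e" by linarith
  qed
qed

lemma fcoef_deriv:
  fixes f :: "real \<Rightarrow> complex"
  assumes f: "\<And>\<theta>. \<theta> \<in> {0..2*pi} \<Longrightarrow> (f has_vector_derivative f' \<theta>) (at \<theta> within {0..2*pi})"
    and cf': "continuous_on {0..2*pi} f'" and per: "f 0 = f (2*pi)"
  shows "fcoef f' j = \<i> * of_int j * fcoef f j"
proof -
  let ?e = "\<lambda>\<theta>. cis (of_int (- j) * \<theta>)"
  have cf: "continuous_on {0..2*pi} f"
    using f by (meson has_vector_derivative_continuous continuous_on_eq_continuous_within)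
  have "((\<lambda>\<theta>. f \<theta> * (\<i> * of_real (of_int (- j)) * ?e \<theta>) + f' \<theta> * ?e \<theta>) has_integral
      (f (2*pi) * ?e (2*pi) - f 0 * ?e 0)) {0..2*pi}"
    by (intro fundamental_theorem_of_calculus has_vector_derivative_mult f has_vector_derivative_cis) auto
  then have "integral {0..2*pi} (\<lambda>\<theta>. f \<theta> * (\<i> * of_real (of_int (- j)) * ?e \<theta>) + f' \<theta> * ?e \<theta>) = 0"
    unfolding cis_int_2pi per by (simp add: integral_unique)
  moreover have "(\<lambda>\<theta>. f \<theta> * (\<i> * of_real (of_int (- j)) * ?e \<theta>)) = (\<lambda>\<theta>. (\<i> * of_int (- j)) * (f \<theta> * ?e \<theta>))"
    by (auto simp: fun_eq_iff)
  moreover have "integral {0..2*pi} (\<lambda>\<theta>. f \<theta> * (\<i> * of_real (of_int (- j)) * ?e \<theta>) + f' \<theta> * ?e \<theta>)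
     = integral {0..2*pi} (\<lambda>\<theta>. f \<theta> * (\<i> * of_real (of_int (- j)) * ?e \<theta>)) + integral {0..2*pi} (\<lambda>\<theta>. f' \<theta> * ?e \<theta>)"
    by (intro Henstock_Kurzweil_Integration.integral_add integrable_continuous_real continuous_intros cf cf')
  ultimately show ?thesis by (simp add: fcoef_def eq_neg_iff_add_eq_0 add.commute)
qed

text \<open>For \<bar>j\<bar> > M a coefficient of f is at most 1 / (M + 1) times the one of f' in
  modulus, and Bessel's inequality bounds the latter.\<close>

lemma wirtinger:
  fixes f :: "real \<Rightarrow> complex"
  assumes f: "\<And>\<theta>. \<theta> \<in> {0..2*pi} \<Longrightarrow> (f has_vector_derivative f' \<theta>) (at \<theta> within {0..2*pi})"
    and cf': "continuous_on {0..2*pi} f'" and per: "f 0 = f (2*pi)"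
  shows "2 * pi * integral {0..2*pi} (\<lambda>\<theta>. (cmod (f \<theta>))\<^sup>2)
     - (\<Sum>j\<in>{- int M..int M}. (cmod (fcoef f j))\<^sup>2)
     \<le> 2 * pi / (real (Suc M))\<^sup>2 * integral {0..2*pi} (\<lambda>\<theta>. (cmod (f' \<theta>))\<^sup>2)" (is "?l \<le> ?r")
proof (rule field_le_epsilon)
  fix e :: real assume e: "0 < e"
  have cf: "continuous_on {0..2*pi} f"
    using f by (meson has_vector_derivative_continuous continuous_on_eq_continuous_within)
  \<comment> \<open>A larger cut-off with Parseval deficit at most e; only the finitely many
    frequencies between M and N remain to be estimated.\<close>
  obtain N where N: "N \<ge> M" "2 * pi * integral {0..2*pi} (\<lambda>\<theta>. (cmod (f \<theta>))\<^sup>2)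
     - (\<Sum>j\<in>{- int N..int N}. (cmod (fcoef f j))\<^sup>2) \<le> e"
    using parseval_deficit[OF cf per e] by (meson nle_le)
  define K where "K = {- int N..int N} - {- int M..int M}"
  have "(\<Sum>j\<in>K. (cmod (fcoef f j))\<^sup>2) \<le> (\<Sum>j\<in>K. (cmod (fcoef f' j))\<^sup>2 / (real (Suc M))\<^sup>2)"
  proof (rule sum_mono)
    fix j assume "j \<in> K"
    then have "real (Suc M) \<le> \<bar>of_int j\<bar>" by (auto simp: K_def)
    then have "(real (Suc M))\<^sup>2 \<le> (of_int j)\<^sup>2" by (metis abs_le_square_iff abs_of_nat)
    then have "(real (Suc M))\<^sup>2 * (cmod (fcoef f j))\<^sup>2 \<le> (of_int j)\<^sup>2 * (cmod (fcoef f j))\<^sup>2"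
      by (rule mult_right_mono) simp
    also have "\<dots> = (cmod (fcoef f' j))\<^sup>2"
    proof -
      have "fcoef f' j = \<i> * of_int j * fcoef f j" by (rule fcoef_deriv) (use f cf' per in auto)
      then show ?thesis by (simp add: norm_mult power_mult_distrib)
    qed
    finally show "(cmod (fcoef f j))\<^sup>2 \<le> (cmod (fcoef f' j))\<^sup>2 / (real (Suc M))\<^sup>2"
      by (simp add: pos_le_divide_eq mult.commute)
  qed
  also have "\<dots> = (\<Sum>j\<in>K. (cmod (fcoef f' j))\<^sup>2) / (real (Suc M))\<^sup>2"
    by (simp add: sum_divide_distrib)
  also have "\<dots> \<le> (2 * pi * integral {0..2*pi} (\<lambda>\<theta>. (cmod (f' \<theta>))\<^sup>2)) / (real (Suc M))\<^sup>2"
    by (intro divide_right_mono bessel cf') (auto simp: K_def)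
  finally have "(\<Sum>j\<in>K. (cmod (fcoef f j))\<^sup>2) \<le> ?r" by simp
  moreover have "(\<Sum>j\<in>{- int N..int N}. (cmod (fcoef f j))\<^sup>2)
      = (\<Sum>j\<in>{- int M..int M}. (cmod (fcoef f j))\<^sup>2) + (\<Sum>j\<in>K. (cmod (fcoef f j))\<^sup>2)"
    unfolding K_def using N(1) by (subst sum.subset_diff[of "{- int M..int M}"]) auto
  ultimately show "?l \<le> ?r + e" using N(2) by linarith
qed

lemma sum_symmetric_int:
  fixes f :: "int \<Rightarrow> 'a::comm_monoid_add"
  shows "(\<Sum>j\<in>{- int M..int M}. f (- j)) = (\<Sum>j\<in>{- int M..int M}. f j)"
  by (rule sum.reindex_bij_witness[where i = uminus and j = uminus]) auto

text \<open>The integral of the square has no sign, but its remainder is dominated in modulus by the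
  Hermitian remainder, to which the estimate of the tail applies.\<close>

lemma integral_power2_remainder_le:
  fixes f :: "real \<Rightarrow> complex"
  assumes f: "\<And>\<theta>. \<theta> \<in> {0..2*pi} \<Longrightarrow> (f has_vector_derivative f' \<theta>) (at \<theta> within {0..2*pi})"
    and cf': "continuous_on {0..2*pi} f'" and per: "f 0 = f (2*pi)"
  shows "2 * pi * Re (integral {0..2*pi} (\<lambda>\<theta>. (f \<theta>)\<^sup>2))
     \<le> Re (\<Sum>j\<in>{- int M..int M}. fcoef f j * fcoef f (- j))
       + 2 * pi / (real (Suc M))\<^sup>2 * integral {0..2*pi} (\<lambda>\<theta>. (cmod (f' \<theta>))\<^sup>2)"
proof -
  let ?J = "{- int M..int M}"
  let ?r = "\<lambda>\<theta>. f \<theta> - trig ?J (\<lambda>j. fcoef f j / (2 * pi)) \<theta>"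
  have cf: "continuous_on {0..2*pi} f"
    using f by (meson has_vector_derivative_continuous continuous_on_eq_continuous_within)
  have "cmod (integral {0..2*pi} (\<lambda>\<theta>. (?r \<theta>)\<^sup>2)) \<le> integral {0..2*pi} (\<lambda>\<theta>. (cmod (?r \<theta>))\<^sup>2)"
    by (intro integral_norm_bound_integral integrable_continuous_real continuous_intros cf)
       (auto simp: norm_power)
  also have "\<dots> = integral {0..2*pi} (\<lambda>\<theta>. (cmod (f \<theta>))\<^sup>2) - (\<Sum>j\<in>?J. (cmod (fcoef f j))\<^sup>2) / (2 * pi)"
    by (simp add: remainder_norm[OF cf])
  finally have "Re (integral {0..2*pi} (\<lambda>\<theta>. (?r \<theta>)\<^sup>2))
      \<le> integral {0..2*pi} (\<lambda>\<theta>. (cmod (f \<theta>))\<^sup>2) - (\<Sum>j\<in>?J. (cmod (fcoef f j))\<^sup>2) / (2 * pi)"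
    using complex_Re_le_cmod order_trans by blast
  then have *: "2 * pi * Re (integral {0..2*pi} (\<lambda>\<theta>. (?r \<theta>)\<^sup>2))
      \<le> 2 * pi * (integral {0..2*pi} (\<lambda>\<theta>. (cmod (f \<theta>))\<^sup>2) - (\<Sum>j\<in>?J. (cmod (fcoef f j))\<^sup>2) / (2 * pi))"
    by (intro mult_left_mono) auto
  have "2 * pi * (a - b / (2 * pi)) = 2 * pi * a - b" for a b by (simp add: field_simps)
  note ** = *[unfolded this]
  have "integral {0..2*pi} (\<lambda>\<theta>. (?r \<theta>)\<^sup>2) = integral {0..2*pi} (\<lambda>\<theta>. (f \<theta>)\<^sup>2)
      - (\<Sum>j\<in>?J. fcoef f j * fcoef f (- j)) / (2 * pi)"
    by (rule remainder_sq[OF cf]) auto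
  moreover have "Re (S / (2 * complex_of_real pi)) = Re S / (2 * pi)" for S
    using Re_divide_of_real[of S "2 * pi"] by simp
  ultimately have "2 * pi * Re (integral {0..2*pi} (\<lambda>\<theta>. (?r \<theta>)\<^sup>2))
      = 2 * pi * Re (integral {0..2*pi} (\<lambda>\<theta>. (f \<theta>)\<^sup>2)) - Re (\<Sum>j\<in>?J. fcoef f j * fcoef f (- j))"
    by (simp only: minus_complex.sel right_diff_distrib) simp
  moreover have "2 * pi * integral {0..2*pi} (\<lambda>\<theta>. (cmod (f \<theta>))\<^sup>2) - (\<Sum>j\<in>?J. (cmod (fcoef f j))\<^sup>2)
     \<le> 2 * pi / (real (Suc M))\<^sup>2 * integral {0..2*pi} (\<lambda>\<theta>. (cmod (f' \<theta>))\<^sup>2)"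
    by (rule wirtinger) (use f cf' per in auto)
  ultimately show ?thesis using ** by linarith
qed

section \<open>The second variation as a sum over pairs of modes\<close>

context two_rates begin

text \<open>The integrand of the second variation with respect to the measure of t and \<theta>. The
  complex number z is the field in the rotating frame, zt and zs are its plain partial derivatives,
  and the real part of the square of z comes from the part of the Simons operator that
  conjugates.\<close>

definition jacobi_density :: "real \<Rightarrow> complex \<Rightarrow> complex \<Rightarrow> complex \<Rightarrow> real" where
  "jacobi_density t z zt zs = (cmod zt)\<^sup>2 + (cmod (zs + \<i> * of_real (conn t) * z))\<^sup>2
     - ((wa t)\<^sup>2 + (wb t)\<^sup>2) / 2 * (cmod z)\<^sup>2 - wa t * wb t * Re (z\<^sup>2)"

definition pair_form :: "real \<Rightarrow> real \<Rightarrow> complex \<Rightarrow> complex \<Rightarrow> complex \<Rightarrow> complex \<Rightarrow> real" where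
  "pair_form m t p q p' q' = (cmod p')\<^sup>2 + (cmod q')\<^sup>2 + (m + conn t)\<^sup>2 * (cmod p)\<^sup>2 + (m - conn t)\<^sup>2 * (cmod q)\<^sup>2
     - ((wa t)\<^sup>2 + (wb t)\<^sup>2) / 2 * ((cmod p)\<^sup>2 + (cmod q)\<^sup>2) - 2 * (wa t * wb t) * Re (p * cnj q)"

lemma pair_form_Re_Im: "pair_form m t p q p' q' =
    mode_form m t (Re p) (Re q) (Re p') (Re q') + mode_form m t (Im p) (Im q) (Im p') (Im q')"
proof -
  define a where "a = ((wa t)\<^sup>2 + (wb t)\<^sup>2) / 2"
  show ?thesis
    unfolding pair_form_def mode_form_def cmod_power2 a_def[symmetric] by (simp add: algebra_simps)
qed

text \<open>Mode 0 is its own partner, so p and q are conjugate and carry one complex function only.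
  Sum and difference of its real and imaginary parts turn it into a single real pair, which is why
  this mode costs one real condition.\<close>

lemma pair_form_zero: "pair_form 0 t z (cnj z) z' (cnj z') =
    mode_form 0 t (Re z + Im z) (Re z - Im z) (Re z' + Im z') (Re z' - Im z')"
  unfolding pair_form_def mode_form_def cmod_power2 by (simp add: power2_eq_square algebra_simps)

lemma pair_form_swap: "pair_form (- m) t (cnj q) (cnj p) (cnj q') (cnj p') = pair_form m t p q p' q'"
proof -
  have "(- m + conn t)\<^sup>2 = (m - conn t)\<^sup>2" "(- m - conn t)\<^sup>2 = (m + conn t)\<^sup>2"
    by (simp_all add: power2_eq_square algebra_simps)
  then show ?thesis unfolding pair_form_def by (simp add: algebra_simps)
qed

text \<open>Each pair (j, - j) occurs twice in the sum and mode 0 is paired with itself; hence the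
  division by 2.\<close>

definition half_modes :: "nat \<Rightarrow> real \<Rightarrow> (int \<Rightarrow> complex) \<Rightarrow> (int \<Rightarrow> complex) \<Rightarrow> real" where
  "half_modes M t z z' = (\<Sum>j\<in>{- int M..int M}.
     pair_form (of_int j) t (z j) (cnj (z (- j))) (z' j) (cnj (z' (- j))) / 2)"

lemma half_modes_eq:
  "half_modes M t z z' = (\<Sum>j\<in>{- int M..int M}. (cmod (z' j))\<^sup>2)
     + (\<Sum>j\<in>{- int M..int M}. (of_int j + conn t)\<^sup>2 * (cmod (z j))\<^sup>2)
     - ((wa t)\<^sup>2 + (wb t)\<^sup>2) / 2 * (\<Sum>j\<in>{- int M..int M}. (cmod (z j))\<^sup>2)
     - wa t * wb t * Re (\<Sum>j\<in>{- int M..int M}. z j * z (- j))"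
proof -
  let ?J = "{- int M..int M}"
  define a b where "a = ((wa t)\<^sup>2 + (wb t)\<^sup>2) / 2" and "b = wa t * wb t"
  have "half_modes M t z z' = (\<Sum>j\<in>?J. (cmod (z' j))\<^sup>2 / 2 + (cmod (z' (- j)))\<^sup>2 / 2
      + ((of_int j + conn t)\<^sup>2 * (cmod (z j))\<^sup>2) / 2 + ((of_int (- j) + conn t)\<^sup>2 * (cmod (z (- j)))\<^sup>2) / 2
      - a * (cmod (z j))\<^sup>2 / 2 - a * (cmod (z (- j)))\<^sup>2 / 2 - b * Re (z j * z (- j)))"
    unfolding half_modes_def pair_form_def a_def[symmetric] b_def[symmetric]
    by (intro sum.cong refl) (simp add: power2_commute[of _ "conn t"] add_divide_distrib diff_divide_distrib distrib_left)
  also have "\<dots> = (\<Sum>j\<in>?J. (cmod (z' j))\<^sup>2 / 2) + (\<Sum>j\<in>?J. (cmod (z' (- j)))\<^sup>2 / 2)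
      + (\<Sum>j\<in>?J. ((of_int j + conn t)\<^sup>2 * (cmod (z j))\<^sup>2) / 2)
      + (\<Sum>j\<in>?J. ((of_int (- j) + conn t)\<^sup>2 * (cmod (z (- j)))\<^sup>2) / 2)
      - (\<Sum>j\<in>?J. a * (cmod (z j))\<^sup>2 / 2) - (\<Sum>j\<in>?J. a * (cmod (z (- j)))\<^sup>2 / 2) - (\<Sum>j\<in>?J. b * Re (z j * z (- j)))"
    by (simp only: sum.distrib sum_subtractf)
  also have "(\<Sum>j\<in>?J. (cmod (z' (- j)))\<^sup>2 / 2) = (\<Sum>j\<in>?J. (cmod (z' j))\<^sup>2 / 2)"
    by (rule sum_symmetric_int)
  also have "(\<Sum>j\<in>?J. ((of_int (- j) + conn t)\<^sup>2 * (cmod (z (- j)))\<^sup>2) / 2)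
      = (\<Sum>j\<in>?J. ((of_int j + conn t)\<^sup>2 * (cmod (z j))\<^sup>2) / 2)"
    by (rule sum_symmetric_int)
  also have "(\<Sum>j\<in>?J. a * (cmod (z (- j)))\<^sup>2 / 2) = (\<Sum>j\<in>?J. a * (cmod (z j))\<^sup>2 / 2)"
    by (rule sum_symmetric_int)
  finally show ?thesis
    by (simp add: a_def[symmetric] b_def[symmetric] sum_divide_distrib[symmetric] sum_distrib_left sum_negf)
qed

lemma density_integral_eq:
  assumes c: "continuous_on {0..2*pi} f" "continuous_on {0..2*pi} ft" "continuous_on {0..2*pi} fs"
  shows "integral {0..2*pi} (\<lambda>\<theta>. jacobi_density t (f \<theta>) (ft \<theta>) (fs \<theta>)) =
     integral {0..2*pi} (\<lambda>\<theta>. (cmod (ft \<theta>))\<^sup>2)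
     + integral {0..2*pi} (\<lambda>\<theta>. (cmod (fs \<theta> + \<i> * of_real (conn t) * f \<theta>))\<^sup>2)
     - ((wa t)\<^sup>2 + (wb t)\<^sup>2) / 2 * integral {0..2*pi} (\<lambda>\<theta>. (cmod (f \<theta>))\<^sup>2)
     - wa t * wb t * Re (integral {0..2*pi} (\<lambda>\<theta>. (f \<theta>)\<^sup>2))"
proof -
  have r: "Re (integral {0..2*pi} (\<lambda>\<theta>. (f \<theta>)\<^sup>2)) = integral {0..2*pi} (\<lambda>\<theta>. Re ((f \<theta>)\<^sup>2))"
    by (rule integral_linear[OF _ bounded_linear_Re, symmetric, unfolded o_def])
       (intro integrable_continuous_real continuous_intros c)
  show ?thesis unfolding jacobi_density_def r
    by (subst Henstock_Kurzweil_Integration.integral_diff Henstock_Kurzweil_Integration.integral_add,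
        (intro integrable_continuous_real continuous_intros c)+)+ simp
qed

text \<open>The two gradient terms enter with a plus sign and are truncated by Bessel's inequality.
  The two curvature terms enter with a minus sign and need upper bounds; these hold up to an error
  that decays with the square of M + 1.\<close>

lemma density_integral_ge:
  assumes f: "\<And>\<theta>. \<theta> \<in> {0..2*pi} \<Longrightarrow> (f has_vector_derivative fs \<theta>) (at \<theta> within {0..2*pi})"
    and c: "continuous_on {0..2*pi} ft" "continuous_on {0..2*pi} fs" and per: "f 0 = f (2*pi)"
  shows "half_modes M t (fcoef f) (fcoef ft)
     - (((wa t)\<^sup>2 + (wb t)\<^sup>2) / 2 + wa t * wb t) * (2 * pi / (real (Suc M))\<^sup>2 * integral {0..2*pi} (\<lambda>\<theta>. (cmod (fs \<theta>))\<^sup>2))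
     \<le> 2 * pi * integral {0..2*pi} (\<lambda>\<theta>. jacobi_density t (f \<theta>) (ft \<theta>) (fs \<theta>))"
proof -
  let ?J = "{- int M..int M}"
  define a b W where "a = ((wa t)\<^sup>2 + (wb t)\<^sup>2) / 2" and "b = wa t * wb t"
    and "W = 2 * pi / (real (Suc M))\<^sup>2 * integral {0..2*pi} (\<lambda>\<theta>. (cmod (fs \<theta>))\<^sup>2)"
  have ab: "0 \<le> a" "0 \<le> b" by (simp_all add: a_def b_def less_imp_le)
  have cf: "continuous_on {0..2*pi} f"
    using f by (meson has_vector_derivative_continuous continuous_on_eq_continuous_within)
  \<comment> \<open>The covariant derivative along the circle; on Fourier coefficients it multiplies
    by \<i> * (j + conn t).\<close>
  define F where "F \<theta> = fs \<theta> + \<i> * of_real (conn t) * f \<theta>" for \<theta>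
  have cF: "continuous_on {0..2*pi} F" unfolding F_def by (intro continuous_intros cf c)
  have "fcoef F j = \<i> * of_real (of_int j + conn t) * fcoef f j" for j
  proof -
    have "fcoef fs j = \<i> * of_int j * fcoef f j" by (rule fcoef_deriv) (use f c per in auto)
    moreover have "fcoef F j = fcoef fs j + \<i> * of_real (conn t) * fcoef f j"
    proof -
      have "fcoef F j = integral {0..2*pi} (\<lambda>\<theta>. fs \<theta> * cis (- (of_int j * \<theta>)) + \<i> * of_real (conn t) * (f \<theta> * cis (- (of_int j * \<theta>))))"
        by (simp add: fcoef_def F_def algebra_simps)
      also have "\<dots> = fcoef fs j + integral {0..2*pi} (\<lambda>\<theta>. \<i> * of_real (conn t) * (f \<theta> * cis (- (of_int j * \<theta>))))"
        unfolding fcoef_def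
        by (intro Henstock_Kurzweil_Integration.integral_add integrable_continuous_real continuous_intros cf c)
      finally show ?thesis by (simp add: fcoef_def)
    qed
    ultimately show ?thesis by (simp add: algebra_simps)
  qed
  then have nF: "(cmod (fcoef F j))\<^sup>2 = (of_int j + conn t)\<^sup>2 * (cmod (fcoef f j))\<^sup>2" for j
    by (simp add: norm_mult power_mult_distrib del: of_real_add)
  have "2 * pi * integral {0..2*pi} (\<lambda>\<theta>. jacobi_density t (f \<theta>) (ft \<theta>) (fs \<theta>)) =
     2 * pi * integral {0..2*pi} (\<lambda>\<theta>. (cmod (ft \<theta>))\<^sup>2)
     + 2 * pi * integral {0..2*pi} (\<lambda>\<theta>. (cmod (F \<theta>))\<^sup>2)
     - a * (2 * pi * integral {0..2*pi} (\<lambda>\<theta>. (cmod (f \<theta>))\<^sup>2))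
     - b * (2 * pi * Re (integral {0..2*pi} (\<lambda>\<theta>. (f \<theta>)\<^sup>2)))"
    unfolding density_integral_eq[OF cf c] a_def b_def F_def by (simp add: algebra_simps)
  moreover have "(\<Sum>j\<in>?J. (cmod (fcoef ft j))\<^sup>2) \<le> 2 * pi * integral {0..2*pi} (\<lambda>\<theta>. (cmod (ft \<theta>))\<^sup>2)"
    by (intro bessel c) simp
  moreover have "(\<Sum>j\<in>?J. (of_int j + conn t)\<^sup>2 * (cmod (fcoef f j))\<^sup>2) \<le> 2 * pi * integral {0..2*pi} (\<lambda>\<theta>. (cmod (F \<theta>))\<^sup>2)"
    unfolding nF[symmetric] by (intro bessel cF) simp
  moreover have "a * (2 * pi * integral {0..2*pi} (\<lambda>\<theta>. (cmod (f \<theta>))\<^sup>2)) \<le> a * ((\<Sum>j\<in>?J. (cmod (fcoef f j))\<^sup>2) + W)"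
    using wirtinger[OF f c(2) per, of M] by (intro mult_left_mono ab) (simp add: W_def)
  moreover have "b * (2 * pi * Re (integral {0..2*pi} (\<lambda>\<theta>. (f \<theta>)\<^sup>2))) \<le> b * (Re (\<Sum>j\<in>?J. fcoef f j * fcoef f (- j)) + W)"
    unfolding W_def by (intro mult_left_mono ab integral_power2_remainder_le f c per)
  ultimately show ?thesis
    unfolding half_modes_eq a_def[symmetric] b_def[symmetric] W_def[symmetric]
    by (simp only: distrib_left distrib_right)
qed

text \<open>For finitely many modes Parseval is an equality. Here z and z' are genuine coefficients,
  smaller by 2 * pi than the values of \<open>fcoef\<close>, which accounts for the factor.\<close>

lemma density_integral_trig:
  assumes f: "\<And>\<theta>. f \<theta> = trig {- int M..int M} z \<theta>" "\<And>\<theta>. ft \<theta> = trig {- int M..int M} z' \<theta>"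
    "\<And>\<theta>. fs \<theta> = trig {- int M..int M} (\<lambda>j. \<i> * of_int j * z j) \<theta>"
  shows "integral {0..2*pi} (\<lambda>\<theta>. jacobi_density t (f \<theta>) (ft \<theta>) (fs \<theta>)) = 2 * pi * half_modes M t z z'"
proof -
  let ?J = "{- int M..int M}"
  have sq: "integral {0..2*pi} (\<lambda>\<theta>. (cmod (trig ?J c \<theta>))\<^sup>2) = 2 * pi * (\<Sum>j\<in>?J. (cmod (c j))\<^sup>2)" for c
  proof -
    have "integral {0..2*pi} (\<lambda>\<theta>. (cmod (trig ?J c \<theta>))\<^sup>2) = (\<Sum>j\<in>?J. (cmod (fcoef (trig ?J c) j))\<^sup>2) / (2 * pi)
       - 2 * pi * (\<Sum>j\<in>?J. (cmod (c j - fcoef (trig ?J c) j / (2 * pi)))\<^sup>2)"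
      using remainder_norm[of "trig ?J c" ?J c] by (simp add: continuous_intros)
    also have "\<dots> = (\<Sum>j\<in>?J. (cmod (2 * pi * c j))\<^sup>2) / (2 * pi)"
      by (simp add: fcoef_trig)
    also have "\<dots> = 2 * pi * (\<Sum>j\<in>?J. (cmod (c j))\<^sup>2)"
      by (simp add: norm_mult power_mult_distrib sum_divide_distrib sum_distrib_left power2_eq_square mult_ac)
    finally show ?thesis .
  qed
  have sq2: "integral {0..2*pi} (\<lambda>\<theta>. (trig ?J z \<theta>)\<^sup>2) = 2 * pi * (\<Sum>j\<in>?J. z j * z (- j))"
  proof -
    have "integral {0..2*pi} (\<lambda>\<theta>. (trig ?J z \<theta>)\<^sup>2) = integral {0..2*pi} (\<lambda>\<theta>. trig ?J z \<theta> * trig ?J z \<theta>)"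
      by (simp add: power2_eq_square)
    also have "\<dots> = (\<Sum>j\<in>?J. z j * fcoef (trig ?J z) (- j))"
      by (intro integral_mult_trig continuous_intros) simp
    also have "\<dots> = (\<Sum>j\<in>?J. 2 * pi * (z j * z (- j)))"
      by (intro sum.cong refl) (simp add: fcoef_trig)
    finally show ?thesis by (simp add: sum_distrib_left)
  qed
  have F: "trig ?J (\<lambda>j. \<i> * of_int j * z j) \<theta> + \<i> * of_real (conn t) * trig ?J z \<theta>
     = trig ?J (\<lambda>j. \<i> * of_real (of_int j + conn t) * z j) \<theta>" for \<theta>
    by (simp add: trig_def sum_distrib_left sum.distrib[symmetric] algebra_simps)
  have n: "cmod (\<i> * complex_of_real (real_of_int j + conn t) * z j) = \<bar>of_int j + conn t\<bar> * cmod (z j)" for j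
    by (simp add: norm_mult del: of_real_add)
  have "Re (2 * complex_of_real pi * S) = 2 * pi * Re S" for S by simp
  note re = this
  show ?thesis
    unfolding f
    apply (subst density_integral_eq)
    apply (intro continuous_intros)+
    unfolding F sq sq2 n re half_modes_eq power_mult_distrib power2_abs
    apply (simp add: right_diff_distrib distrib_left mult_ac)
    done
qed

lemma pair_form_integral_nonneg:
  assumes m: "0 < m"
    and p: "\<And>t. (p has_vector_derivative p' t) (at t)" and q: "\<And>t. (q has_vector_derivative q' t) (at t)"
    and cp: "continuous_on UNIV p'" and cq: "continuous_on UNIV q'"
    and z: "\<And>t. rate t = m \<Longrightarrow> of_real (wa t) * p t + of_real (wb t) * q t = 0"
    and L: "0 < L" and supp: "p L = 0" "q L = 0" "p (-L) = 0" "q (-L) = 0"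
  shows "0 \<le> integral {-L..L} (\<lambda>t. pair_form m t (p t) (q t) (p' t) (q' t))"
proof -
  have d: "((\<lambda>t. Re (p t)) has_real_derivative Re (p' t)) (at t)" "((\<lambda>t. Im (p t)) has_real_derivative Im (p' t)) (at t)"
    "((\<lambda>t. Re (q t)) has_real_derivative Re (q' t)) (at t)" "((\<lambda>t. Im (q t)) has_real_derivative Im (q' t)) (at t)" for t
    unfolding has_real_derivative_iff_has_vector_derivative
    by (intro bounded_linear.has_vector_derivative[OF bounded_linear_Re] bounded_linear.has_vector_derivative[OF bounded_linear_Im] p q)+
  have cp0: "continuous_on UNIV p" "continuous_on UNIV q"
    using p q by (auto intro!: continuous_at_imp_continuous_on has_vector_derivative_continuous)
  note cs = continuous_on_subset[OF cp0(1) subset_UNIV] continuous_on_subset[OF cp0(2) subset_UNIV]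
     continuous_on_subset[OF cp subset_UNIV] continuous_on_subset[OF cq subset_UNIV]
  have i: "(\<lambda>t. mode_form m t (g (p t)) (g (q t)) (g (p' t)) (g (q' t))) integrable_on {-L..L}" if "bounded_linear g" for g
    unfolding mode_form_def
    by (intro integrable_continuous_real continuous_intros bounded_linear.continuous_on[OF that] cs)
       auto
  have "0 \<le> integral {-L..L} (\<lambda>t. mode_form m t (Re (p t)) (Re (q t)) (Re (p' t)) (Re (q' t)))"
  proof (rule mode_form_integral_nonneg[OF d(1,3) _ _ _ L])
    show "wa t * Re (p t) + wb t * Re (q t) = 0" if "rate t = m" for t
      using arg_cong[OF z[OF that], of Re] by simp
  qed (use supp in \<open>auto intro!: continuous_intros cp cq\<close>)
  moreover have "0 \<le> integral {-L..L} (\<lambda>t. mode_form m t (Im (p t)) (Im (q t)) (Im (p' t)) (Im (q' t)))"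
  proof (rule mode_form_integral_nonneg[OF d(2,4) _ _ _ L])
    show "wa t * Im (p t) + wb t * Im (q t) = 0" if "rate t = m" for t
      using arg_cong[OF z[OF that], of Im] by simp
  qed (use supp in \<open>auto intro!: continuous_intros cp cq\<close>)
  ultimately show ?thesis
    unfolding pair_form_Re_Im
    by (subst Henstock_Kurzweil_Integration.integral_add) (auto intro!: i bounded_linear_Re bounded_linear_Im)
qed

lemma zero_mode_integral_nonneg:
  assumes p: "\<And>t. (p has_vector_derivative p' t) (at t)"
    and cp: "continuous_on UNIV p'"
    and z: "\<And>t. rate t = 0 \<Longrightarrow> wa t * (Re (p t) + Im (p t)) + wb t * (Re (p t) - Im (p t)) = 0"
    and L: "0 < L" and supp: "p L = 0" "p (-L) = 0"
  shows "0 \<le> integral {-L..L} (\<lambda>t. pair_form 0 t (p t) (cnj (p t)) (p' t) (cnj (p' t)))"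
proof -
  have d: "((\<lambda>t. Re (p t)) has_real_derivative Re (p' t)) (at t)" "((\<lambda>t. Im (p t)) has_real_derivative Im (p' t)) (at t)" for t
    unfolding has_real_derivative_iff_has_vector_derivative
    by (intro bounded_linear.has_vector_derivative[OF bounded_linear_Re] bounded_linear.has_vector_derivative[OF bounded_linear_Im] p)+
  show ?thesis unfolding pair_form_zero
    by (rule mode_form_integral_nonneg[OF DERIV_add[OF d] DERIV_diff[OF d] _ _ z L])
       (use supp in \<open>auto intro!: continuous_intros cp\<close>)
qed

text \<open>The partial derivatives are carried as data and are jointly continuous, so that Fourier
  coefficients may be differentiated under the integral sign.\<close>

definition C1_field :: "(real \<Rightarrow> real \<Rightarrow> complex) \<Rightarrow> (real \<Rightarrow> real \<Rightarrow> complex) \<Rightarrow> (real \<Rightarrow> real \<Rightarrow> complex) \<Rightarrow> bool" where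
  "C1_field Z Zt Zs \<longleftrightarrow>
     (\<forall>t \<theta>. ((\<lambda>t. Z t \<theta>) has_vector_derivative Zt t \<theta>) (at t)) \<and>
     (\<forall>t \<theta>. (Z t has_vector_derivative Zs t \<theta>) (at \<theta>)) \<and>
     continuous_on UNIV (\<lambda>(t, \<theta>). Z t \<theta>) \<and> continuous_on UNIV (\<lambda>(t, \<theta>). Zt t \<theta>) \<and>
     continuous_on UNIV (\<lambda>(t, \<theta>). Zs t \<theta>) \<and> (\<forall>t. Z t 0 = Z t (2 * pi))"

lemma continuous_slice:
  assumes "continuous_on UNIV (\<lambda>(t :: real, \<theta> :: real). F t \<theta>)"
  shows "continuous_on S (F t)"
proof -
  have "continuous_on UNIV (\<lambda>\<theta>. (\<lambda>(t, \<theta>). F t \<theta>) (t, \<theta>))"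
    by (intro continuous_on_compose2[OF assms]) (auto intro!: continuous_intros)
  then show ?thesis by (auto intro: continuous_on_subset)
qed

lemma continuous_fcoef:
  assumes "continuous_on UNIV (\<lambda>(t :: real, \<theta>). F t \<theta>)"
  shows "continuous_on S (\<lambda>t. fcoef (F t) j)"
proof -
  have c: "continuous_on A (\<lambda>x. F (fst x) (snd x))" for A
    using continuous_on_subset[OF assms subset_UNIV] by (simp add: case_prod_unfold)
  have "continuous_on S (\<lambda>t. integral (cbox 0 (2*pi)) (\<lambda>\<theta>. F t \<theta> * cis (- (of_int j * \<theta>))))"
    by (rule integral_continuous_on_param) (auto simp: case_prod_unfold intro!: continuous_intros c)
  then show ?thesis by (simp add: fcoef_def)
qed

lemma fcoef_has_vector_derivative:
  assumes d: "\<And>t \<theta>. ((\<lambda>t. F t \<theta>) has_vector_derivative Ft t \<theta>) (at t)"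
    and c: "continuous_on UNIV (\<lambda>(t, \<theta>). F t \<theta>)" "continuous_on UNIV (\<lambda>(t, \<theta>). Ft t \<theta>)"
  shows "((\<lambda>t. fcoef (F t) j) has_vector_derivative fcoef (Ft t) j) (at t)"
proof -
  have c2: "continuous_on A (\<lambda>x. Ft (fst x) (snd x))" for A
    using continuous_on_subset[OF c(2) subset_UNIV] by (simp add: case_prod_unfold)
  have "((\<lambda>t. integral (cbox 0 (2*pi)) (\<lambda>\<theta>. F t \<theta> * cis (- (of_int j * \<theta>)))) has_vector_derivative
     integral (cbox 0 (2*pi)) (\<lambda>\<theta>. Ft t \<theta> * cis (- (of_int j * \<theta>)))) (at t within UNIV)"
  proof (rule leibniz_rule_vector_derivative)
    show "((\<lambda>t. F t \<theta> * cis (- (of_int j * \<theta>))) has_vector_derivative Ft t \<theta> * cis (- (of_int j * \<theta>))) (at t within UNIV)" for t \<theta>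
      by (intro has_vector_derivative_mult_left d)
    show "(\<lambda>\<theta>. F t \<theta> * cis (- (of_int j * \<theta>))) integrable_on cbox 0 (2*pi)" for t
      by (intro integrable_continuous continuous_intros continuous_slice c)
    show "continuous_on (UNIV \<times> cbox 0 (2*pi)) (\<lambda>(t, \<theta>). Ft t \<theta> * cis (- (of_int j * \<theta>)))"
      by (auto simp: case_prod_unfold intro!: continuous_intros c2)
  qed auto
  then show ?thesis by (simp add: fcoef_def)
qed

text \<open>For every M the truncated form is non-negative pair by pair. The truncation error is a
  constant independent of M divided by the square of M + 1, so M can tend to infinity.\<close>

lemma density_integral_nonneg:
  assumes Z: "C1_field Z Zt Zs" and L: "0 < L" and supp: "\<And>t \<theta>. L \<le> \<bar>t\<bar> \<Longrightarrow> Z t \<theta> = 0"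
    and pos: "\<And>m t. 0 < m \<Longrightarrow> rate t = of_int m \<Longrightarrow>
       of_real (wa t) * fcoef (Z t) m + of_real (wb t) * cnj (fcoef (Z t) (- m)) = 0"
    and zero: "\<And>t. rate t = 0 \<Longrightarrow>
       wa t * (Re (fcoef (Z t) 0) + Im (fcoef (Z t) 0)) + wb t * (Re (fcoef (Z t) 0) - Im (fcoef (Z t) 0)) = 0"
  shows "0 \<le> integral {-L..L} (\<lambda>t. integral {0..2*pi} (\<lambda>\<theta>. jacobi_density t (Z t \<theta>) (Zt t \<theta>) (Zs t \<theta>)))"
proof -
  note Z' = Z[unfolded C1_field_def, rule_format]
  have dt: "\<And>t \<theta>. ((\<lambda>t. Z t \<theta>) has_vector_derivative Zt t \<theta>) (at t)"
    and ds: "\<And>t \<theta>. (Z t has_vector_derivative Zs t \<theta>) (at \<theta>)"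
    and c: "continuous_on UNIV (\<lambda>(t, \<theta>). Z t \<theta>)" "continuous_on UNIV (\<lambda>(t, \<theta>). Zt t \<theta>)"
      "continuous_on UNIV (\<lambda>(t, \<theta>). Zs t \<theta>)" and per: "\<And>t. Z t 0 = Z t (2 * pi)"
    using Z' by auto
  define z where "z j t = fcoef (Z t) j" for j t
  define z' where "z' j t = fcoef (Zt t) j" for j t
  have dz: "(z j has_vector_derivative z' j t) (at t)" for j t
    unfolding z_def[abs_def] z'_def by (intro fcoef_has_vector_derivative dt c)
  have cz': "continuous_on S (z' j)" and cz: "continuous_on S (z j)" for j S
    unfolding z'_def[abs_def] z_def[abs_def] by (intro continuous_fcoef c)+
  have z0: "z j t = 0" if "L \<le> \<bar>t\<bar>" for j t
    unfolding z_def fcoef_def using supp[OF that] by simp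
  have cc: "continuous_on S (\<lambda>t. cnj (z' j t))" "continuous_on S (\<lambda>t. cnj (z j t))" for j S
    by (intro continuous_intros cz cz')+
  define P where "P j t = pair_form (of_int j) t (z j t) (cnj (z (- j) t)) (z' j t) (cnj (z' (- j) t))" for j t
  have cP: "continuous_on {-L..L} (P j)" for j
    unfolding P_def[abs_def] pair_form_def by (intro continuous_intros cz cz' cc) auto
  have dcnj: "((\<lambda>t. cnj (z j t)) has_vector_derivative cnj (z' j t)) (at t)" for j t
    by (rule bounded_linear.has_vector_derivative[OF bounded_linear_cnj dz])
  have Ppos: "0 \<le> integral {-L..L} (P j)" if "0 < j" for j
    unfolding P_def
    by (rule pair_form_integral_nonneg[OF _ dz dcnj cz' cc(1) _ L])
       (use that pos L z0 in \<open>auto simp: z_def\<close>)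
  have P0: "0 \<le> integral {-L..L} (P 0)"
    unfolding P_def minus_zero of_int_0
    by (rule zero_mode_integral_nonneg[OF dz cz' _ L]) (use zero L z0 in \<open>auto simp: z_def\<close>)
  have "P (- j) = P j" for j
    using pair_form_swap[of "of_int j"] by (auto simp: P_def fun_eq_iff) (metis complex_cnj_cnj)
  \<comment> \<open>The pair for - j is the pair for j with its members exchanged, so conditions at
    positive frequencies cover the negative ones.\<close>
  then have Pall: "0 \<le> integral {-L..L} (P j)" for j
    using Ppos[of j] Ppos[of "- j"] P0 by (cases j "0 :: int" rule: linorder_cases) auto
  define D where "D t = integral {0..2*pi} (\<lambda>\<theta>. jacobi_density t (Z t \<theta>) (Zt t \<theta>) (Zs t \<theta>))" for t
  define N where "N t = integral {0..2*pi} (\<lambda>\<theta>. (cmod (Zs t \<theta>))\<^sup>2)" for t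
  define W where "W t = (((wa t)\<^sup>2 + (wb t)\<^sup>2) / 2 + wa t * wb t) * (2 * pi * N t)" for t
  have c2: "continuous_on S (\<lambda>x. Z (fst x) (snd x))" "continuous_on S (\<lambda>x. Zt (fst x) (snd x))"
    "continuous_on S (\<lambda>x. Zs (fst x) (snd x))" for S
    using c[THEN continuous_on_subset, OF subset_UNIV] by (simp_all add: case_prod_unfold)
  have "continuous_on {-L..L} (\<lambda>t. integral (cbox 0 (2*pi)) (\<lambda>\<theta>. (cmod (Zs t \<theta>))\<^sup>2))"
    by (rule integral_continuous_on_param) (auto simp: case_prod_unfold intro!: continuous_intros c2)
  then have cN: "continuous_on {-L..L} N" by (simp add: N_def[abs_def])
  have "continuous_on {-L..L} (\<lambda>t. integral (cbox 0 (2*pi)) (\<lambda>\<theta>. jacobi_density t (Z t \<theta>) (Zt t \<theta>) (Zs t \<theta>)))"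
    by (rule integral_continuous_on_param) (auto simp: case_prod_unfold jacobi_density_def intro!: continuous_intros c2)
  then have cD: "continuous_on {-L..L} D" by (simp add: D_def[abs_def])
  have cW: "continuous_on {-L..L} W"
    unfolding W_def[abs_def] by (intro continuous_intros cN) auto
  have ge: "- integral {-L..L} W / (real (Suc M))\<^sup>2 \<le> 2 * pi * integral {-L..L} D" for M
  proof -
    let ?H = "\<lambda>t. half_modes M t (fcoef (Z t)) (fcoef (Zt t))"
    have H: "?H = (\<lambda>t. \<Sum>j\<in>{- int M..int M}. P j t / 2)"
      by (simp add: half_modes_def P_def z_def z'_def fun_eq_iff)
    have iH: "?H integrable_on {-L..L}"
      unfolding H by (intro integrable_continuous_real continuous_intros cP) auto
    have "integral {-L..L} ?H = (\<Sum>j\<in>{- int M..int M}. integral {-L..L} (P j) / 2)"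
      unfolding H by (subst Henstock_Kurzweil_Integration.integral_sum) (auto intro!: integrable_continuous_real continuous_intros cP)
    then have H0: "0 \<le> integral {-L..L} ?H" using Pall by (simp add: sum_nonneg)
    have "integral {-L..L} (\<lambda>t. ?H t - W t / (real (Suc M))\<^sup>2) \<le> integral {-L..L} (\<lambda>t. 2 * pi * D t)"
    proof (rule integral_le)
      show "(\<lambda>t. ?H t - W t / (real (Suc M))\<^sup>2) integrable_on {-L..L}"
        by (intro integrable_diff iH integrable_continuous_real continuous_intros cW) auto
      show "(\<lambda>t. 2 * pi * D t) integrable_on {-L..L}"
        by (intro integrable_continuous_real continuous_intros cD)
      show "?H t - W t / (real (Suc M))\<^sup>2 \<le> 2 * pi * D t" if "t \<in> {-L..L}" for t
        using density_integral_ge[of "Z t" "Zs t" "Zt t" M t] ds per continuous_slice[OF c(2)] continuous_slice[OF c(3)]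
        unfolding D_def W_def N_def
        by (simp add: has_vector_derivative_at_within)
    qed
    also have "integral {-L..L} (\<lambda>t. ?H t - W t / (real (Suc M))\<^sup>2) = integral {-L..L} ?H - integral {-L..L} W / (real (Suc M))\<^sup>2"
      by (subst Henstock_Kurzweil_Integration.integral_diff)
         (auto intro!: iH integrable_continuous_real continuous_intros cW)
    finally show ?thesis using H0 by simp
  qed
  have "(\<lambda>M. - integral {-L..L} W / (real (Suc M))\<^sup>2) \<longlonglongrightarrow> 0"
    by (intro real_tendsto_divide_at_top tendsto_const filterlim_pow_at_top filterlim_compose[OF filterlim_real_sequentially filterlim_Suc]) auto
  then have "0 \<le> 2 * pi * integral {-L..L} D"
    by (rule LIMSEQ_le_const2) (use ge in auto)
  then have "2 * pi * 0 \<le> 2 * pi * integral {-L..L} D" by simp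
  then have "0 \<le> integral {-L..L} D" by (rule mult_left_le_imp_le) simp
  then show ?thesis by (simp add: D_def[abs_def])
qed

text \<open>Linear in j with the value \<mu> at j = \<kappa>, where the pair with exponents - \<mu>
  and \<mu> is the bounded Jacobi solution. On the surface it is j * l / k.\<close>

definition slope :: "int \<Rightarrow> real" where "slope j = of_int j / \<kappa> * \<mu>"

lemma slope_minus [simp]: "slope (- j) = - slope j"
  by (simp add: slope_def)

lemma ex_le:
  assumes "\<bar>c\<bar> \<le> \<kappa>"
  shows "ex c t \<le> 2"
proof -
  have "ex c t \<le> exp (\<kappa> * \<bar>t\<bar>) * (2 * exp (- \<kappa> * \<bar>t\<bar>))"
    unfolding ex_def
  proof (intro mult_mono)
    have "c * t \<le> \<bar>c\<bar> * \<bar>t\<bar>" by (metis abs_mult abs_ge_self)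
    also have "\<dots> \<le> \<kappa> * \<bar>t\<bar>" by (intro mult_right_mono assms) simp
    finally show "exp (c * t) \<le> exp (\<kappa> * \<bar>t\<bar>)" by simp
    show "nrm t \<le> 2 * exp (- \<kappa> * \<bar>t\<bar>)" using nrm_le[of t] by (cases "0 \<le> t") auto
  qed (auto simp: less_imp_le)
  also have "\<dots> = 2" by (simp add: exp_minus)
  finally show ?thesis .
qed

lemma ex_pos [simp]: "0 < ex c t"
  by (simp add: ex_def)

lemma continuous_ex [continuous_intros]:
  "continuous_on S g \<Longrightarrow> continuous_on S (\<lambda>x. ex c (g x))"
  unfolding ex_def by (intro continuous_intros)

lemma abs_slope_le: "\<bar>of_int j\<bar> \<le> \<kappa> \<Longrightarrow> \<bar>slope j\<bar> \<le> \<kappa>"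
proof -
  assume "\<bar>of_int j\<bar> \<le> \<kappa>"
  then have "\<bar>of_int j\<bar> / \<kappa> \<le> 1" using kappa_mu(5) by simp
  then have "\<bar>of_int j\<bar> / \<kappa> * \<mu> \<le> 1 * \<mu>" using kappa_mu(3) by (intro mult_right_mono) auto
  then show ?thesis using kappa_mu(3-5) by (simp add: slope_def abs_mult)
qed

text \<open>The excess contributes a fixed negative amount from \<bar>t\<bar> \<le> 1. The explicit
  pair is only bounded, but stretching the cut-off over length N costs merely a constant divided by
  N.\<close>

lemma mode_form_test_negative:
  fixes \<psi> \<psi>' :: "real \<Rightarrow> real"
  assumes d: "\<And>x. (\<psi> has_real_derivative \<psi>' x) (at x)" and cd: "continuous_on UNIV \<psi>'"
    and supp: "\<And>x. 1 \<le> \<bar>x\<bar> \<Longrightarrow> \<psi> x = 0" and pos: "\<And>x. \<bar>x\<bar> < 1 \<Longrightarrow> 0 < \<psi> x"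
    and j: "\<bar>of_int j\<bar> < \<kappa>"
  shows "\<exists>N0>0. \<forall>N\<ge>N0. integral {-N..N} (\<lambda>t. mode_form (of_int j) t
      (\<psi> (t / N) * ex (- slope j) t) (\<psi> (t / N) * ex (slope j) t)
      (\<psi>' (t / N) / N * ex (- slope j) t + \<psi> (t / N) * ((- slope j - rate t) * ex (- slope j) t))
      (\<psi>' (t / N) / N * ex (slope j) t + \<psi> (t / N) * ((slope j - rate t) * ex (slope j) t))) < 0"
proof -
  define x s where "x = of_int j / \<kappa>" and "s = slope j"
  have x: "\<bar>x\<bar> < 1" using j kappa_mu(5) by (simp add: x_def)
  have xk: "x * \<kappa> = of_int j" "x * \<mu> = s" using kappa_mu(5) by (simp_all add: x_def s_def slope_def)
  have sb: "\<bar>s\<bar> \<le> \<kappa>" unfolding s_def using j by (intro abs_slope_le) simp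
  have x1: "0 < 1 - x\<^sup>2" using x by (simp add: abs_square_less_1)
  have ep: "0 < excess s (of_int j) t" for t
  proof -
    have "0 < 2 * \<alpha> * \<beta> * (1 - x\<^sup>2) * (nrm t) ^ 4"
      using alpha_pos beta_pos x1 by (intro mult_pos_pos zero_less_power) auto
    then show ?thesis using excess_ge[of x t] x unfolding xk by linarith
  qed
  have ce: "continuous_on S (excess s (of_int j))" for S
    unfolding excess_def[abs_def] by (intro continuous_intros)
  have c\<psi>: "continuous_on UNIV \<psi>" using d by (auto intro!: continuous_at_imp_continuous_on DERIV_isCont)
  have "{-1..1::real} \<noteq> {}" by simp
  from continuous_attains_inf[OF compact_Icc this ce]
  obtain t0 where t0: "\<And>t. t \<in> {-1..1} \<Longrightarrow> excess s (of_int j) t0 \<le> excess s (of_int j) t" by blast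
  define e0 where "e0 = excess s (of_int j) t0"
  have e0: "0 < e0" by (simp add: e0_def ep)
  have "{-1/2..1/2::real} \<noteq> {}" by simp
  from continuous_attains_inf[OF compact_Icc this continuous_on_subset[OF c\<psi> subset_UNIV]]
  obtain x0 where x0: "x0 \<in> {-1/2..1/2}" "\<And>x. x \<in> {-1/2..1/2} \<Longrightarrow> \<psi> x0 \<le> \<psi> x" by blast
  define c where "c = \<psi> x0"
  have c0: "0 < c" unfolding c_def using x0(1) by (intro pos) auto
  have "bounded (\<psi>' ` {-1..1})"
    by (intro compact_imp_bounded compact_continuous_image continuous_on_subset[OF cd]) auto
  then obtain B where B: "\<And>x. x \<in> {-1..1} \<Longrightarrow> \<bar>\<psi>' x\<bar> \<le> B"
    unfolding bounded_iff by (metis image_eqI real_norm_def)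
  have B0: "0 \<le> B" using B[of 0] by simp
  \<comment> \<open>The quotient makes the cut-off cost 16 * B^2 / N smaller than 2 * c^2 * e0; the
    summand 2 keeps t / N in the half interval, where \<psi> \<ge> c, for all \<bar>t\<bar> \<le>
    1.\<close>
  define N0 where "N0 = 8 * B\<^sup>2 / (c\<^sup>2 * e0) + 2"
  have N0: "N0 \<ge> 2" unfolding N0_def using c0 e0 by simp
  show ?thesis
  proof (intro exI[of _ N0] conjI allI impI)
    show "N0 > 0" using N0 by simp
    fix N assume N: "N0 \<le> N"
    then have N2: "2 \<le> N" using N0 by simp
    define \<phi> where "\<phi> t = \<psi> (t / N)" for t
    define \<phi>' where "\<phi>' t = \<psi>' (t / N) / N" for t
    have d\<phi>: "(\<phi> has_real_derivative \<phi>' t) (at t)" for t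
      unfolding \<phi>_def[abs_def] \<phi>'_def
      by (rule DERIV_cong[OF DERIV_chain2[OF d DERIV_cdivide[OF DERIV_ident]]]) simp
    have c\<phi>: "continuous_on S \<phi>" "continuous_on S \<phi>'" for S
      unfolding \<phi>_def[abs_def] \<phi>'_def[abs_def] using N2
      by (auto intro!: continuous_intros continuous_on_compose2[OF c\<psi>] continuous_on_compose2[OF cd])
    define Y where "Y t = (ex (- s) t)\<^sup>2 + (ex s t)\<^sup>2" for t
    define M where "M t = mode_form (of_int j) t (\<phi> t * ex (- s) t) (\<phi> t * ex s t)
        (\<phi>' t * ex (- s) t + \<phi> t * ((- s - rate t) * ex (- s) t)) (\<phi>' t * ex s t + \<phi> t * ((s - rate t) * ex s t))" for t
    have cM: "continuous_on S M" for S
      unfolding M_def[abs_def] mode_form_def by (intro continuous_intros c\<phi>) auto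
    have cY: "continuous_on S Y" for S unfolding Y_def[abs_def] by (intro continuous_intros)
    have \<phi>0: "\<phi> N = 0" "\<phi> (- N) = 0" using N2 by (auto simp: \<phi>_def supp)
    have "((\<lambda>t. M t - (\<phi>' t)\<^sup>2 * Y t + (\<phi> t)\<^sup>2 * excess s (of_int j) t) has_integral
       ((\<phi> N)\<^sup>2 * ((- s - rate N) * (ex (- s) N)\<^sup>2 + (s - rate N) * (ex s N)\<^sup>2)
       - (\<phi> (- N))\<^sup>2 * ((- s - rate (- N)) * (ex (- s) (- N))\<^sup>2 + (s - rate (- N)) * (ex s (- N))\<^sup>2))) {-N..N}"
      using N2 unfolding M_def Y_def
      by (intro fundamental_theorem_of_calculus)
         (auto intro!: has_field_derivative_at_within[OF mode_form_test[OF d\<phi>]] simp flip: has_real_derivative_iff_has_vector_derivative)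
    then have "integral {-N..N} (\<lambda>t. M t - (\<phi>' t)\<^sup>2 * Y t + (\<phi> t)\<^sup>2 * excess s (of_int j) t) = 0"
      by (simp add: \<phi>0 integral_unique)
    moreover have "integral {-N..N} (\<lambda>t. M t - (\<phi>' t)\<^sup>2 * Y t + (\<phi> t)\<^sup>2 * excess s (of_int j) t) =
       integral {-N..N} M - integral {-N..N} (\<lambda>t. (\<phi>' t)\<^sup>2 * Y t) + integral {-N..N} (\<lambda>t. (\<phi> t)\<^sup>2 * excess s (of_int j) t)"
      by (subst Henstock_Kurzweil_Integration.integral_add Henstock_Kurzweil_Integration.integral_diff,
          (intro integrable_continuous_real continuous_intros cM cY c\<phi> ce)+)+ simp
    moreover have "integral {-N..N} (\<lambda>t. (\<phi>' t)\<^sup>2 * Y t) \<le> integral {-N..N} (\<lambda>t. (B / N)\<^sup>2 * 8)"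
    proof (intro integral_le integrable_continuous_real continuous_intros cY c\<phi>)
      fix t assume t: "t \<in> {-N..N}"
      have "\<bar>\<phi>' t\<bar> \<le> B / N"
        unfolding \<phi>'_def using N2 t by (auto intro!: divide_right_mono B simp: abs_divide field_simps)
      then have "(\<phi>' t)\<^sup>2 \<le> (B / N)\<^sup>2" by (metis abs_ge_zero power2_abs power_mono)
      moreover have "(ex c t)\<^sup>2 \<le> 2\<^sup>2" if "\<bar>c\<bar> \<le> \<kappa>" for c
        by (intro power_mono ex_le that) (simp add: less_imp_le)
      from this[of s] this[of "- s"] sb have "Y t \<le> 8" by (simp add: Y_def)
      ultimately show "(\<phi>' t)\<^sup>2 * Y t \<le> (B / N)\<^sup>2 * 8" by (intro mult_mono) (auto simp: Y_def)
    qed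
    moreover have "integral {-N..N} (\<lambda>t. (B / N)\<^sup>2 * 8) = 16 * B\<^sup>2 / N"
      using N2 by (simp add: power2_eq_square field_simps)
    moreover have "2 * (c\<^sup>2 * e0) \<le> integral {-N..N} (\<lambda>t. (\<phi> t)\<^sup>2 * excess s (of_int j) t)"
    proof -
      have "2 * (c\<^sup>2 * e0) = integral {-1..1} (\<lambda>t :: real. c\<^sup>2 * e0)" by simp
      also have "\<dots> \<le> integral {-1..1} (\<lambda>t. (\<phi> t)\<^sup>2 * excess s (of_int j) t)"
      proof (intro integral_le integrable_continuous_real continuous_intros c\<phi> ce)
        fix t :: real assume t: "t \<in> {-1..1}"
        have "t / N \<in> {-1/2..1/2}" using t N2 by (auto simp: field_simps)
        then have "c \<le> \<phi> t" unfolding c_def \<phi>_def by (rule x0(2))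
        then have "c\<^sup>2 \<le> (\<phi> t)\<^sup>2" using c0 by (intro power_mono) auto
        then show "c\<^sup>2 * e0 \<le> (\<phi> t)\<^sup>2 * excess s (of_int j) t"
          unfolding e0_def using t0[OF t] ep[of t0] by (intro mult_mono) auto
      qed
      also have "\<dots> \<le> integral {-N..N} (\<lambda>t. (\<phi> t)\<^sup>2 * excess s (of_int j) t)"
        using N2 ep by (intro integral_subset_le integrable_continuous_real continuous_intros c\<phi> ce) (auto simp: less_imp_le)
      finally show ?thesis .
    qed
    moreover have "16 * B\<^sup>2 / N < 2 * (c\<^sup>2 * e0)"
    proof -
      have ce0: "0 < c\<^sup>2 * e0" using c0 e0 by simp
      have "8 * B\<^sup>2 / (c\<^sup>2 * e0) < N" using N by (simp add: N0_def)
      then have "8 * B\<^sup>2 < N * (c\<^sup>2 * e0)" using ce0 by (simp add: pos_divide_less_eq)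
      then show ?thesis using N2 by (simp add: pos_divide_less_eq mult.commute)
    qed
    ultimately have "integral {-N..N} M < 0" by linarith
    then show "integral {-N..N} (\<lambda>t. mode_form (of_int j) t
      (\<psi> (t / N) * ex (- slope j) t) (\<psi> (t / N) * ex (slope j) t)
      (\<psi>' (t / N) / N * ex (- slope j) t + \<psi> (t / N) * ((- slope j - rate t) * ex (- slope j) t))
      (\<psi>' (t / N) / N * ex (slope j) t + \<psi> (t / N) * ((slope j - rate t) * ex (slope j) t))) < 0"
      by (simp add: M_def[abs_def] \<phi>_def \<phi>'_def s_def)
  qed
qed

end

section \<open>Calculus of smooth maps and a bump function\<close>

lemma dd_eq: "(F has_derivative F') (at p) \<Longrightarrow> dd F v p = F' v"
  unfolding dd_def by (simp add: frechet_derivative_at[symmetric])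

lemma has_derivative_dd: "F differentiable (at p) \<Longrightarrow> (F has_derivative (\<lambda>v. dd F v p)) (at p)"
  unfolding dd_def by (simp add: frechet_derivative_works)

lemma Ck_SucI:
  assumes "\<And>p. (F has_derivative F' p) (at p)" "\<And>v. Ck n (\<lambda>p. F' p v)"
  shows "Ck (Suc n) F"
proof -
  have "dd F v = (\<lambda>p. F' p v)" for v using dd_eq[OF assms(1)] by (simp add: fun_eq_iff)
  then show ?thesis using assms by (auto simp: differentiable_def)
qed

lemma Ck_Suc_has_derivative: "Ck (Suc n) F \<Longrightarrow> (F has_derivative (\<lambda>v. dd F v p)) (at p)"
  by (simp add: has_derivative_dd)

lemma Ck_SucD: "Ck (Suc n) F \<Longrightarrow> Ck n F"
proof (induction n arbitrary: F)
  case 0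
  then show ?case
    by (auto intro!: continuous_at_imp_continuous_on differentiable_imp_continuous_within)
next
  case (Suc n)
  from Suc.prems have "\<forall>p. F differentiable (at p)" "\<forall>v. Ck (Suc n) (dd F v)" by auto
  then show ?case using Suc.IH by auto
qed

lemma Ck_const: "Ck n (\<lambda>p. c)"
proof (induction n arbitrary: c)
  case (Suc n)
  show ?case by (rule Ck_SucI[OF has_derivative_const]) (rule Suc)
qed simp

lemma Ck_linear: "bounded_linear L \<Longrightarrow> Ck n L"
proof (cases n)
  case (Suc m)
  assume L: "bounded_linear L"
  show ?thesis unfolding Suc
    by (rule Ck_SucI[OF bounded_linear_imp_has_derivative[OF L]]) (rule Ck_const)
qed (simp add: linear_continuous_on)

lemma Ck_add: "Ck n F \<Longrightarrow> Ck n G \<Longrightarrow> Ck n (\<lambda>p. F p + G p)"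
proof (induction n arbitrary: F G)
  case (Suc n)
  show ?case
    by (rule Ck_SucI[OF has_derivative_add[OF Ck_Suc_has_derivative[OF Suc.prems(1)] Ck_Suc_has_derivative[OF Suc.prems(2)]]])
       (use Suc in auto)
qed (auto intro!: continuous_intros)

lemma Ck_bilinear:
  assumes "bounded_bilinear B"
  shows "Ck n F \<Longrightarrow> Ck n G \<Longrightarrow> Ck n (\<lambda>p. B (F p) (G p))"
proof (induction n arbitrary: F G)
  case 0
  then show ?case by (auto intro: bounded_bilinear.continuous_on[OF assms])
next
  case (Suc n)
  note d = bounded_bilinear.FDERIV[OF assms Ck_Suc_has_derivative[OF Suc.prems(1)] Ck_Suc_has_derivative[OF Suc.prems(2)]]
  show ?case
    by (rule Ck_SucI[OF d])
       (intro Ck_add Suc.IH Ck_SucD[OF Suc.prems(1)] Ck_SucD[OF Suc.prems(2)]; use Suc.prems in simp)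
qed

lemmas Ck_scaleR = Ck_bilinear[OF bounded_bilinear_scaleR]
lemmas Ck_mult = Ck_bilinear[OF bounded_bilinear_mult]
lemmas Ck_inner = Ck_bilinear[OF bounded_bilinear_inner]

text \<open>With a real outer function the chain rule involves only its derivative in direction 1,
  composed with the same inner map, so the induction stays within products of functions already
  covered.\<close>

lemma Ck_compose:
  fixes g :: "real \<Rightarrow> real"
  shows "Ck n g \<Longrightarrow> Ck n F \<Longrightarrow> Ck n (\<lambda>p. g (F p))"
proof (induction n arbitrary: g F)
  case 0
  then show ?case by (auto intro: continuous_on_compose2)
next
  case (Suc n)
  note dF = Ck_Suc_has_derivative[OF Suc.prems(2)]
  note dg = Ck_Suc_has_derivative[OF Suc.prems(1)]
  have lin: "dd g v x = dd g 1 x * v" for v x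
    using linear_scale[OF bounded_linear.linear[OF has_derivative_bounded_linear[OF dg[of x]]], of v 1] by simp
  have e: "(\<lambda>v. dd g (dd F v p) (F p)) = (\<lambda>v. dd g 1 (F p) * dd F v p)" for p
    by (rule ext, rule lin)
  show ?case
  proof (rule Ck_SucI)
    show "((\<lambda>p. g (F p)) has_derivative (\<lambda>v. dd g 1 (F p) * dd F v p)) (at p)" for p
      using has_derivative_compose[OF dF dg, of p] unfolding e .
    show "Ck n (\<lambda>p. dd g 1 (F p) * dd F v p)" for v
      by (rule Ck_mult[OF Suc.IH[OF _ Ck_SucD[OF Suc.prems(2)]]]) (use Suc.prems in simp_all)
  qed
qed

lemma Ck_real_SucI:
  fixes g :: "real \<Rightarrow> real"
  assumes "\<And>x. (g has_real_derivative g' x) (at x)" "Ck n g'"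
  shows "Ck (Suc n) g"
  by (rule Ck_SucI[OF assms(1)[unfolded has_field_derivative_def]]) (intro Ck_mult Ck_const assms(2))

lemma smoothI: "(\<And>n. Ck n F) \<Longrightarrow> smooth F"
  by (simp add: smooth_def)

lemma smoothD: "smooth F \<Longrightarrow> Ck n F"
  by (simp add: smooth_def)

lemma smooth_dd: "smooth F \<Longrightarrow> smooth (dd F v)"
  unfolding smooth_def using Ck.simps(2) by blast

lemma smooth_has_derivative: "smooth F \<Longrightarrow> (F has_derivative (\<lambda>v. dd F v p)) (at p)"
  using Ck_Suc_has_derivative smoothD by blast

lemma smooth_continuous: "smooth F \<Longrightarrow> continuous_on S F"
  using smoothD[of F 0] continuous_on_subset by auto

lemma smooth_const: "smooth (\<lambda>p. c)"
  by (intro smoothI Ck_const)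

lemma smooth_linear: "bounded_linear L \<Longrightarrow> smooth L"
  by (intro smoothI Ck_linear)

lemma smooth_add: "smooth F \<Longrightarrow> smooth G \<Longrightarrow> smooth (\<lambda>p. F p + G p)"
  by (rule smoothI, rule Ck_add; rule smoothD)

lemma smooth_scaleR: "smooth f \<Longrightarrow> smooth G \<Longrightarrow> smooth (\<lambda>p. f p *\<^sub>R G p)"
  by (rule smoothI, rule Ck_scaleR; rule smoothD)

lemma smooth_mult: "smooth f \<Longrightarrow> smooth g \<Longrightarrow> smooth (\<lambda>p. f p * g p)"
  for f :: "'a::real_normed_vector \<Rightarrow> 'b::real_normed_algebra"
  by (rule smoothI, rule Ck_mult; rule smoothD)

lemma smooth_inner: "smooth F \<Longrightarrow> smooth G \<Longrightarrow> smooth (\<lambda>p. F p \<bullet> G p)"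
  by (rule smoothI, rule Ck_inner; rule smoothD)

lemma smooth_compose: "smooth h \<Longrightarrow> smooth f \<Longrightarrow> smooth (\<lambda>p. h (f p))"
  for h :: "real \<Rightarrow> real"
  by (rule smoothI, rule Ck_compose; rule smoothD)

lemma smooth_minus: "smooth F \<Longrightarrow> smooth (\<lambda>p. - F p)"
  using smooth_scaleR[OF smooth_const, of F "- 1"] by simp

lemma smooth_sum: "(\<And>i. i \<in> I \<Longrightarrow> smooth (F i)) \<Longrightarrow> smooth (\<lambda>p. \<Sum>i\<in>I. F i p)"
  by (induction I rule: infinite_finite_induct) (simp_all add: smooth_add smooth_const)

lemma smooth_fst: "smooth (fst :: real \<times> real \<Rightarrow> real)" and smooth_snd: "smooth (snd :: real \<times> real \<Rightarrow> real)"
  by (simp_all add: smooth_linear bounded_linear_fst bounded_linear_snd)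

lemma smooth_exp: "smooth (exp :: real \<Rightarrow> real)"
proof (rule smoothI)
  show "Ck n (exp :: real \<Rightarrow> real)" for n
  proof (induction n)
    case (Suc n)
    show ?case by (rule Ck_real_SucI[OF DERIV_exp Suc])
  qed (auto intro!: continuous_intros)
qed

lemma smooth_sin: "smooth (sin :: real \<Rightarrow> real)" and smooth_cos: "smooth (cos :: real \<Rightarrow> real)"
proof -
  have "Ck n (sin :: real \<Rightarrow> real) \<and> Ck n (cos :: real \<Rightarrow> real)" for n
  proof (induction n)
    case (Suc n)
    have "Ck n (\<lambda>x :: real. - sin x)" using Ck_mult[OF Ck_const[of n "-1"] conjunct1[OF Suc]] by simp
    then show ?case using Suc by (intro conjI Ck_real_SucI[OF DERIV_sin] Ck_real_SucI[OF DERIV_cos]) auto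
  qed (auto intro!: continuous_intros)
  then show "smooth (sin :: real \<Rightarrow> real)" "smooth (cos :: real \<Rightarrow> real)" by (auto intro: smoothI)
qed

text \<open>The derivative is a product of the reciprocal with itself and with a derivative of F, so
  each order of differentiability yields the next.\<close>

lemma smooth_inverse:
  fixes F :: "'a::real_normed_vector \<Rightarrow> real"
  assumes "smooth F" "\<And>p. F p \<noteq> 0"
  shows "smooth (\<lambda>p. inverse (F p))"
proof (rule smoothI)
  show "Ck n (\<lambda>p. inverse (F p))" for n
  proof (induction n)
    case 0
    show ?case using assms smooth_continuous[of F UNIV] by (auto intro!: continuous_intros)
  next
    case (Suc n)
    show ?case
    proof (rule Ck_SucI)
      show "((\<lambda>p. inverse (F p)) has_derivative (\<lambda>v. (- 1) * ((inverse (F p) * inverse (F p)) * dd F v p))) (at p)" for p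
        using Deriv.has_derivative_inverse[OF assms(2) smooth_has_derivative[OF assms(1)], of p] by (simp add: mult_ac)
      show "Ck n (\<lambda>p. (- 1) * ((inverse (F p) * inverse (F p)) * dd F v p))" for v
        by (rule Ck_mult[OF Ck_const Ck_mult[OF Ck_mult[OF Suc Suc] smoothD[OF smooth_dd[OF assms(1)]]]])
    qed
  qed
qed

text \<open>Dividing by powers of x gives a family that is closed under differentiation up to linear
  combinations, so continuity and one derivative formula for all members give smoothness.\<close>

definition flat :: "nat \<Rightarrow> real \<Rightarrow> real" where
  "flat n x = (if x > 0 then exp (- 1 / x) / x ^ n else 0)"

lemma flat_tendsto_0: "(flat n \<longlongrightarrow> 0) (at 0)"
proof -
  have "((\<lambda>y::real. y ^ n / exp y) \<longlongrightarrow> 0) at_top" by (rule tendsto_power_div_exp_0)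
  then have "((\<lambda>x. (1 / x) ^ n / exp (1 / x)) \<longlongrightarrow> 0) (at_right (0::real))"
    by (rule filterlim_compose) (simp add: filterlim_inverse_at_top_right flip: inverse_eq_divide)
  then have "(flat n \<longlongrightarrow> 0) (at_right 0)"
    by (rule Lim_transform_eventually)
       (auto simp: eventually_at_filter flat_def power_one_over exp_minus field_simps)
  moreover have "(flat n \<longlongrightarrow> 0) (at_left 0)"
    by (rule Lim_transform_eventually[OF tendsto_const]) (auto simp: eventually_at_filter flat_def)
  ultimately show ?thesis by (simp add: filterlim_at_split)
qed

lemma DERIV_flat: "(flat n has_real_derivative - real n * flat (Suc n) x + flat (Suc (Suc n)) x) (at x)"
proof (cases x "0 :: real" rule: linorder_cases)
  case equal
  \<comment> \<open>The difference quotient of \<open>flat n\<close> at 0 is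
    \<open>flat (Suc n)\<close>.\<close>
  have "((\<lambda>y. (flat n y - flat n 0) / (y - 0)) \<longlongrightarrow> 0) (at 0)"
    by (rule Lim_transform_eventually[OF flat_tendsto_0[of "Suc n"]])
       (auto simp: eventually_at_filter flat_def)
  then show ?thesis unfolding equal by (simp add: has_field_derivative_iff flat_def)
next
  case less
  have "((\<lambda>x. 0) has_real_derivative - real n * flat (Suc n) x + flat (Suc (Suc n)) x) (at x)"
    using less by (simp add: flat_def)
  then show ?thesis
    by (rule has_field_derivative_transform_within_open[of _ _ _ "{..<0}"]) (use less in \<open>auto simp: flat_def\<close>)
next
  case greater
  have "((\<lambda>x. exp (- 1 / x) / x ^ n) has_real_derivative - real n * flat (Suc n) x + flat (Suc (Suc n)) x) (at x)"
    using greater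
    by (auto intro!: derivative_eq_intros simp: flat_def) (cases n; simp add: field_simps power2_eq_square)
  then show ?thesis
    by (rule has_field_derivative_transform_within_open[of _ _ _ "{0<..}"]) (use greater in \<open>auto simp: flat_def\<close>)
qed

lemma smooth_flat: "smooth (flat n)"
proof (rule smoothI)
  show "Ck m (flat n)" for m
  proof (induction m arbitrary: n)
    case 0
    show ?case by (auto intro!: continuous_at_imp_continuous_on DERIV_isCont DERIV_flat)
  next
    case (Suc m)
    show ?case by (rule Ck_real_SucI[OF DERIV_flat]) (intro Ck_add Ck_mult Ck_const Suc)
  qed
qed

lemma smooth_has_real_derivative:
  assumes "smooth (h :: real \<Rightarrow> real)"
  shows "(h has_real_derivative dd h 1 x) (at x)"
proof -
  note d = smooth_has_derivative[OF assms, of x]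
  have "(\<lambda>v. dd h v x) = (*) (dd h 1 x)"
  proof
    show "dd h v x = dd h 1 x * v" for v
      using linear_scale[OF bounded_linear.linear[OF has_derivative_bounded_linear[OF d]], of v 1] by simp
  qed
  with d show ?thesis by (simp only: has_field_derivative_def)
qed

text \<open>Evenness is demanded so that the cut-off fields can descend to the Moebius band.\<close>

lemma exists_bump:
 obtains \<psi> \<psi>' :: "real \<Rightarrow> real" where "smooth \<psi>" "\<And>x. (\<psi> has_real_derivative \<psi>' x) (at x)"
    "continuous_on UNIV \<psi>'" "\<And>x. 1 \<le> \<bar>x\<bar> \<Longrightarrow> \<psi> x = 0" "\<And>x. \<bar>x\<bar> < 1 \<Longrightarrow> 0 < \<psi> x" "\<And>x. \<psi> (- x) = \<psi> x"
proof
  let ?\<psi> = "\<lambda>x. flat 0 (1 + x) * flat 0 (1 + - x)"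
  show s: "smooth ?\<psi>"
    by (rule smooth_mult[OF smooth_compose[OF smooth_flat smooth_add[OF smooth_const smooth_linear[OF bounded_linear_ident]]]
          smooth_compose[OF smooth_flat smooth_add[OF smooth_const smooth_minus[OF smooth_linear[OF bounded_linear_ident]]]]])
  show "(?\<psi> has_real_derivative dd ?\<psi> 1 x) (at x)" for x
    by (rule smooth_has_real_derivative[OF s])
  show "continuous_on UNIV (dd ?\<psi> 1)" by (rule smooth_continuous[OF smooth_dd[OF s]])
qed (auto simp: flat_def)

section \<open>The tangent and normal frame of the immersion\<close>

definition vec4 :: "real \<Rightarrow> real \<Rightarrow> real \<Rightarrow> real \<Rightarrow> real ^ 4" where
  "vec4 a b c d = vector [a, b, c, d]"

lemma vec4_nth [simp]: "vec4 a b c d $ 1 = a" "vec4 a b c d $ 2 = b" "vec4 a b c d $ 3 = c" "vec4 a b c d $ 4 = d"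
  by (simp_all add: vec4_def vector_def)

lemma vec4_eqI: "x $ 1 = y $ 1 \<Longrightarrow> x $ 2 = y $ 2 \<Longrightarrow> x $ 3 = y $ 3 \<Longrightarrow> x $ 4 = y $ 4 \<Longrightarrow> x = y"
  for x y :: "real ^ 4"
  by (simp add: vec_eq_iff forall_4)

lemma vec4_axis: "vec4 a b c d = a *\<^sub>R axis 1 1 + b *\<^sub>R axis 2 1 + c *\<^sub>R axis 3 1 + d *\<^sub>R axis 4 1"
  by (rule vec4_eqI) (simp_all add: axis_def)

lemma inner_vec4: "vec4 a b c d \<bullet> vec4 a' b' c' d' = a * a' + b * b' + c * c' + d * d'"
  by (simp add: inner_vec_def sum_4)

lemma inner_vec4': "x \<bullet> vec4 a b c d = x $ 1 * a + x $ 2 * b + x $ 3 * c + x $ 4 * d"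
  by (simp add: inner_vec_def sum_4)

lemma smooth_vec4:
  assumes "smooth f1" "smooth f2" "smooth f3" "smooth f4"
  shows "smooth (\<lambda>p. vec4 (f1 p) (f2 p) (f3 p) (f4 p))"
  unfolding vec4_axis
  by (rule smooth_add[OF smooth_add[OF smooth_add]]; rule smooth_scaleR[OF _ smooth_const]; rule assms)

lemma has_derivative_vec4:
  assumes "(f1 has_derivative g1) F" "(f2 has_derivative g2) F" "(f3 has_derivative g3) F" "(f4 has_derivative g4) F"
  shows "((\<lambda>p. vec4 (f1 p) (f2 p) (f3 p) (f4 p)) has_derivative (\<lambda>v. vec4 (g1 v) (g2 v) (g3 v) (g4 v))) F"
  unfolding vec4_axis by (intro has_derivative_add has_derivative_scaleR_left assms)

lemma has_derivative_vec4_separated: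
  assumes "(g1 has_real_derivative g1') (at (fst p))" "(h1 has_real_derivative h1') (at (snd p))"
    "(g2 has_real_derivative g2') (at (fst p))" "(h2 has_real_derivative h2') (at (snd p))"
    "(g3 has_real_derivative g3') (at (fst p))" "(h3 has_real_derivative h3') (at (snd p))"
    "(g4 has_real_derivative g4') (at (fst p))" "(h4 has_real_derivative h4') (at (snd p))"
  shows "((\<lambda>p :: plane. vec4 (g1 (fst p) * h1 (snd p)) (g2 (fst p) * h2 (snd p)) (g3 (fst p) * h3 (snd p)) (g4 (fst p) * h4 (snd p)))
    has_derivative (\<lambda>v. fst v *\<^sub>R vec4 (g1' * h1 (snd p)) (g2' * h2 (snd p)) (g3' * h3 (snd p)) (g4' * h4 (snd p))
       + snd v *\<^sub>R vec4 (g1 (fst p) * h1') (g2 (fst p) * h2') (g3 (fst p) * h3') (g4 (fst p) * h4'))) (at p)"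
proof -
  have *: "((\<lambda>p. g (fst p) * h (snd p)) has_derivative (\<lambda>v. g (fst p) * (h' * snd v) + (g' * fst v) * h (snd p))) (at p)"
    if "(g has_real_derivative g') (at (fst p))" "(h has_real_derivative h') (at (snd p))" for g h g' h'
    by (rule has_derivative_mult[OF has_derivative_compose[OF has_derivative_fst[OF has_derivative_ident] that(1)[unfolded has_field_derivative_def]]
          has_derivative_compose[OF has_derivative_snd[OF has_derivative_ident] that(2)[unfolded has_field_derivative_def]]])
  show ?thesis
    by (rule has_derivative_eq_rhs[OF has_derivative_vec4[OF *[OF assms(1,2)] *[OF assms(3,4)] *[OF assms(5,6)] *[OF assms(7,8)]]])
       (rule ext, rule vec4_eqI; simp)
qed

lemma dd_scale: "F differentiable (at p) \<Longrightarrow> dd F (a *\<^sub>R v) p = a *\<^sub>R dd F v p"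
  using linear_scale[OF bounded_linear.linear[OF has_derivative_bounded_linear[OF has_derivative_dd]]] by blast

lemma has_derivative_of_fst:
  assumes "(g has_real_derivative g') (at (fst p))"
  shows "((\<lambda>p :: plane. g (fst p)) has_derivative (\<lambda>v. g' * fst v)) (at p)"
  using has_derivative_compose[OF has_derivative_fst[OF has_derivative_ident] assms[unfolded has_field_derivative_def]]
  by simp

locale fraser_sargent =
  fixes k l :: nat
  assumes l_pos: "0 < l" and l_less: "l < k"
begin

sublocale two_rates "real k + real l" "real k - real l"
  using l_pos l_less by unfold_locales auto

lemma kappa_eq: "\<kappa> = real k" and mu_eq: "\<mu> = real l"
  by (simp_all add: \<kappa>_def \<mu>_def)

text \<open>The vectors \<open>T1\<close>, \<open>T2\<close>, \<open>N1\<close>, \<open>N2\<close>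
  are pairwise orthogonal and deliberately not normalised: their common squared length is
  \<open>E\<close>, and no square root has to be differentiated.\<close>

definition T1 :: "plane \<Rightarrow> real ^ 4" where
  "T1 p = vec4 (cosh (real l * fst p) * cos (real l * snd p)) (cosh (real l * fst p) * sin (real l * snd p))
     (sinh (real k * fst p) * cos (real k * snd p)) (sinh (real k * fst p) * sin (real k * snd p))"

definition T2 :: "plane \<Rightarrow> real ^ 4" where
  "T2 p = vec4 (- sinh (real l * fst p) * sin (real l * snd p)) (sinh (real l * fst p) * cos (real l * snd p))
     (- cosh (real k * fst p) * sin (real k * snd p)) (cosh (real k * fst p) * cos (real k * snd p))"

definition N1 :: "plane \<Rightarrow> real ^ 4" where
  "N1 p = vec4 (sinh (real k * fst p) * cos (real l * snd p)) (sinh (real k * fst p) * sin (real l * snd p))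
     (- cosh (real l * fst p) * cos (real k * snd p)) (- cosh (real l * fst p) * sin (real k * snd p))"

definition N2 :: "plane \<Rightarrow> real ^ 4" where
  "N2 p = vec4 (- cosh (real k * fst p) * sin (real l * snd p)) (cosh (real k * fst p) * cos (real l * snd p))
     (sinh (real l * fst p) * sin (real k * snd p)) (- sinh (real l * fst p) * cos (real k * snd p))"

definition T1t :: "plane \<Rightarrow> real ^ 4" where
  "T1t p = vec4 (real l * sinh (real l * fst p) * cos (real l * snd p)) (real l * sinh (real l * fst p) * sin (real l * snd p))
     (real k * cosh (real k * fst p) * cos (real k * snd p)) (real k * cosh (real k * fst p) * sin (real k * snd p))"

definition T1s :: "plane \<Rightarrow> real ^ 4" where
  "T1s p = vec4 (- real l * cosh (real l * fst p) * sin (real l * snd p)) (real l * cosh (real l * fst p) * cos (real l * snd p))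
     (- real k * sinh (real k * fst p) * sin (real k * snd p)) (real k * sinh (real k * fst p) * cos (real k * snd p))"

definition N1t :: "plane \<Rightarrow> real ^ 4" where
  "N1t p = vec4 (real k * cosh (real k * fst p) * cos (real l * snd p)) (real k * cosh (real k * fst p) * sin (real l * snd p))
     (- real l * sinh (real l * fst p) * cos (real k * snd p)) (- real l * sinh (real l * fst p) * sin (real k * snd p))"

definition N1s :: "plane \<Rightarrow> real ^ 4" where
  "N1s p = vec4 (- real l * sinh (real k * fst p) * sin (real l * snd p)) (real l * sinh (real k * fst p) * cos (real l * snd p))
     (real k * cosh (real l * fst p) * sin (real k * snd p)) (- real k * cosh (real l * fst p) * cos (real k * snd p))"

definition N2t :: "plane \<Rightarrow> real ^ 4" where
  "N2t p = vec4 (- real k * sinh (real k * fst p) * sin (real l * snd p)) (real k * sinh (real k * fst p) * cos (real l * snd p))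
     (real l * cosh (real l * fst p) * sin (real k * snd p)) (- real l * cosh (real l * fst p) * cos (real k * snd p))"

definition N2s :: "plane \<Rightarrow> real ^ 4" where
  "N2s p = vec4 (- real l * cosh (real k * fst p) * cos (real l * snd p)) (- real l * cosh (real k * fst p) * sin (real l * snd p))
     (real k * sinh (real l * fst p) * cos (real k * snd p)) (real k * sinh (real l * fst p) * sin (real k * snd p))"

lemmas frame_defs = T1_def T2_def N1_def N2_def T1t_def T1s_def N1t_def N1s_def N2t_def N2s_def

text \<open>No separate derivative vectors are introduced for \<open>T2\<close>: mixed partial
  derivatives of the immersion agree, and harmonicity makes the \<theta>-derivative of
  \<open>T2\<close> the negative of the t-derivative of \<open>T1\<close>.\<close>

lemma has_derivative_frame:
  "(T1 has_derivative (\<lambda>v. fst v *\<^sub>R T1t p + snd v *\<^sub>R T1s p)) (at p)"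
  "(T2 has_derivative (\<lambda>v. fst v *\<^sub>R T1s p - snd v *\<^sub>R T1t p)) (at p)"
  "(N1 has_derivative (\<lambda>v. fst v *\<^sub>R N1t p + snd v *\<^sub>R N1s p)) (at p)"
  "(N2 has_derivative (\<lambda>v. fst v *\<^sub>R N2t p + snd v *\<^sub>R N2s p)) (at p)"
proof -
  have d: "((\<lambda>x. cosh (c * x)) has_real_derivative c * sinh (c * x)) (at x)" "((\<lambda>x. sinh (c * x)) has_real_derivative c * cosh (c * x)) (at x)"
    "((\<lambda>x. - cosh (c * x)) has_real_derivative - c * sinh (c * x)) (at x)" "((\<lambda>x. - sinh (c * x)) has_real_derivative - c * cosh (c * x)) (at x)"
    "((\<lambda>x. cos (c * x)) has_real_derivative - c * sin (c * x)) (at x)" "((\<lambda>x. sin (c * x)) has_real_derivative c * cos (c * x)) (at x)"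
    for c x :: real
    by (auto intro!: derivative_eq_intros)
  show "(T1 has_derivative (\<lambda>v. fst v *\<^sub>R T1t p + snd v *\<^sub>R T1s p)) (at p)"
    unfolding T1_def[abs_def]
    by (rule has_derivative_eq_rhs[OF has_derivative_vec4_separated[OF d(1)[of "real l" "fst p"] d(5)[of "real l" "snd p"] d(1)[of "real l" "fst p"] d(6)[of "real l" "snd p"] d(2)[of "real k" "fst p"] d(5)[of "real k" "snd p"] d(2)[of "real k" "fst p"] d(6)[of "real k" "snd p"]]])
       (rule ext, rule vec4_eqI; simp add: frame_defs)
  show "(T2 has_derivative (\<lambda>v. fst v *\<^sub>R T1s p - snd v *\<^sub>R T1t p)) (at p)"
    unfolding T2_def[abs_def]
    by (rule has_derivative_eq_rhs[OF has_derivative_vec4_separated[OF d(4)[of "real l" "fst p"] d(6)[of "real l" "snd p"] d(2)[of "real l" "fst p"] d(5)[of "real l" "snd p"] d(3)[of "real k" "fst p"] d(6)[of "real k" "snd p"] d(1)[of "real k" "fst p"] d(5)[of "real k" "snd p"]]])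
       (rule ext, rule vec4_eqI; simp add: frame_defs)
  show "(N1 has_derivative (\<lambda>v. fst v *\<^sub>R N1t p + snd v *\<^sub>R N1s p)) (at p)"
    unfolding N1_def[abs_def]
    by (rule has_derivative_eq_rhs[OF has_derivative_vec4_separated[OF d(2)[of "real k" "fst p"] d(5)[of "real l" "snd p"] d(2)[of "real k" "fst p"] d(6)[of "real l" "snd p"] d(3)[of "real l" "fst p"] d(5)[of "real k" "snd p"] d(3)[of "real l" "fst p"] d(6)[of "real k" "snd p"]]])
       (rule ext, rule vec4_eqI; simp add: frame_defs)
  show "(N2 has_derivative (\<lambda>v. fst v *\<^sub>R N2t p + snd v *\<^sub>R N2s p)) (at p)"
    unfolding N2_def[abs_def]
    by (rule has_derivative_eq_rhs[OF has_derivative_vec4_separated[OF d(3)[of "real k" "fst p"] d(6)[of "real l" "snd p"] d(1)[of "real k" "fst p"] d(5)[of "real l" "snd p"] d(2)[of "real l" "fst p"] d(6)[of "real k" "snd p"] d(4)[of "real l" "fst p"] d(5)[of "real k" "snd p"]]])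
       (rule ext, rule vec4_eqI; simp add: frame_defs)
qed

definition E :: "real \<Rightarrow> real" where "E t = (cosh (real l * t))\<^sup>2 + (sinh (real k * t))\<^sup>2"

lemma E_alt: "E t = (sinh (real l * t))\<^sup>2 + (cosh (real k * t))\<^sup>2"
  using hyperbolic_pythagoras[of "real l * t"] hyperbolic_pythagoras[of "real k * t"] by (simp add: E_def)

lemma hyp_products:
  "sinh ((real k + real l) * t) = sinh (real k * t) * cosh (real l * t) + cosh (real k * t) * sinh (real l * t)"
  "sinh ((real k - real l) * t) = sinh (real k * t) * cosh (real l * t) - cosh (real k * t) * sinh (real l * t)"
  "cosh ((real k + real l) * t) = cosh (real k * t) * cosh (real l * t) + sinh (real k * t) * sinh (real l * t)"
  "cosh ((real k - real l) * t) = cosh (real k * t) * cosh (real l * t) - sinh (real k * t) * sinh (real l * t)"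
  by (simp_all only: ring_distribs left_diff_distrib sinh_add sinh_diff cosh_add cosh_diff)

text \<open>The product of the two addition formulas is a difference of squares. This identifies
  \<open>E\<close> with the reciprocal of the square of \<open>nrm\<close> and links the geometry to
  the two rates.\<close>

lemma E_prod: "E t = cosh ((real k + real l) * t) * cosh ((real k - real l) * t)"
proof -
  have "cosh ((real k + real l) * t) * cosh ((real k - real l) * t)
     = (cosh (real k * t))\<^sup>2 * (cosh (real l * t))\<^sup>2 - (sinh (real k * t))\<^sup>2 * (sinh (real l * t))\<^sup>2"
    unfolding hyp_products by (simp add: power2_eq_square algebra_simps)
  also have "\<dots> = E t"
    using hyperbolic_pythagoras[of "real l * t"] hyperbolic_pythagoras[of "real k * t"]
    unfolding E_def by algebra
  finally show ?thesis by simp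
qed

lemma E_pos: "0 < E t"
  by (simp add: E_prod)

lemma nrm_sq_E: "(nrm t)\<^sup>2 = 1 / E t"
  by (simp add: nrm_sq E_prod)

lemma nrm_nrm_E: "nrm t * nrm t * E t = 1"
  using nrm_sq_E[of t] E_pos[of t] by (simp add: power2_eq_square field_simps)

lemma rate_E: "rate t * E t = real l * sinh (real l * t) * cosh (real l * t) + real k * sinh (real k * t) * cosh (real k * t)"
proof -
  have "2 * (rate t * E t) = (real k + real l) * sinh ((real k + real l) * t) * cosh ((real k - real l) * t)
     + (real k - real l) * sinh ((real k - real l) * t) * cosh ((real k + real l) * t)"
    by (simp add: rate_def E_prod tanh_def field_simps)
  also have "\<dots> = 2 * (real l * sinh (real l * t) * cosh (real l * t) + real k * sinh (real k * t) * cosh (real k * t))"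
    unfolding hyp_products
    using hyperbolic_pythagoras[of "real l * t"] hyperbolic_pythagoras[of "real k * t"] by algebra
  finally show ?thesis by simp
qed

lemma conn_E: "conn t * E t = real l * sinh (real k * t) * cosh (real k * t) + real k * cosh (real l * t) * sinh (real l * t)"
proof -
  have "2 * (conn t * E t) = (real k + real l) * sinh ((real k + real l) * t) * cosh ((real k - real l) * t)
     - (real k - real l) * sinh ((real k - real l) * t) * cosh ((real k + real l) * t)"
    by (simp add: conn_def E_prod tanh_def field_simps)
  also have "\<dots> = 2 * (real l * sinh (real k * t) * cosh (real k * t) + real k * cosh (real l * t) * sinh (real l * t))"
    unfolding hyp_products
    using hyperbolic_pythagoras[of "real l * t"] hyperbolic_pythagoras[of "real k * t"] by algebra
  finally show ?thesis by simp
qed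

lemma wa_wb_E:
  "(wa t + wb t) * E t = 2 * (real k * cosh (real k * t) * cosh (real l * t) - real l * sinh (real l * t) * sinh (real k * t))"
  "(wa t - wb t) * E t = 2 * (real l * cosh (real l * t) * cosh (real k * t) - real k * sinh (real k * t) * sinh (real l * t))"
proof -
  have "wa t * E t = (real k + real l) * cosh ((real k - real l) * t)" "wb t * E t = (real k - real l) * cosh ((real k + real l) * t)"
    by (simp_all add: wa_def wb_def E_prod)
  then show "(wa t + wb t) * E t = 2 * (real k * cosh (real k * t) * cosh (real l * t) - real l * sinh (real l * t) * sinh (real k * t))"
    "(wa t - wb t) * E t = 2 * (real l * cosh (real l * t) * cosh (real k * t) - real k * sinh (real k * t) * sinh (real l * t))"
    unfolding distrib_right[of "wa t"] left_diff_distrib[of "wa t"] by (simp_all only: hyp_products) (simp_all add: algebra_simps)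
qed

lemma frame_inner:
  "T1 p \<bullet> T1 p = E (fst p)" "T2 p \<bullet> T2 p = E (fst p)" "N1 p \<bullet> N1 p = E (fst p)" "N2 p \<bullet> N2 p = E (fst p)"
  "T1 p \<bullet> T2 p = 0" "T1 p \<bullet> N1 p = 0" "T1 p \<bullet> N2 p = 0" "T2 p \<bullet> N1 p = 0" "T2 p \<bullet> N2 p = 0" "N1 p \<bullet> N2 p = 0"
proof -
  define s1 c1 s2 c2 where "s1 = sin (real l * snd p)" and "c1 = cos (real l * snd p)" and "s2 = sin (real k * snd p)" and "c2 = cos (real k * snd p)"
  have "s1\<^sup>2 + c1\<^sup>2 = 1" "s2\<^sup>2 + c2\<^sup>2 = 1" by (simp_all add: s1_def c1_def s2_def c2_def)
  note sc = this
  show "T1 p \<bullet> T1 p = E (fst p)" "N1 p \<bullet> N1 p = E (fst p)"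
    unfolding frame_defs inner_vec4 E_def s1_def[symmetric] c1_def[symmetric] s2_def[symmetric] c2_def[symmetric]
    using sc by (algebra | simp add: algebra_simps)+
  show "T2 p \<bullet> T2 p = E (fst p)" "N2 p \<bullet> N2 p = E (fst p)"
    unfolding frame_defs inner_vec4 E_alt s1_def[symmetric] c1_def[symmetric] s2_def[symmetric] c2_def[symmetric]
    using sc by (algebra | simp add: algebra_simps)+
  show "T1 p \<bullet> T2 p = 0" "T1 p \<bullet> N1 p = 0" "T1 p \<bullet> N2 p = 0" "T2 p \<bullet> N1 p = 0" "T2 p \<bullet> N2 p = 0" "N1 p \<bullet> N2 p = 0"
    unfolding frame_defs inner_vec4 s1_def[symmetric] c1_def[symmetric] s2_def[symmetric] c2_def[symmetric]
    using sc by (algebra | simp add: algebra_simps)+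
qed

text \<open>The structure equations. The products of derivatives of \<open>T1\<close> with the
  normals carry the second fundamental form; those of derivatives of the normals with each other
  carry the normal connection, whose only rotation is \<open>conn\<close>, along the
  circles.\<close>

lemma frame_deriv_inner:
  "T1t p \<bullet> T1 p = rate (fst p) * E (fst p)" "T1t p \<bullet> T2 p = 0" "T1s p \<bullet> T1 p = 0" "T1s p \<bullet> T2 p = rate (fst p) * E (fst p)"
  "T1t p \<bullet> N1 p = - (wa (fst p) + wb (fst p)) / 2 * E (fst p)" "T1t p \<bullet> N2 p = 0" "T1s p \<bullet> N1 p = 0"
  "T1s p \<bullet> N2 p = (wa (fst p) - wb (fst p)) / 2 * E (fst p)"
  "N1t p \<bullet> N1 p = rate (fst p) * E (fst p)" "N1t p \<bullet> N2 p = 0" "N2t p \<bullet> N1 p = 0" "N2t p \<bullet> N2 p = rate (fst p) * E (fst p)"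
  "N1s p \<bullet> N1 p = 0" "N1s p \<bullet> N2 p = conn (fst p) * E (fst p)" "N2s p \<bullet> N1 p = - conn (fst p) * E (fst p)" "N2s p \<bullet> N2 p = 0"
proof -
  define s1 c1 s2 c2 where "s1 = sin (real l * snd p)" and "c1 = cos (real l * snd p)" and "s2 = sin (real k * snd p)" and "c2 = cos (real k * snd p)"
  have "s1\<^sup>2 + c1\<^sup>2 = 1" "s2\<^sup>2 + c2\<^sup>2 = 1" by (simp_all add: s1_def c1_def s2_def c2_def)
  note sc = this
  note f = frame_defs inner_vec4 s1_def[symmetric] c1_def[symmetric] s2_def[symmetric] c2_def[symmetric]
  show "T1t p \<bullet> T1 p = rate (fst p) * E (fst p)" "T1s p \<bullet> T2 p = rate (fst p) * E (fst p)"
    "N1t p \<bullet> N1 p = rate (fst p) * E (fst p)" "N2t p \<bullet> N2 p = rate (fst p) * E (fst p)"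
    unfolding f rate_E using sc by (algebra | simp add: algebra_simps)+
  show "T1t p \<bullet> T2 p = 0" "T1s p \<bullet> T1 p = 0" "T1t p \<bullet> N2 p = 0" "T1s p \<bullet> N1 p = 0"
    "N1t p \<bullet> N2 p = 0" "N2t p \<bullet> N1 p = 0" "N1s p \<bullet> N1 p = 0" "N2s p \<bullet> N2 p = 0"
    unfolding f using sc by (algebra | simp add: algebra_simps)+
  have c: "N2s p \<bullet> N1 p = - (conn (fst p) * E (fst p))" and d: "N1s p \<bullet> N2 p = conn (fst p) * E (fst p)"
    unfolding f conn_E using sc by (algebra | simp add: algebra_simps)+
  from c show "N2s p \<bullet> N1 p = - conn (fst p) * E (fst p)" by simp
  from d show "N1s p \<bullet> N2 p = conn (fst p) * E (fst p)" .
  have a: "2 * (T1t p \<bullet> N1 p) = - ((wa (fst p) + wb (fst p)) * E (fst p))" and b: "2 * (T1s p \<bullet> N2 p) = (wa (fst p) - wb (fst p)) * E (fst p)"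
    unfolding f wa_wb_E using sc by (algebra | simp add: algebra_simps)+
  from a show "T1t p \<bullet> N1 p = - (wa (fst p) + wb (fst p)) / 2 * E (fst p)" by (simp add: field_simps)
  from b show "T1s p \<bullet> N2 p = (wa (fst p) - wb (fst p)) / 2 * E (fst p)" by (simp add: field_simps)
qed

lemma frame_complete:
  "E (fst p) *\<^sub>R w = (w \<bullet> T1 p) *\<^sub>R T1 p + (w \<bullet> T2 p) *\<^sub>R T2 p + (w \<bullet> N1 p) *\<^sub>R N1 p + (w \<bullet> N2 p) *\<^sub>R N2 p"
proof -
  define s1 c1 s2 c2 where "s1 = sin (real l * snd p)" and "c1 = cos (real l * snd p)" and "s2 = sin (real k * snd p)" and "c2 = cos (real k * snd p)"
  define sl cl sk ck where "sl = sinh (real l * fst p)" and "cl = cosh (real l * fst p)" and "sk = sinh (real k * fst p)" and "ck = cosh (real k * fst p)"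
  have sc: "s1\<^sup>2 + c1\<^sup>2 = 1" "s2\<^sup>2 + c2\<^sup>2 = 1" by (simp_all add: s1_def c1_def s2_def c2_def)
  have h: "cl\<^sup>2 - sl\<^sup>2 = 1" "ck\<^sup>2 - sk\<^sup>2 = 1" by (simp_all add: sl_def cl_def sk_def ck_def hyperbolic_pythagoras)
  have f: "T1 p = vec4 (cl * c1) (cl * s1) (sk * c2) (sk * s2)" "T2 p = vec4 (- sl * s1) (sl * c1) (- ck * s2) (ck * c2)"
    "N1 p = vec4 (sk * c1) (sk * s1) (- cl * c2) (- cl * s2)" "N2 p = vec4 (- ck * s1) (ck * c1) (sl * s2) (- sl * c2)"
    "E (fst p) = cl\<^sup>2 + sk\<^sup>2"
    by (simp_all add: frame_defs E_def s1_def c1_def s2_def c2_def sl_def cl_def sk_def ck_def)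
  show ?thesis unfolding f inner_vec4'
  proof (rule vec4_eqI; simp only: vector_scaleR_component vector_add_component vec4_nth real_scaleR_def)
  qed (use sc h in algebra)+
qed

end

section \<open>The normal bundle in a complex coordinate\<close>

context fraser_sargent begin

abbreviation u :: "plane \<Rightarrow> real ^ 4" where "u \<equiv> FS_u k l"

definition cc :: real where "cc = real k * real l / FS_r k l"

lemma FS_r_pos: "0 < FS_r k l"
proof -
  have "0 < (real l)\<^sup>2 * (cosh (real k * FS_T k l))\<^sup>2" using l_pos by simp
  then show ?thesis unfolding FS_r_def by (simp add: add_nonneg_pos)
qed

lemma cc_pos: "0 < cc"
  using FS_r_pos l_pos l_less by (simp add: cc_def)

lemma has_derivative_u: "(u has_derivative (\<lambda>v. cc *\<^sub>R (fst v *\<^sub>R T1 p + snd v *\<^sub>R T2 p))) (at p)"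
proof -
  have u: "u = (\<lambda>p. (1 / FS_r k l) *\<^sub>R vec4 ((real k * sinh (real l * fst p)) * cos (real l * snd p)) ((real k * sinh (real l * fst p)) * sin (real l * snd p))
     ((real l * cosh (real k * fst p)) * cos (real k * snd p)) ((real l * cosh (real k * fst p)) * sin (real k * snd p)))"
    by (simp add: FS_u_def vec4_def case_prod_unfold)
  have d: "((\<lambda>x. real k * sinh (real l * x)) has_real_derivative real k * (real l * cosh (real l * x))) (at x)"
    "((\<lambda>x. real l * cosh (real k * x)) has_real_derivative real l * (real k * sinh (real k * x))) (at x)"
    "((\<lambda>x. cos (c * x)) has_real_derivative - c * sin (c * x)) (at x)" "((\<lambda>x. sin (c * x)) has_real_derivative c * cos (c * x)) (at x)"
    for c x :: real
    by (auto intro!: derivative_eq_intros)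
  show ?thesis unfolding u
    by (rule has_derivative_eq_rhs[OF has_derivative_scaleR_right[OF has_derivative_vec4_separated[OF
          d(1)[of "fst p"] d(3)[of "real l" "snd p"] d(1)[of "fst p"] d(4)[of "real l" "snd p"]
          d(2)[of "fst p"] d(3)[of "real k" "snd p"] d(2)[of "fst p"] d(4)[of "real k" "snd p"]]]])
       (rule ext, rule vec4_eqI; simp add: T1_def T2_def cc_def algebra_simps)
qed

lemma dd_u: "dd u v p = cc *\<^sub>R (fst v *\<^sub>R T1 p + snd v *\<^sub>R T2 p)"
  by (rule dd_eq[OF has_derivative_u])

text \<open>The reciprocal of the common length of the two coordinate vectors of the conformal
  immersion; the Gram-Schmidt frame is the coordinate frame times this factor.\<close>

definition \<nu> :: "real \<Rightarrow> real" where "\<nu> t = nrm t / cc"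

lemma nu_pos [simp]: "0 < \<nu> t"
  using cc_pos by (simp add: \<nu>_def)

lemma nu_cc: "cc * \<nu> t = nrm t"
  using cc_pos by (simp add: \<nu>_def)

lemma sqrt_E_nu: "cc * sqrt (E t) = 1 / \<nu> t"
  using cc_pos by (simp add: \<nu>_def nrm_def E_prod)

lemma frame1_u: "frame1 u p = (\<nu> (fst p), 0)"
proof -
  have "norm (T1 p) = sqrt (E (fst p))" by (simp add: norm_eq_sqrt_inner frame_inner)
  then have "norm (dd u (1, 0) p) = cc * sqrt (E (fst p))"
    using cc_pos by (simp add: dd_u)
  then show ?thesis by (simp add: frame1_def sqrt_E_nu)
qed

lemma frame2_u: "frame2 u p = (0, \<nu> (fst p))"
proof -
  have z: "dd u (0, 1) p \<bullet> dd u (frame1 u p) p = 0"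
    by (simp add: dd_u frame1_u frame_inner inner_commute[of "T2 p" "T1 p"])
  have "norm (T2 p) = sqrt (E (fst p))" by (simp add: norm_eq_sqrt_inner frame_inner)
  then have "norm (dd u (0, 1) p) = cc * sqrt (E (fst p))"
    using cc_pos by (simp add: dd_u)
  then show ?thesis unfolding frame2_def z Let_def by (simp add: sqrt_E_nu)
qed

lemma frame_u: "frame u 1 p = (\<nu> (fst p), 0)" "frame u (Suc 0) p = (\<nu> (fst p), 0)" "frame u 2 p = (0, \<nu> (fst p))"
  by (simp_all add: frame_def frame1_u frame2_u)

lemma push_frame_u: "push u (frame u 1) p = nrm (fst p) *\<^sub>R T1 p" "push u (frame u 2) p = nrm (fst p) *\<^sub>R T2 p"
  unfolding push_def frame_u dd_u by (simp_all add: nu_cc)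

lemma area_density_u: "area_density u p = 1 / (\<nu> (fst p))\<^sup>2"
proof -
  have "area_density u p = sqrt ((cc * cc * E (fst p)) * (cc * cc * E (fst p)))"
    unfolding area_density_def dd_u by (simp add: frame_inner power2_eq_square mult_ac)
  also have "\<dots> = cc * cc * E (fst p)" using cc_pos E_pos[of "fst p"] by simp
  also have "\<dots> = (cc * sqrt (E (fst p)))\<^sup>2" using E_pos[of "fst p"] by (simp add: power_mult_distrib power2_eq_square)
  finally show ?thesis by (simp add: sqrt_E_nu power_divide)
qed

definition npart :: "plane \<Rightarrow> real ^ 4 \<Rightarrow> real ^ 4" where
  "npart p w = (nrm (fst p))\<^sup>2 *\<^sub>R ((w \<bullet> N1 p) *\<^sub>R N1 p + (w \<bullet> N2 p) *\<^sub>R N2 p)"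

lemma frame_complete': "w = (nrm (fst p))\<^sup>2 *\<^sub>R ((w \<bullet> T1 p) *\<^sub>R T1 p + (w \<bullet> T2 p) *\<^sub>R T2 p) + npart p w"
proof -
  have "w = (nrm (fst p))\<^sup>2 *\<^sub>R (E (fst p) *\<^sub>R w)"
    using E_pos[of "fst p"] by (simp add: nrm_sq_E)
  then show ?thesis unfolding frame_complete npart_def by (simp add: scaleR_add_right add_ac)
qed

lemma normal_part_u: "normal_part u p w = npart p w"
proof -
  have "(\<Sum>i\<in>{1,2}. (w \<bullet> push u (frame u i) p) *\<^sub>R push u (frame u i) p)
      = (nrm (fst p))\<^sup>2 *\<^sub>R ((w \<bullet> T1 p) *\<^sub>R T1 p + (w \<bullet> T2 p) *\<^sub>R T2 p)"
    by (simp add: push_frame_u push_frame_u(1)[simplified] scaleR_add_right power2_eq_square mult_ac)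
  then show ?thesis
    unfolding normal_part_def using frame_complete'[of w p] by (simp add: algebra_simps)
qed

text \<open>The complex coordinate with respect to the orthonormal frame nrm * N1, nrm * N2. It sees
  only the normal part of a vector.\<close>

definition comp :: "plane \<Rightarrow> real ^ 4 \<Rightarrow> complex" where
  "comp p w = Complex (nrm (fst p) * (w \<bullet> N1 p)) (nrm (fst p) * (w \<bullet> N2 p))"

lemma comp_linear: "comp p (v + w) = comp p v + comp p w" "comp p (v - w) = comp p v - comp p w"
    "comp p (a *\<^sub>R w) = of_real a * comp p w" "comp p 0 = 0"
  by (simp_all add: comp_def complex_eq_iff inner_add_left inner_diff_left algebra_simps)

lemma comp_frame: "comp p (N1 p) = of_real (1 / nrm (fst p))" "comp p (N2 p) = \<i> * of_real (1 / nrm (fst p))"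
  "comp p (T1 p) = 0" "comp p (T2 p) = 0"
proof -
  have "nrm (fst p) * E (fst p) = 1 / nrm (fst p)"
    using nrm_nrm_E[of "fst p"] nrm_pos[of "fst p"] by (simp add: eq_divide_eq mult_ac)
  then show "comp p (N1 p) = of_real (1 / nrm (fst p))" "comp p (N2 p) = \<i> * of_real (1 / nrm (fst p))"
    by (simp_all add: comp_def complex_eq_iff frame_inner inner_commute[of "N2 p" "N1 p"])
  show "comp p (T1 p) = 0" "comp p (T2 p) = 0"
    by (simp_all add: comp_def complex_eq_iff frame_inner)
qed

lemma comp_npart: "comp p (npart p w) = comp p w"
  unfolding npart_def comp_linear comp_frame
  by (simp add: comp_def complex_eq_iff power2_eq_square)

lemma npart_inner: "npart p v \<bullet> w = Re (comp p v * cnj (comp p w))"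
  by (simp add: npart_def comp_def inner_add_left power2_eq_square algebra_simps inner_commute)

lemma npart_npart: "npart p (npart p w) = npart p w"
proof -
  have "npart p w \<bullet> N1 p = w \<bullet> N1 p" "npart p w \<bullet> N2 p = w \<bullet> N2 p"
    using comp_npart[of p w] nrm_pos[of "fst p"] by (auto simp: comp_def complex_eq_iff)
  then show ?thesis by (simp add: npart_def)
qed

lemma norm_npart: "(norm (npart p w))\<^sup>2 = (cmod (comp p w))\<^sup>2"
proof -
  have "(norm (npart p w))\<^sup>2 = npart p w \<bullet> npart p w" by (simp add: power2_norm_eq_inner)
  also have "\<dots> = Re (comp p w * cnj (comp p w))" unfolding npart_inner comp_npart ..
  finally show ?thesis by (simp add: complex_norm_square[symmetric] cmod_power2 power2_eq_square)
qed

lemma npart_eq_comp: "npart p w = (nrm (fst p) * Re (comp p w)) *\<^sub>R N1 p + (nrm (fst p) * Im (comp p w)) *\<^sub>R N2 p"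
  by (simp add: npart_def comp_def scaleR_add_right power2_eq_square mult_ac)

lemma npart_linear: "npart p (v + w) = npart p v + npart p w" "npart p (v - w) = npart p v - npart p w"
    "npart p (a *\<^sub>R w) = a *\<^sub>R npart p w" "npart p 0 = 0"
  by (simp_all add: npart_def inner_add_left inner_diff_left algebra_simps)

definition normal_field :: "(plane \<Rightarrow> real ^ 4) \<Rightarrow> bool" where
  "normal_field X \<longleftrightarrow> (\<forall>p. npart p (X p) = X p)"

lemma normal_field_iff: "normal_field X \<longleftrightarrow> (\<forall>p v. X p \<bullet> dd u v p = 0)"
proof
  assume "normal_field X"
  then have X: "X p = npart p (X p)" for p by (metis normal_field_def)
  show "\<forall>p v. X p \<bullet> dd u v p = 0"
    by (intro allI, subst X) (simp add: npart_def dd_u inner_add_left inner_add_right frame_inner inner_commute[of "N1 _"] inner_commute[of "N2 _" "T1 _"] inner_commute[of "N2 _" "T2 _"])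
next
  assume *: "\<forall>p v. X p \<bullet> dd u v p = 0"
  have "X p \<bullet> T1 p = 0" "X p \<bullet> T2 p = 0" for p
    using *[rule_format, of p "(1, 0)"] *[rule_format, of p "(0, 1)"] cc_pos by (auto simp: dd_u)
  then show "normal_field X" unfolding normal_field_def using frame_complete' by (metis add.left_neutral add_0 scaleR_zero_left scaleR_zero_right)
qed

lemma has_derivative_nrm: "((\<lambda>p :: plane. nrm (fst p)) has_derivative (\<lambda>v. - rate (fst p) * nrm (fst p) * fst v)) (at p)"
  using has_derivative_of_fst[OF DERIV_nrm[OF DERIV_ident]] by simp

lemma dd_nrm_T: 
  "dd (\<lambda>p. nrm (fst p) *\<^sub>R T1 p) v p = nrm (fst p) *\<^sub>R (fst v *\<^sub>R T1t p + snd v *\<^sub>R T1s p) + (- rate (fst p) * nrm (fst p) * fst v) *\<^sub>R T1 p"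
  "dd (\<lambda>p. nrm (fst p) *\<^sub>R T2 p) v p = nrm (fst p) *\<^sub>R (fst v *\<^sub>R T1s p - snd v *\<^sub>R T1t p) + (- rate (fst p) * nrm (fst p) * fst v) *\<^sub>R T2 p"
  by (rule dd_eq[OF has_derivative_scaleR[OF has_derivative_nrm has_derivative_frame(1)]]
      dd_eq[OF has_derivative_scaleR[OF has_derivative_nrm has_derivative_frame(2)]])+

lemma npart_frame_deriv: "npart p (T1t p) = (- (wa (fst p) + wb (fst p)) / 2) *\<^sub>R N1 p"
  "npart p (T1s p) = ((wa (fst p) - wb (fst p)) / 2) *\<^sub>R N2 p" "npart p (T1 p) = 0" "npart p (T2 p) = 0"
  using E_pos[of "fst p"]
  by (simp_all add: npart_def frame_deriv_inner frame_inner nrm_sq_E)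

lemma push_frame_u_fun: "push u (frame u 1) = (\<lambda>p. nrm (fst p) *\<^sub>R T1 p)" "push u (frame u 2) = (\<lambda>p. nrm (fst p) *\<^sub>R T2 p)"
  by (rule ext, rule push_frame_u)+

definition shape_a :: "real \<Rightarrow> real" where "shape_a t = \<nu> t * nrm t * (- (wa t + wb t) / 2)"
definition shape_b :: "real \<Rightarrow> real" where "shape_b t = \<nu> t * nrm t * ((wa t - wb t) / 2)"

lemma second_ff_u:
  "second_ff u 1 1 p = shape_a (fst p) *\<^sub>R N1 p" "second_ff u 1 2 p = shape_b (fst p) *\<^sub>R N2 p"
  "second_ff u 2 1 p = shape_b (fst p) *\<^sub>R N2 p" "second_ff u 2 2 p = (- shape_a (fst p)) *\<^sub>R N1 p"
  unfolding second_ff_def normal_part_u push_frame_u_fun dd_nrm_T frame_u shape_a_def shape_b_def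
  by (simp_all only: fst_conv snd_conv npart_linear npart_frame_deriv scaleR_zero_left scaleR_zero_right)
     (simp_all add: mult_ac)

lemma simons_u: "simons u X p = (2 * (shape_a (fst p))\<^sup>2 * (X p \<bullet> N1 p)) *\<^sub>R N1 p + (2 * (shape_b (fst p))\<^sup>2 * (X p \<bullet> N2 p)) *\<^sub>R N2 p"
proof -
  have "simons u X p = (second_ff u 1 1 p \<bullet> X p) *\<^sub>R second_ff u 1 1 p + (second_ff u 1 2 p \<bullet> X p) *\<^sub>R second_ff u 1 2 p
     + ((second_ff u 2 1 p \<bullet> X p) *\<^sub>R second_ff u 2 1 p + (second_ff u 2 2 p \<bullet> X p) *\<^sub>R second_ff u 2 2 p)"
    unfolding simons_def by simp
  moreover have "(second_ff u 1 1 p \<bullet> X p) *\<^sub>R second_ff u 1 1 p = ((shape_a (fst p))\<^sup>2 * (X p \<bullet> N1 p)) *\<^sub>R N1 p"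
    "(second_ff u 1 2 p \<bullet> X p) *\<^sub>R second_ff u 1 2 p = ((shape_b (fst p))\<^sup>2 * (X p \<bullet> N2 p)) *\<^sub>R N2 p"
    "(second_ff u 2 1 p \<bullet> X p) *\<^sub>R second_ff u 2 1 p = ((shape_b (fst p))\<^sup>2 * (X p \<bullet> N2 p)) *\<^sub>R N2 p"
    "(second_ff u 2 2 p \<bullet> X p) *\<^sub>R second_ff u 2 2 p = ((shape_a (fst p))\<^sup>2 * (X p \<bullet> N1 p)) *\<^sub>R N1 p"
    unfolding second_ff_u by (simp_all add: inner_commute[of _ "X p"] power2_eq_square mult_ac)
  moreover have "x *\<^sub>R v + y *\<^sub>R w + (y *\<^sub>R w + x *\<^sub>R v) = (2 * x) *\<^sub>R v + (2 * y) *\<^sub>R w" for x y :: real and v w :: "real ^ 4"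
    by (simp only: mult_2 scaleR_add_left add_ac)
  ultimately show ?thesis by (simp only: mult.assoc)
qed

text \<open>The Simons operator is diagonal in the frame. Half the sum of its eigenvalues acts as a
  multiplication and half their difference multiplies a conjugation; the conjugation is what couples
  the frequency j to - j.\<close>

lemma comp_simons:
  "comp p (simons u X p) = of_real ((\<nu> (fst p))\<^sup>2) *
     (of_real (((wa (fst p))\<^sup>2 + (wb (fst p))\<^sup>2) / 2) * comp p (X p) + of_real (wa (fst p) * wb (fst p)) * cnj (comp p (X p)))"
proof -
  define n v where "n = nrm (fst p)" and "v = \<nu> (fst p)"
  have n: "n > 0" by (simp add: n_def)
  define x y where "x = X p \<bullet> N1 p" and "y = X p \<bullet> N2 p"
  have c: "comp p (X p) = Complex (n * x) (n * y)" by (simp add: comp_def x_def y_def n_def)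
  have ab: "2 * (shape_a (fst p))\<^sup>2 = v\<^sup>2 * n\<^sup>2 * (((wa (fst p))\<^sup>2 + (wb (fst p))\<^sup>2) / 2 + wa (fst p) * wb (fst p))"
    "2 * (shape_b (fst p))\<^sup>2 = v\<^sup>2 * n\<^sup>2 * (((wa (fst p))\<^sup>2 + (wb (fst p))\<^sup>2) / 2 - wa (fst p) * wb (fst p))"
    by (simp_all add: shape_a_def shape_b_def n_def v_def power2_eq_square field_simps)
  have nn: "v\<^sup>2 * n\<^sup>2 * W * x / n = v\<^sup>2 * (W * (n * x))" for W x
    using n by (simp add: power2_eq_square)
  have "comp p (simons u X p) = Complex (2 * (shape_a (fst p))\<^sup>2 * x / n) (2 * (shape_b (fst p))\<^sup>2 * y / n)"
    unfolding simons_u comp_linear comp_frame n_def[symmetric] x_def[symmetric] y_def[symmetric]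
    by (simp add: complex_eq_iff)
  then show ?thesis unfolding ab nn c v_def[symmetric]
    by (simp add: complex_eq_iff algebra_simps)
qed

lemma simons_normal: "npart p (simons u X p) = simons u X p"
proof -
  have "npart p (N1 p) = N1 p" "npart p (N2 p) = N2 p"
    using E_pos[of "fst p"] by (simp_all add: npart_def frame_inner nrm_sq_E inner_commute[of "N2 p" "N1 p"])
  then show ?thesis unfolding simons_u npart_linear by simp
qed

text \<open>The orthonormal frame is parallel in direction t and rotates with speed
  \<open>conn\<close> in direction \<theta>, so the covariant derivative is the plain one,
  respectively the plain one plus \<i> * conn times the field.\<close>

lemma has_derivative_comp_field:
  assumes X: "normal_field X" and d: "\<And>p. X differentiable (at p)"
  shows "((\<lambda>t. comp (t, \<theta>) (X (t, \<theta>))) has_vector_derivative comp (t, \<theta>) (dd X (1, 0) (t, \<theta>))) (at t)"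
    "((\<lambda>\<theta>. comp (t, \<theta>) (X (t, \<theta>))) has_vector_derivative
       comp (t, \<theta>) (dd X (0, 1) (t, \<theta>)) - \<i> * of_real (conn t) * comp (t, \<theta>) (X (t, \<theta>))) (at \<theta>)"
proof -
  define p where "p = (t, \<theta>)"
  have Xn: "X p = (nrm t)\<^sup>2 *\<^sub>R ((X p \<bullet> N1 p) *\<^sub>R N1 p + (X p \<bullet> N2 p) *\<^sub>R N2 p)"
    using X[unfolded normal_field_def, rule_format, of p] by (simp add: npart_def p_def)
  have E: "(nrm t)\<^sup>2 * E t = 1" using nrm_nrm_E[of t] by (simp add: power2_eq_square)
  \<comment> \<open>Since X is normal, its products with the derivatives of the frame are determined
    by the normal components of those derivatives.\<close>
  have i: "X p \<bullet> N1t p = rate t * (X p \<bullet> N1 p)" "X p \<bullet> N2t p = rate t * (X p \<bullet> N2 p)"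
     "X p \<bullet> N1s p = conn t * (X p \<bullet> N2 p)" "X p \<bullet> N2s p = - conn t * (X p \<bullet> N1 p)"
  proof -
    have fp: "fst p = t" by (simp add: p_def)
    note fi = frame_deriv_inner[of p, unfolded fp] frame_deriv_inner[of p, unfolded fp, THEN trans[OF inner_commute]]
    have g: "X p \<bullet> w = (nrm t)\<^sup>2 * ((X p \<bullet> N1 p) * (N1 p \<bullet> w) + (X p \<bullet> N2 p) * (N2 p \<bullet> w))" for w
      by (subst Xn) (simp add: inner_add_left)
    have "a * (nrm t)\<^sup>2 * (b * E t) = a * b" for a b using E by (metis mult.assoc mult.commute mult.right_neutral)
    note h = this
    have h2: "(nrm t)\<^sup>2 * (a * (b * E t)) = b * a" for a b using h[of a b] by (simp add: mult_ac)
    show "X p \<bullet> N1t p = rate t * (X p \<bullet> N1 p)" "X p \<bullet> N2t p = rate t * (X p \<bullet> N2 p)"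
     "X p \<bullet> N1s p = conn t * (X p \<bullet> N2 p)" "X p \<bullet> N2s p = - conn t * (X p \<bullet> N1 p)"
      by (subst g, simp only: fi mult_zero_right add_0_left add_0_right h2)+
  qed
  have D: "((\<lambda>q. nrm (fst q) * (X q \<bullet> N q)) has_derivative
      (\<lambda>v. nrm t * (X p \<bullet> (fst v *\<^sub>R Nt + snd v *\<^sub>R Ns) + dd X v p \<bullet> N p) + (- rate t * nrm t * fst v) * (X p \<bullet> N p))) (at p)"
    if "(N has_derivative (\<lambda>v. fst v *\<^sub>R Nt + snd v *\<^sub>R Ns)) (at p)" for N Nt Ns
    using has_derivative_mult[OF has_derivative_nrm has_derivative_inner[OF has_derivative_dd[OF d] that]]
    by (simp add: p_def)
  note D12 = D[OF has_derivative_frame(3)] D[OF has_derivative_frame(4)]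
  have sl: "((\<lambda>t. f (t, \<theta>)) has_real_derivative f' (1, 0)) (at t)" "((\<lambda>\<theta>. f (t, \<theta>)) has_real_derivative f' (0, 1)) (at \<theta>)"
    if f: "(f has_derivative f') (at p)" for f :: "plane \<Rightarrow> real" and f'
  proof -
    have lin: "f' (a *\<^sub>R v) = a * f' v" for a v
      using linear_scale[OF bounded_linear.linear[OF has_derivative_bounded_linear[OF f]]] by simp
    have 1: "((\<lambda>t. (t, \<theta>)) has_derivative (\<lambda>h. (h, 0))) (at t)" "((\<lambda>\<theta>. (t, \<theta>)) has_derivative (\<lambda>h. (0, h))) (at \<theta>)"
      by (rule has_derivative_Pair[OF has_derivative_ident has_derivative_const] has_derivative_Pair[OF has_derivative_const has_derivative_ident])+
    have "f' (h, 0) = f' (1, 0) * h" "f' (0, h) = f' (0, 1) * h" for h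
      using lin[of h "(1, 0)"] lin[of h "(0, 1)"] by (simp_all add: mult.commute)
    note e = ext[OF this(1)] ext[OF this(2)]
    show "((\<lambda>t. f (t, \<theta>)) has_real_derivative f' (1, 0)) (at t)" "((\<lambda>\<theta>. f (t, \<theta>)) has_real_derivative f' (0, 1)) (at \<theta>)"
      using has_derivative_compose[OF 1(1) f[unfolded p_def]] has_derivative_compose[OF 1(2) f[unfolded p_def]]
      unfolding e has_field_derivative_def .
  qed
  have C: "((\<lambda>x. Complex (f x) (g x)) has_vector_derivative Complex f' g') (at x)"
    if "(f has_real_derivative f') (at x)" "(g has_real_derivative g') (at x)" for f g f' g' and x :: real
    unfolding Complex_eq
    by (intro has_vector_derivative_add has_vector_derivative_mult_right has_vector_derivative_of_real)
       (use that in \<open>auto simp: has_real_derivative_iff_has_vector_derivative\<close>)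
  show "((\<lambda>t. comp (t, \<theta>) (X (t, \<theta>))) has_vector_derivative comp (t, \<theta>) (dd X (1, 0) (t, \<theta>))) (at t)"
    using C[OF sl(1)[OF D12(1)] sl(1)[OF D12(2)]]
    by (simp add: comp_def i flip: p_def) (simp add: p_def algebra_simps)
  show "((\<lambda>\<theta>. comp (t, \<theta>) (X (t, \<theta>))) has_vector_derivative
       comp (t, \<theta>) (dd X (0, 1) (t, \<theta>)) - \<i> * of_real (conn t) * comp (t, \<theta>) (X (t, \<theta>))) (at \<theta>)"
    using C[OF sl(2)[OF D12(1)] sl(2)[OF D12(2)]]
    by (simp add: comp_def i flip: p_def) (simp add: p_def complex_eq_iff Complex_eq algebra_simps)
qed

end

section \<open>The second variation and the Jacobi operator in coordinates\<close>

lemma smooth_cosh: "smooth (cosh :: real \<Rightarrow> real)" and smooth_sinh: "smooth (sinh :: real \<Rightarrow> real)"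
proof -
  note id = smooth_linear[OF bounded_linear_ident]
  have a: "smooth (\<lambda>x::real. exp x + exp (- x))"
    by (rule smooth_add[OF smooth_exp smooth_compose[OF smooth_exp smooth_minus[OF id]]])
  have b: "smooth (\<lambda>x::real. exp x + - exp (- x))"
    by (rule smooth_add[OF smooth_exp smooth_minus[OF smooth_compose[OF smooth_exp smooth_minus[OF id]]]])
  have "smooth (\<lambda>x::real. (1/2) *\<^sub>R (exp x + exp (- x)))" "smooth (\<lambda>x::real. (1/2) *\<^sub>R (exp x + - exp (- x)))"
    by (rule smooth_scaleR[OF smooth_const a] smooth_scaleR[OF smooth_const b])+
  moreover have "(\<lambda>x::real. (1/2) *\<^sub>R (exp x + exp (- x))) = cosh" "(\<lambda>x::real. (1/2) *\<^sub>R (exp x + - exp (- x))) = sinh"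
    by (auto simp: cosh_def sinh_def)
  ultimately show "smooth (cosh :: real \<Rightarrow> real)" "smooth (sinh :: real \<Rightarrow> real)" by simp_all
qed

lemma smooth_differentiable: "smooth F \<Longrightarrow> F differentiable (at p)"
  using smoothD[of F "Suc 0"] by simp

lemma smooth_of_coordinate:
  assumes "smooth (g :: real \<Rightarrow> real)"
  shows "smooth (\<lambda>p :: plane. g (c * fst p))" "smooth (\<lambda>p :: plane. g (c * snd p))"
  using smooth_compose[OF assms smooth_mult[OF smooth_const smooth_fst]]
    smooth_compose[OF assms smooth_mult[OF smooth_const smooth_snd]] by auto

text \<open>The half-open fundamental domain and the compact box differ by a segment of measure zero
  and by a region where f vanishes; on the box Fubini holds for continuous functions.\<close>

lemma set_integral_strip:
  fixes f :: "plane \<Rightarrow> real"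
  assumes f: "continuous_on UNIV f" and L: "0 \<le> L" and supp: "\<And>p. L \<le> \<bar>fst p\<bar> \<Longrightarrow> f p = 0" and c: "0 \<le> c"
  shows "(LINT p:UNIV \<times> {0..<c}|lborel. f p) = integral {-L..L} (\<lambda>t. integral {0..c} (\<lambda>\<theta>. f (t, \<theta>)))"
proof -
  let ?S = "UNIV \<times> {0..<c} :: plane set" and ?K = "cbox (- L, 0) (L, c) :: plane set"
  have S: "?S \<in> sets lborel"
  proof -
    have "?S = snd -` {0..<c} \<inter> space lborel" by auto
    also have "\<dots> \<in> sets lborel" by (rule measurable_sets[of _ _ borel]) (auto intro!: borel_measurable_continuous_onI continuous_intros)
    finally show ?thesis .
  qed
  have "integrable lborel (\<lambda>p. indicator ?K p *\<^sub>R f p)"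
    by (rule borel_integrable_compact) (auto intro: continuous_on_subset[OF f])
  from integrable_mult_indicator[OF S this]
  have "integrable lborel (\<lambda>p. indicator ?S p *\<^sub>R (indicator ?K p *\<^sub>R f p))" .
  moreover have "(\<lambda>p. indicator ?S p *\<^sub>R (indicator ?K p *\<^sub>R f p)) = (\<lambda>p. indicator ?S p *\<^sub>R f p)"
  proof
    fix p show "indicator ?S p *\<^sub>R (indicator ?K p *\<^sub>R f p) = indicator ?S p *\<^sub>R f p"
    proof (cases "L \<le> \<bar>fst p\<bar>")
      case False
      then show ?thesis by (cases p) (auto simp: indicator_def cbox_Pair_eq)
    qed (simp add: supp)
  qed
  ultimately have int: "set_integrable lborel ?S f" by (simp add: set_integrable_def)
  have "(LINT p:?S|lborel. f p) = integral ?S f"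
    by (rule set_borel_integral_eq_integral[OF int])
  also have "\<dots> = integral ?K f"
  proof (rule integral_spike_set)
    have "f (t, \<theta>) = 0" if "\<not> (- L \<le> t \<and> t \<le> L)" for t \<theta>
      using supp[of "(t, \<theta>)"] that by auto
    then have "{p \<in> ?S - ?K. f p \<noteq> 0} = {}" by (auto simp: cbox_Pair_eq)
    then show "negligible {p \<in> ?S - ?K. f p \<noteq> 0}" by (simp only: negligible_empty)
    have "{p \<in> ?K - ?S. f p \<noteq> 0} \<subseteq> {p. p \<bullet> (0, 1) = c}" by (auto simp: cbox_Pair_eq)
    moreover have "negligible {p :: plane. p \<bullet> (0, 1) = c}"
      by (rule negligible_standard_hyperplane) (simp add: Basis_prod_def)
    ultimately show "negligible {p \<in> ?K - ?S. f p \<noteq> 0}" by (rule negligible_subset[rotated])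
  qed
  also have "\<dots> = integral (cbox (- L) L) (\<lambda>t. integral (cbox 0 c) (\<lambda>\<theta>. f (t, \<theta>)))"
    by (rule integral_prod_continuous) (auto intro: continuous_on_subset[OF f])
  finally show ?thesis by simp
qed

context fraser_sargent begin

lemma smooth_N1: "smooth N1" and smooth_N2: "smooth N2"
proof -
  note t = smooth_of_coordinate(1)[OF smooth_cosh] smooth_of_coordinate(1)[OF smooth_sinh]
    smooth_minus[OF smooth_of_coordinate(1)[OF smooth_cosh]] smooth_minus[OF smooth_of_coordinate(1)[OF smooth_sinh]]
  note s = smooth_of_coordinate(2)[OF smooth_sin] smooth_of_coordinate(2)[OF smooth_cos]
  show "smooth N1" "smooth N2"
    unfolding N1_def[abs_def] N2_def[abs_def]
    by (rule smooth_vec4; rule smooth_mult; rule t s)+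
qed

text \<open>The normal projection contains only the square of \<open>nrm\<close>, a reciprocal of a
  product of hyperbolic cosines.\<close>

lemma smooth_nrm_sq: "smooth (\<lambda>p :: plane. (nrm (fst p))\<^sup>2)"
proof -
  have "smooth (\<lambda>p :: plane. cosh ((real k + real l) * fst p) * cosh ((real k - real l) * fst p))"
    by (rule smooth_mult; rule smooth_of_coordinate(1)[OF smooth_cosh])
  from smooth_inverse[OF this] show ?thesis by (simp add: nrm_sq inverse_eq_divide)
qed

lemma smooth_npart: "smooth X \<Longrightarrow> smooth (\<lambda>p. npart p (X p))"
  unfolding npart_def
  by (rule smooth_scaleR[OF smooth_nrm_sq smooth_add]; rule smooth_scaleR[OF smooth_inner]; (assumption | rule smooth_N1 smooth_N2))

lemma normal_conn_u:
  assumes "X differentiable (at p)"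
  shows "normal_conn u (frame u 1) X p = \<nu> (fst p) *\<^sub>R npart p (dd X (1, 0) p)"
    "normal_conn u (frame u 2) X p = \<nu> (fst p) *\<^sub>R npart p (dd X (0, 1) p)"
  unfolding normal_conn_def normal_part_u frame_u
  using dd_scale[OF assms, of "\<nu> (fst p)" "(1, 0)"] dd_scale[OF assms, of "\<nu> (fst p)" "(0, 1)"]
  by (simp_all add: npart_linear)

definition fieldZ :: "(plane \<Rightarrow> real ^ 4) \<Rightarrow> real \<Rightarrow> real \<Rightarrow> complex" where
  "fieldZ X t \<theta> = comp (t, \<theta>) (X (t, \<theta>))"
definition fieldZt :: "(plane \<Rightarrow> real ^ 4) \<Rightarrow> real \<Rightarrow> real \<Rightarrow> complex" where
  "fieldZt X t \<theta> = comp (t, \<theta>) (dd X (1, 0) (t, \<theta>))"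
text \<open>The plain \<theta>-derivative of the coordinate: the covariant derivative with the
  connection term removed.\<close>

definition fieldZs :: "(plane \<Rightarrow> real ^ 4) \<Rightarrow> real \<Rightarrow> real \<Rightarrow> complex" where
  "fieldZs X t \<theta> = comp (t, \<theta>) (dd X (0, 1) (t, \<theta>)) - \<i> * of_real (conn t) * fieldZ X t \<theta>"

lemma continuous_comp: "continuous_on UNIV X \<Longrightarrow> continuous_on UNIV (\<lambda>(t, \<theta>). comp (t, \<theta>) (X (t, \<theta>)))"
  unfolding comp_def Complex_eq case_prod_unfold prod.collapse
  by (intro continuous_intros smooth_continuous[OF smooth_N1] smooth_continuous[OF smooth_N2])

lemma frame_periodic:
  "N1 (t, \<theta> + 2 * pi) = N1 (t, \<theta>)" "N2 (t, \<theta> + 2 * pi) = N2 (t, \<theta>)"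
proof -
  have "sin (real m * (\<theta> + 2 * pi)) = sin (real m * \<theta>)" "cos (real m * (\<theta> + 2 * pi)) = cos (real m * \<theta>)" for m
    using sin_int_2pin[of "int m"] cos_int_2pin[of "int m"]
    by (simp_all add: distrib_left sin_add cos_add mult.commute mult.left_commute)
  then show "N1 (t, \<theta> + 2 * pi) = N1 (t, \<theta>)" "N2 (t, \<theta> + 2 * pi) = N2 (t, \<theta>)"
    by (simp_all add: N1_def N2_def)
qed

lemma fieldZ_periodic:
  assumes "\<And>t \<theta>. X (t, \<theta> + 2 * pi) = X (t, \<theta>)"
  shows "fieldZ X t (\<theta> + 2 * pi) = fieldZ X t \<theta>"
  by (simp add: fieldZ_def comp_def frame_periodic assms)

lemma C1_field_fieldZ:
  assumes X: "smooth X" "normal_field X" and per: "\<And>t \<theta>. X (t, \<theta> + 2 * pi) = X (t, \<theta>)"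
  shows "C1_field (fieldZ X) (fieldZt X) (fieldZs X)"
proof -
  have d: "X differentiable (at p)" for p by (rule smooth_differentiable[OF X(1)])
  have "continuous_on UNIV (\<lambda>(t :: real, \<theta> :: real). \<i> * complex_of_real (conn t) * fieldZ X t \<theta>)"
    unfolding case_prod_unfold
    using continuous_comp[OF smooth_continuous[OF X(1)]]
    by (intro continuous_intros) (auto simp: fieldZ_def case_prod_unfold)
  from continuous_on_diff[OF continuous_comp[OF smooth_continuous[OF smooth_dd[OF X(1), of "(0, 1)"]]] this]
  have "continuous_on UNIV (\<lambda>(t, \<theta>). fieldZs X t \<theta>)"
    by (simp add: fieldZs_def case_prod_unfold)
  then show ?thesis
    unfolding C1_field_def fieldZs_def fieldZt_def
    using has_derivative_comp_field[OF X(2) d] continuous_comp[OF smooth_continuous[OF X(1)]]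
      continuous_comp[OF smooth_continuous[OF smooth_dd[OF X(1), of "(1, 0)"]]] fieldZ_periodic[OF per, of _ 0]
    by (simp add: fieldZ_def[abs_def])
qed

text \<open>Conformal invariance in dimension two: the gradient and the Simons term both carry the
  square of \<nu>, which cancels against the area density.\<close>

lemma second_variation_integrand:
  assumes X: "smooth X"
  shows "((\<Sum>i\<in>{1,2}. (norm (normal_conn u (frame u i) X (t, \<theta>)))\<^sup>2) - simons u X (t, \<theta>) \<bullet> X (t, \<theta>)) * area_density u (t, \<theta>)
     = jacobi_density t (fieldZ X t \<theta>) (fieldZt X t \<theta>) (fieldZs X t \<theta>)"
proof -
  have d: "X differentiable (at p)" for p by (rule smooth_differentiable[OF X])
  define z a b v where "z = fieldZ X t \<theta>" and "a = ((wa t)\<^sup>2 + (wb t)\<^sup>2) / 2" and "b = wa t * wb t" and "v = \<nu> t"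
  have v: "v > 0" by (simp add: v_def)
  have "simons u X (t, \<theta>) \<bullet> X (t, \<theta>) = Re (comp (t, \<theta>) (simons u X (t, \<theta>)) * cnj (comp (t, \<theta>) (X (t, \<theta>))))"
    using npart_inner[of "(t, \<theta>)" "simons u X (t, \<theta>)"] by (simp add: simons_normal)
  also have "\<dots> = v\<^sup>2 * (a * (cmod z)\<^sup>2 + b * Re (z\<^sup>2))"
    unfolding comp_simons fst_conv fieldZ_def[symmetric] z_def[symmetric] a_def[symmetric] b_def[symmetric] v_def[symmetric] cmod_power2
    by (simp add: power2_eq_square algebra_simps)
  finally have s: "simons u X (t, \<theta>) \<bullet> X (t, \<theta>) = v\<^sup>2 * (a * (cmod z)\<^sup>2 + b * Re (z\<^sup>2))" .
  have n: "(norm (normal_conn u (frame u 1) X (t, \<theta>)))\<^sup>2 = v\<^sup>2 * (cmod (fieldZt X t \<theta>))\<^sup>2"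
    "(norm (normal_conn u (frame u 2) X (t, \<theta>)))\<^sup>2 = v\<^sup>2 * (cmod (fieldZs X t \<theta> + \<i> * of_real (conn t) * z))\<^sup>2"
    unfolding normal_conn_u[OF d] norm_scaleR power_mult_distrib norm_npart
    by (simp_all add: v_def fieldZt_def fieldZs_def z_def)
  have "(\<Sum>i\<in>{1,2}. (norm (normal_conn u (frame u i) X (t, \<theta>)))\<^sup>2)
     = v\<^sup>2 * ((cmod (fieldZt X t \<theta>))\<^sup>2 + (cmod (fieldZs X t \<theta> + \<i> * of_real (conn t) * z))\<^sup>2)"
    using n by (simp add: distrib_left)
  then show ?thesis
    unfolding s area_density_u jacobi_density_def using v
    by (simp add: z_def[symmetric] a_def[symmetric] b_def[symmetric] v_def[symmetric] field_simps)
qed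

lemma comp_normal_conn_conn:
  assumes Y: "smooth Y"
  shows "comp p (normal_conn u (frame u 1) (\<lambda>p. \<nu> (fst p) *\<^sub>R Y p) p) =
      of_real ((\<nu> (fst p))\<^sup>2) * (comp p (dd Y (1, 0) p) - of_real (rate (fst p)) * comp p (Y p))"
    "comp p (normal_conn u (frame u 2) (\<lambda>p. \<nu> (fst p) *\<^sub>R Y p) p) = of_real ((\<nu> (fst p))\<^sup>2) * comp p (dd Y (0, 1) p)"
proof -
  have dY: "(Y has_derivative (\<lambda>v. dd Y v p)) (at p)" by (rule smooth_has_derivative[OF Y])
  have dn: "((\<lambda>p :: plane. \<nu> (fst p)) has_derivative (\<lambda>v. - rate (fst p) * \<nu> (fst p) * fst v)) (at p)"
    using has_derivative_divide'[OF has_derivative_nrm has_derivative_const, of cc p] cc_pos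
    unfolding \<nu>_def by (simp add: field_simps power2_eq_square)
  note D = has_derivative_scaleR[OF dn dY]
  have diff: "(\<lambda>p. \<nu> (fst p) *\<^sub>R Y p) differentiable (at p)" using D by (auto simp: differentiable_def)
  show "comp p (normal_conn u (frame u 1) (\<lambda>p. \<nu> (fst p) *\<^sub>R Y p) p) =
      of_real ((\<nu> (fst p))\<^sup>2) * (comp p (dd Y (1, 0) p) - of_real (rate (fst p)) * comp p (Y p))"
    "comp p (normal_conn u (frame u 2) (\<lambda>p. \<nu> (fst p) *\<^sub>R Y p) p) = of_real ((\<nu> (fst p))\<^sup>2) * comp p (dd Y (0, 1) p)"
    unfolding normal_conn_u[OF diff] dd_eq[OF D] comp_linear comp_npart
    by (simp_all add: power2_eq_square algebra_simps)
qed

lemma levi_civita_u: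
  "levi_civita u (frame u 1) (frame u 1) p = 0"
  "levi_civita u (frame u 2) (frame u 2) p = (- ((\<nu> (fst p))\<^sup>2 * rate (fst p))) *\<^sub>R (1, 0)"
proof -
  have nE: "nrm (fst p) * (nrm (fst p) * E (fst p)) = 1" using nrm_nrm_E[of "fst p"] by (simp add: mult.assoc)
  have t: "tangential_part u p w = (nrm (fst p) * (w \<bullet> T1 p)) *\<^sub>R (\<nu> (fst p), 0) + (nrm (fst p) * (w \<bullet> T2 p)) *\<^sub>R (0, \<nu> (fst p))" for w
    unfolding tangential_part_def by (simp add: push_frame_u push_frame_u(1)[simplified] frame_u)
  note fi = frame_deriv_inner(1-4)[of p] frame_inner[of p] inner_commute[of "T2 p" "T1 p"]
  show "levi_civita u (frame u 1) (frame u 1) p = 0"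
    unfolding levi_civita_def t push_frame_u_fun dd_nrm_T frame_u
    by (simp add: inner_add_left inner_diff_left fi algebra_simps zero_prod_def)
  have c: "\<nu> (fst p) * (nrm (fst p) * (rate (fst p) * E (fst p))) * nrm (fst p) = \<nu> (fst p) * rate (fst p)"
  proof -
    have "\<nu> (fst p) * (nrm (fst p) * (rate (fst p) * E (fst p))) * nrm (fst p)
      = \<nu> (fst p) * rate (fst p) * (nrm (fst p) * (nrm (fst p) * E (fst p)))" by (simp add: mult_ac)
    then show ?thesis by (simp only: nE mult_1_right)
  qed
  show "levi_civita u (frame u 2) (frame u 2) p = (- ((\<nu> (fst p))\<^sup>2 * rate (fst p))) *\<^sub>R (1, 0)"
    unfolding levi_civita_def t push_frame_u_fun dd_nrm_T frame_u
    using c by (simp add: inner_add_left inner_diff_left fi power2_eq_square mult_ac)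
qed

text \<open>The first-order terms cancel. Differentiating the factor \<nu> of the first frame vector
  produces - rate, and the Levi-Civita derivative of the second frame vector along itself gives the
  same term with the opposite sign.\<close>

lemma comp_jacobi_op:
  assumes X: "smooth X"
  defines "Y1 \<equiv> \<lambda>p. npart p (dd X (1, 0) p)" and "Y2 \<equiv> \<lambda>p. npart p (dd X (0, 1) p)"
  shows "comp p (jacobi_op u X p) = of_real ((\<nu> (fst p))\<^sup>2) *
     (comp p (dd Y1 (1, 0) p) + comp p (dd Y2 (0, 1) p)
      + of_real (((wa (fst p))\<^sup>2 + (wb (fst p))\<^sup>2) / 2) * comp p (X p) + of_real (wa (fst p) * wb (fst p)) * cnj (comp p (X p)))"
    and "npart p (jacobi_op u X p) = jacobi_op u X p"
proof -
  have d: "X differentiable (at p)" for p by (rule smooth_differentiable[OF X(1)])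
  have s: "smooth Y1" "smooth Y2" unfolding Y1_def Y2_def by (intro smooth_npart smooth_dd X)+
  have c: "normal_conn u (frame u 1) X = (\<lambda>p. \<nu> (fst p) *\<^sub>R Y1 p)" "normal_conn u (frame u 2) X = (\<lambda>p. \<nu> (fst p) *\<^sub>R Y2 p)"
    by (auto simp: fun_eq_iff normal_conn_u[OF d] normal_conn_u(1)[OF d, simplified] Y1_def Y2_def)
  have lc: "normal_conn u (levi_civita u (frame u 1) (frame u 1)) X p = 0"
    "normal_conn u (levi_civita u (frame u 2) (frame u 2)) X p = (- ((\<nu> (fst p))\<^sup>2 * rate (fst p))) *\<^sub>R Y1 p"
    unfolding normal_conn_def normal_part_u levi_civita_u dd_scale[OF d] npart_linear Y1_def
    using dd_scale[OF d, of 0 "(0, 0)" p] by (simp_all add: npart_linear zero_prod_def)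
  have nl: "normal_laplacian u X p = normal_conn u (frame u 1) (normal_conn u (frame u 1) X) p - normal_conn u (levi_civita u (frame u 1) (frame u 1)) X p
     + (normal_conn u (frame u 2) (normal_conn u (frame u 2) X) p - normal_conn u (levi_civita u (frame u 2) (frame u 2)) X p)"
    unfolding normal_laplacian_def by simp
  show "comp p (jacobi_op u X p) = of_real ((\<nu> (fst p))\<^sup>2) *
     (comp p (dd Y1 (1, 0) p) + comp p (dd Y2 (0, 1) p)
      + of_real (((wa (fst p))\<^sup>2 + (wb (fst p))\<^sup>2) / 2) * comp p (X p) + of_real (wa (fst p) * wb (fst p)) * cnj (comp p (X p)))"
    unfolding jacobi_op_def nl lc comp_linear comp_simons c comp_normal_conn_conn[OF s(1)] comp_normal_conn_conn[OF s(2)]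
    by (simp add: algebra_simps)
  have "npart p (normal_conn u V W p) = normal_conn u V W p" for V W
    by (simp add: normal_conn_def normal_part_u npart_npart)
  then show "npart p (jacobi_op u X p) = jacobi_op u X p"
    unfolding jacobi_op_def nl npart_linear simons_normal by simp
qed

end

section \<open>Counting dimensions\<close>

lemma vdim_le_card:
  assumes "finite B" "V \<subseteq> span B"
  shows "vdim V \<le> enat (card B)"
  using assms dim_le_card[OF assms(2,1)] by (auto simp: vdim_def)

text \<open>The kernel of one functional has codimension at most one, so induction on their number
  applies. Linearity is asked for on V only, as Fourier coefficients are additive on continuous
  fields.\<close>

lemma span_of_functionals:
  fixes f :: "nat \<Rightarrow> 'a::real_vector \<Rightarrow> real"
  assumes "subspace V"
    and add: "\<And>i x y. x \<in> V \<Longrightarrow> y \<in> V \<Longrightarrow> f i (x + y) = f i x + f i y"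
    and scale: "\<And>i x c. x \<in> V \<Longrightarrow> f i (c *\<^sub>R x) = c * f i x"
    and inj: "\<And>x. x \<in> V \<Longrightarrow> (\<forall>i<N. f i x = 0) \<Longrightarrow> x = 0"
  shows "\<exists>B. finite B \<and> card B \<le> N \<and> V \<subseteq> span B"
  using assms
proof (induction N arbitrary: V)
  case 0
  then have "V \<subseteq> span {}" by auto
  then show ?case by (intro exI[of _ "{}"]) simp
next
  case (Suc N)
  define W where "W = {x \<in> V. f N x = 0}"
  have z: "f i 0 = 0" for i using Suc.prems(3)[of 0 i 0] subspace_0[OF Suc.prems(1)] by simp
  have "subspace W"
    unfolding subspace_def W_def
    using Suc.prems(1-3) z by (auto simp: subspace_0 subspace_add subspace_scale)
  then obtain B where B: "finite B" "card B \<le> N" "W \<subseteq> span B"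
    using Suc.IH[of W] Suc.prems(2-4) unfolding W_def by (auto simp: less_Suc_eq)
  show ?case
  proof (cases "W = V")
    case True
    then show ?thesis using B by (intro exI[of _ B]) auto
  next
    case False
    then obtain x0 where x0: "x0 \<in> V" "f N x0 \<noteq> 0" by (auto simp: W_def)
    have "x \<in> span (insert x0 B)" if x: "x \<in> V" for x
    proof -
      define r where "r = f N x / f N x0"
      have m: "(- r) *\<^sub>R x0 \<in> V" by (intro subspace_scale Suc.prems x0)
      have "x + (- r) *\<^sub>R x0 \<in> W"
        unfolding W_def using x x0 m Suc.prems(2)[OF x m] Suc.prems(3)[OF x0(1), of N "- r"]
        by (simp add: r_def subspace_add[OF Suc.prems(1)] subspace_diff[OF Suc.prems(1)] subspace_scale[OF Suc.prems(1)])
      then have "x + (- r) *\<^sub>R x0 \<in> span (insert x0 B)" using B(3) span_mono[of B "insert x0 B"] by blast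
      moreover have "r *\<^sub>R x0 \<in> span (insert x0 B)" by (intro span_scale span_base) simp
      ultimately have "x + (- r) *\<^sub>R x0 + r *\<^sub>R x0 \<in> span (insert x0 B)" by (rule span_add)
      then show ?thesis by simp
    qed
    then show ?thesis using B by (intro exI[of _ "insert x0 B"]) (auto simp: card_insert_if)
  qed
qed

text \<open>A copy of the real vectors with index set A inside one fixed type, so that spaces of
  test fields of different dimensions are images under the same linear map.\<close>

definition coords :: "int set \<Rightarrow> (int \<Rightarrow> real) set" where
  "coords A = {c. \<forall>a. a \<notin> A \<longrightarrow> c a = 0}"

definition unit_coord :: "int \<Rightarrow> int \<Rightarrow> real" where
  "unit_coord a b = (if b = a then 1 else 0)"

lemma coords_decomp:
  assumes "finite A" "c \<in> coords A"
  shows "c = (\<Sum>a\<in>A. c a *\<^sub>R unit_coord a)"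
proof
  fix b
  have "(\<Sum>a\<in>A. c a *\<^sub>R unit_coord a) b = (\<Sum>a\<in>A. c a * unit_coord a b)"
    using assms(1) by (induction A) (auto simp: plus_fun_def zero_fun_def)
  also have "\<dots> = (\<Sum>a\<in>A. if a = b then c b else 0)"
    by (intro sum.cong) (auto simp: unit_coord_def)
  also have "\<dots> = c b" using assms by (auto simp: coords_def)
  finally show "c b = (\<Sum>a\<in>A. c a *\<^sub>R unit_coord a) b" by simp
qed

lemma subspace_coords: "subspace (coords A)"
  by (auto simp: subspace_def coords_def plus_fun_def zero_fun_def)

lemma coords_basis:
  fixes T :: "(int \<Rightarrow> real) \<Rightarrow> 'a::real_vector"
  assumes A: "finite A" and T: "linear T" and inj: "\<And>c. c \<in> coords A \<Longrightarrow> T c = 0 \<Longrightarrow> c = 0"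
  defines "D \<equiv> (\<lambda>a. T (unit_coord a)) ` A"
  shows "finite D" "card D = card A" "independent D" "T ` coords A = span D"
proof -
  let ?b = "\<lambda>a. T (unit_coord a)"
  have u: "unit_coord a \<in> coords A" if "a \<in> A" for a using that by (auto simp: coords_def unit_coord_def)
  have comb: "T c = (\<Sum>a\<in>A. c a *\<^sub>R ?b a)" if "c \<in> coords A" for c
    by (subst coords_decomp[OF A that]) (simp add: linear_sum[OF T] linear_scale[OF T])
  have injb: "inj_on ?b A"
  proof (rule inj_onI)
    fix a a' assume a: "a \<in> A" "a' \<in> A" "?b a = ?b a'"
    then have "unit_coord a - unit_coord a' = 0"
      by (intro inj subspace_diff[OF subspace_coords] u) (auto simp: linear_diff[OF T])
    then have "unit_coord a a = unit_coord a' a" by (metis eq_iff_diff_eq_0)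
    then show "a = a'" by (auto simp: unit_coord_def split: if_splits)
  qed
  show fin: "finite D" unfolding D_def using A by simp
  show "card D = card A" unfolding D_def by (rule card_image[OF injb])
  show "independent D"
  proof (rule independent_if_scalars_zero[OF fin])
    fix f x assume s: "(\<Sum>x\<in>D. f x *\<^sub>R x) = 0" and x: "x \<in> D"
    define c where "c a = (if a \<in> A then f (?b a) else 0)" for a
    have c: "c \<in> coords A" by (auto simp: coords_def c_def)
    have "(\<Sum>x\<in>D. f x *\<^sub>R x) = (\<Sum>a\<in>A. c a *\<^sub>R ?b a)"
      unfolding D_def sum.reindex[OF injb] by (intro sum.cong) (auto simp: c_def)
    then have "T c = 0" using s comb[OF c] by simp
    then have "c = 0" by (rule inj[OF c])
    moreover obtain a where "a \<in> A" "x = ?b a" using x by (auto simp: D_def)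
    ultimately show "f x = 0" by (metis c_def zero_fun_def)
  qed
  show "T ` coords A = span D"
  proof
    show "T ` coords A \<subseteq> span D"
    proof clarify
      fix c assume "c \<in> coords A"
      then show "T c \<in> span D"
        by (subst comb) (auto intro!: span_sum span_scale intro: span_base simp: D_def)
    qed
    have "subspace (T ` coords A)" by (rule linear_subspace_image[OF T subspace_coords])
    then show "span D \<subseteq> T ` coords A" by (intro span_minimal) (auto simp: D_def intro: u)
  qed
qed

lemma vdim_image_coords:
  fixes T :: "(int \<Rightarrow> real) \<Rightarrow> 'a::real_vector"
  assumes "finite A" "linear T" "\<And>c. c \<in> coords A \<Longrightarrow> T c = 0 \<Longrightarrow> c = 0"
  shows "vdim (T ` coords A) = enat (card A)"
proof -
  let ?D = "(\<lambda>a. T (unit_coord a)) ` A"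
  have b: "finite ?D" "card ?D = card A" "independent ?D" "T ` coords A = span ?D"
    by (rule coords_basis[where T = T and A = A]; use assms in blast)+
  have "dim (T ` coords A) = card A"
    unfolding b(4) by (simp only: dim_span_eq_card_independent[OF b(3)] b(2))
  moreover have "T ` coords A \<subseteq> span ?D" unfolding b(4) ..
  ultimately have "\<exists>B. finite B \<and> T ` coords A \<subseteq> span B" using b(1) by blast
  then show ?thesis unfolding vdim_def by (simp only: if_True \<open>dim (T ` coords A) = card A\<close>)
qed

text \<open>A basis of V together with D stays independent because the two spans meet only in 0, and
  it lies in the span of B; so D takes its share of the card B places.\<close>

lemma vdim_complement_le:
  fixes V :: "'a::real_vector set"
  assumes V: "subspace V" and D: "finite D" "independent D" and int: "V \<inter> span D \<subseteq> {0}"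
    and B: "finite B" "V \<subseteq> span B" "D \<subseteq> span B"
  shows "vdim V \<le> enat (card B - card D)"
proof -
  obtain C where C: "C \<subseteq> V" "independent C" "V \<subseteq> span C" 
    by (rule basis_exists[of V])
  have sC: "span C = V" using C V by (simp add: span_subspace)
  have "independent (C \<union> D)"
    using D int
  proof (induction D)
    case (insert d D)
    have "d \<notin> span (C \<union> D)"
    proof
      assume "d \<in> span (C \<union> D)"
      then obtain v e where ve: "d = v + e" "v \<in> V" "e \<in> span D" by (auto simp: span_Un sC)
      have e: "e \<in> span (insert d D)" using ve(3) span_mono[of D "insert d D"] by (meson subsetD subset_insertI)
      have "d - e \<in> span (insert d D)" by (rule span_diff[OF span_base e]) simp
      moreover have "v = d - e" using ve(1) by simp
      ultimately have "v = 0" using insert.prems(2) ve(2) by (metis IntI singletonD subsetD)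
      then have "d \<in> span D" using ve by simp
      then show False using insert.prems(1) insert.hyps(2) by (simp add: independent_insert)
    qed
    moreover have "independent (C \<union> D)"
    proof (rule insert.IH)
      show "independent D" using insert.prems(1) by (rule independent_mono) blast
      show "V \<inter> span D \<subseteq> {0}" using insert.prems(2) span_mono[of D "insert d D"] by (meson Int_mono order_refl order_trans subset_insertI)
    qed
    ultimately show ?case by (simp add: independent_insertI)
  qed (simp add: C)
  then have *: "finite (C \<union> D)" "card (C \<union> D) \<le> card B"
    using independent_span_bound[OF B(1)] subset_trans[OF C(1) B(2)] B(3) by (metis Un_least)+
  have "C \<inter> D = {}"
  proof (rule ccontr)
    assume "C \<inter> D \<noteq> {}"
    then obtain x where "x \<in> C" "x \<in> D" by blast
    then have "x \<in> V \<inter> span D" using C(1) span_base by (metis IntI subsetD)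
    then have "x = 0" using int by blast
    then show False using \<open>x \<in> D\<close> D dependent_zero by blast
  qed
  then have "card C + card D \<le> card B" using * by (simp add: card_Un_disjoint)
  moreover have "vdim V \<le> enat (card C)" by (rule vdim_le_card[OF _ C(3)]) (use *(1) in simp)
  moreover from * have "card C \<le> card B - card D" using calculation(1) by linarith
  ultimately show ?thesis by (meson enat_ord_simps(1) order_trans)
qed

section \<open>Topology of the quotient surfaces\<close>

lemma topspace_quotient_top: "topspace (quotient_top G) = range (orbit G)"
  using quotient_imp_surjective_map[OF quotient_map_quotient_top, of G] by simp

text \<open>What the deck groups of cylinder and Moebius band have in common: \<bar>t\<bar> descends
  to the quotient, and \<theta> can be moved into one period.\<close>

locale strip_action =
  fixes G :: "(plane \<Rightarrow> plane) set"
  assumes id_in: "(\<lambda>p. p) \<in> G" and abs_fst: "\<And>g p. g \<in> G \<Longrightarrow> \<bar>fst (g p)\<bar> = \<bar>fst p\<bar>"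
    and shift: "\<And>t \<theta> n. orbit G (t, \<theta> + 2 * pi * of_int n) = orbit G (t, \<theta>)"
begin

lemma orbit_eq_abs_fst: "orbit G p = orbit G q \<Longrightarrow> \<bar>fst p\<bar> = \<bar>fst q\<bar>"
proof -
  assume e: "orbit G p = orbit G q"
  have "p \<in> orbit G p" using id_in by (force simp: orbit_def)
  then obtain g where "g \<in> G" "p = g q" unfolding e by (auto simp: orbit_def)
  then show ?thesis by (simp add: abs_fst)
qed

lemma vimage_orbit: "orbit G -` (orbit G ` {p. P \<bar>fst p\<bar>}) = {p. P \<bar>fst p\<bar>}"
proof (intro equalityI subsetI)
  fix p assume "p \<in> orbit G -` (orbit G ` {p. P \<bar>fst p\<bar>})"
  then obtain q where "orbit G p = orbit G q" "P \<bar>fst q\<bar>" by blast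
  then show "p \<in> {p. P \<bar>fst p\<bar>}" using orbit_eq_abs_fst by (metis mem_Collect_eq)
qed blast

lemma openin_strip: "openin (quotient_top G) (orbit G ` {p. \<bar>fst p\<bar> < c})"
  unfolding openin_quotient_top vimage_orbit[of "\<lambda>x. x < c"]
  by (auto intro!: open_Collect_less continuous_intros)

lemma closedin_strip: "closedin (quotient_top G) (orbit G ` {p. \<bar>fst p\<bar> \<le> c})"
proof -
  have "range (orbit G) - orbit G ` {p. \<bar>fst p\<bar> \<le> c} = orbit G ` {p. c < \<bar>fst p\<bar>}"
  proof (intro equalityI subsetI)
    fix x assume "x \<in> range (orbit G) - orbit G ` {p. \<bar>fst p\<bar> \<le> c}"
    then obtain p where "x = orbit G p" "\<not> \<bar>fst p\<bar> \<le> c" by blast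
    then show "x \<in> orbit G ` {p. c < \<bar>fst p\<bar>}" by (metis imageI linorder_not_le mem_Collect_eq)
  next
    fix x assume "x \<in> orbit G ` {p. c < \<bar>fst p\<bar>}"
    then obtain p where p: "x = orbit G p" "c < \<bar>fst p\<bar>" by blast
    have "x \<notin> orbit G ` {p. \<bar>fst p\<bar> \<le> c}"
    proof
      assume "x \<in> orbit G ` {p. \<bar>fst p\<bar> \<le> c}"
      then obtain q where "orbit G p = orbit G q" "\<bar>fst q\<bar> \<le> c" using p(1) by blast
      then show False using orbit_eq_abs_fst[of p q] p(2) by linarith
    qed
    then show "x \<in> range (orbit G) - orbit G ` {p. \<bar>fst p\<bar> \<le> c}" using p(1) by blast
  qed
  moreover have "openin (quotient_top G) (orbit G ` {p. c < \<bar>fst p\<bar>})"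
    unfolding openin_quotient_top vimage_orbit[of "\<lambda>x. c < x"]
    by (auto intro!: open_Collect_less continuous_intros)
  ultimately show ?thesis unfolding closedin_def topspace_quotient_top by auto
qed

lemma continuous_orbit: "continuous_map euclidean (quotient_top G) (orbit G)"
  by (rule quotient_imp_continuous_map[OF quotient_map_quotient_top])

lemma compactin_strip: "compactin (quotient_top G) (orbit G ` {p. \<bar>fst p\<bar> \<le> c})"
proof -
  have "orbit G ` {p. \<bar>fst p\<bar> \<le> c} = orbit G ` ({-c..c} \<times> {0..2*pi})"
  proof
    show "orbit G ` {p. \<bar>fst p\<bar> \<le> c} \<subseteq> orbit G ` ({-c..c} \<times> {0..2*pi})"
    proof clarify
      fix t \<theta> :: real assume t: "\<bar>fst (t, \<theta>)\<bar> \<le> c"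
      obtain n :: int where n: "\<theta> + 2 * pi * of_int n \<in> {0..<2*pi}"
        using ex1_shift[of "2 * pi" \<theta>] by auto
      show "orbit G (t, \<theta>) \<in> orbit G ` ({-c..c} \<times> {0..2*pi})"
        unfolding shift[of t \<theta> n, symmetric] using t n by (intro imageI) auto
    qed
  qed auto
  moreover have "compactin euclidean ({-c..c} \<times> {0..2*pi} :: plane set)"
    by (simp add: compact_Times)
  ultimately show ?thesis using image_compactin[OF _ continuous_orbit] by metis
qed

text \<open>The images of the strips \<bar>t\<bar> < n form an increasing open cover, so a compact
  set lies in one of them.\<close>

lemma support_bound:
  assumes K: "compactin (quotient_top G) K" and X: "orbit G ` {p. X p \<noteq> (0 :: 'b::real_vector)} \<subseteq> K"
  shows "\<exists>L>0. \<forall>p. L \<le> \<bar>fst p\<bar> \<longrightarrow> X p = 0"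
proof -
  define U where "U n = orbit G ` {p. \<bar>fst p\<bar> < real n}" for n :: nat
  have cov: "K \<subseteq> \<Union> (range U)"
  proof
    fix x assume "x \<in> K"
    then obtain p where p: "x = orbit G p"
      using compactin_subset_topspace[OF K] by (auto simp: topspace_quotient_top)
    obtain n where "\<bar>fst p\<bar> < real n" using reals_Archimedean2 by blast
    then show "x \<in> \<Union> (range U)" using p unfolding U_def by blast
  qed
  have "openin (quotient_top G) V" if "V \<in> range U" for V
    using that openin_strip unfolding U_def by blast
  from compactinD[OF K this cov] obtain F where F: "finite F" "F \<subseteq> range U" "K \<subseteq> \<Union> F"
    by blast
  then obtain I where I: "finite I" "F = U ` I" by (meson finite_subset_image)
  \<comment> \<open>The sum of the finitely many indices serves as an upper bound for each of them,
    also for an empty index set; the successor makes L positive.\<close>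
  define L where "L = real (Suc (\<Sum>I))"
  have "X p = 0" if p: "L \<le> \<bar>fst p\<bar>" for p
  proof (rule ccontr)
    assume "X p \<noteq> 0"
    then have "orbit G p \<in> K" using X by blast
    then obtain n where n: "n \<in> I" "orbit G p \<in> U n" using F(3) I(2) by blast
    then obtain q where q: "orbit G p = orbit G q" "\<bar>fst q\<bar> < real n" unfolding U_def by blast
    then have "\<bar>fst p\<bar> < real n" using orbit_eq_abs_fst[OF q(1)] by simp
    moreover from I(1) have "n \<le> \<Sum>I" by (intro member_le_sum[OF n(1)]) simp_all
    then have "n \<le> Suc (\<Sum>I)" by simp
    then have "real n \<le> L" unfolding L_def by (simp only: of_nat_le_iff)
    ultimately show False using p by linarith
  qed
  moreover have "0 < L" unfolding L_def by (simp only: of_nat_0_less_iff)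
  ultimately show ?thesis by blast
qed

end

lemma strip_action_cylinder: "strip_action cylinder_deck"
proof
  show "(\<lambda>p. p) \<in> cylinder_deck"
    unfolding cylinder_deck_def by (rule image_eqI[of _ _ 0]) (simp_all add: case_prod_unfold)
  show "\<bar>fst (g p)\<bar> = \<bar>fst p\<bar>" if "g \<in> cylinder_deck" for g p
    using that by (cases p) (auto simp: cylinder_deck_def)
  fix t \<theta> :: real and n :: int
  have o: "orbit cylinder_deck (t, \<theta>) = range (\<lambda>m :: int. (t, \<theta> + 2 * pi * of_int m))" for \<theta>
    by (simp add: orbit_def cylinder_deck_def image_image)
  show "orbit cylinder_deck (t, \<theta> + 2 * pi * of_int n) = orbit cylinder_deck (t, \<theta>)"
    unfolding o
  proof safe
    fix m :: int
    show "(t, \<theta> + 2 * pi * of_int n + 2 * pi * of_int m) \<in> range (\<lambda>m :: int. (t, \<theta> + 2 * pi * of_int m))"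
      by (rule image_eqI[of _ _ "n + m"]) (simp_all add: algebra_simps)
    show "(t, \<theta> + 2 * pi * of_int m) \<in> range (\<lambda>m :: int. (t, \<theta> + 2 * pi * of_int n + 2 * pi * of_int m))"
      by (rule image_eqI[of _ _ "m - n"]) (simp_all add: algebra_simps)
  qed
qed

lemma strip_action_moebius: "strip_action moebius_deck"
proof
  interpret c: strip_action cylinder_deck by (rule strip_action_cylinder)
  show "(\<lambda>p. p) \<in> moebius_deck" using c.id_in by (simp add: moebius_deck_def)
  show "\<bar>fst (g p)\<bar> = \<bar>fst p\<bar>" if "g \<in> moebius_deck" for g p
    using that by (cases p) (auto simp: moebius_deck_def c.abs_fst FS_involution_def)
  fix t \<theta> :: real and n :: int
  have o: "orbit moebius_deck (t, \<theta>) = orbit cylinder_deck (t, \<theta>) \<union> orbit cylinder_deck (- t, \<theta> + pi)" for \<theta>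
    by (simp add: orbit_def moebius_deck_def image_Un image_image FS_involution_def)
  have "\<theta> + 2 * pi * of_int n + pi = (\<theta> + pi) + 2 * pi * of_int n" by simp
  then show "orbit moebius_deck (t, \<theta> + 2 * pi * of_int n) = orbit moebius_deck (t, \<theta>)"
    unfolding o by (simp only: c.shift)
qed

lemma strip_action_FS: "strip_action (deck (FS k l))"
  using strip_action_cylinder strip_action_moebius by (simp add: FS_def)

lemma FS_support_bound:
  assumes "bounded_domain (FS k l) \<Omega>" "section_support (FS k l) X \<subseteq> \<Omega>"
  shows "\<exists>L>0. \<forall>p. L \<le> \<bar>fst p\<bar> \<longrightarrow> X p = 0"
proof (rule strip_action.support_bound[OF strip_action_FS])
  let ?T = "surface_top (FS k l)"
  show "compactin ?T (?T closure_of \<Omega>)" using assms(1) by (simp add: bounded_domain_def)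
  have "openin ?T \<Omega>" using assms(1) by (simp add: bounded_domain_def)
  then have "\<Omega> \<subseteq> ?T closure_of \<Omega>" by (intro closure_of_subset openin_subset)
  moreover have "orbit (deck (FS k l)) ` {p. X p \<noteq> 0} \<subseteq> ?T closure_of (orbit (deck (FS k l)) ` {p. X p \<noteq> 0})"
    by (rule closure_of_subset) (auto simp: topspace_quotient_top)
  ultimately show "orbit (deck (FS k l)) ` {p. X p \<noteq> 0} \<subseteq> ?T closure_of \<Omega>"
    using assms(2) by (auto simp: section_support_def)
qed

definition strip :: "nat \<Rightarrow> nat \<Rightarrow> real \<Rightarrow> plane set set" where
  "strip k l N = orbit (deck (FS k l)) ` {p. \<bar>fst p\<bar> < N}"

text \<open>The support is closed and may reach \<bar>t\<bar> = N, so the open domain is taken one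
  unit wider.\<close>

lemma FS_strip_domain:
  "bounded_domain (FS k l) (strip k l (N + 1))"
  "(\<And>p. N \<le> \<bar>fst p\<bar> \<Longrightarrow> X p = 0) \<Longrightarrow> section_support (FS k l) X \<subseteq> strip k l (N + 1)"
proof -
  note A = strip_action_FS[of k l]
  define T where "T = quotient_top (deck (FS k l))"
  define C where "C c = orbit (deck (FS k l)) ` {p. \<bar>fst p\<bar> \<le> c}" for c
  have "connected {p :: plane. \<bar>fst p\<bar> < N + 1}"
  proof -
    have "{p :: plane. \<bar>fst p\<bar> < N + 1} = {-(N+1)<..<N+1} \<times> UNIV" by (auto simp: abs_less_iff)
    then show ?thesis by (simp only: connected_Times) (simp add: convex_connected)
  qed
  then have con: "connectedin T (strip k l (N + 1))"
    unfolding strip_def T_def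
    by (intro connectedin_continuous_map_image[OF strip_action.continuous_orbit[OF A]]) simp
  have cl: "closedin T (C c)" for c
    unfolding T_def C_def by (rule strip_action.closedin_strip[OF A])
  have op: "openin T (strip k l c)" for c
    unfolding T_def strip_def by (rule strip_action.openin_strip[OF A])
  have cp: "compactin T (C c)" for c
    unfolding T_def C_def by (rule strip_action.compactin_strip[OF A])
  have "strip k l (N + 1) \<subseteq> C (N + 1)"
    unfolding strip_def C_def by (rule image_mono) (auto simp: less_imp_le)
  then have "T closure_of strip k l (N + 1) \<subseteq> C (N + 1)"
    using cl by (rule closure_of_minimal)
  then have com: "compactin T (T closure_of strip k l (N + 1))"
    using closed_compactin[OF cp] closedin_closure_of by blast
  show "bounded_domain (FS k l) (strip k l (N + 1))"
    unfolding bounded_domain_def T_def[symmetric] using con com op by blast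
  show "section_support (FS k l) X \<subseteq> strip k l (N + 1)" if X: "\<And>p. N \<le> \<bar>fst p\<bar> \<Longrightarrow> X p = 0"
  proof -
    have "orbit (deck (FS k l)) ` {p. X p \<noteq> 0} \<subseteq> C N"
      unfolding C_def by (rule image_mono) (use X in force)
    then have "section_support (FS k l) X \<subseteq> C N"
      unfolding section_support_def T_def[symmetric] using cl by (rule closure_of_minimal)
    also have "\<dots> \<subseteq> strip k l (N + 1)" unfolding C_def strip_def by (rule image_mono) auto
    finally show ?thesis .
  qed
qed

lemma dd_add:
  assumes "F differentiable (at p)" "G differentiable (at p)"
  shows "dd (F + G) v p = dd F v p + dd G v p" "dd (F - G) v p = dd F v p - dd G v p"
  using dd_eq[OF has_derivative_add[OF has_derivative_dd[OF assms(1)] has_derivative_dd[OF assms(2)]]]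
    dd_eq[OF has_derivative_diff[OF has_derivative_dd[OF assms(1)] has_derivative_dd[OF assms(2)]]]
  by (simp_all add: plus_fun_def fun_diff_def)

lemma dd_zero_on_open:
  assumes "open S" "p \<in> S" "\<And>q. q \<in> S \<Longrightarrow> X q = 0"
  shows "dd X v p = 0"
proof -
  have "(X has_derivative (\<lambda>_. 0)) (at p)"
    by (rule has_derivative_transform_within_open[OF has_derivative_const assms(1,2)]) (simp add: assms(3))
  then show ?thesis by (rule dd_eq)
qed

text \<open>Strictly outside the strip the field vanishes on an open set; on the boundary lines the
  derivative vanishes as a limit from outside.\<close>

lemma dd_zero_outside_strip:
  fixes X :: "plane \<Rightarrow> 'b::real_normed_vector"
  assumes X: "smooth X" and z: "\<And>p. L \<le> \<bar>fst p\<bar> \<Longrightarrow> X p = 0" and p: "L \<le> \<bar>fst p\<bar>"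
  shows "dd X v p = 0"
proof -
  have o: "dd X v q = 0" if "L < \<bar>fst q\<bar>" for q
  proof (rule dd_zero_on_open)
    show "open {q :: plane. L < \<bar>fst q\<bar>}" by (intro open_Collect_less continuous_intros)
  qed (use that z in auto)
  \<comment> \<open>The outward direction, so that the points q n approach p through the region
    where the field vanishes.\<close>
  define s :: real where "s = (if fst p \<ge> 0 then 1 else - 1)"
  define q where "q n = (fst p + s * inverse (real (Suc n)), snd p)" for n
  have "dd X v (q n) = 0" for n
  proof (rule o)
    have "\<bar>fst p + s * e\<bar> = \<bar>fst p\<bar> + e" if "0 < e" for e
      using that unfolding s_def by (auto simp: abs_if)
    then have "\<bar>fst (q n)\<bar> = \<bar>fst p\<bar> + inverse (real (Suc n))" by (simp add: q_def)
    moreover have "0 < inverse (real (Suc n))" by simp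
    ultimately show "L < \<bar>fst (q n)\<bar>" using p by linarith
  qed
  moreover have "(\<lambda>n. dd X v (q n)) \<longlonglongrightarrow> dd X v p"
  proof (rule continuous_on_tendsto_compose[OF smooth_continuous[OF smooth_dd[OF X], of UNIV]])
    have "q \<longlonglongrightarrow> (fst p + s * 0, snd p)"
      unfolding q_def by (intro tendsto_intros LIMSEQ_inverse_real_of_nat)
    then show "q \<longlonglongrightarrow> p" by simp
  qed auto
  ultimately show ?thesis by (simp add: LIMSEQ_const_iff)
qed

lemma integral_rotated_circle:
  fixes g :: "real \<Rightarrow> real"
  assumes g: "continuous_on UNIV g" and per: "\<And>\<theta>. g (\<theta> + 2 * pi) = g \<theta>"
  shows "integral {0..2*pi} (\<lambda>\<theta>. g (\<theta> + pi)) = integral {0..2*pi} g"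
    "integral {0..2*pi} g = integral {0..pi} g + integral {0..pi} (\<lambda>\<theta>. g (\<theta> + pi))"
proof -
  have c: "continuous_on S g" for S using g continuous_on_subset by blast
  have sh: "integral {a..b} (\<lambda>\<theta>. g (\<theta> + d)) = integral {a+d..b+d} g" for a b d
    using integral_shift[OF c, of a b d] by (simp add: o_def)
  have co: "integral {a..b} g = integral {a..d} g + integral {d..b} g" if "a \<le> d" "d \<le> b" for a b d
    by (rule Henstock_Kurzweil_Integration.integral_combine[OF that integrable_continuous_interval[OF c], symmetric])
  have "integral {0..2*pi} (\<lambda>\<theta>. g (\<theta> + pi)) = integral {pi..2*pi} g + integral {2*pi..3*pi} g"
    unfolding sh by (subst co[of _ "2*pi"]) (auto simp: algebra_simps)
  also have "integral {2*pi..3*pi} g = integral {0..pi} g"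
    using sh[of 0 pi "2*pi"] by (simp add: per)
  also have "integral {pi..2*pi} g + integral {0..pi} g = integral {0..2*pi} g"
    by (subst co[of 0 pi "2*pi"]) auto
  finally show "integral {0..2*pi} (\<lambda>\<theta>. g (\<theta> + pi)) = integral {0..2*pi} g" .
  show "integral {0..2*pi} g = integral {0..pi} g + integral {0..pi} (\<lambda>\<theta>. g (\<theta> + pi))"
    unfolding sh by (subst co[of 0 pi "2*pi"]) auto
qed

lemma integral_symmetric_reflect:
  "integral {-L..L} (\<lambda>t. h (- t)) = integral {-L..L} (h :: real \<Rightarrow> real)"
  using Henstock_Kurzweil_Integration.integral_reflect_real[where a = "- L" and b = L and f = h] by simp

section \<open>The form on the covering cylinder and the involution\<close>

context fraser_sargent begin

definition dens :: "(plane \<Rightarrow> real ^ 4) \<Rightarrow> plane \<Rightarrow> real" where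
  "dens X p = jacobi_density (fst p) (fieldZ X (fst p) (snd p)) (fieldZt X (fst p) (snd p)) (fieldZs X (fst p) (snd p))"

text \<open>Always integrated over the whole cylinder, also when the surface is the Moebius band;
  invariant and anti-invariant fields can then be compared in one form.\<close>

definition cyl :: "(plane \<Rightarrow> real ^ 4) \<Rightarrow> real" where
  "cyl X = (LINT p:UNIV \<times> {0..<2*pi}|lborel. dens X p)"

definition fields :: "real \<Rightarrow> (plane \<Rightarrow> real ^ 4) set" where
  "fields L = {X. smooth X \<and> normal_field X \<and> (\<forall>t \<theta>. X (t, \<theta> + 2 * pi) = X (t, \<theta>)) \<and> (\<forall>p. L \<le> \<bar>fst p\<bar> \<longrightarrow> X p = 0)}"

lemma fieldsD:
  assumes "X \<in> fields L"
  shows "smooth X" "normal_field X" "X (t, \<theta> + 2 * pi) = X (t, \<theta>)" "L \<le> \<bar>fst p\<bar> \<Longrightarrow> X p = 0"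
  using assms unfolding fields_def by blast+

lemma fields_mono: "X \<in> fields L \<Longrightarrow> L \<le> L' \<Longrightarrow> X \<in> fields L'"
  by (auto simp: fields_def)

lemma fields_linear:
  assumes "X \<in> fields L" "Y \<in> fields L"
  shows "X + Y \<in> fields L" "X - Y \<in> fields L" "c *\<^sub>R X \<in> fields L"
proof -
  have s: "smooth X" "smooth Y" and n: "normal_field X" "normal_field Y" using assms by (simp_all add: fieldsD)
  have "X - Y = (\<lambda>p. X p + - Y p)" by (simp add: fun_eq_iff)
  then show "X + Y \<in> fields L" "X - Y \<in> fields L" "c *\<^sub>R X \<in> fields L"
    using assms smooth_add[OF s] smooth_add[OF s(1) smooth_minus[OF s(2)]] smooth_scaleR[OF smooth_const s(1)] n
    unfolding fields_def normal_field_def mem_Collect_eq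
    by (simp_all add: npart_linear plus_fun_def scaleR_fun_def)
qed

lemma dens_continuous: "X \<in> fields L \<Longrightarrow> continuous_on S (dens X)"
proof -
  assume X: "X \<in> fields L"
  note C = C1_field_fieldZ[OF fieldsD(1-3)[OF X], unfolded C1_field_def case_prod_unfold]
  have "continuous_on UNIV (dens X)"
    unfolding dens_def jacobi_density_def using C by (intro continuous_intros) auto
  then show ?thesis using continuous_on_subset by blast
qed

lemma jacobi_density_0 [simp]: "jacobi_density t 0 0 0 = 0"
  by (simp add: jacobi_density_def)

lemma dens_outside:
  assumes X: "X \<in> fields L" and p: "L \<le> \<bar>fst p\<bar>"
  shows "dens X p = 0"
  using dd_zero_outside_strip[OF fieldsD(1)[OF X] _ p] fieldsD(4)[OF X] p
  by (simp add: dens_def fieldZ_def fieldZt_def fieldZs_def comp_linear)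

lemma cyl_eq:
  assumes X: "X \<in> fields L" and L: "0 \<le> L"
  shows "cyl X = integral {-L..L} (\<lambda>t. integral {0..2*pi} (\<lambda>\<theta>. dens X (t, \<theta>)))"
  unfolding cyl_def by (rule set_integral_strip[OF dens_continuous[OF X] L dens_outside[OF X]]) auto

lemma cyl_eq_cbox:
  assumes X: "X \<in> fields L" and L: "0 \<le> L"
  shows "cyl X = integral (cbox (-L, 0) (L, 2*pi)) (dens X)"
  unfolding cyl_eq[OF assms] by (subst integral_prod_continuous[OF dens_continuous[OF X]]) simp

lemma field_linear:
  assumes "smooth X" "smooth Y"
  shows "fieldZ (X + Y) t \<theta> = fieldZ X t \<theta> + fieldZ Y t \<theta>" "fieldZt (X + Y) t \<theta> = fieldZt X t \<theta> + fieldZt Y t \<theta>"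
    "fieldZs (X + Y) t \<theta> = fieldZs X t \<theta> + fieldZs Y t \<theta>"
    "fieldZ (X - Y) t \<theta> = fieldZ X t \<theta> - fieldZ Y t \<theta>" "fieldZt (X - Y) t \<theta> = fieldZt X t \<theta> - fieldZt Y t \<theta>"
    "fieldZs (X - Y) t \<theta> = fieldZs X t \<theta> - fieldZs Y t \<theta>"
  unfolding fieldZ_def fieldZt_def fieldZs_def dd_add[OF smooth_differentiable[OF assms(1)] smooth_differentiable[OF assms(2)]]
  by (simp_all add: comp_linear algebra_simps)

lemma jacobi_density_parallelogram:
  "jacobi_density t (z + w) (zt + wt) (zs + ws) + jacobi_density t (z - w) (zt - wt) (zs - ws)
   = 2 * jacobi_density t z zt zs + 2 * jacobi_density t w wt ws"
  unfolding jacobi_density_def cmod_power2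
  unfolding power2_eq_square by (simp add: field_simps)

text \<open>Takes the place of the polarised form: if X + Y and X - Y have equal energy, the energy
  of the sum is the sum of the energies.\<close>

lemma cyl_parallelogram:
  assumes X: "X \<in> fields L" and Y: "Y \<in> fields L" and L: "0 \<le> L"
  shows "cyl (X + Y) + cyl (X - Y) = 2 * cyl X + 2 * cyl Y"
proof -
  note XY = fields_linear(1,2)[OF X Y]
  have i: "dens W integrable_on cbox (-L, 0) (L, 2*pi)" if "W \<in> fields L" for W
    by (rule integrable_continuous[OF dens_continuous[OF that]])
  note add = Henstock_Kurzweil_Integration.integral_add
  have "dens (X + Y) p + dens (X - Y) p = 2 * dens X p + 2 * dens Y p" for p
    unfolding dens_def field_linear[OF fieldsD(1)[OF X] fieldsD(1)[OF Y]] by (rule jacobi_density_parallelogram)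
  then have "integral (cbox (-L, 0) (L, 2*pi)) (\<lambda>p. dens (X + Y) p + dens (X - Y) p)
    = integral (cbox (-L, 0) (L, 2*pi)) (\<lambda>p. 2 * dens X p + 2 * dens Y p)" by simp
  then show ?thesis
    unfolding cyl_eq_cbox[OF X L] cyl_eq_cbox[OF Y L] cyl_eq_cbox[OF XY(1) L] cyl_eq_cbox[OF XY(2) L]
      add[OF i[OF XY(1)] i[OF XY(2)]] add[OF integrable_on_mult_right[OF i[OF X]] integrable_on_mult_right[OF i[OF Y]]]
    by simp
qed

lemma cyl_0: "cyl 0 = 0"
  by (simp add: cyl_def dens_def fieldZ_def fieldZt_def fieldZs_def comp_linear dd_eq[OF has_derivative_const] zero_fun_def)

lemma dd_precompose:
  fixes X :: "plane \<Rightarrow> real ^ 4"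
  assumes X: "smooth X" and Y: "\<And>q. Y q = X (s * fst q, snd q + a)"
  shows "dd Y v p = dd X (s * fst v, snd v) (s * fst p, snd p + a)"
proof -
  have "((\<lambda>q :: plane. (s * fst q, snd q + a)) has_derivative (\<lambda>v. (s * fst v, snd v))) (at p)"
    by (auto intro!: derivative_eq_intros)
  from has_derivative_compose[OF this smooth_has_derivative[OF X]]
  have "(Y has_derivative (\<lambda>v. dd X (s * fst v, snd v) (s * fst p, snd p + a))) (at p)"
    unfolding Y[abs_def] .
  then show ?thesis by (rule dd_eq)
qed

lemma dens_periodic:
  assumes X: "X \<in> fields L"
  shows "dens X (t, \<theta> + 2 * pi) = dens X (t, \<theta>)"
proof -
  have "dd X v (t, \<theta> + 2 * pi) = dd X v (t, \<theta>)" for v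
    using dd_precompose[OF fieldsD(1)[OF X], of X 1 "2 * pi" v "(t, \<theta>)"] fieldsD(3)[OF X] by simp
  then show ?thesis
    by (simp add: dens_def fieldZ_def fieldZt_def fieldZs_def comp_def frame_periodic fieldsD(3)[OF X])
qed

text \<open>The involution preserves \<open>N1\<close> and reverses \<open>N2\<close>, so it acts on
  the complex coordinate as conjugation.\<close>

lemma comp_involution:
  assumes "even k" "odd l"
  shows "comp (- t, \<theta> + pi) w = cnj (comp (t, \<theta>) w)"
proof -
  have "cos (real m * (\<theta> + pi)) = (- 1) ^ m * cos (real m * \<theta>)"
    and "sin (real m * (\<theta> + pi)) = (- 1) ^ m * sin (real m * \<theta>)" for m
    by (simp_all add: distrib_left cos_add sin_add)
  then have "N1 (- t, \<theta> + pi) = N1 (t, \<theta>)" "N2 (- t, \<theta> + pi) = - N2 (t, \<theta>)"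
    using assms by (auto simp: N1_def N2_def intro!: vec4_eqI)
  then show ?thesis by (simp add: comp_def complex_eq_iff)
qed

text \<open>Conjugation changes the sign of the connection term, and so does t, because
  \<open>conn\<close> is odd.\<close>

lemma jacobi_density_reflect:
  "jacobi_density t (cnj z) (- cnj zt) (cnj zs) = jacobi_density (- t) z zt zs"
  unfolding jacobi_density_def cmod_power2 parity
  unfolding power2_eq_square by (simp add: algebra_simps)

lemma dens_involution:
  assumes par: "even k" "odd l" and X: "smooth X" and Y: "\<And>t \<theta>. Y (t, \<theta>) = X (- t, \<theta> + pi)"
  shows "dens Y (t, \<theta>) = dens X (- t, \<theta> + pi)"
proof -
  have Y': "Y q = X ((- 1) * fst q, snd q + pi)" for q using Y[of "fst q" "snd q"] by simp
  note d = dd_precompose[OF X Y', of _ "(t, \<theta>)"]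
  have c: "comp (t, \<theta>) w = cnj (comp (- t, \<theta> + pi) w)" for w by (simp add: comp_involution[OF par])
  have "dd X (- 1, 0) q = - dd X (1, 0) q" for q
    using dd_scale[OF smooth_differentiable[OF X], of "- 1" "(1, 0)" q] by simp
  then have "fieldZ Y t \<theta> = cnj (fieldZ X (- t) (\<theta> + pi))" "fieldZt Y t \<theta> = - cnj (fieldZt X (- t) (\<theta> + pi))"
     "fieldZs Y t \<theta> = cnj (fieldZs X (- t) (\<theta> + pi))"
    using d[of "(1, 0)"] d[of "(0, 1)"] comp_linear(3)[of _ "- 1"]
    by (simp_all add: fieldZ_def fieldZt_def fieldZs_def Y c)
  then show ?thesis by (simp add: dens_def jacobi_density_reflect)
qed

lemma cyl_involution:
  assumes par: "even k" "odd l" and X: "X \<in> fields L" and Y: "Y \<in> fields L" and L: "0 \<le> L"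
    and XY: "\<And>t \<theta>. Y (t, \<theta>) = X (- t, \<theta> + pi)"
  shows "cyl Y = cyl X"
proof -
  let ?h = "\<lambda>t. integral {0..2*pi} (\<lambda>\<theta>. dens X (t, \<theta>))"
  have c: "continuous_on UNIV (\<lambda>\<theta>. dens X (t, \<theta>))" for t
    by (rule continuous_on_compose2[OF dens_continuous[OF X, of UNIV]]) (auto intro!: continuous_intros)
  have "integral {0..2*pi} (\<lambda>\<theta>. dens Y (t, \<theta>)) = ?h (- t)" for t
    unfolding dens_involution[OF par fieldsD(1)[OF X] XY] by (rule integral_rotated_circle(1)[OF c dens_periodic[OF X]])
  then show ?thesis unfolding cyl_eq[OF X L] cyl_eq[OF Y L] by (simp add: integral_symmetric_reflect[of L ?h])
qed

text \<open>For an invariant field the second half of the circle at t contributes what the first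
  half contributes at - t; integrating over a symmetric interval yields the factor 2.\<close>

lemma cyl_half:
  assumes par: "even k" "odd l" and X: "X \<in> fields L" and L: "0 \<le> L"
    and inv: "\<And>t \<theta>. X (- t, \<theta> + pi) = X (t, \<theta>)"
  shows "(LINT p:UNIV \<times> {0..<pi}|lborel. dens X p) = cyl X / 2"
proof -
  let ?h = "\<lambda>t. integral {0..pi} (\<lambda>\<theta>. dens X (t, \<theta>))"
  have c: "continuous_on UNIV (\<lambda>\<theta>. dens X (t, \<theta>))" for t
    by (rule continuous_on_compose2[OF dens_continuous[OF X, of UNIV]]) (auto intro!: continuous_intros)
  have i: "dens X (- t, \<theta> + pi) = dens X (t, \<theta>)" for t \<theta>
    by (rule dens_involution[OF par fieldsD(1)[OF X], symmetric]) (simp add: inv)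
  have hc: "continuous_on UNIV ?h"
    using integral_continuous_on_param[of UNIV 0 pi "\<lambda>t \<theta>. dens X (t, \<theta>)"] dens_continuous[OF X] by simp
  have "continuous_on {-L..L} (\<lambda>t. ?h (- t))"
    by (rule continuous_on_compose2[OF hc, of _ uminus]) (auto intro: continuous_intros)
  then have ci: "?h integrable_on {-L..L}" "(\<lambda>t. ?h (- t)) integrable_on {-L..L}"
    using continuous_on_subset[OF hc] by (auto intro!: integrable_continuous_interval)
  have "integral {0..2*pi} (\<lambda>\<theta>. dens X (t, \<theta>)) = ?h t + ?h (- t)" for t
    using integral_rotated_circle(2)[OF c dens_periodic[OF X], of t] i[of "- t"] by simp
  then have "cyl X = integral {-L..L} (\<lambda>t. ?h t + ?h (- t))" unfolding cyl_eq[OF X L] by simp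
  also have "\<dots> = 2 * integral {-L..L} ?h"
    unfolding Henstock_Kurzweil_Integration.integral_add[OF ci] by (simp add: integral_symmetric_reflect[of L ?h])
  also have "integral {-L..L} ?h = (LINT p:UNIV \<times> {0..<pi}|lborel. dens X p)"
    by (rule set_integral_strip[OF dens_continuous[OF X] L dens_outside[OF X], symmetric]) auto
  finally show ?thesis by simp
qed

lemma second_variation_cyl:
  assumes par: "coprime k l" and X: "X \<in> fields L" and L: "0 \<le> L"
    and inv: "\<And>p. even k \<Longrightarrow> X (FS_involution p) = X p"
  shows "second_variation (FS k l) X < 0 \<longleftrightarrow> cyl X < 0"
proof -
  have g: "((\<Sum>i\<in>{1,2}. (norm (normal_conn u (frame u i) X p))\<^sup>2) - simons u X p \<bullet> X p) * area_density u p = dens X p" for p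
    using second_variation_integrand[OF fieldsD(1)[OF X], of "fst p" "snd p"] by (simp add: dens_def)
  have im: "immersion (FS k l) = u" by (simp add: FS_def)
  have s: "second_variation (FS k l) X = (LINT p:fdom (FS k l)|lborel. dens X p)"
    
    unfolding second_variation_def Let_def im g ..
  show ?thesis
  proof (cases "odd k")
    case True
    then show ?thesis unfolding s by (simp add: FS_def cyl_def)
  next
    case False
    then have "odd l" using par coprime_common_divisor[of k l 2] by auto
    then have half: "(LINT p:UNIV \<times> {0..<pi}|lborel. dens X p) = cyl X / 2"
      using False inv by (intro cyl_half[OF _ _ X L]) (auto simp: FS_involution_def )
    have fd: "fdom (FS k l) = UNIV \<times> {0..<pi}" using False by (simp add: FS_def)
    show ?thesis unfolding s fd half by simp
  qed
qed

end

section \<open>The linear functionals that control negative directions\<close>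

lemma fcoef_add:
  assumes "continuous_on {0..2*pi} f" "continuous_on {0..2*pi} g"
  shows "fcoef (\<lambda>\<theta>. f \<theta> + g \<theta>) j = fcoef f j + fcoef g j"
  unfolding fcoef_def distrib_right
  by (rule Henstock_Kurzweil_Integration.integral_add; intro integrable_continuous_interval continuous_intros assms)

lemma fcoef_scale: "fcoef (\<lambda>\<theta>. a * f \<theta>) j = a * fcoef f j"
  unfolding fcoef_def mult.assoc by (rule integral_mult_right)

context fraser_sargent begin

lemma rate_inj: "rate s = rate t \<Longrightarrow> s = t"
  using rate_strict_mono[of s t] rate_strict_mono[of t s] by (cases s t rule: linorder_cases) auto

lemma continuous_fieldZ: "smooth X \<Longrightarrow> continuous_on S (fieldZ X t)"
  using continuous_slice[OF continuous_comp[OF smooth_continuous]] unfolding fieldZ_def[abs_def] .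

lemma fcoef_field_linear:
  assumes X: "smooth X" and Y: "smooth Y"
  shows "fcoef (fieldZ (X + Y) t) j = fcoef (fieldZ X t) j + fcoef (fieldZ Y t) j"
    "fcoef (fieldZ (c *\<^sub>R X) t) j = of_real c * fcoef (fieldZ X t) j"
proof -
  have "fieldZ (X + Y) t = (\<lambda>\<theta>. fieldZ X t \<theta> + fieldZ Y t \<theta>)" "fieldZ (c *\<^sub>R X) t = (\<lambda>\<theta>. of_real c * fieldZ X t \<theta>)"
    by (simp_all add: fun_eq_iff fieldZ_def comp_linear)
  then show "fcoef (fieldZ (X + Y) t) j = fcoef (fieldZ X t) j + fcoef (fieldZ Y t) j"
    "fcoef (fieldZ (c *\<^sub>R X) t) j = of_real c * fcoef (fieldZ X t) j"
    by (simp_all add: fcoef_add[OF continuous_fieldZ[OF X] continuous_fieldZ[OF Y]] fcoef_scale)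
qed

text \<open>The pole of the potential of mode m, unique since \<open>rate\<close> is strictly
  increasing. If the value m is not attained the choice is arbitrary, and \<open>crit_eq\<close>
  says nothing about it.\<close>

definition crit :: "int \<Rightarrow> real" where "crit m = (SOME t. rate t = of_int m)"

lemma crit_eq: "rate t = of_int m \<Longrightarrow> crit m = t"
  unfolding crit_def by (rule some_equality) (auto intro: rate_inj)

definition node :: "int \<Rightarrow> (plane \<Rightarrow> real ^ 4) \<Rightarrow> complex" where
  "node m X = of_real (wa (crit m)) * fcoef (fieldZ X (crit m)) m + of_real (wb (crit m)) * cnj (fcoef (fieldZ X (crit m)) (- m))"

definition node0 :: "(plane \<Rightarrow> real ^ 4) \<Rightarrow> real" where
  "node0 X = wa (crit 0) * (Re (fcoef (fieldZ X (crit 0)) 0) + Im (fcoef (fieldZ X (crit 0)) 0))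
     + wb (crit 0) * (Re (fcoef (fieldZ X (crit 0)) 0) - Im (fcoef (fieldZ X (crit 0)) 0))"

text \<open>An enumeration of the conditions: index 0 is the real condition of mode 0, while 2 * n -
  1 and 2 * n are the real and imaginary parts for mode n. The modes below k therefore use the
  indices below 2 * k - 1.\<close>

definition obs :: "nat \<Rightarrow> (plane \<Rightarrow> real ^ 4) \<Rightarrow> real" where
  "obs i X = (if i = 0 then node0 X else if odd i then Re (node (int ((i + 1) div 2)) X) else Im (node (int (i div 2)) X))"

lemma obs_linear:
  assumes X: "X \<in> fields L" and Y: "Y \<in> fields L"
  shows "obs i (X + Y) = obs i X + obs i Y" "obs i (c *\<^sub>R X) = c * obs i X"
proof -
  note n = node_def node0_def fcoef_field_linear[OF fieldsD(1)[OF X] fieldsD(1)[OF Y]]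
  have "node m (X + Y) = node m X + node m Y" "node m (c *\<^sub>R X) = of_real c * node m X"
    "node0 (X + Y) = node0 X + node0 Y" "node0 (c *\<^sub>R X) = c * node0 X" for m
    unfolding n by (simp_all add: algebra_simps)
  then show "obs i (X + Y) = obs i X + obs i Y" "obs i (c *\<^sub>R X) = c * obs i X"
    by (simp_all add: obs_def)
qed

text \<open>By \<open>rate_bound\<close> a positive mode with a pole is smaller than k, so all
  conditions that positivity asks for are among the listed functionals.\<close>

lemma cyl_nonneg:
  assumes X: "X \<in> fields L" and L: "0 < L" and o: "\<And>i. i < 2 * k - 1 \<Longrightarrow> obs i X = 0"
  shows "0 \<le> cyl X"
proof -
  have k: "0 < k" using l_less by simp
  have "0 \<le> integral {-L..L} (\<lambda>t. integral {0..2*pi} (\<lambda>\<theta>. jacobi_density t (fieldZ X t \<theta>) (fieldZt X t \<theta>) (fieldZs X t \<theta>)))"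
  proof (rule density_integral_nonneg[OF C1_field_fieldZ[OF fieldsD(1-3)[OF X]] L])
    show "fieldZ X t \<theta> = 0" if "L \<le> \<bar>t\<bar>" for t \<theta>
      using fieldsD(4)[OF X] that by (simp add: fieldZ_def comp_linear)
  next
    fix m :: int and t assume m: "0 < m" "rate t = of_int m"
    then have "m < int k" using rate_bound[of t] by simp
    define n where "n = nat m"
    have n: "m = int n" "0 < n" "n < k" using m \<open>m < int k\<close> by (simp_all add: n_def)
    have "obs (2 * n - 1) X = Re (node m X)" "obs (2 * n) X = Im (node m X)"
      using n by (simp_all add: obs_def)
    then have "node m X = 0" using o[of "2 * n - 1"] o[of "2 * n"] n by (simp add: complex_eq_iff)
    then show "of_real (wa t) * fcoef (fieldZ X t) m + of_real (wb t) * cnj (fcoef (fieldZ X t) (- m)) = 0"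
      unfolding node_def crit_eq[OF m(2)] .
  next
    fix t assume t: "rate t = 0"
    then have "crit 0 = t" using crit_eq[of t 0] by simp
    then show "wa t * (Re (fcoef (fieldZ X t) 0) + Im (fcoef (fieldZ X t) 0)) + wb t * (Re (fcoef (fieldZ X t) 0) - Im (fcoef (fieldZ X t) 0)) = 0"
      using o[of 0] k by (simp add: obs_def node0_def)
  qed
  then show ?thesis unfolding cyl_eq[OF X less_imp_le[OF L]] dens_def by simp
qed

text \<open>A negative space meets the common kernel of the functionals only in 0, so their number
  bounds its dimension.\<close>

lemma negative_subspace_span:
  assumes V: "subspace V" and VF: "\<And>X. X \<in> V \<Longrightarrow> \<exists>L>0. X \<in> fields L" and neg: "\<And>X. X \<in> V \<Longrightarrow> X \<noteq> 0 \<Longrightarrow> cyl X < 0"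
  shows "\<exists>B. finite B \<and> card B \<le> 2 * k - 1 \<and> V \<subseteq> span B"
proof (rule span_of_functionals[OF V, of obs])
  fix i X Y c assume X: "X \<in> V"
  obtain L where L: "0 < L" "X \<in> fields L" using VF[OF X] by blast
  show "obs i (c *\<^sub>R X) = c * obs i X" by (rule obs_linear(2)[OF L(2) L(2)])
  assume "Y \<in> V"
  then obtain L' where L': "Y \<in> fields L'" using VF by blast
  show "obs i (X + Y) = obs i X + obs i Y"
    by (rule obs_linear(1)[OF fields_mono[OF L(2)] fields_mono[OF L'], of "max L L'"]) auto
next
  fix X assume X: "X \<in> V" "\<forall>i<2 * k - 1. obs i X = 0"
  obtain L where L: "0 < L" "X \<in> fields L" using VF[OF X(1)] by blast
  show "X = 0" using cyl_nonneg[OF L(2,1)] X(2) neg[OF X(1)] by force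
qed

section \<open>Test fields of negative energy\<close>

text \<open>Real coordinates are packed into coefficients with \<open>zeta c (- j)\<close> conjugate
  to \<open>zeta c j\<close>. Both members of a pair then share one complex factor, and the
  coefficient of mode 0 is real because sgn 0 = 0; this gives 2 * k - 1 real parameters.\<close>

definition zeta :: "(int \<Rightarrow> real) \<Rightarrow> int \<Rightarrow> complex" where
  "zeta c j = Complex (c \<bar>j\<bar>) (of_int (sgn j) * c (- \<bar>j\<bar>))"

abbreviation modes :: "int set" where "modes \<equiv> {- int (k - 1)..int (k - 1)}"

definition test_re :: "(int \<Rightarrow> real) \<Rightarrow> plane \<Rightarrow> real" where
  "test_re c p = (\<Sum>j\<in>modes. exp (- slope j * fst p) * (Re (zeta c j) * cos (of_int j * snd p) + (- Im (zeta c j)) * sin (of_int j * snd p)))"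

definition test_im :: "(int \<Rightarrow> real) \<Rightarrow> plane \<Rightarrow> real" where
  "test_im c p = (\<Sum>j\<in>modes. exp (- slope j * fst p) * (Re (zeta c j) * sin (of_int j * snd p) + Im (zeta c j) * cos (of_int j * snd p)))"

text \<open>One factor \<open>nrm\<close> normalises the frame, the other one belongs to the
  functions \<open>ex\<close>, of which \<open>test_re\<close> and \<open>test_im\<close> contain
  only the exponentials.\<close>

definition test :: "(real \<Rightarrow> real) \<Rightarrow> real \<Rightarrow> (int \<Rightarrow> real) \<Rightarrow> plane \<Rightarrow> real ^ 4" where
  "test \<psi> N c p = (\<psi> (1 / N * fst p) * (nrm (fst p))\<^sup>2) *\<^sub>R (test_re c p *\<^sub>R N1 p + test_im c p *\<^sub>R N2 p)"

lemma zeta_linear: "zeta (c + d) j = zeta c j + zeta d j" "zeta (a *\<^sub>R c) j = of_real a * zeta c j"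
  by (simp_all add: zeta_def complex_eq_iff algebra_simps)

lemma cnj_zeta: "cnj (zeta c (- j)) = zeta c j"
  by (simp add: zeta_def complex_eq_iff)

lemma linear_test: "linear (test \<psi> N)"
proof (rule linearI)
  have "test_re (c + d) p = test_re c p + test_re d p" "test_im (c + d) p = test_im c p + test_im d p" for c d p
    unfolding test_re_def test_im_def zeta_linear sum.distrib[symmetric] by (simp_all add: algebra_simps)
  then show "test \<psi> N (c + d) = test \<psi> N c + test \<psi> N d" for c d
    by (simp add: fun_eq_iff test_def algebra_simps)
  have "test_re (a *\<^sub>R c) p = a * test_re c p" "test_im (a *\<^sub>R c) p = a * test_im c p" for a c p
    unfolding test_re_def test_im_def zeta_linear sum_distrib_left by (simp_all add: algebra_simps)
  then show "test \<psi> N (a *\<^sub>R c) = a *\<^sub>R test \<psi> N c" for a c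
    by (simp add: fun_eq_iff test_def algebra_simps)
qed

definition profile :: "(real \<Rightarrow> real) \<Rightarrow> real \<Rightarrow> real \<Rightarrow> real \<Rightarrow> real" where
  "profile \<psi> N s t = \<psi> (t / N) * ex s t"
definition profile' :: "(real \<Rightarrow> real) \<Rightarrow> (real \<Rightarrow> real) \<Rightarrow> real \<Rightarrow> real \<Rightarrow> real \<Rightarrow> real" where
  "profile' \<psi> \<psi>' N s t = \<psi>' (t / N) / N * ex s t + \<psi> (t / N) * ((s - rate t) * ex s t)"

lemma comp_test:
  "comp (t, \<theta>) (test \<psi> N c (t, \<theta>)) = of_real (\<psi> (t / N) * nrm t) * Complex (test_re c (t, \<theta>)) (test_im c (t, \<theta>))"
  "comp (t, \<theta>) (test \<psi> N c (t, \<theta>)) = trig modes (\<lambda>j. zeta c j * of_real (profile \<psi> N (- slope j) t)) \<theta>"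
proof -
  have n: "nrm t \<noteq> 0" using nrm_pos[of t] by linarith
  show 1: "comp (t, \<theta>) (test \<psi> N c (t, \<theta>)) = of_real (\<psi> (t / N) * nrm t) * Complex (test_re c (t, \<theta>)) (test_im c (t, \<theta>))"
    unfolding test_def comp_linear comp_frame using n
    by (simp add: complex_eq_iff power2_eq_square)
  have "Complex (test_re c (t, \<theta>)) (test_im c (t, \<theta>)) = trig modes (\<lambda>j. zeta c j * of_real (exp (- slope j * t))) \<theta>"
    unfolding trig_def complex_eq_iff Re_sum Im_sum test_re_def test_im_def complex.sel
    by (intro conjI sum.cong refl) (simp_all add: cis.sel algebra_simps)
  then show "comp (t, \<theta>) (test \<psi> N c (t, \<theta>)) = trig modes (\<lambda>j. zeta c j * of_real (profile \<psi> N (- slope j) t)) \<theta>"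
    unfolding 1 by (simp add: trig_def sum_distrib_left profile_def ex_def mult_ac)
qed

definition bump :: "(real \<Rightarrow> real) \<Rightarrow> (real \<Rightarrow> real) \<Rightarrow> bool" where
  "bump \<psi> \<psi>' \<longleftrightarrow> smooth \<psi> \<and> (\<forall>x. (\<psi> has_real_derivative \<psi>' x) (at x)) \<and> continuous_on UNIV \<psi>' \<and>
     (\<forall>x. 1 \<le> \<bar>x\<bar> \<longrightarrow> \<psi> x = 0) \<and> (\<forall>x. \<bar>x\<bar> < 1 \<longrightarrow> 0 < \<psi> x) \<and> (\<forall>x. \<psi> (- x) = \<psi> x)"

lemma test_fields:
  assumes b: "bump \<psi> \<psi>'" and N: "0 < N"
  shows "test \<psi> N c \<in> fields N"
proof -
  note e = smooth_of_coordinate(1)[OF smooth_exp] and s = smooth_of_coordinate(2)[OF smooth_sin] smooth_of_coordinate(2)[OF smooth_cos]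
  have "smooth (test_re c)" "smooth (test_im c)"
    unfolding test_re_def[abs_def] test_im_def[abs_def]
    by (rule smooth_sum, rule smooth_mult[OF e smooth_add], rule smooth_mult[OF smooth_const s(2)], rule smooth_mult[OF smooth_const s(1)],
        rule smooth_sum, rule smooth_mult[OF e smooth_add], rule smooth_mult[OF smooth_const s(1)], rule smooth_mult[OF smooth_const s(2)])
  moreover have "smooth \<psi>" using b by (simp add: bump_def)
  ultimately have "smooth (test \<psi> N c)"
    unfolding test_def[abs_def]
    by (intro smooth_scaleR[OF smooth_mult[OF smooth_of_coordinate(1) smooth_nrm_sq] smooth_add[OF smooth_scaleR[OF _ smooth_N1] smooth_scaleR[OF _ smooth_N2]]])
  moreover have "normal_field (test \<psi> N c)"
    unfolding normal_field_def
  proof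
    fix p :: plane
    obtain t \<theta> where p: "p = (t, \<theta>)" by (cases p)
    show "npart p (test \<psi> N c p) = test \<psi> N c p"
      unfolding npart_eq_comp p comp_test(1) by (simp add: test_def scaleR_add_right power2_eq_square mult_ac)
  qed
  moreover have "test \<psi> N c (t, \<theta> + 2 * pi) = test \<psi> N c (t, \<theta>)" for t \<theta>
  proof -
    have "cos (of_int j * (\<theta> + 2 * pi)) = cos (of_int j * \<theta>)" "sin (of_int j * (\<theta> + 2 * pi)) = sin (of_int j * \<theta>)" for j :: int
      using sin_int_2pin[of j] cos_int_2pin[of j] by (simp_all add: distrib_left sin_add cos_add mult.commute mult.left_commute)
    then show ?thesis by (simp add: test_def test_re_def test_im_def frame_periodic)
  qed
  moreover have "test \<psi> N c p = 0" if "N \<le> \<bar>fst p\<bar>" for p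
  proof -
    have "1 \<le> \<bar>1 / N * fst p\<bar>" using that N by (simp add: abs_mult le_divide_eq)
    then have "\<psi> (1 / N * fst p) = 0" using b unfolding bump_def by blast
    then show ?thesis by (simp add: test_def)
  qed
  ultimately show ?thesis unfolding fields_def by blast
qed

lemma pair_form_scale:
  "pair_form m t (z * of_real p) (z * of_real q) (z * of_real p') (z * of_real q') = (cmod z)\<^sup>2 * mode_form m t p q p' q'"
proof -
  have "Re (z * of_real p * cnj (z * of_real q)) = (cmod z)\<^sup>2 * (p * q)"
    unfolding cmod_power2 by (simp add: power2_eq_square algebra_simps)
  then show ?thesis
    unfolding pair_form_def mode_form_def norm_mult norm_of_real power_mult_distrib power2_abs by (simp add: algebra_simps)
qed

lemma DERIV_profile:
  assumes b: "bump \<psi> \<psi>'"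
  shows "(profile \<psi> N s has_real_derivative profile' \<psi> \<psi>' N s t) (at t)"
proof -
  have "(\<psi> has_real_derivative \<psi>' (t / N)) (at (t / N))" using b by (simp add: bump_def)
  from DERIV_mult[OF DERIV_chain2[OF this DERIV_cdivide[OF DERIV_ident]] DERIV_ex_first]
  show ?thesis unfolding profile_def[abs_def] profile'_def by (rule DERIV_cong) (simp add: algebra_simps)
qed

definition mode_energy :: "(real \<Rightarrow> real) \<Rightarrow> (real \<Rightarrow> real) \<Rightarrow> real \<Rightarrow> int \<Rightarrow> real" where
  "mode_energy \<psi> \<psi>' N j = integral {-N..N} (\<lambda>t. mode_form (of_int j) t (profile \<psi> N (- slope j) t) (profile \<psi> N (slope j) t)
      (profile' \<psi> \<psi>' N (- slope j) t) (profile' \<psi> \<psi>' N (slope j) t))"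

text \<open>The field is a trigonometric polynomial in \<theta>, so the splitting into modes is
  exact, and the shared factor of each pair makes the energy diagonal in the parameters.\<close>

lemma cyl_test:
  assumes b: "bump \<psi> \<psi>'" and N: "0 < N"
  shows "cyl (test \<psi> N c) = pi * (\<Sum>j\<in>modes. (cmod (zeta c j))\<^sup>2 * mode_energy \<psi> \<psi>' N j)"
proof -
  let ?X = "test \<psi> N c"
  note X = test_fields[OF b N, of c]
  note C = C1_field_fieldZ[OF fieldsD(1-3)[OF X], unfolded C1_field_def]
  define z where "z t j = zeta c j * of_real (profile \<psi> N (- slope j) t)" for t j
  define z' where "z' t j = zeta c j * of_real (profile' \<psi> \<psi>' N (- slope j) t)" for t j
  have f: "fieldZ ?X t \<theta> = trig modes (z t) \<theta>" for t \<theta>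
    unfolding fieldZ_def comp_test(2) z_def ..
  have ft: "fieldZt ?X t \<theta> = trig modes (z' t) \<theta>" for t \<theta>
  proof (rule vector_derivative_unique_at)
    show "((\<lambda>t. fieldZ ?X t \<theta>) has_vector_derivative fieldZt ?X t \<theta>) (at t)" using C by blast
    show "((\<lambda>t. fieldZ ?X t \<theta>) has_vector_derivative trig modes (z' t) \<theta>) (at t)"
      unfolding f trig_def z_def z'_def
      by (intro has_vector_derivative_sum has_vector_derivative_mult_left has_vector_derivative_mult_right has_vector_derivative_of_real)
        (rule DERIV_profile[OF b])
  qed
  have fs: "fieldZs ?X t \<theta> = trig modes (\<lambda>j. \<i> * of_int j * z t j) \<theta>" for t \<theta>
  proof (rule vector_derivative_unique_at)
    show "(fieldZ ?X t has_vector_derivative fieldZs ?X t \<theta>) (at \<theta>)" using C by blast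
    have "(trig modes (z t) has_vector_derivative (\<Sum>j\<in>modes. z t j * (\<i> * of_real (of_int j) * cis (of_int j * \<theta>)))) (at \<theta>)"
      unfolding trig_def[abs_def] by (intro has_vector_derivative_sum has_vector_derivative_mult_right has_vector_derivative_cis)
    moreover have "(\<Sum>j\<in>modes. z t j * (\<i> * of_real (of_int j) * cis (of_int j * \<theta>))) = trig modes (\<lambda>j. \<i> * of_int j * z t j) \<theta>"
      unfolding trig_def by (simp add: mult_ac)
    moreover have "fieldZ ?X t = trig modes (z t)" by (rule ext) (rule f)
    ultimately show "(fieldZ ?X t has_vector_derivative trig modes (\<lambda>j. \<i> * of_int j * z t j) \<theta>) (at \<theta>)" by simp
  qed
  define q where "q j t = mode_form (of_int j) t (profile \<psi> N (- slope j) t) (profile \<psi> N (slope j) t)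
      (profile' \<psi> \<psi>' N (- slope j) t) (profile' \<psi> \<psi>' N (slope j) t)" for j t
  have "2 * pi * half_modes (k - 1) t (z t) (z' t) = pi * (\<Sum>j\<in>modes. (cmod (zeta c j))\<^sup>2 * q j t)" for t
    unfolding half_modes_def z_def z'_def q_def
    by (simp only: complex_cnj_mult complex_cnj_complex_of_real cnj_zeta slope_minus minus_minus pair_form_scale sum_divide_distrib[symmetric])
  from trans[OF density_integral_trig[OF f ft fs] this]
  have "cyl ?X = integral {-N..N} (\<lambda>t. pi * (\<Sum>j\<in>modes. (cmod (zeta c j))\<^sup>2 * q j t))"
    unfolding cyl_eq[OF X less_imp_le[OF N]] dens_def fst_conv snd_conv by (simp only:)
  also have "\<dots> = pi * (\<Sum>j\<in>modes. integral {-N..N} (\<lambda>t. (cmod (zeta c j))\<^sup>2 * q j t))"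
  proof -
    have cps: "continuous_on UNIV \<psi>" using b by (intro smooth_continuous) (simp add: bump_def)
    have cps': "continuous_on UNIV \<psi>'" using b by (simp add: bump_def)
    have dv: "continuous_on {-N..N} (\<lambda>t. t / N)" using N by (intro continuous_intros) auto
    have "continuous_on {-N..N} (\<lambda>t. \<psi> (t / N))" "continuous_on {-N..N} (\<lambda>t. \<psi>' (t / N))"
      by (rule continuous_on_compose2[OF cps dv subset_UNIV] continuous_on_compose2[OF cps' dv subset_UNIV])+
    then have "continuous_on {-N..N} (q j)" for j
      unfolding q_def mode_form_def profile_def profile'_def using N by (intro continuous_intros) auto
    then have "(\<lambda>t. (cmod (zeta c j))\<^sup>2 * q j t) integrable_on {-N..N}" for j
      by (intro integrable_continuous_interval continuous_intros)
    then show ?thesis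
      unfolding integral_mult_right by (subst Henstock_Kurzweil_Integration.integral_sum) auto
  qed
  finally show ?thesis unfolding mode_energy_def q_def integral_mult_right .
qed

lemma exists_negative_bump:
  "\<exists>\<psi> \<psi>' N. bump \<psi> \<psi>' \<and> 0 < N \<and> (\<forall>j\<in>modes. mode_energy \<psi> \<psi>' N j < 0)"
proof (rule exists_bump)
  fix \<psi> \<psi>' :: "real \<Rightarrow> real"
  assume p: "smooth \<psi>" "\<And>x. (\<psi> has_real_derivative \<psi>' x) (at x)"
    "continuous_on UNIV \<psi>'" "\<And>x. 1 \<le> \<bar>x\<bar> \<Longrightarrow> \<psi> x = 0" "\<And>x. \<bar>x\<bar> < 1 \<Longrightarrow> 0 < \<psi> x" "\<And>x. \<psi> (- x) = \<psi> x"
  have b: "bump \<psi> \<psi>'" unfolding bump_def using p by blast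
  have "\<exists>N0>0. \<forall>N\<ge>N0. mode_energy \<psi> \<psi>' N j < 0" if "j \<in> modes" for j
  proof -
    have "\<bar>j\<bar> < int k" using that l_less by auto
    then have "\<bar>of_int j\<bar> < \<kappa>" unfolding kappa_eq by linarith
    from mode_form_test_negative[OF p(2-5) this] show ?thesis
      unfolding mode_energy_def profile_def profile'_def by simp
  qed
  then have "\<forall>j\<in>modes. \<exists>N0>0. \<forall>N\<ge>N0. mode_energy \<psi> \<psi>' N j < 0" by blast
  then obtain f where f: "\<forall>j\<in>modes. 0 < f j \<and> (\<forall>N\<ge>f j. mode_energy \<psi> \<psi>' N j < 0)" by (metis bchoice)
  \<comment> \<open>Every mode has its own threshold for the cut-off length; there are finitely
    many, so one length serves all.\<close>
  define N where "N = Max (f ` modes)"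
  have "f j \<le> N" if "j \<in> modes" for j unfolding N_def using that by (intro Max_ge) auto
  \<comment> \<open>Mode 0 is always present, which gives the positivity of N.\<close>
  moreover have "0 \<in> modes" by simp
  ultimately have "0 < N" "\<forall>j\<in>modes. mode_energy \<psi> \<psi>' N j < 0" using f by force+
  then show ?thesis using b by blast
qed

lemma zeta_eq_0:
  assumes "\<And>j. j \<in> modes \<Longrightarrow> zeta c j = 0" "c \<in> coords modes"
  shows "c = 0"
proof
  fix a
  show "c a = (0 :: int \<Rightarrow> real) a"
  proof (cases "a \<in> modes")
    case True
    then have "\<bar>a\<bar> \<in> modes" by auto
    from assms(1)[OF this] show ?thesis by (cases "0 \<le> a") (auto simp: zeta_def complex_eq_iff)
  qed (use assms(2) in \<open>auto simp: coords_def\<close>)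
qed

lemma cyl_test_negative:
  assumes b: "bump \<psi> \<psi>'" and N: "0 < N" and neg: "\<And>j. j \<in> modes \<Longrightarrow> mode_energy \<psi> \<psi>' N j < 0"
    and c: "c \<in> coords modes" "c \<noteq> 0"
  shows "cyl (test \<psi> N c) < 0"
proof -
  obtain i where i: "i \<in> modes" "zeta c i \<noteq> 0" using zeta_eq_0 c by blast
  have "(\<Sum>j\<in>modes. (cmod (zeta c j))\<^sup>2 * mode_energy \<psi> \<psi>' N j) < (\<Sum>j\<in>modes. 0)"
  proof (rule sum_strict_mono_ex1)
    show "\<forall>j\<in>modes. (cmod (zeta c j))\<^sup>2 * mode_energy \<psi> \<psi>' N j \<le> 0"
      using neg by (intro ballI mult_nonneg_nonpos) (auto simp: less_imp_le)
    show "\<exists>j\<in>modes. (cmod (zeta c j))\<^sup>2 * mode_energy \<psi> \<psi>' N j < 0"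
      using i neg[OF i(1)] by (intro bexI[OF _ i(1)] mult_pos_neg) auto
  qed simp
  then show ?thesis unfolding cyl_test[OF b N] by (intro mult_pos_neg) auto
qed

text \<open>The half turn multiplies mode j by (-1)^j. Reflecting t exchanges the exponents of j and
  - j, which the conjugate coefficients and the even cut-off undo; the parity of the support decides
  the sign.\<close>

lemma test_involution:
  assumes b: "bump \<psi> \<psi>'" and par: "even k" "odd l" and c: "\<And>a. c a \<noteq> 0 \<Longrightarrow> even a = e"
  shows "test \<psi> N c (- t, \<theta> + pi) = (if e then 1 else - 1) *\<^sub>R test \<psi> N c (t, \<theta>)"
proof -
  define s :: real where "s = (if e then 1 else - 1)"
  have cs: "cos (real m * (\<theta> + pi)) = (- 1) ^ m * cos (real m * \<theta>)"
    and sn: "sin (real m * (\<theta> + pi)) = (- 1) ^ m * sin (real m * \<theta>)" for m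
    by (simp_all add: distrib_left cos_add sin_add)
  have "N1 (- t, \<theta> + pi) = N1 (t, \<theta>)" "N2 (- t, \<theta> + pi) = - N2 (t, \<theta>)"
    using par cs sn by (auto simp: N1_def N2_def intro!: vec4_eqI)
  moreover have "\<psi> (- x) = \<psi> x" for x using b by (simp add: bump_def)
  moreover have "test_re c (- t, \<theta> + pi) = s * test_re c (t, \<theta>)" "test_im c (- t, \<theta> + pi) = - s * test_im c (t, \<theta>)"
  proof -
    have ci: "cos (of_int j * (\<theta> + pi)) = (if even j then 1 else - 1) * cos (of_int j * \<theta>)"
      "sin (of_int j * (\<theta> + pi)) = (if even j then 1 else - 1) * sin (of_int j * \<theta>)" for j :: int
    proof -
      have "cos (of_int j * pi) = (if even j then 1 else - 1)" "sin (of_int j * pi) = 0"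
        using cos_npi_int[of j] sin_npi_int[of j] by (simp_all add: mult.commute)
      then show "cos (of_int j * (\<theta> + pi)) = (if even j then 1 else - 1) * cos (of_int j * \<theta>)"
        "sin (of_int j * (\<theta> + pi)) = (if even j then 1 else - 1) * sin (of_int j * \<theta>)"
        by (simp_all add: distrib_left cos_add sin_add)
    qed
    have z: "zeta c j = 0" if "even j \<noteq> e" for j
      using c[of "\<bar>j\<bar>"] c[of "- \<bar>j\<bar>"] that by (auto simp: zeta_def complex_eq_iff)
    have zr: "Re (zeta c (- j)) = Re (zeta c j)" "Im (zeta c (- j)) = - Im (zeta c j)" for j
      using cnj_zeta[of c "- j"] by (auto simp: complex_eq_iff)
    \<comment> \<open>Reindexing by - j matches the reflected exponents with the original
      ones.\<close>
    have re: "(\<Sum>j\<in>modes. f j) = (\<Sum>j\<in>modes. f (- j))" for f :: "int \<Rightarrow> real"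
      by (rule sum_symmetric_int[symmetric])
    show "test_re c (- t, \<theta> + pi) = s * test_re c (t, \<theta>)"
      unfolding test_re_def sum_distrib_left fst_conv snd_conv ci
      by (subst re, rule sum.cong[OF refl], case_tac "even x = e") (auto simp: z zr s_def split: if_splits)
    show "test_im c (- t, \<theta> + pi) = - s * test_im c (t, \<theta>)"
      unfolding test_im_def sum_distrib_left fst_conv snd_conv ci
      by (subst re, rule sum.cong[OF refl], case_tac "even x = e") (auto simp: z zr s_def algebra_simps split: if_splits)
  qed
  ultimately have "test \<psi> N c (- t, \<theta> + pi) = s *\<^sub>R test \<psi> N c (t, \<theta>)"
    by (simp add: test_def algebra_simps)
  then show ?thesis by (simp add: s_def)
qed

end

section \<open>Sections over the quotient and the index\<close>

lemma periodic_int: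
  assumes per: "\<And>t \<theta>. X (t :: real, \<theta> + 2 * pi) = X (t, \<theta>)"
  shows "X (t, \<theta> + 2 * pi * of_int n) = X (t, \<theta>)"
proof (induction n rule: int_induct[of _ 0])
  case (step1 i)
  then show ?case using per[of t "\<theta> + 2 * pi * of_int i"] by (simp add: algebra_simps)
next
  case (step2 i)
  then show ?case using per[of t "\<theta> + 2 * pi * of_int (i - 1)"] by (simp add: algebra_simps)
qed simp

lemma cylinder_invariant_iff:
  "(\<forall>g\<in>cylinder_deck. \<forall>p. X (g p) = X p) \<longleftrightarrow> (\<forall>t \<theta>. X (t, \<theta> + 2 * pi) = X (t, \<theta>))"
proof
  assume "\<forall>g\<in>cylinder_deck. \<forall>p. X (g p) = X p"
  moreover have "(\<lambda>(t, \<theta>). (t, \<theta> + 2 * pi * of_int 1)) \<in> cylinder_deck" unfolding cylinder_deck_def by (rule rangeI)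
  ultimately have "\<forall>p. X ((\<lambda>(t, \<theta>). (t, \<theta> + 2 * pi * of_int 1)) p) = X p" by (rule bspec)
  then show "\<forall>t \<theta>. X (t, \<theta> + 2 * pi) = X (t, \<theta>)" by simp
next
  assume "\<forall>t \<theta>. X (t, \<theta> + 2 * pi) = X (t, \<theta>)"
  then show "\<forall>g\<in>cylinder_deck. \<forall>p. X (g p) = X p"
    using periodic_int[of X] by (auto simp: cylinder_deck_def)
qed

lemma moebius_invariant_iff:
  "(\<forall>g\<in>moebius_deck. \<forall>p. X (g p) = X p) \<longleftrightarrow>
     (\<forall>t \<theta>. X (t, \<theta> + 2 * pi) = X (t, \<theta>)) \<and> (\<forall>p. X (FS_involution p) = X p)"
proof -
  have id: "(\<lambda>p. p) \<in> cylinder_deck" using strip_action_cylinder by (simp add: strip_action_def)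
  have "(\<forall>g\<in>moebius_deck. \<forall>p. X (g p) = X p) \<longleftrightarrow>
     (\<forall>g\<in>cylinder_deck. \<forall>p. X (g p) = X p) \<and> (\<forall>g\<in>cylinder_deck. \<forall>p. X (g (FS_involution p)) = X p)"
    by (simp add: moebius_deck_def ball_Un)
  also have "\<dots> \<longleftrightarrow> (\<forall>g\<in>cylinder_deck. \<forall>p. X (g p) = X p) \<and> (\<forall>p. X (FS_involution p) = X p)"
    using id by metis
  finally show ?thesis unfolding cylinder_invariant_iff .
qed

context fraser_sargent begin

lemma normal_sections_iff:
  "X \<in> normal_sections (FS k l) \<longleftrightarrow> smooth X \<and> normal_field X \<and> (\<forall>t \<theta>. X (t, \<theta> + 2 * pi) = X (t, \<theta>)) \<and>
     (even k \<longrightarrow> (\<forall>p. X (FS_involution p) = X p))"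
proof -
  have "immersion (FS k l) = u" by (simp add: FS_def)
  moreover have "(\<forall>g\<in>deck (FS k l). \<forall>p. X (g p) = X p) \<longleftrightarrow>
     (\<forall>t \<theta>. X (t, \<theta> + 2 * pi) = X (t, \<theta>)) \<and> (even k \<longrightarrow> (\<forall>p. X (FS_involution p) = X p))"
  proof (cases "odd k")
    case True
    then have "deck (FS k l) = cylinder_deck" by (simp add: FS_def)
    then show ?thesis using True cylinder_invariant_iff[of X] by (simp only:) blast
  next
    case False
    then have "deck (FS k l) = moebius_deck" by (simp add: FS_def)
    then show ?thesis using False moebius_invariant_iff[of X] by (simp only:) blast
  qed
  ultimately show ?thesis unfolding normal_sections_def normal_field_iff by auto
qed

lemma normal_section_fields:
  assumes "X \<in> normal_sections (FS k l)" "\<And>p. L \<le> \<bar>fst p\<bar> \<Longrightarrow> X p = 0"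
  shows "X \<in> fields L"
  using assms unfolding normal_sections_iff fields_def by blast

text \<open>For even k the odd modes give the anti-invariant test fields and the even modes the
  invariant ones. The former are the larger class by one, so 2 * k - 1 minus k leaves the index of
  the Moebius band.\<close>

lemma card_parity_modes:
  assumes k: "even k"
  shows "card {j \<in> modes. odd j} = k" "card {j \<in> modes. even j} = k - 1"
proof -
  obtain h where h: "k = 2 * h" using k by (rule evenE)
  have h0: "0 < h" using l_less h by simp
  have o: "{j \<in> modes. odd j} = (\<lambda>i. 2 * i + 1) ` {- int h..int h - 1}"
  proof (intro equalityI subsetI)
    fix j assume j: "j \<in> {j \<in> modes. odd j}"
    then obtain i where "j = 2 * i + 1" by (auto elim: oddE)
    then show "j \<in> (\<lambda>i. 2 * i + 1) ` {- int h..int h - 1}" using j h h0 by (intro image_eqI[of _ _ i]) auto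
  qed (use h h0 in auto)
  have e: "{j \<in> modes. even j} = (\<lambda>i. 2 * i) ` {- (int h - 1)..int h - 1}"
  proof (intro equalityI subsetI)
    fix j assume j: "j \<in> {j \<in> modes. even j}"
    then obtain i where "j = 2 * i" by (auto elim: evenE)
    then show "j \<in> (\<lambda>i. 2 * i) ` {- (int h - 1)..int h - 1}" using j h h0 by (intro image_eqI[of _ _ i]) auto
  qed (use h h0 in auto)
  show "card {j \<in> modes. odd j} = k" unfolding o by (subst card_image) (auto simp: inj_on_def h)
  show "card {j \<in> modes. even j} = k - 1" unfolding e using h0 by (subst card_image) (auto simp: inj_on_def h nat_diff_distrib)
qed

lemma coords_mono: "A \<subseteq> B \<Longrightarrow> c \<in> coords A \<Longrightarrow> c \<in> coords B"
  by (auto simp: coords_def)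

text \<open>On the Moebius band the index is cut down by adjoining to an invariant negative space the anti-invariant
  test fields: they are orthogonal to it for the second variation of the covering cylinder.\<close>

lemma negative_section_space_le:
  assumes par: "coprime k l" and V: "subspace V" and \<Omega>: "bounded_domain (FS k l) \<Omega>"
    and sec: "V \<subseteq> {X \<in> normal_sections (FS k l). section_support (FS k l) X \<subseteq> \<Omega>}"
    and neg: "\<forall>X\<in>V. X \<noteq> 0 \<longrightarrow> second_variation (FS k l) X < 0"
  shows "vdim V \<le> enat (if odd k then 2 * k - 1 else k - 1)"
proof -
  have VF: "\<exists>L>0. X \<in> fields L" if "X \<in> V" for X
  proof -
    have X: "X \<in> normal_sections (FS k l)" "section_support (FS k l) X \<subseteq> \<Omega>" using sec that by blast+
    obtain L where "0 < L" "\<forall>p. L \<le> \<bar>fst p\<bar> \<longrightarrow> X p = 0" using FS_support_bound[OF \<Omega> X(2)] by blast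
    then show ?thesis using normal_section_fields[OF X(1), of L] by blast
  qed
  have inv: "even k \<Longrightarrow> X (FS_involution p) = X p" if "X \<in> V" for X p
  proof -
    assume "even k"
    have "X \<in> normal_sections (FS k l)" using sec that by blast
    from normal_sections_iff[THEN iffD1, OF this] show ?thesis using \<open>even k\<close> by blast
  qed
  have Vneg: "cyl X < 0" if X: "X \<in> V" "X \<noteq> 0" for X
  proof -
    obtain L where L: "0 < L" "X \<in> fields L" using VF[OF X(1)] by blast
    have "second_variation (FS k l) X < 0" using neg X by blast
    then show ?thesis using second_variation_cyl[OF par L(2) less_imp_le[OF L(1)] inv[OF X(1)]] by blast
  qed
  show ?thesis
  proof (cases "odd k")
    case True
    obtain B where B: "finite B" "card B \<le> 2 * k - 1" "V \<subseteq> span B"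
      using negative_subspace_span[OF V VF Vneg] by blast
    have "vdim V \<le> enat (card B)" by (rule vdim_le_card[OF B(1,3)])
    also have "\<dots> \<le> enat (2 * k - 1)" using B(2) by simp
    finally show ?thesis using True by simp
  next
    case False
    then have ev: "even k" "odd l" using par coprime_common_divisor[of k l 2] by auto
    obtain \<psi> \<psi>' N where b: "bump \<psi> \<psi>'" "0 < N" "\<forall>j\<in>modes. mode_energy \<psi> \<psi>' N j < 0"
      using exists_negative_bump by blast
    define A where "A = {j \<in> modes. odd j}"
    have A': "A \<subseteq> modes" by (auto simp: A_def)
  have A: "finite A" "A \<subseteq> modes" using A' finite_subset[OF A'] by simp_all
    have Tneg: "cyl (test \<psi> N c) < 0" if "c \<in> coords A" "c \<noteq> 0" for c
      using cyl_test_negative[OF b(1,2)] b(3) coords_mono[OF A(2) that(1)] that(2) by blast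
    have Tinj: "c = 0" if "c \<in> coords A" "test \<psi> N c = 0" for c
    proof (rule ccontr)
      assume "c \<noteq> 0"
      then have "cyl (test \<psi> N c) < 0" by (rule Tneg[OF that(1)])
      then show False unfolding that(2) cyl_0 by simp
    qed
    define D where "D = (\<lambda>a. test \<psi> N (unit_coord a)) ` A"
    have D: "finite D" "card D = card A" "independent D" "test \<psi> N ` coords A = span D"
      unfolding D_def by (rule coords_basis[where T = "test \<psi> N" and A = A]; use A(1) linear_test Tinj in blast)+
    have anti: "w (- t, \<theta> + pi) = - w (t, \<theta>)" if w: "w \<in> span D" for w t \<theta>
    proof -
      obtain c where c: "c \<in> coords A" "w = test \<psi> N c" using w D(4) by blast
      have "even a = False" if "c a \<noteq> 0" for a using c(1) that by (auto simp: coords_def A_def)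
      from test_involution[OF b(1) ev this] show ?thesis unfolding c(2) by simp
    qed
    have sum: "cyl (v + w) = cyl v + cyl w" "\<exists>L>0. v + w \<in> fields L" if v: "v \<in> V" and w: "w \<in> span D" for v w
    proof -
      obtain L where L: "0 < L" "v \<in> fields L" using VF[OF v] by blast
      define K where "K = max L N"
      obtain c where c: "w = test \<psi> N c" using w D(4) by blast
      have K: "v \<in> fields K" "w \<in> fields K" "0 < K"
        using fields_mono[OF L(2), of K] fields_mono[OF test_fields[OF b(1,2)], of K c] b(2) by (auto simp: K_def c)
      \<comment> \<open>The involution fixes v and reverses w, so it carries one of these fields to
        the other; by the parallelogram law the energies then add.\<close>
      have "cyl (v - w) = cyl (v + w)"
      proof (rule cyl_involution[OF ev fields_linear(1)[OF K(1,2)] fields_linear(2)[OF K(1,2)] less_imp_le[OF K(3)]])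
        fix t \<theta>
        have "v (- t, \<theta> + pi) = v (t, \<theta>)" using inv[OF v ev(1), of "(t, \<theta>)"] by (simp add: FS_involution_def)
        then show "(v - w) (t, \<theta>) = (v + w) (- t, \<theta> + pi)" using anti[OF w, of t \<theta>] by simp
      qed
      then show "cyl (v + w) = cyl v + cyl w"
        using cyl_parallelogram[OF K(1,2) less_imp_le[OF K(3)]] by simp
      show "\<exists>L>0. v + w \<in> fields L" using fields_linear(1)[OF K(1,2)] K(3) by blast
    qed
    \<comment> \<open>Negative on the cylinder and containing both V and the anti-invariant test
      fields, hence subject to the bound of the cylinder.\<close>
    define W where "W = {v + w |v w. v \<in> V \<and> w \<in> span D}"
    have W: "subspace W" unfolding W_def by (rule subspace_sums[OF V subspace_span])
    have WF: "\<exists>L>0. X \<in> fields L" if "X \<in> W" for X using that sum(2) unfolding W_def by blast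
    have Wneg: "cyl X < 0" if X: "X \<in> W" "X \<noteq> 0" for X
    proof -
      obtain v w where vw: "X = v + w" "v \<in> V" "w \<in> span D" using X(1) by (auto simp: W_def)
      obtain c where c: "c \<in> coords A" "w = test \<psi> N c" using vw(3) D(4) by blast
      have "test \<psi> N 0 = 0" by (rule linear_0[OF linear_test])
      then have "w \<noteq> 0 \<Longrightarrow> cyl w < 0" using Tneg[OF c(1)] c(2) by auto
      then show ?thesis unfolding vw(1) sum(1)[OF vw(2,3)] using Vneg[OF vw(2)] cyl_0 X(2) vw(1)
        by (cases "v = 0"; cases "w = 0") auto
    qed
    obtain B where B: "finite B" "card B \<le> 2 * k - 1" "W \<subseteq> span B"
      using negative_subspace_span[OF W WF Wneg] by blast
    have VW: "V \<subseteq> W" 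
    proof
      fix v assume "v \<in> V"
      then have "v + 0 \<in> W" unfolding W_def using span_zero by blast
      then show "v \<in> W" by simp
    qed
    have DW: "D \<subseteq> W"
    proof
      fix d assume "d \<in> D"
      then have "0 + d \<in> W" unfolding W_def using subspace_0[OF V] span_base by blast
      then show "d \<in> W" by simp
    qed
    have "V \<inter> span D \<subseteq> {0}"
    proof
      fix w assume w: "w \<in> V \<inter> span D"
      have "w (t, \<theta>) = 0" for t \<theta>
      proof -
        have "w (- t, \<theta> + pi) = w (t, \<theta>)" using inv[of w "(t, \<theta>)"] ev(1) w by (simp add: FS_involution_def)
        then have "w (t, \<theta>) = - w (t, \<theta>)" using anti[of w t \<theta>] w by simp
        then show ?thesis by (simp add: vec_eq_iff)
      qed
      then show "w \<in> {0}" by (auto simp: fun_eq_iff)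
    qed
    from vdim_complement_le[OF V D(1,3) this B(1) subset_trans[OF VW B(3)] subset_trans[OF DW B(3)]]
    have "vdim V \<le> enat (card B - card D)" .
    \<comment> \<open>There are k odd modes, and 2 * k - 1 - k = k - 1.\<close>
    also have "card B - card D \<le> k - 1"
      using B(2) card_parity_modes(1)[OF ev(1)] unfolding D(2) A_def by linarith
    finally show ?thesis using False by simp
  qed
qed

lemma index_FS:
  assumes par: "coprime k l"
  shows "index (FS k l) = enat (if odd k then 2 * k - 1 else k - 1)"
proof (rule antisym)
  show "index (FS k l) \<le> enat (if odd k then 2 * k - 1 else k - 1)"
    unfolding index_def
  proof (rule SUP_least)
    fix \<Omega> assume "\<Omega> \<in> {\<Omega>. bounded_domain (FS k l) \<Omega>}"
    then have \<Omega>: "bounded_domain (FS k l) \<Omega>" by (rule CollectD)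
    show "index_on (FS k l) \<Omega> \<le> enat (if odd k then 2 * k - 1 else k - 1)"
      unfolding index_on_def
      by (rule Sup_least, elim CollectE exE conjE, erule ssubst, rule negative_section_space_le[OF par _ \<Omega>], assumption+)
  qed
next
  obtain \<psi> \<psi>' N where b: "bump \<psi> \<psi>'" "0 < N" "\<forall>j\<in>modes. mode_energy \<psi> \<psi>' N j < 0"
    using exists_negative_bump by blast
  \<comment> \<open>All modes on the cylinder; on the Moebius band only the even ones, whose test
    fields are invariant.\<close>
  define A where "A = {j \<in> modes. odd k \<or> even j}"
  have A': "A \<subseteq> modes" by (auto simp: A_def)
  have A: "finite A" "A \<subseteq> modes" using A' finite_subset[OF A'] by simp_all
  have cA: "card A = (if odd k then 2 * k - 1 else k - 1)"
  proof (cases "odd k")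
    case True
    then have "A = modes" by (auto simp: A_def)
    then show ?thesis using True l_less by (simp add: nat_diff_distrib)
  next
    case False
    then have "A = {j \<in> modes. even j}" by (auto simp: A_def)
    then show ?thesis using card_parity_modes(2) False by simp
  qed
  have Tneg: "cyl (test \<psi> N c) < 0" if "c \<in> coords A" "c \<noteq> 0" for c
    using cyl_test_negative[OF b(1,2)] b(3) coords_mono[OF A(2) that(1)] that(2) by blast
  have Tinj: "c = 0" if "c \<in> coords A" "test \<psi> N c = 0" for c
  proof (rule ccontr)
    assume "c \<noteq> 0"
    then have "cyl (test \<psi> N c) < 0" by (rule Tneg[OF that(1)])
    then show False unfolding that(2) cyl_0 by simp
  qed
  note F = test_fields[OF b(1,2)]
  have inv: "test \<psi> N c (FS_involution p) = test \<psi> N c p" if c: "c \<in> coords A" and k: "even k" for c p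
  proof -
    have l: "odd l" using k par coprime_common_divisor[of k l 2] by auto
    have "even a = True" if "c a \<noteq> 0" for a using c k that by (auto simp: coords_def A_def)
    from test_involution[OF b(1) k l this, where N = N and t = "fst p" and \<theta> = "snd p"] show ?thesis
      by (simp add: FS_involution_def case_prod_unfold)
  qed
  define V where "V = test \<psi> N ` coords A"
  define \<Omega> where "\<Omega> = strip k l (N + 1)"
  have vd: "vdim V = enat (card A)"
    unfolding V_def by (rule vdim_image_coords[OF A(1) linear_test Tinj])
  have V1: "subspace V" unfolding V_def by (rule linear_subspace_image[OF linear_test subspace_coords])
  have V2: "V \<subseteq> {X \<in> normal_sections (FS k l). section_support (FS k l) X \<subseteq> \<Omega>}"
  proof
    fix X assume "X \<in> V"
    then obtain c where c: "c \<in> coords A" "X = test \<psi> N c" unfolding V_def by blast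
    have "X \<in> normal_sections (FS k l)"
      unfolding normal_sections_iff c(2) using F[of c] inv[OF c(1)] unfolding fields_def by blast
    moreover have "section_support (FS k l) X \<subseteq> \<Omega>"
      unfolding \<Omega>_def c(2) by (rule FS_strip_domain(2)) (rule fieldsD(4)[OF F])
    ultimately show "X \<in> {X \<in> normal_sections (FS k l). section_support (FS k l) X \<subseteq> \<Omega>}" by blast
  qed
  have V3: "\<forall>X\<in>V. X \<noteq> 0 \<longrightarrow> second_variation (FS k l) X < 0"
  proof (intro ballI impI)
    fix X assume "X \<in> V" and X: "X \<noteq> 0"
    then obtain c where c: "c \<in> coords A" "X = test \<psi> N c" unfolding V_def by blast
    have "c \<noteq> 0"
    proof
      assume "c = 0"
      then have "X = 0" unfolding c(2) by (simp only: linear_0[OF linear_test])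
      then show False using X by contradiction
    qed
    then have "cyl (test \<psi> N c) < 0" by (rule Tneg[OF c(1)])
    then show "second_variation (FS k l) X < 0"
      unfolding c(2) using second_variation_cyl[OF par F[of c] less_imp_le[OF b(2)] inv[OF c(1)]] by blast
  qed
  have "vdim V \<in> {vdim V |V. subspace V \<and>
     V \<subseteq> {X \<in> normal_sections (FS k l). section_support (FS k l) X \<subseteq> \<Omega>} \<and>
     (\<forall>X\<in>V. X \<noteq> 0 \<longrightarrow> second_variation (FS k l) X < 0)}"
    by (intro CollectI exI[of _ V] conjI refl V1 V2 V3)
  then have "vdim V \<le> index_on (FS k l) \<Omega>" unfolding index_on_def by (rule Sup_upper)
  also have "\<dots> \<le> index (FS k l)"
    unfolding index_def \<Omega>_def using FS_strip_domain(1) by (intro SUP_upper) simp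
  finally show "enat (if odd k then 2 * k - 1 else k - 1) \<le> index (FS k l)" unfolding vd cA .
qed

end

section \<open>Constant vectors give bounded Jacobi fields\<close>

lemma Re_Im_deriv:
  assumes "(f has_vector_derivative f') (at (x :: real))"
  shows "((\<lambda>x. Re (f x)) has_real_derivative Re f') (at x)" "((\<lambda>x. Im (f x)) has_real_derivative Im f') (at x)"
  using bounded_linear.has_vector_derivative[OF bounded_linear_Re assms] bounded_linear.has_vector_derivative[OF bounded_linear_Im assms]
  by (simp_all add: has_real_derivative_iff_has_vector_derivative)

lemma fcoef_cnj:
  assumes "continuous_on {0..2*pi} f"
  shows "fcoef (\<lambda>\<theta>. cnj (f \<theta>)) j = cnj (fcoef f (- j))"
proof -
  have "(\<lambda>\<theta>. f \<theta> * cis (- (of_int (- j) * \<theta>))) integrable_on {0..2*pi}"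
    by (intro integrable_continuous_interval continuous_intros assms)
  then show ?thesis unfolding fcoef_def
    using integral_linear[OF _ bounded_linear_cnj, of "\<lambda>\<theta>. f \<theta> * cis (- (of_int (- j) * \<theta>))" "{0..2*pi}"]
    by (simp add: o_def cis_cnj)
qed

lemma norm_fcoef_le:
  assumes f: "continuous_on {0..2*pi} f" and C: "\<And>\<theta>. cmod (f \<theta>) \<le> C"
  shows "cmod (fcoef f j) \<le> 2 * pi * C"
proof -
  have "cmod (f 0) \<le> C" by (rule C)
  then have "0 \<le> C" using norm_ge_zero order_trans by blast
  then have "cmod (fcoef f j) \<le> C * (2 * pi - 0)"
    unfolding fcoef_def
    using C by (intro integral_bound continuous_intros f) (auto simp: norm_mult)
  then show ?thesis by (simp add: mult.commute)
qed

text \<open>Parseval forces the square norm to vanish, and a continuous non-negative function with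
  zero integral is zero.\<close>

lemma fcoef_all_zero:
  assumes f: "continuous_on {0..2*pi} f" and per: "f 0 = f (2*pi)" and z: "\<And>j. fcoef f j = 0" and x: "x \<in> {0..2*pi}"
  shows "f x = 0"
proof -
  let ?g = "\<lambda>\<theta>. (cmod (f \<theta>))\<^sup>2"
  have c: "continuous_on {0..2*pi} ?g" by (intro continuous_intros f)
  have "2 * pi * integral {0..2*pi} ?g \<le> e" if "0 < e" for e
    using parseval_deficit[OF f per that] z by auto
  then have "2 * pi * integral {0..2*pi} ?g \<le> 0" by (rule field_le_epsilon[of _ 0, simplified])
  then have "integral {0..2*pi} ?g \<le> 0" by (metis mult_pos_pos not_le pi_gt_zero zero_less_numeral)
  moreover have "0 \<le> integral {0..2*pi} ?g" by (intro integral_nonneg integrable_continuous_interval c) auto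
  ultimately have "integral {0..2*pi} ?g = 0" by simp
  then have "\<forall>\<theta>\<in>{0..2*pi}. ?g \<theta> = 0" using integral_eq_0_iff[OF c] by simp
  then show ?thesis using x by simp
qed

context fraser_sargent begin

text \<open>Each difference of squares factors into terms such as (k + l) * (1 + tanh ((k + l) *
  t)), and such a term equals \<open>wa t\<close> times an exponential.\<close>

lemma ex_identities:
  fixes t :: real
  shows "(real k + rate t)\<^sup>2 - (real l + conn t)\<^sup>2 = wa t * wb t * exp (2 * real k * t)"
  "(real k - rate t)\<^sup>2 - (real l - conn t)\<^sup>2 = wa t * wb t * exp (- (2 * real k * t))"
  "(real l + rate t)\<^sup>2 - (real k + conn t)\<^sup>2 = - (wa t * wb t * exp (2 * real l * t))"
  "(real l - rate t)\<^sup>2 - (real k - conn t)\<^sup>2 = - (wa t * wb t * exp (- (2 * real l * t)))"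
proof -
  let ?a = "real k + real l" and ?b = "real k - real l"
  have p: "?a + ?a * tanh (?a * t) = wa t * exp (?a * t)" "?a - ?a * tanh (?a * t) = wa t * exp (- (?a * t))"
    "?b + ?b * tanh (?b * t) = wb t * exp (?b * t)" "?b - ?b * tanh (?b * t) = wb t * exp (- (?b * t))"
  proof -
    have "?a * (1 + tanh (?a * t)) = wa t * exp (?a * t)" "?a * (1 - tanh (?a * t)) = wa t * exp (- (?a * t))"
      "?b * (1 + tanh (?b * t)) = wb t * exp (?b * t)" "?b * (1 - tanh (?b * t)) = wb t * exp (- (?b * t))"
      unfolding one_plus_tanh by (simp_all add: wa_def wb_def)
    then show "?a + ?a * tanh (?a * t) = wa t * exp (?a * t)" "?a - ?a * tanh (?a * t) = wa t * exp (- (?a * t))"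
    "?b + ?b * tanh (?b * t) = wb t * exp (?b * t)" "?b - ?b * tanh (?b * t) = wb t * exp (- (?b * t))"
      by (simp_all only: distrib_left right_diff_distrib mult_1_right)
  qed
  have f: "(K + \<rho>)\<^sup>2 - (L + \<gamma>)\<^sup>2 = (K + L + (\<rho> + \<gamma>)) * (K - L + (\<rho> - \<gamma>))"
    "(K - \<rho>)\<^sup>2 - (L - \<gamma>)\<^sup>2 = (K + L - (\<rho> + \<gamma>)) * (K - L - (\<rho> - \<gamma>))"
    "(L + \<rho>)\<^sup>2 - (K + \<gamma>)\<^sup>2 = - ((K + L + (\<rho> + \<gamma>)) * (K - L - (\<rho> - \<gamma>)))"
    "(L - \<rho>)\<^sup>2 - (K - \<gamma>)\<^sup>2 = - ((K + L - (\<rho> + \<gamma>)) * (K - L + (\<rho> - \<gamma>)))" for K L \<rho> \<gamma> :: real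
    by (simp_all add: power2_eq_square algebra_simps)
  have e: "exp (2 * real k * t) = exp (?a * t) * exp (?b * t)" "exp (- (2 * real k * t)) = exp (- (?a * t)) * exp (- (?b * t))"
    "exp (2 * real l * t) = exp (?a * t) * exp (- (?b * t))" "exp (- (2 * real l * t)) = exp (- (?a * t)) * exp (?b * t)"
    by (simp_all add: exp_add[symmetric] algebra_simps)
  show "(real k + rate t)\<^sup>2 - (real l + conn t)\<^sup>2 = wa t * wb t * exp (2 * real k * t)"
  "(real k - rate t)\<^sup>2 - (real l - conn t)\<^sup>2 = wa t * wb t * exp (- (2 * real k * t))"
  "(real l + rate t)\<^sup>2 - (real k + conn t)\<^sup>2 = - (wa t * wb t * exp (2 * real l * t))"
  "(real l - rate t)\<^sup>2 - (real k - conn t)\<^sup>2 = - (wa t * wb t * exp (- (2 * real l * t)))"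
    unfolding e f(1,2)[of "real k" _ "real l"] f(3,4)[of "real l" _ "real k"] rate_conn
    unfolding p by (simp_all only: mult_ac)
qed

text \<open>What the Jacobi equation of the frequency n leaves over for \<open>ex c\<close> before
  the coupling to the opposite frequency is added. For the fields of constant vectors it is
  compensated by that coupling.\<close>

definition residual :: "real \<Rightarrow> real \<Rightarrow> real \<Rightarrow> real" where
  "residual c n t = (((c - rate t)\<^sup>2 - ((wa t)\<^sup>2 + (wb t)\<^sup>2) / 2) - pot n t) * ex c t"

lemma residual_modes:
  "residual (real k) (- real l) t = wa t * wb t * ex (- real k) t" "residual (- real k) (real l) t = wa t * wb t * ex (real k) t"
  "residual (real l) (- real k) t = - (wa t * wb t * ex (- real l) t)" "residual (- real l) (real k) t = - (wa t * wb t * ex (real l) t)"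
proof -
  have e: "exp (- (2 * c * t)) * ex c t = ex (- c) t" "exp (2 * c * t) * ex (- c) t = ex c t" for c
    unfolding ex_def mult.assoc[symmetric] exp_add[symmetric] by (simp_all add: algebra_simps)
  have r: "residual c n t = w * (f * ex c t)" if "(c - rate t)\<^sup>2 - (n + conn t)\<^sup>2 = w * f" for c n w f
  proof -
    have "residual c n t = ((c - rate t)\<^sup>2 - (n + conn t)\<^sup>2) * ex c t" by (simp add: residual_def pot_def)
    then show ?thesis by (simp only: that mult.assoc)
  qed
  let ?w = "wa t * wb t"
  have "residual (real k) (- real l) t = ?w * (exp (- (2 * real k * t)) * ex (real k) t)"
    by (rule r) (use ex_identities(2)[of t] in \<open>simp add: power2_eq_square algebra_simps\<close>)
  then show "residual (real k) (- real l) t = wa t * wb t * ex (- real k) t" unfolding e .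
  have "residual (- real k) (real l) t = ?w * (exp (2 * real k * t) * ex (- real k) t)"
    by (rule r) (use ex_identities(1)[of t] in \<open>simp add: power2_eq_square algebra_simps\<close>)
  then show "residual (- real k) (real l) t = wa t * wb t * ex (real k) t" unfolding e .
  have "residual (real l) (- real k) t = - ?w * (exp (- (2 * real l * t)) * ex (real l) t)"
    by (rule r) (use ex_identities(4)[of t] in \<open>simp add: power2_eq_square algebra_simps\<close>)
  then show "residual (real l) (- real k) t = - (wa t * wb t * ex (- real l) t)" unfolding e by simp
  have "residual (- real l) (real k) t = - ?w * (exp (2 * real l * t) * ex (- real l) t)"
    by (rule r) (use ex_identities(3)[of t] in \<open>simp add: power2_eq_square algebra_simps\<close>)
  then show "residual (- real l) (real k) t = - (wa t * wb t * ex (real l) t)" unfolding e by simp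
qed

text \<open>The first coordinate plane rotates with frequency l and the second one with frequency k,
  while the hyperbolic factors carry the other number as exponent: frequencies l and - l go with
  \<open>ex\<close> of plus or minus k, and conversely. The halves come from writing cosh and sinh
  by exponentials.\<close>

lemma comp_constant:
  fixes w :: "real ^ 4"
  defines "a \<equiv> Complex (w $ 1 / 2) (w $ 2 / 2)" and "b \<equiv> - Complex (w $ 3 / 2) (w $ 4 / 2)"
  shows "comp (t, \<theta>) w = a * of_real (ex k t) * cis (- real l * \<theta>) + - cnj a * of_real (ex (- real k) t) * cis (real l * \<theta>)
     + b * of_real (ex l t) * cis (- real k * \<theta>) + cnj b * of_real (ex (- real l) t) * cis (real k * \<theta>)"
  unfolding comp_def N1_def N2_def inner_vec4' a_def b_def complex_eq_iff ex_def cosh_def sinh_def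
  by (simp add: field_simps)

text \<open>First and second covariant derivatives of a field in the complex coordinate, bundled. In
  direction t they are plain derivatives; \<open>Z2\<close> and \<open>Z22\<close> are covariant in
  \<theta>, hence the connection terms on the right.\<close>

definition jacobi_system where
  "jacobi_system X ZT ZTT Z2 Z22 \<longleftrightarrow>
     (\<forall>t \<theta>. ((\<lambda>t. fieldZ X t \<theta>) has_vector_derivative ZT t \<theta>) (at t)) \<and>
     (\<forall>t \<theta>. ((\<lambda>t. ZT t \<theta>) has_vector_derivative ZTT t \<theta>) (at t)) \<and>
     (\<forall>t \<theta>. (fieldZ X t has_vector_derivative Z2 t \<theta> - \<i> * of_real (conn t) * fieldZ X t \<theta>) (at \<theta>)) \<and>
     (\<forall>t \<theta>. (Z2 t has_vector_derivative Z22 t \<theta> - \<i> * of_real (conn t) * Z2 t \<theta>) (at \<theta>)) \<and>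
     (\<forall>t \<theta>. comp (t, \<theta>) (jacobi_op u X (t, \<theta>)) = of_real ((\<nu> t)\<^sup>2) *
       (ZTT t \<theta> + Z22 t \<theta> + of_real (((wa t)\<^sup>2 + (wb t)\<^sup>2) / 2) * fieldZ X t \<theta> + of_real (wa t * wb t) * cnj (fieldZ X t \<theta>))) \<and>
     (continuous_on UNIV (\<lambda>(t, \<theta>). ZT t \<theta>)) \<and>
     (continuous_on UNIV (\<lambda>(t, \<theta>). ZTT t \<theta>)) \<and>
     (continuous_on UNIV (\<lambda>(t, \<theta>). Z2 t \<theta>)) \<and>
     (continuous_on UNIV (\<lambda>(t, \<theta>). Z22 t \<theta>)) \<and>
     (\<forall>t. Z2 t 0 = Z2 t (2 * pi))"

lemma comp_jacobi_op_derivatives: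
  assumes X: "smooth X" "normal_field X" and per: "\<And>t \<theta>. X (t, \<theta> + 2 * pi) = X (t, \<theta>)"
  shows "\<exists>ZT ZTT Z2 Z22. jacobi_system X ZT ZTT Z2 Z22"
proof -
  define Y1 where "Y1 = (\<lambda>p. npart p (dd X (1, 0) p))"
  define Y2 where "Y2 = (\<lambda>p. npart p (dd X (0, 1) p))"
  have s: "smooth Y1" "smooth Y2" unfolding Y1_def Y2_def by (intro smooth_npart smooth_dd X(1))+
  have n: "normal_field Y1" "normal_field Y2" unfolding Y1_def Y2_def normal_field_def npart_npart by simp_all
  have c: "comp p (Y1 p) = comp p (dd X (1, 0) p)" "comp p (Y2 p) = comp p (dd X (0, 1) p)" for p
    unfolding Y1_def Y2_def comp_npart by simp_all
  note D = smooth_differentiable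
  note cont = continuous_comp[OF smooth_continuous]
  have "jacobi_system X (\<lambda>t \<theta>. comp (t, \<theta>) (Y1 (t, \<theta>))) (\<lambda>t \<theta>. comp (t, \<theta>) (dd Y1 (1, 0) (t, \<theta>)))
        (\<lambda>t \<theta>. comp (t, \<theta>) (Y2 (t, \<theta>))) (\<lambda>t \<theta>. comp (t, \<theta>) (dd Y2 (0, 1) (t, \<theta>)))"
    unfolding jacobi_system_def
  proof (intro conjI allI)
    fix t \<theta>
    show "((\<lambda>t. fieldZ X t \<theta>) has_vector_derivative comp (t, \<theta>) (Y1 (t, \<theta>))) (at t)"
      unfolding fieldZ_def c by (rule has_derivative_comp_field(1)[OF X(2) D[OF X(1)]])
    show "((\<lambda>t. comp (t, \<theta>) (Y1 (t, \<theta>))) has_vector_derivative comp (t, \<theta>) (dd Y1 (1, 0) (t, \<theta>))) (at t)"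
      by (rule has_derivative_comp_field(1)[OF n(1) D[OF s(1)]])
    show "(fieldZ X t has_vector_derivative comp (t, \<theta>) (Y2 (t, \<theta>)) - \<i> * of_real (conn t) * fieldZ X t \<theta>) (at \<theta>)"
      unfolding fieldZ_def[abs_def] c by (rule has_derivative_comp_field(2)[OF X(2) D[OF X(1)]])
    show "((\<lambda>\<theta>. comp (t, \<theta>) (Y2 (t, \<theta>))) has_vector_derivative comp (t, \<theta>) (dd Y2 (0, 1) (t, \<theta>)) - \<i> * of_real (conn t) * comp (t, \<theta>) (Y2 (t, \<theta>))) (at \<theta>)"
      by (rule has_derivative_comp_field(2)[OF n(2) D[OF s(2)]])
    show "comp (t, \<theta>) (jacobi_op u X (t, \<theta>)) = of_real ((\<nu> t)\<^sup>2) *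
       (comp (t, \<theta>) (dd Y1 (1, 0) (t, \<theta>)) + comp (t, \<theta>) (dd Y2 (0, 1) (t, \<theta>))
        + of_real (((wa t)\<^sup>2 + (wb t)\<^sup>2) / 2) * fieldZ X t \<theta> + of_real (wa t * wb t) * cnj (fieldZ X t \<theta>))"
      unfolding comp_jacobi_op(1)[OF X(1)] fieldZ_def Y1_def Y2_def by (simp only: fst_conv)
    show "continuous_on UNIV (\<lambda>(t, \<theta>). comp (t, \<theta>) (Y1 (t, \<theta>)))" "continuous_on UNIV (\<lambda>(t, \<theta>). comp (t, \<theta>) (dd Y1 (1, 0) (t, \<theta>)))"
      "continuous_on UNIV (\<lambda>(t, \<theta>). comp (t, \<theta>) (Y2 (t, \<theta>)))" "continuous_on UNIV (\<lambda>(t, \<theta>). comp (t, \<theta>) (dd Y2 (0, 1) (t, \<theta>)))"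
      by (rule cont[OF s(1)] cont[OF smooth_dd[OF s(1)]] cont[OF s(2)] cont[OF smooth_dd[OF s(2)]])+
  next
    fix t
    have "dd X v (t, \<theta> + 2 * pi) = dd X v (t, \<theta>)" for v \<theta>
      using dd_precompose[OF X(1), of X 1 "2 * pi" v "(t, \<theta>)"] per by simp
    then show "comp (t, 0) (Y2 (t, 0)) = comp (t, 2 * pi) (Y2 (t, 2 * pi))"
      unfolding c using frame_periodic[of t 0] by (simp add: comp_def) (metis add_0)
  qed
  then show ?thesis by blast
qed

text \<open>Translations of the ambient space preserve area, so their normal parts are Jacobi
  fields. Here this is checked frequency by frequency: the residuals cancel against the conjugated
  field.\<close>

lemma constant_jacobi: "jacobi_op u (\<lambda>p. npart p w) p = 0"
proof -
  let ?X = "\<lambda>p. npart p w"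
  obtain t \<theta> where p: "p = (t, \<theta>)" by (cases p)
  have X: "smooth ?X" "normal_field ?X"
    by (rule smooth_npart[OF smooth_const]) (simp add: normal_field_def npart_npart)
  have per: "?X (t, \<theta> + 2 * pi) = ?X (t, \<theta>)" for t \<theta> by (simp add: npart_def frame_periodic)
  obtain ZT ZTT Z2 Z22 where J: "jacobi_system ?X ZT ZTT Z2 Z22"
    using comp_jacobi_op_derivatives[OF X per] by blast
  have D: "\<And>t \<theta>. ((\<lambda>t. fieldZ ?X t \<theta>) has_vector_derivative ZT t \<theta>) (at t)"
    "\<And>t \<theta>. ((\<lambda>t. ZT t \<theta>) has_vector_derivative ZTT t \<theta>) (at t)"
    "\<And>t \<theta>. (fieldZ ?X t has_vector_derivative Z2 t \<theta> - \<i> * of_real (conn t) * fieldZ ?X t \<theta>) (at \<theta>)"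
    "\<And>t \<theta>. (Z2 t has_vector_derivative Z22 t \<theta> - \<i> * of_real (conn t) * Z2 t \<theta>) (at \<theta>)"
    "\<And>t \<theta>. comp (t, \<theta>) (jacobi_op u ?X (t, \<theta>)) = of_real ((\<nu> t)\<^sup>2) *
       (ZTT t \<theta> + Z22 t \<theta> + of_real (((wa t)\<^sup>2 + (wb t)\<^sup>2) / 2) * fieldZ ?X t \<theta> + of_real (wa t * wb t) * cnj (fieldZ ?X t \<theta>))"
    using J unfolding jacobi_system_def by blast+
  define a where "a = Complex (w $ 1 / 2) (w $ 2 / 2)"
  define b where "b = - Complex (w $ 3 / 2) (w $ 4 / 2)"
  define F where "F f1 f2 f3 f4 \<theta> = a * f1 * cis (- real l * \<theta>) + - cnj a * f2 * cis (real l * \<theta>)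
     + b * f3 * cis (- real k * \<theta>) + cnj b * f4 * cis (real k * \<theta>)" for f1 f2 f3 f4 \<theta>
  define g where "g c t = (c - rate t) * ex c t" for c t
  define h where "h c t = ((c - rate t)\<^sup>2 - ((wa t)\<^sup>2 + (wb t)\<^sup>2) / 2) * ex c t" for c t
  define R where "R f t \<theta> = F (of_real (f (real k) t)) (of_real (f (- real k) t)) (of_real (f (real l) t)) (of_real (f (- real l) t)) \<theta>" for f :: "real \<Rightarrow> real \<Rightarrow> real" and t \<theta>
  have Z: "fieldZ ?X t \<theta> = R ex t \<theta>" for t \<theta>
    unfolding fieldZ_def comp_npart comp_constant R_def F_def a_def b_def ..
  have Dt: "((\<lambda>t. R f t \<theta>) has_vector_derivative R f' t \<theta>) (at t)" if "\<And>c. (f c has_real_derivative f' c t) (at t)" for f f' t \<theta>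
    unfolding R_def F_def
    by (intro has_vector_derivative_add has_vector_derivative_mult_left has_vector_derivative_mult_right has_vector_derivative_of_real that)
  have "(ex c has_real_derivative g c t) (at t)" for c t unfolding g_def by (rule DERIV_ex_first)
  then have ZT: "ZT t \<theta> = R g t \<theta>" for t \<theta>
    using vector_derivative_unique_at[OF D(1)[unfolded Z] Dt] by blast
  have "(g c has_real_derivative h c t) (at t)" for c t unfolding g_def[abs_def] h_def by (rule DERIV_ex_second)
  then have ZTT: "ZTT t \<theta> = R h t \<theta>" for t \<theta>
    using vector_derivative_unique_at[OF D(2)[unfolded ZT] Dt] by blast
  define S where "S f1 f2 f3 f4 t \<theta> = F (\<i> * of_real (- real l + conn t) * f1) (\<i> * of_real (real l + conn t) * f2) (\<i> * of_real (- real k + conn t) * f3) (\<i> * of_real (real k + conn t) * f4) \<theta>" for f1 f2 f3 f4 t \<theta>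
  have Ds: "(F f1 f2 f3 f4 has_vector_derivative S f1 f2 f3 f4 t \<theta> - \<i> * of_real (conn t) * F f1 f2 f3 f4 \<theta>) (at \<theta>)" for f1 f2 f3 f4 t \<theta>
  proof -
    have "(F f1 f2 f3 f4 has_vector_derivative
      a * f1 * (\<i> * of_real (- real l) * cis (- real l * \<theta>)) + - cnj a * f2 * (\<i> * of_real (real l) * cis (real l * \<theta>))
     + b * f3 * (\<i> * of_real (- real k) * cis (- real k * \<theta>)) + cnj b * f4 * (\<i> * of_real (real k) * cis (real k * \<theta>))) (at \<theta>)"
      unfolding F_def[abs_def] by (intro has_vector_derivative_add has_vector_derivative_mult_right has_vector_derivative_cis)
    then show ?thesis by (rule has_vector_derivative_eq_rhs) (simp add: S_def F_def algebra_simps)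
  qed
  let ?e = "\<lambda>c t. complex_of_real (ex c t)"
  have Zt: "fieldZ ?X t = F (?e (real k) t) (?e (- real k) t) (?e (real l) t) (?e (- real l) t)" for t
    by (rule ext) (simp add: Z R_def)
  have Z2: "Z2 t \<theta> = S (?e (real k) t) (?e (- real k) t) (?e (real l) t) (?e (- real l) t) t \<theta>" for t \<theta>
    using vector_derivative_unique_at[OF D(3)[of t \<theta>, unfolded Zt] Ds[of _ _ _ _ t \<theta>]] by simp
  let ?f = "\<lambda>n c t. \<i> * complex_of_real (n + conn t) * ?e c t"
  have Z2t: "Z2 t = F (?f (- real l) (real k) t) (?f (real l) (- real k) t) (?f (- real k) (real l) t) (?f (real k) (- real l) t)" for t
    by (rule ext) (simp add: Z2 S_def)
  have Z22: "Z22 t \<theta> = S (?f (- real l) (real k) t) (?f (real l) (- real k) t) (?f (- real k) (real l) t) (?f (real k) (- real l) t) t \<theta>" for t \<theta>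
    using vector_derivative_unique_at[OF D(4)[of t \<theta>, unfolded Z2t] Ds[of _ _ _ _ t \<theta>]] by simp
  define s where "s = ((wa t)\<^sup>2 + (wb t)\<^sup>2) / 2"
  define v where "v = wa t * wb t"
  have trm: "of_real (h c t) + \<i> * of_real (n + conn t) * ?f n c t + of_real s * ?e c t = of_real (residual c n t)" for c n
    unfolding h_def residual_def pot_def s_def[symmetric] by (simp add: complex_eq_iff power2_eq_square algebra_simps)
  have Flin: "F x1 x2 x3 x4 \<theta> + F y1 y2 y3 y4 \<theta> + of_real s * F z1 z2 z3 z4 \<theta> = F (x1 + y1 + of_real s * z1) (x2 + y2 + of_real s * z2) (x3 + y3 + of_real s * z3) (x4 + y4 + of_real s * z4) \<theta>"
    for x1 x2 x3 x4 y1 y2 y3 y4 z1 z2 z3 z4 by (simp add: F_def algebra_simps)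
  have "ZTT t \<theta> + Z22 t \<theta> + of_real s * fieldZ ?X t \<theta>
     = F (of_real (residual (real k) (- real l) t)) (of_real (residual (- real k) (real l) t)) (of_real (residual (real l) (- real k) t)) (of_real (residual (- real l) (real k) t)) \<theta>"
    unfolding ZTT Z22 Zt R_def S_def Flin trm ..
  also have "\<dots> + of_real v * cnj (fieldZ ?X t \<theta>) = 0"
    unfolding residual_modes v_def[symmetric] Zt F_def by (simp add: cis_cnj algebra_simps)
  finally have "comp (t, \<theta>) (jacobi_op u ?X (t, \<theta>)) = 0"
    unfolding D(5) s_def v_def by simp
  then have "norm (npart p (jacobi_op u ?X p)) = 0" using norm_npart[of p "jacobi_op u ?X p"] by (simp add: p)
  then show ?thesis unfolding comp_jacobi_op(2)[OF X(1)] by simp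
qed

end

section \<open>Classification of the bounded Jacobi fields and the nullity\<close>

lemma vdim_eqI:
  fixes V :: "'a::real_vector set"
  assumes D: "finite D" "independent D" "D \<subseteq> V" and B: "finite B" "V \<subseteq> span B" "card B \<le> card D"
  shows "vdim V = enat (card D)"
proof -
  obtain C where C: "C \<subseteq> V" "independent C" "V \<subseteq> span C" "card C = dim V" by (rule basis_exists[of V])
  have c: "finite C" "card C \<le> card B"
    using independent_span_bound[OF B(1) C(2) subset_trans[OF C(1) B(2)]] by simp_all
  have "card D \<le> card C"
    using independent_span_bound[OF c(1) D(2) subset_trans[OF D(3) C(3)]] by simp
  then have "dim V = card D" using c(2) B(3) C(4) by linarith
  moreover have "\<exists>B. finite B \<and> V \<subseteq> span B" using B(1,2) by blast
  ultimately show ?thesis unfolding vdim_def by (simp only: if_True)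
qed

context fraser_sargent begin

text \<open>All coefficients of a bounded Jacobi field in terms of two complex numbers, its
  coefficients of frequency l and k at t = 0, where every function \<open>ex\<close> equals
  1.\<close>

definition kernel_mode :: "complex \<Rightarrow> complex \<Rightarrow> int \<Rightarrow> real \<Rightarrow> complex" where
  "kernel_mode a b j t =
     (if j = int l then a * of_real (ex (- real k) t) else if j = - int l then - cnj a * of_real (ex (real k) t)
      else if j = int k then b * of_real (ex (- real l) t) else if j = - int k then cnj b * of_real (ex (real l) t) else 0)"

text \<open>Fourier expansion in \<theta> turns the Jacobi equation into one that couples the
  coefficient of m to the conjugate of that of - m. Real and imaginary parts separate, and the
  conjugation shows as the minus sign in the second system.\<close>

lemma jacobi_modes_solve:
  assumes X: "smooth X" "normal_field X" and per: "\<And>t \<theta>. X (t, \<theta> + 2 * pi) = X (t, \<theta>)"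
    and J: "\<And>p. jacobi_op u X p = 0"
  shows "\<exists>y'. solves (of_int m) (\<lambda>t. Re (fcoef (fieldZ X t) m)) (\<lambda>t. Re (fcoef (fieldZ X t) (- m))) (\<lambda>t. Re (y' m t)) (\<lambda>t. Re (y' (- m) t)) \<and>
     solves (of_int m) (\<lambda>t. Im (fcoef (fieldZ X t) m)) (\<lambda>t. - Im (fcoef (fieldZ X t) (- m))) (\<lambda>t. Im (y' m t)) (\<lambda>t. - Im (y' (- m) t))"
proof -
  obtain ZT ZTT Z2 Z22 where S: "jacobi_system X ZT ZTT Z2 Z22"
    using comp_jacobi_op_derivatives[OF X per] by blast
  have D: "((\<lambda>t. fieldZ X t \<theta>) has_vector_derivative ZT t \<theta>) (at t)"
    "((\<lambda>t. ZT t \<theta>) has_vector_derivative ZTT t \<theta>) (at t)"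
    "(fieldZ X t has_vector_derivative Z2 t \<theta> - \<i> * of_real (conn t) * fieldZ X t \<theta>) (at \<theta>)"
    "(Z2 t has_vector_derivative Z22 t \<theta> - \<i> * of_real (conn t) * Z2 t \<theta>) (at \<theta>)"
    "comp (t, \<theta>) (jacobi_op u X (t, \<theta>)) = of_real ((\<nu> t)\<^sup>2) *
       (ZTT t \<theta> + Z22 t \<theta> + of_real (((wa t)\<^sup>2 + (wb t)\<^sup>2) / 2) * fieldZ X t \<theta> + of_real (wa t * wb t) * cnj (fieldZ X t \<theta>))"
    for t \<theta> using S unfolding jacobi_system_def by blast+
  have C: "continuous_on UNIV (\<lambda>(t, \<theta>). ZT t \<theta>)" "continuous_on UNIV (\<lambda>(t, \<theta>). ZTT t \<theta>)"
    "continuous_on UNIV (\<lambda>(t, \<theta>). Z2 t \<theta>)" "continuous_on UNIV (\<lambda>(t, \<theta>). Z22 t \<theta>)" "Z2 t 0 = Z2 t (2 * pi)" for t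
    using S unfolding jacobi_system_def by blast+
  have CZ: "continuous_on UNIV (\<lambda>(t, \<theta>). fieldZ X t \<theta>)"
    unfolding fieldZ_def by (rule continuous_comp[OF smooth_continuous[OF X(1)]])
  note sl = continuous_slice[OF CZ, of "{0..2*pi}"] continuous_slice[OF C(2), of "{0..2*pi}"] continuous_slice[OF C(3), of "{0..2*pi}"] continuous_slice[OF C(4), of "{0..2*pi}"]
  define z where "z j t = fcoef (fieldZ X t) j" for j t
  \<comment> \<open>The connection coefficient does not depend on \<theta>, so covariant
    differentiation along the circle is diagonal on frequencies.\<close>
  have covariant: "fcoef G j = \<i> * of_real (of_int j + conn t) * fcoef F j"
    if F: "\<And>\<theta>. (F has_vector_derivative G \<theta> - \<i> * of_real (conn t) * F \<theta>) (at \<theta>)"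
      and c: "continuous_on {0..2*pi} F" "continuous_on {0..2*pi} G" and p: "F 0 = F (2*pi)" for F G t j
  proof -
    have "fcoef (\<lambda>\<theta>. G \<theta> + - (\<i> * of_real (conn t)) * F \<theta>) j = \<i> * of_int j * fcoef F j"
    proof (rule fcoef_deriv[OF _ _ p])
      show "(F has_vector_derivative G \<theta> + - (\<i> * of_real (conn t)) * F \<theta>) (at \<theta> within {0..2*pi})" for \<theta>
        using has_vector_derivative_at_within[OF F] by simp
    qed (intro continuous_intros c)
    moreover have "continuous_on {0..2*pi} (\<lambda>\<theta>. - (\<i> * of_real (conn t)) * F \<theta>)" by (intro continuous_intros c)
    ultimately show ?thesis by (simp only: fcoef_add[OF c(2)] fcoef_scale) (simp add: algebra_simps)
  qed
  have p0: "fieldZ X t 0 = fieldZ X t (2*pi)" for t using fieldZ_periodic[OF per, of t 0] by simp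
  have z2: "fcoef (Z2 t) j = \<i> * of_real (of_int j + conn t) * z j t" for t j
    unfolding z_def by (rule covariant[OF D(3) sl(1,3) p0])
  have z22: "fcoef (Z22 t) j = \<i> * of_real (of_int j + conn t) * fcoef (Z2 t) j" for t j
    by (rule covariant[OF D(4) sl(3,4) C(5)])
  have ztt: "fcoef (ZTT t) j = of_real (pot (of_int j) t) * z j t - of_real (wa t * wb t) * cnj (z (- j) t)" for t j
  proof -
    have nu: "\<nu> t \<noteq> 0" using nu_pos[of t] by linarith
    have "ZTT t \<theta> + Z22 t \<theta> + of_real (((wa t)\<^sup>2 + (wb t)\<^sup>2) / 2) * fieldZ X t \<theta> + of_real (wa t * wb t) * cnj (fieldZ X t \<theta>) = 0" for \<theta>
      using D(5)[of t \<theta>] nu unfolding J comp_linear by simp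
    then have "fcoef (\<lambda>\<theta>. ZTT t \<theta> + Z22 t \<theta> + of_real (((wa t)\<^sup>2 + (wb t)\<^sup>2) / 2) * fieldZ X t \<theta> + of_real (wa t * wb t) * cnj (fieldZ X t \<theta>)) j = 0"
      by (simp add: fcoef_def)
    moreover have "fcoef (\<lambda>\<theta>. ZTT t \<theta> + Z22 t \<theta> + of_real (((wa t)\<^sup>2 + (wb t)\<^sup>2) / 2) * fieldZ X t \<theta> + of_real (wa t * wb t) * cnj (fieldZ X t \<theta>)) j
      = fcoef (ZTT t) j + fcoef (Z22 t) j + of_real (((wa t)\<^sup>2 + (wb t)\<^sup>2) / 2) * z j t + of_real (wa t * wb t) * cnj (z (- j) t)"
    proof -
      have "continuous_on {0..2*pi} (\<lambda>\<theta>. ZTT t \<theta> + Z22 t \<theta>)" "continuous_on {0..2*pi} (\<lambda>\<theta>. of_real (((wa t)\<^sup>2 + (wb t)\<^sup>2) / 2) * fieldZ X t \<theta>)"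
        "continuous_on {0..2*pi} (\<lambda>\<theta>. of_real (wa t * wb t) * cnj (fieldZ X t \<theta>))"
        by (intro continuous_intros sl)+
      note a = this
      show ?thesis
        unfolding fcoef_add[OF continuous_on_add[OF a(1,2)] a(3)] fcoef_add[OF a(1,2)] fcoef_add[OF sl(2,4)] fcoef_scale
          fcoef_cnj[OF sl(1)] z_def ..
    qed
    ultimately have "fcoef (ZTT t) j = - fcoef (Z22 t) j - of_real (((wa t)\<^sup>2 + (wb t)\<^sup>2) / 2) * z j t - of_real (wa t * wb t) * cnj (z (- j) t)"
      by (simp add: algebra_simps add_eq_0_iff)
    then show ?thesis unfolding z22 z2 pot_def by (simp add: complex_eq_iff power2_eq_square algebra_simps)
  qed
  define y' where "y' j t = fcoef (ZT t) j" for j t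
  have d: "((\<lambda>t. z j t) has_vector_derivative y' j t) (at t)" "((\<lambda>t. y' j t) has_vector_derivative fcoef (ZTT t) j) (at t)" for j t
    unfolding z_def y'_def
    by (rule fcoef_has_vector_derivative[OF D(1) CZ C(1)] fcoef_has_vector_derivative[OF D(2) C(1,2)])+
  note RI = Re_Im_deriv
  have "solves (of_int m) (\<lambda>t. Re (z m t)) (\<lambda>t. Re (z (- m) t)) (\<lambda>t. Re (y' m t)) (\<lambda>t. Re (y' (- m) t))"
    unfolding solves_def
  proof (intro allI conjI)
    fix t
    show "((\<lambda>t. Re (y' m t)) has_real_derivative pot (of_int m) t * Re (z m t) - wa t * wb t * Re (z (- m) t)) (at t)"
      using RI(1)[OF d(2)[of m t]] unfolding ztt by simp
    show "((\<lambda>t. Re (y' (- m) t)) has_real_derivative pot (- of_int m) t * Re (z (- m) t) - wa t * wb t * Re (z m t)) (at t)"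
      using RI(1)[OF d(2)[of "- m" t]] unfolding ztt by simp
  qed (rule RI(1)[OF d(1)])+
  moreover have "solves (of_int m) (\<lambda>t. Im (z m t)) (\<lambda>t. - Im (z (- m) t)) (\<lambda>t. Im (y' m t)) (\<lambda>t. - Im (y' (- m) t))"
    unfolding solves_def
  proof (intro allI conjI)
    fix t
    show "((\<lambda>t. Im (z m t)) has_real_derivative Im (y' m t)) (at t)" by (rule RI(2)[OF d(1)])
    show "((\<lambda>t. - Im (z (- m) t)) has_real_derivative - Im (y' (- m) t)) (at t)" by (rule DERIV_minus[OF RI(2)[OF d(1)]])
    show "((\<lambda>t. Im (y' m t)) has_real_derivative pot (of_int m) t * Im (z m t) - wa t * wb t * - Im (z (- m) t)) (at t)"
      using RI(2)[OF d(2)[of m t]] unfolding ztt by simp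
    show "((\<lambda>t. - Im (y' (- m) t)) has_real_derivative pot (- of_int m) t * - Im (z (- m) t) - wa t * wb t * Im (z m t)) (at t)"
      using DERIV_minus[OF RI(2)[OF d(2)[of "- m" t]]] unfolding ztt by simp
  qed
  ultimately show ?thesis unfolding z_def by blast
qed

text \<open>A bound for the field bounds every coefficient, so the classification of bounded
  solutions applies to real and imaginary parts. The exceptional modes \<mu> and \<kappa> are the
  integers l and k.\<close>

lemma bounded_jacobi_modes:
  assumes X: "smooth X" "normal_field X" and per: "\<And>t \<theta>. X (t, \<theta> + 2 * pi) = X (t, \<theta>)"
    and J: "\<And>p. jacobi_op u X p = 0" and bd: "bounded (range X)"
  shows "fcoef (fieldZ X t) j = kernel_mode (fcoef (fieldZ X 0) (int l)) (fcoef (fieldZ X 0) (int k)) j t"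
proof -
  define z where "z j t = fcoef (fieldZ X t) j" for j t
  obtain C where C: "\<And>p. norm (X p) \<le> C" using bd unfolding bounded_iff by blast
  have "cmod (fieldZ X t \<theta>) \<le> C" for t \<theta>
  proof -
    have "(norm (npart (t, \<theta>) (X (t, \<theta>))))\<^sup>2 = (cmod (fieldZ X t \<theta>))\<^sup>2" unfolding norm_npart fieldZ_def ..
    moreover have "npart (t, \<theta>) (X (t, \<theta>)) = X (t, \<theta>)" using X(2) unfolding normal_field_def by blast
    ultimately have "cmod (fieldZ X t \<theta>) = norm (X (t, \<theta>))" by (simp add: power2_eq_iff_nonneg)
    then show ?thesis using C by simp
  qed
  then have zb: "cmod (z j t) \<le> 2 * pi * C" for j t
    unfolding z_def by (intro norm_fcoef_le continuous_fieldZ X(1))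
  have zb': "\<bar>Re (z j t)\<bar> \<le> 2 * pi * C" "\<bar>Im (z j t)\<bar> \<le> 2 * pi * C" "\<bar>- Im (z j t)\<bar> \<le> 2 * pi * C" for j t
    using abs_Re_le_cmod[of "z j t"] abs_Im_le_cmod[of "z j t"] zb[of j t] by linarith+
  have pair: "z m t = kernel_mode (z (int l) 0) (z (int k) 0) m t \<and> z (- m) t = kernel_mode (z (int l) 0) (z (int k) 0) (- m) t"
    if m: "0 \<le> m" for m t
  proof -
    obtain y' where "solves (of_int m) (\<lambda>t. Re (z m t)) (\<lambda>t. Re (z (- m) t)) (\<lambda>t. Re (y' m t)) (\<lambda>t. Re (y' (- m) t))"
      "solves (of_int m) (\<lambda>t. Im (z m t)) (\<lambda>t. - Im (z (- m) t)) (\<lambda>t. Im (y' m t)) (\<lambda>t. - Im (y' (- m) t))"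
      using jacobi_modes_solve[OF X per J, of m] unfolding z_def by blast
    note sol = this
    have m0: "0 \<le> real_of_int m" using m by simp
    note R = bounded_solution[OF sol(1) m0 zb'(1) zb'(1), unfolded kappa_eq mu_eq]
    note I = bounded_solution[OF sol(2) m0 zb'(2) zb'(3), unfolded kappa_eq mu_eq]
    have eqs: "real_of_int m = real l \<longleftrightarrow> m = int l" "real_of_int m = real k \<longleftrightarrow> m = int k" by linarith+
    consider "m = int l" | "m = int k" | "m \<noteq> int l" "m \<noteq> int k" by blast
    then show ?thesis
    proof cases
      case 1
      obtain c where c: "\<And>t. Re (z m t) = - c * ex (- real k) t" "\<And>t. Re (z (- m) t) = c * ex (real k) t"
        using R(2) eqs 1 by blast
      obtain d where d: "\<And>t. Im (z m t) = - d * ex (- real k) t" "\<And>t. - Im (z (- m) t) = d * ex (real k) t"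
        using I(2) eqs 1 by blast
      have "Re (z m 0) = - c" "Im (z m 0) = - d" using c(1)[of 0] d(1)[of 0] by simp_all
      moreover have "Im (z (- m) t) = - (d * ex (real k) t)" using d(2)[of t] by linarith
      ultimately show ?thesis using 1 l_pos c d(1) by (simp add: kernel_mode_def complex_eq_iff)
    next
      case 2
      obtain c where c: "\<And>t. Re (z m t) = c * ex (- real l) t" "\<And>t. Re (z (- m) t) = c * ex (real l) t"
        using R(3) eqs 2 by blast
      obtain d where d: "\<And>t. Im (z m t) = d * ex (- real l) t" "\<And>t. - Im (z (- m) t) = d * ex (real l) t"
        using I(3) eqs 2 by blast
      have "Re (z m 0) = c" "Im (z m 0) = d" using c(1)[of 0] d(1)[of 0] by simp_all
      moreover have "Im (z (- m) t) = - (d * ex (real l) t)" using d(2)[of t] by linarith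
      ultimately show ?thesis using 2 l_pos l_less c d(1) by (simp add: kernel_mode_def complex_eq_iff)
    next
      case 3
      then have "z m t = 0" "z (- m) t = 0" using R(1)[of t] I(1)[of t] eqs by (simp_all add: complex_eq_iff)
      then show ?thesis using 3 m l_pos l_less by (auto simp: kernel_mode_def)
    qed
  qed
  show ?thesis using pair[of j t] pair[of "- j" t] unfolding z_def by (cases "0 \<le> j") auto
qed

text \<open>Stated by Fourier coefficients instead of the Jacobi equation: it contains the bounded
  Jacobi fields, and its linearity follows from that of the coefficients alone.\<close>

definition kernel_fields :: "(plane \<Rightarrow> real ^ 4) set" where
  "kernel_fields = {X. smooth X \<and> normal_field X \<and> (\<forall>t \<theta>. X (t, \<theta> + 2 * pi) = X (t, \<theta>)) \<and>
     (\<forall>t j. fcoef (fieldZ X t) j = kernel_mode (fcoef (fieldZ X 0) (int l)) (fcoef (fieldZ X 0) (int k)) j t)}"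

lemma kernel_mode_linear:
  "kernel_mode (a + a') (b + b') j t = kernel_mode a b j t + kernel_mode a' b' j t"
  "kernel_mode (of_real c * a) (of_real c * b) j t = of_real c * kernel_mode a b j t"
  "kernel_mode 0 0 j t = 0"
  by (simp_all add: kernel_mode_def algebra_simps)

lemma subspace_kernel_fields: "subspace kernel_fields"
  unfolding subspace_def
proof (intro conjI ballI allI)
  have "fieldZ 0 t = (\<lambda>\<theta>. 0)" for t by (simp add: fun_eq_iff fieldZ_def comp_linear)
  then show "0 \<in> kernel_fields"
    using smooth_const[of "0 :: real ^ 4"]
    by (simp add: kernel_fields_def normal_field_def npart_linear fcoef_def kernel_mode_linear zero_fun_def)
next
  fix X Y assume "X \<in> kernel_fields" "Y \<in> kernel_fields"
  then have X: "smooth X" "normal_field X" "\<And>t \<theta>. X (t, \<theta> + 2 * pi) = X (t, \<theta>)"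
      "\<And>t j. fcoef (fieldZ X t) j = kernel_mode (fcoef (fieldZ X 0) (int l)) (fcoef (fieldZ X 0) (int k)) j t"
    and Y: "smooth Y" "normal_field Y" "\<And>t \<theta>. Y (t, \<theta> + 2 * pi) = Y (t, \<theta>)"
      "\<And>t j. fcoef (fieldZ Y t) j = kernel_mode (fcoef (fieldZ Y 0) (int l)) (fcoef (fieldZ Y 0) (int k)) j t"
    unfolding kernel_fields_def by blast+
  have "fcoef (fieldZ (X + Y) t) j = kernel_mode (fcoef (fieldZ (X + Y) 0) (int l)) (fcoef (fieldZ (X + Y) 0) (int k)) j t" for t j
    unfolding fcoef_field_linear(1)[OF X(1) Y(1)] kernel_mode_linear by (rule arg_cong2[of _ _ _ _ "(+)", OF X(4) Y(4)])
  moreover have "smooth (X + Y)" using smooth_add[OF X(1) Y(1)] by (simp add: plus_fun_def)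
  moreover have "normal_field (X + Y)" using X(2) Y(2) unfolding normal_field_def by (simp add: npart_linear)
  moreover have "(X + Y) (t, \<theta> + 2 * pi) = (X + Y) (t, \<theta>)" for t \<theta> using X(3) Y(3) by simp
  ultimately show "X + Y \<in> kernel_fields" unfolding kernel_fields_def by blast
next
  fix c X assume "X \<in> kernel_fields"
  then have X: "smooth X" "normal_field X" "\<And>t \<theta>. X (t, \<theta> + 2 * pi) = X (t, \<theta>)"
      "\<And>t j. fcoef (fieldZ X t) j = kernel_mode (fcoef (fieldZ X 0) (int l)) (fcoef (fieldZ X 0) (int k)) j t"
    unfolding kernel_fields_def by blast+
  have "fcoef (fieldZ (c *\<^sub>R X) t) j = kernel_mode (fcoef (fieldZ (c *\<^sub>R X) 0) (int l)) (fcoef (fieldZ (c *\<^sub>R X) 0) (int k)) j t" for t j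
    unfolding fcoef_field_linear(2)[OF X(1) X(1)] kernel_mode_linear by (rule arg_cong[OF X(4)])
  moreover have "smooth (c *\<^sub>R X)" using smooth_scaleR[OF smooth_const X(1)] by (simp add: scaleR_fun_def)
  moreover have "normal_field (c *\<^sub>R X)" using X(2) unfolding normal_field_def by (simp add: npart_linear)
  moreover have "(c *\<^sub>R X) (t, \<theta> + 2 * pi) = (c *\<^sub>R X) (t, \<theta>)" for t \<theta> using X(3) by simp
  ultimately show "c *\<^sub>R X \<in> kernel_fields" unfolding kernel_fields_def by blast
qed

text \<open>The real and imaginary parts of the two parameters are four linear functionals; if they
  vanish, so do all coefficients and hence the field.\<close>

lemma kernel_fields_span: "\<exists>B. finite B \<and> card B \<le> 4 \<and> kernel_fields \<subseteq> span B"
proof -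
  define a where "a X = fcoef (fieldZ X 0) (int l)" for X
  define b where "b X = fcoef (fieldZ X 0) (int k)" for X
  define f where "f i X = (if i = 0 then Re (a X) else if i = 1 then Im (a X) else if i = 2 then Re (b X) else Im (b X))" for i :: nat and X
  show ?thesis
  proof (rule span_of_functionals[OF subspace_kernel_fields, of f])
    fix i X Y c assume X: "X \<in> kernel_fields"
    then have sX: "smooth X" by (simp add: kernel_fields_def)
    show "f i (c *\<^sub>R X) = c * f i X" by (simp add: f_def a_def b_def fcoef_field_linear(2)[OF sX sX])
    assume "Y \<in> kernel_fields"
    then have sY: "smooth Y" by (simp add: kernel_fields_def)
    show "f i (X + Y) = f i X + f i Y" by (simp add: f_def a_def b_def fcoef_field_linear(1)[OF sX sY])
  next
    fix X assume X: "X \<in> kernel_fields" and "\<forall>i<4. f i X = 0"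
    then have "f 0 X = 0" "f 1 X = 0" "f 2 X = 0" "f 3 X = 0" by simp_all
    then have "a X = 0" "b X = 0" by (simp_all add: f_def complex_eq_iff)
    then have z: "fcoef (fieldZ X t) j = 0" for t j
      using X unfolding kernel_fields_def a_def b_def by (simp add: kernel_mode_linear(3))
    have n: "npart p (X p) = X p" and per: "X (t, \<theta> + 2 * pi) = X (t, \<theta>)" and s: "smooth X" for p t \<theta>
      using X unfolding kernel_fields_def normal_field_def by blast+
    show "X = 0"
    proof
      fix p :: plane
      obtain t \<theta> where p: "p = (t, \<theta>)" by (cases p)
      \<comment> \<open>The vanishing is known over one period of \<theta>, so an arbitrary angle is
        shifted there first.\<close>
      obtain i :: int where i: "\<theta> + 2 * pi * of_int i \<in> {0..<2 * pi}" using ex1_shift[of "2 * pi" \<theta>] by auto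
      define q where "q = (t, \<theta> + 2 * pi * of_int i)"
      have "fieldZ X t (\<theta> + 2 * pi * of_int i) = 0"
      proof (rule fcoef_all_zero[OF continuous_fieldZ[OF s] _ z])
        show "fieldZ X t 0 = fieldZ X t (2 * pi)" using fieldZ_periodic[OF per, of t 0] by simp
        show "\<theta> + 2 * pi * of_int i \<in> {0..2 * pi}" using i by simp
      qed
      then have "norm (npart q (X q)) = 0" using norm_npart[of q "X q"] by (simp add: fieldZ_def q_def)
      then have "X q = 0" unfolding n by simp
      then show "X p = 0 p" using periodic_int[of X t \<theta> i, OF per] by (simp add: p q_def)
    qed
  qed
qed

definition const_field :: "(int \<Rightarrow> real) \<Rightarrow> plane \<Rightarrow> real ^ 4" where
  "const_field c = (\<lambda>p. npart p (vec4 (c 1) (c 2) (c 3) (c 4)))"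

lemma linear_const_field: "linear const_field"
proof (rule linearI)
  have "vec4 (x + x') (y + y') (z + z') (w + w') = vec4 x y z w + vec4 x' y' z' w'" "vec4 (r * x) (r * y) (r * z) (r * w) = r *\<^sub>R vec4 x y z w"
    for x x' y y' z z' w w' r by (rule vec4_eqI; simp)+
  then show "const_field (c + d) = const_field c + const_field d" "const_field (r *\<^sub>R c) = r *\<^sub>R const_field c" for c d r
    by (simp_all add: const_field_def fun_eq_iff npart_linear)
qed

text \<open>On the circle t = 0 the vector \<open>N1\<close> sees only the third and fourth
  coordinate and \<open>N2\<close> only the first two. The angle 0 and the quarter periods pi / (2 *
  l) and pi / (2 * k) isolate the single coordinates.\<close>

lemma const_field_eq_0:
  assumes c: "c \<in> coords {1..4}" and z: "const_field c = 0"
  shows "c = 0"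
proof -
  define w where "w = vec4 (c 1) (c 2) (c 3) (c 4)"
  have i: "w \<bullet> N1 p = 0" "w \<bullet> N2 p = 0" for p
  proof -
    have "npart p w = 0" using z unfolding const_field_def w_def by (metis zero_fun_apply)
    then have "comp p w = 0" using comp_npart[of p w] by (simp add: comp_linear)
    then show "w \<bullet> N1 p = 0" "w \<bullet> N2 p = 0" using nrm_pos[of "fst p"] by (auto simp: comp_def complex_eq_iff)
  qed
  have kl: "real l * (pi / (2 * real l)) = pi / 2" "real k * (pi / (2 * real k)) = pi / 2" using l_pos l_less by simp_all
  have "c 3 = 0" using i(1)[of "(0, 0)"] by (simp add: w_def N1_def inner_vec4)
  moreover have "c 2 = 0" using i(2)[of "(0, 0)"] by (simp add: w_def N2_def inner_vec4)
  moreover have "c 1 = 0" using i(2)[of "(0, pi / (2 * real l))", unfolded w_def N2_def inner_vec4 fst_conv snd_conv kl] by simp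
  moreover have "c 4 = 0" using i(1)[of "(0, pi / (2 * real k))", unfolded w_def N1_def inner_vec4 fst_conv snd_conv kl] by simp
  ultimately have "c a = 0" for a
  proof (cases "a \<in> {1..4}")
    case True
    then have "a = 1 \<or> a = 2 \<or> a = 3 \<or> a = 4" by auto
    then show ?thesis using \<open>c 1 = 0\<close> \<open>c 2 = 0\<close> \<open>c 3 = 0\<close> \<open>c 4 = 0\<close> by blast
  qed (use c in \<open>auto simp: coords_def\<close>)
  then show ?thesis by (simp add: fun_eq_iff)
qed

lemma npart_involution:
  assumes "even k" "odd l"
  shows "npart (- t, \<theta> + pi) w = npart (t, \<theta>) w"
proof -
  have "cos (real m * (\<theta> + pi)) = (- 1) ^ m * cos (real m * \<theta>)"
    and "sin (real m * (\<theta> + pi)) = (- 1) ^ m * sin (real m * \<theta>)" for m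
    by (simp_all add: distrib_left cos_add sin_add)
  then have "N1 (- t, \<theta> + pi) = N1 (t, \<theta>)" "N2 (- t, \<theta> + pi) = - N2 (t, \<theta>)"
    using assms by (auto simp: N1_def N2_def intro!: vec4_eqI)
  then show ?thesis by (simp add: npart_def)
qed

lemma norm_npart_le: "norm (npart p w) \<le> norm w"
proof -
  have "(norm (npart p w))\<^sup>2 = npart p w \<bullet> w"
    unfolding norm_npart npart_inner cmod_power2 by (simp add: power2_eq_square)
  also have "\<dots> \<le> norm (npart p w) * norm w" by (rule norm_cauchy_schwarz)
  finally show ?thesis by (cases "npart p w = 0") (auto simp: power2_eq_square)
qed

text \<open>The four constant vectors have independent normal parts, and these are invariant under
  the involution as well; together with the bound by four functionals they fill the kernel for both
  kinds of surface.\<close>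

lemma nullity_FS:
  assumes par: "coprime k l"
  shows "nullity (FS k l) = 4"
proof -
  define S where "S = {X \<in> normal_sections (FS k l). (\<forall>p. jacobi_op u X p = 0) \<and> bounded (range X)}"
  have "immersion (FS k l) = u" by (simp add: FS_def)
  then have null: "nullity (FS k l) = vdim S" unfolding nullity_def S_def by (simp only:)
  obtain B where B: "finite B" "card B \<le> 4" "kernel_fields \<subseteq> span B" using kernel_fields_span by blast
  have "S \<subseteq> kernel_fields"
  proof
    fix X assume "X \<in> S"
    then have X: "smooth X" "normal_field X" "\<And>t \<theta>. X (t, \<theta> + 2 * pi) = X (t, \<theta>)" "\<And>p. jacobi_op u X p = 0" "bounded (range X)"
      unfolding S_def normal_sections_iff by blast+
    have "\<forall>t j. fcoef (fieldZ X t) j = kernel_mode (fcoef (fieldZ X 0) (int l)) (fcoef (fieldZ X 0) (int k)) j t"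
      by (intro allI) (rule bounded_jacobi_modes[OF X])
    then show "X \<in> kernel_fields" unfolding kernel_fields_def using X(1-3) by blast
  qed
  then have SB: "S \<subseteq> span B" using B(3) by blast
  have sub: "const_field c \<in> S" for c
  proof -
    let ?w = "vec4 (c 1) (c 2) (c 3) (c 4)"
    have "smooth (const_field c)" unfolding const_field_def by (rule smooth_npart[OF smooth_const])
    moreover have "normal_field (const_field c)" by (simp add: normal_field_def const_field_def npart_npart)
    moreover have "\<forall>t \<theta>. const_field c (t, \<theta> + 2 * pi) = const_field c (t, \<theta>)"
      by (simp add: const_field_def npart_def frame_periodic)
    moreover have "const_field c (FS_involution p) = const_field c p" if "even k" for p
    proof -
      have "odd l" using that par coprime_common_divisor[of k l 2] by auto
      then show ?thesis using npart_involution[OF that, of "fst p" "snd p"]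
        by (simp add: const_field_def FS_involution_def case_prod_unfold)
    qed
    moreover have "jacobi_op u (const_field c) p = 0" for p unfolding const_field_def by (rule constant_jacobi)
    moreover have "bounded (range (const_field c))"
      unfolding bounded_iff const_field_def using norm_npart_le[of _ ?w] by blast
    ultimately show ?thesis unfolding S_def normal_sections_iff by blast
  qed
  define D where "D = (\<lambda>a. const_field (unit_coord a)) ` {1..4}"
  have D: "finite D" "card D = card {1..4::int}" "independent D"
    unfolding D_def by (rule coords_basis[where T = const_field and A = "{1..4}"]; use linear_const_field const_field_eq_0 in blast)+
  have "D \<subseteq> S" unfolding D_def using sub by blast
  moreover have "card B \<le> card D" using B(2) D(2) by simp
  ultimately have "vdim S = enat (card D)" using vdim_eqI[OF D(1,3) _ B(1) SB] by blast
  then show ?thesis unfolding null D(2) by (simp add: numeral_eq_enat)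
qed

end

theorem theorem1p1:
  fixes k l :: nat
  assumes "coprime k l" and "k > l" and "l > 0"
  shows "index (FS k l) = enat (if odd k then 2 * k - 1 else k - 1) \<and> nullity (FS k l) = 4"
proof -
  interpret fraser_sargent k l using assms by unfold_locales
  show ?thesis using index_FS nullity_FS assms(1) by blast
qed

end
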